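(* For every integer $n\ge 1$ and every $\delta>0$ there exists a constant $\varepsilon_{\delta,n}>0$, depending only on $\delta$ and $n$, such that the following holds. Let $V\in L^2_{\mathrm{loc}}(\mathbb{R}^n)$ be such that for every $R>0$ there exists $c_R\ge 0$ with $$\int_{B_R}|V|^2|u|^2\,dx\le \varepsilon_{\delta,n}\int_{\mathbb{R}^n}\big|(-\Delta)^{\frac34-\delta}u\big|^2\,dx+c_R\int_{\mathbb{R}^n}|u|^2\,dx\qquad\text{for all }u\in H^2(\mathbb{R}^n).$$ Let $\Psi\in H^2_{\mathrm{loc}}(\mathbb{R}^n)$ be a solution of $-\Delta\Psi+V\Psi=0$. If $\Psi$ vanishes on a set of positive Lebesgue measure, or if $\Psi$ vanishes to infinite order at some point, then $\Psi=0$ almost everywhere.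
   Context: $B_R$ denotes the open ball of radius $R$ centered at the origin of $\mathbb{R}^n$. The fractional Laplacian $(-\Delta)^{s}$ is defined via the Fourier transform as multiplication by $|k|^{2s}$. A function $\Psi\in L^2_{\mathrm{loc}}(\mathbb{R}^n)$ vanishes to infinite order at $x_0\in\mathbb{R}^n$ if for every $k\ge1$ there is $c_k$ such that $\int_{|x-x_0|<\epsilon}|\Psi|^2\,dx<c_k\epsilon^k$ for every $\epsilon<1$. *)

theory Defs
  imports "HOL-Analysis.Analysis"
begin

definition L2 :: "(real^'n::finite \<Rightarrow> complex) \<Rightarrow> bool" where
  "L2 u \<longleftrightarrow> u \<in> borel_measurable lebesgue \<and>
     (\<integral>\<^sup>+ x. ennreal ((cmod (u x))\<^sup>2) \<partial>lebesgue) < \<infinity>"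

definition L2loc :: "(real^'n::finite \<Rightarrow> complex) \<Rightarrow> bool" where
  "L2loc u \<longleftrightarrow> u \<in> borel_measurable lebesgue \<and>
     (\<forall>R>0. (\<integral>\<^sup>+ x\<in>ball 0 R. ennreal ((cmod (u x))\<^sup>2) \<partial>lebesgue) < \<infinity>)"

text \<open>Fourier transform of the truncation of u to the ball of radius R
  (an L^1 function when u is L^2), convention e^{-i k.x}.\<close>

definition fourier_trunc :: "(real^'n::finite \<Rightarrow> complex) \<Rightarrow> real \<Rightarrow> real^'n \<Rightarrow> complex" where
  "fourier_trunc u R k = (\<integral> x\<in>ball 0 R. cis (- (k \<bullet> x)) * u x \<partial>lebesgue)"

definition has_L2_fourier :: "(real^'n::finite \<Rightarrow> complex) \<Rightarrow> (real^'n \<Rightarrow> complex) \<Rightarrow> bool" where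
  "has_L2_fourier u g \<longleftrightarrow> L2 u \<and> g \<in> borel_measurable lebesgue \<and>
     ((\<lambda>R. \<integral>\<^sup>+ k. ennreal ((cmod (fourier_trunc u R k - g k))\<^sup>2) \<partial>lebesgue) \<longlongrightarrow> 0) at_top"

definition is_frac_laplacian :: "real \<Rightarrow> (real^'n::finite \<Rightarrow> complex) \<Rightarrow> (real^'n \<Rightarrow> complex) \<Rightarrow> bool" where
  "is_frac_laplacian s u w \<longleftrightarrow>
     (\<exists>g. has_L2_fourier u g \<and> has_L2_fourier w (\<lambda>k. complex_of_real (norm k powr (2 * s)) * g k))"

definition H2 :: "(real^'n::finite \<Rightarrow> complex) \<Rightarrow> bool" where
  "H2 u \<longleftrightarrow> (\<exists>g. has_L2_fourier u g \<and>
     (\<integral>\<^sup>+ k. ennreal ((1 + (norm k)\<^sup>2)\<^sup>2 * (cmod (g k))\<^sup>2) \<partial>lebesgue) < \<infinity>)"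

definition H2loc :: "(real^'n::finite \<Rightarrow> complex) \<Rightarrow> bool" where
  "H2loc \<Psi> \<longleftrightarrow> \<Psi> \<in> borel_measurable lebesgue \<and>
     (\<forall>R>0. \<exists>u. H2 u \<and> (AE x in lebesgue. x \<in> ball 0 R \<longrightarrow> u x = \<Psi> x))"

text \<open>\<Psi> in H^2_loc solves -Delta \<Psi> + V \<Psi> = 0 (a.e.), where on each ball -Delta \<Psi>
  is computed from an H^2 function agreeing with \<Psi> there.\<close>

definition solves_schroedinger :: "(real^'n::finite \<Rightarrow> complex) \<Rightarrow> (real^'n \<Rightarrow> complex) \<Rightarrow> bool" where
  "solves_schroedinger V \<Psi> \<longleftrightarrow> H2loc \<Psi> \<and>
     (\<forall>R>0. \<exists>u w. H2 u \<and> (AE x in lebesgue. x \<in> ball 0 R \<longrightarrow> u x = \<Psi> x) \<and>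
        is_frac_laplacian 1 u w \<and>
        (AE x in lebesgue. x \<in> ball 0 R \<longrightarrow> w x + V x * \<Psi> x = 0))"

definition vanishes_infinite_order :: "(real^'n::finite \<Rightarrow> complex) \<Rightarrow> real^'n \<Rightarrow> bool" where
  "vanishes_infinite_order \<Psi> x0 \<longleftrightarrow>
     (\<forall>k::nat\<ge>1. \<exists>c::real. \<forall>e. 0 < e \<and> e < 1 \<longrightarrow>
        (\<integral> x\<in>ball x0 e. (cmod (\<Psi> x))\<^sup>2 \<partial>lebesgue) < c * e ^ k)"

end

theory Submission
  imports Defs "HOL-Probability.Probability"
begin

text \<open>The statement holds with \<open>\<epsilon> = 1\<close>, because the exponent \<open>3/4 - \<delta>\<close> leaves room. For \<open>v\<close> supported in
  a fixed ball, cutting the Fourier transform of \<open>v\<close> into frequencies turns the hypothesis on \<open>V\<close> into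
  \<open>\<integral>|V v|^2 \<le> K \<tau>^(-4d) (\<tau>^(-1) \<integral>|\<Delta>v|^2 + \<tau>^3 \<integral>|v|^2)\<close> for all \<open>\<tau> \<ge> 1\<close>, where \<open>d = min \<delta> (3/4)\<close>.
  On the other hand there is the Carleman inequality \<open>\<tau>^3 \<integral>|x| w |u|^2 \<le> 8 \<integral>|x|^4 w |\<Delta>u|^2\<close> with the
  weight \<open>w = |x|^(-n) exp (2 \<tau> (|x| - ln |x|))\<close>. Using the bound for \<open>V\<close> on the dyadic shell \<open>|x| \<approx> e^(-i)\<close> with
  parameter \<open>\<tau> e^i\<close> and summing over \<open>i\<close> gives \<open>\<integral>|x|^4 w |V u|^2 \<le> C \<tau>^(-4d) \<integral>|x|^4 w |\<Delta>u|^2\<close>, so for large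
  \<open>\<tau>\<close> the potential is absorbed; letting \<open>\<tau> \<rightarrow> \<infinity>\<close>, a solution that vanishes to infinite order at a point vanishes on
  the ball of radius \<open>1/8\<close> around it, and then everywhere, since every point of that ball is again a zero of infinite order.
  If the solution vanishes on a set of positive measure, let \<open>x0\<close> be a density point of that set. Splitting
  frequencies at \<open>M/r\<close> and using the Caccioppoli inequality, the mass \<open>N r\<close> of \<open>|\<Psi>|^2\<close> in the ball of radius \<open>r\<close>
  around \<open>x0\<close> satisfies \<open>N r \<le> C (M^(-4) + M^n |B_r - S| / r^n) N (e r)\<close>. The factor can be made arbitrarily
  small as \<open>r \<rightarrow> 0\<close>, so \<open>x0\<close> is a zero of infinite order.\<close>

section \<open>Classical derivatives\<close>

text \<open>In t = ln |x| the Carleman phase e^t - t is decreasing for t < 0 and has second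
  derivative e^t. This convexity is the source of positivity, and it fades like |x|; hence the
  factor |x| on the left of the inequality. That is just enough: at |x| ~ e^(-i) a derivative of the
  weight costs \<tau> e^i, and (\<tau> e^i)^3 |x|^4 is comparable to \<tau>^3 |x|. The powers
  \<tau>^(-1) and \<tau>^3 in the bound for V match this; y^3 <= y^4/\<tau> + \<tau>^3 is the
  borderline case of 3/4, and the reserve d yields the factor \<tau>^(-4d) that permits absorption.
  The obstacle is that V is controlled only through its action on functions, never pointwise, while
  a solution is only locally H^2. So every localisation multiplies the function by a cut-off before
  V acts, and all estimates are proved for C2 functions with the defect \<open>err\<close>, which
  tends to zero only in the limit. The Carleman inequality has no gradient term; gradients, which
  each cut-off produces, are recovered from energy estimates.\<close>

abbreviation L2sq :: "('a::euclidean_space \<Rightarrow> complex) \<Rightarrow> real" where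
  "L2sq f \<equiv> LBINT x. (cmod (f x))^2"

abbreviation L2on :: "'a::euclidean_space set \<Rightarrow> ('a \<Rightarrow> complex) \<Rightarrow> real" where
  "L2on A f \<equiv> LBINT x. indicator A x * (cmod (f x))^2"

abbreviation L2int :: "'a::euclidean_space set \<Rightarrow> ('a \<Rightarrow> complex) \<Rightarrow> bool" where
  "L2int A f \<equiv> integrable lborel (\<lambda>x. indicator A x * (cmod (f x))^2)"

lemmas integrable_bound = Bochner_Integration.integrable_bound
  and integral_cong = Bochner_Integration.integral_cong

definition pd :: "'a::euclidean_space \<Rightarrow> ('a \<Rightarrow> 'b::real_normed_vector) \<Rightarrow> 'a \<Rightarrow> 'b" where
  "pd b f x = frechet_derivative f (at x) b"

definition C1_on :: "'a::euclidean_space set \<Rightarrow> ('a \<Rightarrow> 'b::real_normed_vector) \<Rightarrow> bool" where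
  "C1_on S f \<longleftrightarrow> (\<forall>x\<in>S. f differentiable (at x)) \<and> (\<forall>b\<in>Basis. continuous_on S (pd b f))"

text \<open>The symmetry of the second derivatives is part of the definition, not derived from continuity.\<close>

definition C2_on :: "'a::euclidean_space set \<Rightarrow> ('a \<Rightarrow> 'b::real_normed_vector) \<Rightarrow> bool" where
  "C2_on S f \<longleftrightarrow> C1_on S f \<and> (\<forall>b\<in>Basis. C1_on S (pd b f)) \<and>
     (\<forall>x\<in>S. \<forall>b\<in>Basis. \<forall>c\<in>Basis. pd b (pd c f) x = pd c (pd b f) x)"

definition lap :: "('a::euclidean_space \<Rightarrow> 'b::real_normed_vector) \<Rightarrow> 'a \<Rightarrow> 'b" where
  "lap f x = (\<Sum>b\<in>Basis. pd b (pd b f) x)"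

lemma pd_eqI: "(f has_derivative f') (at x) \<Longrightarrow> pd b f x = f' b"
  unfolding pd_def using frechet_derivative_at by metis

lemma has_derivative_pd: "f differentiable (at x) \<Longrightarrow> (f has_derivative (\<lambda>h. \<Sum>b\<in>Basis. (h \<bullet> b) *\<^sub>R pd b f x)) (at x)"
proof -
  assume "f differentiable (at x)"
  then have d: "(f has_derivative frechet_derivative f (at x)) (at x)"
    by (simp add: frechet_derivative_works)
  then have l: "linear (frechet_derivative f (at x))"
    by (simp add: has_derivative_linear)
  have "frechet_derivative f (at x) = (\<lambda>h. \<Sum>b\<in>Basis. (h \<bullet> b) *\<^sub>R pd b f x)"
  proof
    fix h :: 'a
    have "frechet_derivative f (at x) h = frechet_derivative f (at x) (\<Sum>b\<in>Basis. (h \<bullet> b) *\<^sub>R b)"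
      by (simp add: euclidean_representation)
    also have "\<dots> = (\<Sum>b\<in>Basis. (h \<bullet> b) *\<^sub>R pd b f x)"
      by (simp add: linear_sum[OF l] linear_cmul[OF l] pd_def)
    finally show "frechet_derivative f (at x) h = (\<Sum>b\<in>Basis. (h \<bullet> b) *\<^sub>R pd b f x)" .
  qed
  with d show ?thesis by simp
qed

lemma pd_cong_open:
  assumes "open S" "x \<in> S" "\<And>y. y \<in> S \<Longrightarrow> f y = g y"
  shows "pd b f x = pd b g x" "f differentiable (at x) \<longleftrightarrow> g differentiable (at x)"
proof -
  have *: "(f has_derivative D) (at x) \<longleftrightarrow> (g has_derivative D) (at x)" for D
    using assms by (metis has_derivative_transform_within_open)
  show "pd b f x = pd b g x" unfolding pd_def frechet_derivative_def * ..
  show "f differentiable (at x) \<longleftrightarrow> g differentiable (at x)" unfolding differentiable_def * ..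
qed

lemma C1_onD: "C1_on S f \<Longrightarrow> x \<in> S \<Longrightarrow> f differentiable (at x)"
  unfolding C1_on_def by blast
lemma C1_on_continuous: "C1_on S f \<Longrightarrow> continuous_on S f"
  unfolding C1_on_def by (metis continuous_at_imp_continuous_on differentiable_imp_continuous_within)
lemma C1_on_continuous_pd: "C1_on S f \<Longrightarrow> b \<in> Basis \<Longrightarrow> continuous_on S (pd b f)"
  unfolding C1_on_def by blast

lemma C1_on_cong:
  assumes "open S" "\<And>y. y \<in> S \<Longrightarrow> f y = g y" "C1_on S f"
  shows "C1_on S g"
  unfolding C1_on_def
proof (intro conjI ballI)
  show "g differentiable at x" if "x \<in> S" for x
    using pd_cong_open(2)[OF assms(1) that, of f g] assms(2) C1_onD[OF assms(3) that] by simp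
  show "continuous_on S (pd b g)" if "b \<in> Basis" for b
    by (rule continuous_on_eq[OF C1_on_continuous_pd[OF assms(3) that]])
       (rule pd_cong_open(1)[OF assms(1)], auto intro: assms(2))
qed

lemma C2_C1: "C2_on S f \<Longrightarrow> C1_on S f" unfolding C2_on_def by blast
lemma C2_C1_pd: "C2_on S f \<Longrightarrow> b \<in> Basis \<Longrightarrow> C1_on S (pd b f)" unfolding C2_on_def by blast
lemma C2_sym: "C2_on S f \<Longrightarrow> x \<in> S \<Longrightarrow> b \<in> Basis \<Longrightarrow> c \<in> Basis \<Longrightarrow> pd b (pd c f) x = pd c (pd b f) x"
  unfolding C2_on_def by blast

lemma C2_on_cong:
  assumes "open S" "\<And>y. y \<in> S \<Longrightarrow> f y = g y" "C2_on S f"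
  shows "C2_on S g"
proof -
  have p: "\<And>b x. x \<in> S \<Longrightarrow> pd b f x = pd b g x"
    by (rule pd_cong_open(1)[OF assms(1)]) (auto intro: assms(2))
  have pp: "\<And>b c x. x \<in> S \<Longrightarrow> pd c (pd b f) x = pd c (pd b g) x"
    by (rule pd_cong_open(1)[OF assms(1)]) (auto intro: p)
  show ?thesis
    unfolding C2_on_def
  proof (intro conjI ballI)
    show "C1_on S g" by (rule C1_on_cong[OF assms(1,2) C2_C1[OF assms(3)]])
    show "C1_on S (pd b g)" if "b \<in> Basis" for b
      by (rule C1_on_cong[OF assms(1) p C2_C1_pd[OF assms(3) that]])
    show "pd b (pd c g) x = pd c (pd b g) x" if "x \<in> S" "b \<in> Basis" "c \<in> Basis" for x b c
      using C2_sym[OF assms(3) that] pp[OF that(1)] by simp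
  qed
qed

lemma C1_on_Un:
  assumes "open S" "open T" "C1_on S f" "C1_on T f" shows "C1_on (S \<union> T) f"
  using assms unfolding C1_on_def by (auto intro: continuous_on_open_Un)

lemma C2_on_Un:
  assumes "open S" "open T" "C2_on S f" "C2_on T f" shows "C2_on (S \<union> T) f"
  using assms unfolding C2_on_def by (metis C1_on_Un UnE)

lemma C1_on_subset: "C1_on T f \<Longrightarrow> S \<subseteq> T \<Longrightarrow> C1_on S f"
  unfolding C1_on_def using continuous_on_subset by blast

lemma C2_on_subset: "C2_on T f \<Longrightarrow> S \<subseteq> T \<Longrightarrow> C2_on S f"
  unfolding C2_on_def by (metis C1_on_subset subsetD)

lemma C2_onD: "C2_on S f \<Longrightarrow> x \<in> S \<Longrightarrow> f differentiable (at x)"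
  "C2_on S f \<Longrightarrow> b \<in> Basis \<Longrightarrow> x \<in> S \<Longrightarrow> pd b f differentiable (at x)"
  by (rule C1_onD[OF C2_C1]; assumption) (rule C1_onD[OF C2_C1_pd]; assumption)
lemma C2_on_continuous_lap: "C2_on S f \<Longrightarrow> continuous_on S (lap f)"
  unfolding lap_def using C2_C1_pd C1_on_continuous_pd by (intro continuous_on_sum) blast
lemma C2_on_continuous: "C2_on S f \<Longrightarrow> continuous_on S f"
  by (rule C1_on_continuous[OF C2_C1])

lemma pd_const [simp]: "pd b (\<lambda>x. c) = (\<lambda>x. 0)"
  unfolding pd_def by auto

lemma C1_on_const: "C1_on S (\<lambda>x. c)" unfolding C1_on_def by auto
lemma C2_on_const: "C2_on S (\<lambda>x. c)" unfolding C2_on_def by (simp add: C1_on_const)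

lemma pd_add: "f differentiable (at x) \<Longrightarrow> g differentiable (at x) \<Longrightarrow>
  pd b (\<lambda>x. f x + g x) x = pd b f x + pd b g x"
  using pd_eqI[OF has_derivative_add[of f _ "at x" g]] by (simp add: frechet_derivative_works pd_def)

lemma C1_on_add:
  assumes "open S" "C1_on S f" "C1_on S g" shows "C1_on S (\<lambda>x. f x + g x)"
  unfolding C1_on_def
proof (intro conjI ballI)
  show "(\<lambda>x. f x + g x) differentiable at x" if "x \<in> S" for x
    using assms that unfolding C1_on_def by auto
  show "continuous_on S (pd b (\<lambda>x. f x + g x))" if "b \<in> Basis" for b
  proof -
    have "continuous_on S (\<lambda>x. pd b f x + pd b g x)"
      using assms that unfolding C1_on_def by (auto intro: continuous_on_add)
    then show ?thesis
      by (rule continuous_on_eq) (rule pd_add[symmetric]; rule C1_onD, rule assms)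
  qed
qed

lemma pd_linear: "bounded_linear h \<Longrightarrow> f differentiable (at x) \<Longrightarrow> pd b (\<lambda>x. h (f x)) x = h (pd b f x)"
  using pd_eqI[OF bounded_linear.has_derivative[of h f _ "at x"]] by (simp add: frechet_derivative_works pd_def)

lemma C1_on_linear:
  assumes "open S" "C1_on S f" "bounded_linear h" shows "C1_on S (\<lambda>x. h (f x))"
  unfolding C1_on_def
proof (intro conjI ballI)
  show "(\<lambda>x. h (f x)) differentiable at x" if "x \<in> S" for x
    using C1_onD[OF assms(2) that] bounded_linear.has_derivative[OF assms(3)] unfolding differentiable_def by blast
  show "continuous_on S (pd b (\<lambda>x. h (f x)))" if "b \<in> Basis" for b
  proof -
    have "continuous_on S (\<lambda>x. h (pd b f x))"
      using assms that unfolding C1_on_def by (auto intro: bounded_linear.continuous_on)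
    then show ?thesis
      by (rule continuous_on_eq) (rule pd_linear[symmetric, OF assms(3) C1_onD[OF assms(2)]])
  qed
qed

lemma C2_on_linear:
  assumes S: "open S" "C2_on S f" "bounded_linear h"
  shows "C2_on S (\<lambda>x. h (f x))"
    and "\<And>x. x \<in> S \<Longrightarrow> b \<in> Basis \<Longrightarrow> c \<in> Basis \<Longrightarrow> pd c (pd b (\<lambda>x. h (f x))) x = h (pd c (pd b f) x)"
    and "\<And>x. x \<in> S \<Longrightarrow> lap (\<lambda>x. h (f x)) x = h (lap f x)"
proof -
  have p: "\<And>b x. x \<in> S \<Longrightarrow> pd b (\<lambda>x. h (f x)) x = h (pd b f x)"
    by (rule pd_linear[OF S(3) C2_onD(1)[OF S(2)]])
  have pp: "pd c (pd b (\<lambda>x. h (f x))) x = h (pd c (pd b f) x)" if "x \<in> S" "b \<in> Basis" "c \<in> Basis" for b c x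
  proof -
    have "pd c (pd b (\<lambda>x. h (f x))) x = pd c (\<lambda>x. h (pd b f x)) x"
      by (rule pd_cong_open(1)[OF S(1) that(1)]) (rule p)
    then show ?thesis using pd_linear[OF S(3) C2_onD(2)[OF S(2) that(2,1)]] by simp
  qed
  show "\<And>x. x \<in> S \<Longrightarrow> b \<in> Basis \<Longrightarrow> c \<in> Basis \<Longrightarrow> pd c (pd b (\<lambda>x. h (f x))) x = h (pd c (pd b f) x)"
    using pp .
  show "\<And>x. x \<in> S \<Longrightarrow> lap (\<lambda>x. h (f x)) x = h (lap f x)"
    unfolding lap_def by (simp add: pp linear_sum[OF bounded_linear.linear[OF S(3)]])
  show "C2_on S (\<lambda>x. h (f x))"
    unfolding C2_on_def
  proof (intro conjI ballI)
    show "C1_on S (\<lambda>x. h (f x))" by (rule C1_on_linear[OF S(1) C2_C1[OF S(2)] S(3)])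
    show "C1_on S (pd b (\<lambda>x. h (f x)))" if "b \<in> Basis" for b
      by (rule C1_on_cong[OF S(1) p[symmetric] C1_on_linear[OF S(1) C2_C1_pd[OF S(2) that] S(3)]])
    show "pd b (pd c (\<lambda>x. h (f x))) x = pd c (pd b (\<lambda>x. h (f x))) x" if "x \<in> S" "b \<in> Basis" "c \<in> Basis" for x b c
      using pp[OF that] pp[OF that(1,3,2)] C2_sym[OF S(2) that] by simp
  qed
qed

lemma pd_add2:
  assumes S: "open S" "C2_on S f" "C2_on S g" "x \<in> S" "b \<in> Basis"
  shows "pd c (pd b (\<lambda>x. f x + g x)) x = pd c (pd b f) x + pd c (pd b g) x"
proof -
  have "pd c (pd b (\<lambda>x. f x + g x)) x = pd c (\<lambda>x. pd b f x + pd b g x) x"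
    by (rule pd_cong_open(1)[OF S(1,4)]) (rule pd_add; rule C2_onD, rule S)
  then show ?thesis using pd_add[OF C2_onD(2)[OF S(2,5,4)] C2_onD(2)[OF S(3,5,4)]] by simp
qed

lemma C2_on_add:
  assumes S: "open S" "C2_on S f" "C2_on S g" shows "C2_on S (\<lambda>x. f x + g x)"
  unfolding C2_on_def
proof (intro conjI ballI)
  show "C1_on S (\<lambda>x. f x + g x)" by (rule C1_on_add[OF S(1) C2_C1[OF S(2)] C2_C1[OF S(3)]])
  show "C1_on S (pd b (\<lambda>x. f x + g x))" if "b \<in> Basis" for b
  proof (rule C1_on_cong[OF S(1)])
    show "C1_on S (\<lambda>x. pd b f x + pd b g x)"
      by (rule C1_on_add[OF S(1) C2_C1_pd[OF S(2) that] C2_C1_pd[OF S(3) that]])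
    show "pd b f y + pd b g y = pd b (\<lambda>x. f x + g x) y" if "y \<in> S" for y
      by (rule pd_add[symmetric]) (rule C2_onD(1)[OF _ that], rule S)+
  qed
  show "pd b (pd c (\<lambda>x. f x + g x)) x = pd c (pd b (\<lambda>x. f x + g x)) x" if "x \<in> S" "b \<in> Basis" "c \<in> Basis" for x b c
    unfolding pd_add2[OF S that(1,2)] pd_add2[OF S that(1,3)] C2_sym[OF S(2) that] C2_sym[OF S(3) that] ..
qed

lemma lap_add:
  assumes S: "open S" "C2_on S f" "C2_on S g" "x \<in> S"
  shows "lap (\<lambda>x. f x + g x) x = lap f x + lap g x"
  unfolding lap_def by (simp add: pd_add2[OF S] sum.distrib)

section \<open>Product rules for bounded bilinear maps, covering real products and real multiples of
  complex functions\<close>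

context bounded_bilinear
begin

lemma pd_prod: "f differentiable (at x) \<Longrightarrow> g differentiable (at x) \<Longrightarrow>
  pd b (\<lambda>x. prod (f x) (g x)) x = prod (f x) (pd b g x) + prod (pd b f x) (g x)"
  using pd_eqI[OF FDERIV[of f _ x UNIV g]] by (simp add: frechet_derivative_works pd_def)

lemma C1_on_prod:
  assumes "open S" "C1_on S f" "C1_on S g" shows "C1_on S (\<lambda>x. prod (f x) (g x))"
  unfolding C1_on_def
proof (intro conjI ballI)
  show "(\<lambda>x. prod (f x) (g x)) differentiable at x" if "x \<in> S" for x
    using C1_onD[OF assms(2) that] C1_onD[OF assms(3) that] FDERIV unfolding differentiable_def by blast
  show "continuous_on S (pd b (\<lambda>x. prod (f x) (g x)))" if "b \<in> Basis" for b
  proof -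
    have "continuous_on S (\<lambda>x. prod (f x) (pd b g x) + prod (pd b f x) (g x))"
      using assms that by (intro continuous_on_add continuous_on C1_on_continuous C1_on_continuous_pd)
    then show ?thesis
      by (rule continuous_on_eq) (rule pd_prod[symmetric]; rule C1_onD, rule assms)
  qed
qed

lemma pd_prod2:
  assumes S: "open S" "C2_on S f" "C2_on S g" "x \<in> S" "b \<in> Basis" "c \<in> Basis"
  shows "pd c (pd b (\<lambda>x. prod (f x) (g x))) x =
    prod (f x) (pd c (pd b g) x) + prod (pd c f x) (pd b g x) +
    (prod (pd b f x) (pd c g x) + prod (pd c (pd b f) x) (g x))"
proof -
  have d: "f differentiable (at x)" "g differentiable (at x)" "pd b f differentiable (at x)" "pd b g differentiable (at x)"
    by (rule C2_onD(1)[OF S(2,4)] C2_onD(1)[OF S(3,4)] C2_onD(2)[OF S(2,5,4)] C2_onD(2)[OF S(3,5,4)])+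
  have "pd c (pd b (\<lambda>x. prod (f x) (g x))) x = pd c (\<lambda>x. prod (f x) (pd b g x) + prod (pd b f x) (g x)) x"
    by (rule pd_cong_open(1)[OF S(1,4)]) (rule pd_prod; rule C2_onD, rule S)
  also have "\<dots> = pd c (\<lambda>x. prod (f x) (pd b g x)) x + pd c (\<lambda>x. prod (pd b f x) (g x)) x"
    using d by (intro pd_add) (auto simp: differentiable_def intro: FDERIV)
  finally show ?thesis by (simp add: pd_prod d)
qed

lemma C2_on_prod:
  assumes S: "open S" "C2_on S f" "C2_on S g" shows "C2_on S (\<lambda>x. prod (f x) (g x))"
  unfolding C2_on_def
proof (intro conjI ballI)
  show "C1_on S (\<lambda>x. prod (f x) (g x))" by (rule C1_on_prod[OF S(1) C2_C1[OF S(2)] C2_C1[OF S(3)]])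
  show "C1_on S (pd b (\<lambda>x. prod (f x) (g x)))" if "b \<in> Basis" for b
  proof (rule C1_on_cong[OF S(1)])
    show "C1_on S (\<lambda>x. prod (f x) (pd b g x) + prod (pd b f x) (g x))"
      by (rule C1_on_add[OF S(1) C1_on_prod[OF S(1) C2_C1[OF S(2)] C2_C1_pd[OF S(3) that]]
        C1_on_prod[OF S(1) C2_C1_pd[OF S(2) that] C2_C1[OF S(3)]]])
    show "prod (f y) (pd b g y) + prod (pd b f y) (g y) = pd b (\<lambda>x. prod (f x) (g x)) y" if "y \<in> S" for y
      by (rule pd_prod[symmetric]) (rule C2_onD(1)[OF _ that], rule S)+
  qed
  show "pd b (pd c (\<lambda>x. prod (f x) (g x))) x = pd c (pd b (\<lambda>x. prod (f x) (g x))) x" if "x \<in> S" "b \<in> Basis" "c \<in> Basis" for x b c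
    unfolding pd_prod2[OF S that(1,3,2)] pd_prod2[OF S that] C2_sym[OF S(2) that] C2_sym[OF S(3) that]
    by (simp add: algebra_simps)
qed

lemma lap_prod:
  assumes S: "open S" "C2_on S f" "C2_on S g" "x \<in> S"
  shows "lap (\<lambda>x. prod (f x) (g x)) x =
    prod (f x) (lap g x) + 2 *\<^sub>R (\<Sum>b\<in>Basis. prod (pd b f x) (pd b g x)) + prod (lap f x) (g x)"
  unfolding lap_def
  by (simp add: pd_prod2[OF S] sum.distrib sum_left sum_right scaleR_sum_right scaleR_2 )

end

lemmas pd_mult = bounded_bilinear.pd_prod[OF bounded_bilinear_mult]
lemmas C1_on_mult = bounded_bilinear.C1_on_prod[OF bounded_bilinear_mult]
lemmas C2_on_mult = bounded_bilinear.C2_on_prod[OF bounded_bilinear_mult]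
lemmas lap_mult = bounded_bilinear.lap_prod[OF bounded_bilinear_mult]
lemmas C2_on_scaleR = bounded_bilinear.C2_on_prod[OF bounded_bilinear_scaleR]
lemmas lap_scaleR = bounded_bilinear.lap_prod[OF bounded_bilinear_scaleR]

lemma pd_zero_outside:
  assumes "closed K" "\<And>x. x \<notin> K \<Longrightarrow> f x = 0" "x \<notin> K"
  shows "pd b f x = 0"
proof -
  have "pd b f x = pd b (\<lambda>x. 0) x"
    by (rule pd_cong_open[of "-K"]) (use assms in auto)
  then show ?thesis by simp
qed

lemma lap_zero_outside:
  assumes "closed K" "\<And>x. x \<notin> K \<Longrightarrow> f x = 0" "x \<notin> K"
  shows "lap f x = 0"
  unfolding lap_def using pd_zero_outside[OF assms(1) pd_zero_outside[OF assms(1,2)] assms(3)] by simp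

text \<open>The open sets \<open>S\<close> and \<open>- K\<close> cover the space. This is how a
  weight that is singular at the origin becomes harmless once it multiplies a function vanishing
  near the origin.\<close>

lemma C1_on_UNIV_extend:
  assumes "open S" "C1_on S f" "closed K" "K \<subseteq> S" "\<And>x. x \<notin> K \<Longrightarrow> f x = 0"
  shows "C1_on UNIV f"
proof -
  have "C1_on (S \<union> -K) f"
  proof (rule C1_on_Un)
    show "C1_on (-K) f" by (rule C1_on_cong[OF _ _ C1_on_const[of _ 0]]) (use assms in auto)
  qed (use assms in auto)
  moreover have "S \<union> -K = UNIV" using assms by auto
  ultimately show ?thesis by simp
qed

lemma C2_on_UNIV_extend:
  assumes "open S" "C2_on S f" "closed K" "K \<subseteq> S" "\<And>x. x \<notin> K \<Longrightarrow> f x = 0"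
  shows "C2_on UNIV f"
proof -
  have "C2_on (S \<union> -K) f"
  proof (rule C2_on_Un)
    show "C2_on (-K) f" by (rule C2_on_cong[OF _ _ C2_on_const[of _ 0]]) (use assms in auto)
  qed (use assms in auto)
  moreover have "S \<union> -K = UNIV" using assms by auto
  ultimately show ?thesis by simp
qed

section \<open>Integration of compactly supported functions\<close>

lemma integrable_compact_support:
  fixes f :: "'a::euclidean_space \<Rightarrow> 'b::{banach, second_countable_topology}"
  assumes "continuous_on UNIV f" "\<And>x. x \<notin> ball 0 R \<Longrightarrow> f x = 0"
  shows "integrable lborel f"
proof -
  have "integrable lborel (\<lambda>x. indicator (cball 0 R) x *\<^sub>R f x)"
    using assms by (intro borel_integrable_compact) (auto intro: continuous_on_subset)
  also have "(\<lambda>x. indicator (cball 0 R) x *\<^sub>R f x) = f"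
    using assms(2) by (auto simp: indicator_def fun_eq_iff)
  finally show ?thesis .
qed

lemma integral_translate:
  fixes f :: "'a::euclidean_space \<Rightarrow> 'b::{banach, second_countable_topology}"
  shows "(LBINT x. f (x + c)) = (LBINT x. f x)"
    "integrable lborel (\<lambda>x. f (x + c)) \<longleftrightarrow> integrable lborel f"
proof -
  have *: "lborel = distr lborel borel (\<lambda>x. x + c)"
    using lborel_distr_plus[of c] by (simp add: add.commute[of _ c])
  have m: "(\<lambda>x. x + c) \<in> measurable lborel borel" by simp
  have i: "integrable lborel f" if "integrable lborel (\<lambda>x. f (x + c))" for f :: "'a \<Rightarrow> 'b" and c
  proof -
    have *: "lborel = distr lborel borel (\<lambda>x. x + c)"
      using lborel_distr_plus[of c] by (simp add: add.commute[of _ c])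
    have "(\<lambda>x. f ((x + -c) + c)) \<in> borel_measurable lborel"
      using borel_measurable_integrable[OF that] by measurable
    then have "f \<in> borel_measurable borel" by simp
    then show ?thesis using that by (subst *) (simp add: integrable_distr_eq)
  qed
  show "integrable lborel (\<lambda>x. f (x + c)) \<longleftrightarrow> integrable lborel f"
    using i[of f c] i[of "\<lambda>x. f (x + c)" "-c"] by (auto simp: add.assoc)
  then show "(LBINT x. f (x + c)) = (LBINT x. f x)"
    apply (cases "integrable lborel f")
    subgoal by (subst (2) *) (auto simp: integral_distr)
    subgoal by (simp add: not_integrable_integral_eq)
    done
qed

lemma compact_support_bounded:
  fixes f :: "'a::euclidean_space \<Rightarrow> 'b::real_normed_vector"
  assumes "continuous_on UNIV f" "\<And>x. x \<notin> ball 0 R \<Longrightarrow> f x = 0"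
  obtains B where "B \<ge> 0" "\<And>x. norm (f x) \<le> B"
proof -
  have "compact (f ` cball 0 R)"
    using assms by (intro compact_continuous_image) (auto intro: continuous_on_subset)
  then obtain B where "\<forall>y\<in>f ` cball 0 R. norm y \<le> B" using compact_imp_bounded bounded_iff by metis
  then have "norm (f x) \<le> max B 0" for x using assms(2)[of x] by (cases "x \<in> cball 0 R") force+
  then show ?thesis using that[of "max B 0"] by auto
qed

text \<open>Difference quotients of \<open>f\<close> have integral zero by translation invariance of
  Lebesgue measure, and they converge to the partial derivative under a common integrable
  bound.\<close>

theorem integral_pd_zero:
  fixes f :: "'a::euclidean_space \<Rightarrow> 'b::{banach, second_countable_topology}"
  assumes f: "C1_on UNIV f" "\<And>x. x \<notin> ball 0 R \<Longrightarrow> f x = 0" and b: "b \<in> Basis"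
  shows "(LBINT x. pd b f x) = 0"
proof -
  have c: "continuous_on UNIV f" "continuous_on UNIV (pd b f)" using C1_on_continuous C1_on_continuous_pd f b by blast+
  have z: "pd b f x = 0" if "x \<notin> cball 0 R" for x
    by (rule pd_zero_outside[of "cball 0 R"]) (use that f in auto)
  obtain B where B: "B \<ge> 0" "\<And>x. norm (pd b f x) \<le> B"
    using compact_support_bounded[OF c(2), of "R+1"] z by auto
  define t where "t n = 1 / real (Suc n)" for n
  have t: "t n > 0" "t n \<le> 1" for n by (auto simp: t_def)
  have t0: "t \<longlonglongrightarrow> 0" unfolding t_def using LIMSEQ_Suc[OF lim_1_over_n] by simp
  define q where "q n x = (1 / t n) *\<^sub>R (f (x + t n *\<^sub>R b) - f x)" for n x
  have hd: "((\<lambda>s. f (x + s *\<^sub>R b)) has_vector_derivative pd b f (x + s *\<^sub>R b)) (at s)" for x s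
  proof -
    have "(f has_derivative (\<lambda>h. \<Sum>c\<in>Basis. (h \<bullet> c) *\<^sub>R pd c f (x + s *\<^sub>R b))) (at (x + s *\<^sub>R b))"
      by (rule has_derivative_pd[OF C1_onD[OF f(1)]]) simp
    moreover have "((\<lambda>s. x + s *\<^sub>R b) has_derivative (\<lambda>h. h *\<^sub>R b)) (at s)"
      by (auto intro!: derivative_eq_intros)
    ultimately have "((\<lambda>s. f (x + s *\<^sub>R b)) has_derivative (\<lambda>h. \<Sum>c\<in>Basis. ((h *\<^sub>R b) \<bullet> c) *\<^sub>R pd c f (x + s *\<^sub>R b))) (at s)"
      by (rule has_derivative_compose[of "\<lambda>s. x + s *\<^sub>R b" _ s UNIV f, rotated])
    moreover have "(\<Sum>c\<in>Basis. ((h *\<^sub>R b) \<bullet> c) *\<^sub>R pd c f (x + s *\<^sub>R b)) = h *\<^sub>R pd b f (x + s *\<^sub>R b)" for h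
      using b by (simp add: inner_Basis if_distrib if_distribR sum.delta cong: if_cong)
    ultimately show ?thesis by (simp add: has_vector_derivative_def)
  qed
  have lim: "(\<lambda>n. q n x) \<longlonglongrightarrow> pd b f x" for x
  proof -
    have "((\<lambda>s. norm (f (x + s *\<^sub>R b) - f x - s *\<^sub>R pd b f x) / norm s) \<longlongrightarrow> 0) (at 0)"
      using hd[of x 0] unfolding has_vector_derivative_def has_derivative_iff_norm by simp
    moreover have "filterlim t (at 0) sequentially"
      using t0 t by (intro filterlim_atI) (auto simp: less_imp_neq[symmetric])
    ultimately have "(\<lambda>n. norm (f (x + t n *\<^sub>R b) - f x - t n *\<^sub>R pd b f x) / norm (t n)) \<longlonglongrightarrow> 0"
      by (rule filterlim_compose)
    moreover have "norm (f (x + t n *\<^sub>R b) - f x - t n *\<^sub>R pd b f x) / norm (t n) = norm (q n x - pd b f x)" for n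
    proof -
      have "q n x - pd b f x = (1 / t n) *\<^sub>R (f (x + t n *\<^sub>R b) - f x - t n *\<^sub>R pd b f x)"
        using t[of n] by (simp add: q_def scaleR_diff_right)
      then show ?thesis using t[of n] by simp
    qed
    ultimately have "(\<lambda>n. q n x - pd b f x) \<longlonglongrightarrow> 0" by (simp add: tendsto_norm_zero_iff)
    then show ?thesis by (simp add: LIM_zero_iff)
  qed
  \<comment> \<open>Mean value inequality along the segment. As every \<open>t n\<close> is at most
    1, all quotients vanish outside the ball of radius \<open>R + 1\<close>, so \<open>B\<close>
    times its indicator dominates them.\<close>
  have bd: "norm (q n x) \<le> B" for n x
  proof -
    have "norm (f (x + t n *\<^sub>R b) - f (x + 0 *\<^sub>R b)) \<le> B * norm (t n - 0)"
      by (rule differentiable_bound[of UNIV "\<lambda>s. f (x + s *\<^sub>R b)" "\<lambda>s h. h *\<^sub>R pd b f (x + s *\<^sub>R b)"])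
         (use hd B in \<open>auto simp: has_vector_derivative_def mult.commute[of B] intro!: onorm_bound mult_left_mono\<close>)
    then have "norm (f (x + t n *\<^sub>R b) - f x) \<le> B * t n" using t[of n] by simp
    moreover have "norm (q n x) = norm (f (x + t n *\<^sub>R b) - f x) / t n"
      using t[of n] by (simp add: q_def)
    ultimately show ?thesis using t[of n] by (simp add: divide_le_eq)
  qed
  have "(\<lambda>n. LBINT x. q n x) \<longlonglongrightarrow> (LBINT x. pd b f x)"
  proof (rule integral_dominated_convergence[where w="\<lambda>x. B * indicator (ball 0 (R+1)) x"])
    show "integrable lborel (\<lambda>x. B * indicator (ball 0 (R + 1)) x)"
      by (intro integrable_mult_right integrable_real_indicator) (use emeasure_lborel_ball_finite in auto)
    show "q n \<in> borel_measurable lborel" for n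
      unfolding q_def using borel_measurable_continuous_onI[OF c(1)] by measurable
    show "pd b f \<in> borel_measurable lborel" using borel_measurable_continuous_onI[OF c(2)] by simp
    show "AE x in lborel. norm (q n x) \<le> B * indicator (ball 0 (R + 1)) x" for n
    proof (rule AE_I2)
      fix x :: 'a
      show "norm (q n x) \<le> B * indicator (ball 0 (R + 1)) x"
      proof (cases "x \<in> ball 0 (R+1)")
        case False
        then have "norm x \<ge> R + 1" by simp
        moreover have "norm x \<le> norm (x + t n *\<^sub>R b) + 1"
          using norm_triangle_ineq4[of "x + t n *\<^sub>R b" "t n *\<^sub>R b"] b t[of n] by simp
        ultimately have "f x = 0" "f (x + t n *\<^sub>R b) = 0" using f(2) by auto
        then show ?thesis using False B by (simp add: q_def)
      qed (use bd in auto)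
    qed
  qed (use lim in auto)
  moreover have "(LBINT x. q n x) = 0" for n
    unfolding q_def using integrable_compact_support[OF c(1) f(2)]
    by (simp add: integral_translate)
  ultimately show ?thesis by (simp add: LIMSEQ_const_iff)
qed

section \<open>Square-integrable functions\<close>

definition sqint :: "('a::euclidean_space \<Rightarrow> complex) \<Rightarrow> bool" where
  "sqint f \<longleftrightarrow> f \<in> borel_measurable borel \<and> integrable lborel (\<lambda>x. (cmod (f x))^2)"

lemma sqint_meas: "sqint f \<Longrightarrow> f \<in> borel_measurable borel" and sqint_int: "sqint f \<Longrightarrow> integrable lborel (\<lambda>x. (cmod (f x))^2)"
  by (auto simp: sqint_def)

lemma cmod_add_sq: "(cmod (a + b))^2 \<le> 2 * (cmod a)^2 + 2 * (cmod b)^2"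
proof -
  have "(cmod (a + b))^2 \<le> (cmod a + cmod b)^2" by (intro power_mono norm_triangle_ineq) simp
  also have "\<dots> \<le> 2 * (cmod a)^2 + 2 * (cmod b)^2"
    using sum_squares_bound[of "cmod a" "cmod b"] by (simp add: power2_sum)
  finally show ?thesis .
qed

lemma cmod_diff_sq: "(cmod (a - b))^2 \<le> 2 * (cmod a)^2 + 2 * (cmod b)^2"
  using cmod_add_sq[of a "- b"] by simp

lemma sqint_bound:
  assumes "sqint g" "f \<in> borel_measurable borel" "\<And>x. cmod (f x) \<le> c * cmod (g x)"
  shows "sqint f"
  unfolding sqint_def
proof (intro conjI assms(2))
  note [measurable] = assms(2)
  show "integrable lborel (\<lambda>x. (cmod (f x))^2)"
  proof (rule integrable_bound)
    show "integrable lborel (\<lambda>x. c^2 * (cmod (g x))^2)" using sqint_int[OF assms(1)] by simp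
    have "(cmod (f x))^2 \<le> (c * cmod (g x))^2" for x by (intro power_mono assms(3)) simp
    then show "AE x in lborel. norm ((cmod (f x))^2) \<le> norm (c^2 * (cmod (g x))^2)"
      by (auto simp: power_mult_distrib)
  qed measurable
qed

lemma sqint_add: assumes "sqint f" "sqint g" shows "sqint (\<lambda>x. f x + g x)"
  unfolding sqint_def
proof
  note [measurable] = sqint_meas[OF assms(1)] sqint_meas[OF assms(2)]
  show "(\<lambda>x. f x + g x) \<in> borel_measurable borel" by measurable
  show "integrable lborel (\<lambda>x. (cmod (f x + g x))^2)"
  proof (rule integrable_bound)
    show "integrable lborel (\<lambda>x. 2 * (cmod (f x))^2 + 2 * (cmod (g x))^2)" using assms by (simp add: sqint_int)
    show "AE x in lborel. norm ((cmod (f x + g x))^2) \<le> norm (2 * (cmod (f x))^2 + 2 * (cmod (g x))^2)"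
      using cmod_add_sq by (intro AE_I2) auto
  qed measurable
qed

lemma sqint_scale: "sqint f \<Longrightarrow> sqint (\<lambda>x. c * f x)"
  by (rule sqint_bound[of f _ "cmod c"]) (auto simp: norm_mult dest: sqint_meas)

lemma sqint_diff: assumes "sqint f" "sqint g" shows "sqint (\<lambda>x. f x - g x)"
  using sqint_add[OF assms(1) sqint_scale[OF assms(2), of "-1"]] by simp

lemma sqint_indicator: "sqint f \<Longrightarrow> A \<in> sets borel \<Longrightarrow> sqint (\<lambda>x. indicator A x * f x)"
  by (rule sqint_bound[of f _ 1]) (auto dest: sqint_meas simp: indicator_def)

lemma sqint_mult_integrable:
  assumes "sqint f" "sqint g" shows "integrable lborel (\<lambda>x. f x * g x)" "integrable lborel (\<lambda>x. f x * cnj (g x))"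
proof -
  note [measurable] = sqint_meas[OF assms(1)] sqint_meas[OF assms(2)]
  have i: "integrable lborel (\<lambda>x. (cmod (f x))^2 + (cmod (g x))^2)" using assms by (simp add: sqint_int)
  have b: "cmod (f x) * cmod (g x) \<le> (cmod (f x))^2 + (cmod (g x))^2" for x
  proof -
    have "p * q \<le> p^2 + q^2" if "p \<ge> 0" "q \<ge> 0" for p q :: real
      using sum_squares_bound[of p q] mult_nonneg_nonneg[OF that] unfolding mult.assoc by linarith
    then show ?thesis by simp
  qed
  show "integrable lborel (\<lambda>x. f x * g x)"
    by (rule integrable_bound[OF i]) (use b in \<open>auto simp: norm_mult\<close>)
  have "(\<lambda>x. f x * cnj (g x)) \<in> borel_measurable lborel"
    using borel_measurable_continuous_on[OF continuous_on_cnj[OF continuous_on_id], of g lborel] by simp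
  then show "integrable lborel (\<lambda>x. f x * cnj (g x))"
    by (rule integrable_bound[OF i]) (use b in \<open>auto simp: norm_mult\<close>)
qed

lemma sqint_translate: "sqint f \<Longrightarrow> sqint (\<lambda>x. f (x + c))"
  unfolding sqint_def using integral_translate(2)[of "\<lambda>x. (cmod (f x))^2" c] by auto

lemma sqint_cont: "continuous_on UNIV f \<Longrightarrow> (\<And>x. x \<notin> ball 0 R \<Longrightarrow> f x = 0) \<Longrightarrow> sqint f"
  unfolding sqint_def
  by (auto intro!: borel_measurable_continuous_onI integrable_compact_support[of _ R] continuous_intros)

lemma L2_triangle:
  assumes "sqint f" "sqint g" "sqint h"
  shows "L2sq (\<lambda>x. f x - h x) \<le> 2 * L2sq (\<lambda>x. f x - g x) + 2 * L2sq (\<lambda>x. g x - h x)"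
proof -
  note i = sqint_int[OF sqint_diff[OF assms(1,2)]] sqint_int[OF sqint_diff[OF assms(2,3)]]
  have "L2sq (\<lambda>x. f x - h x) \<le> (LBINT x. 2 * (cmod (f x - g x))^2 + 2 * (cmod (g x - h x))^2)"
  proof (rule integral_mono[OF sqint_int[OF sqint_diff[OF assms(1,3)]]])
    show "(cmod (f x - h x))^2 \<le> 2 * (cmod (f x - g x))^2 + 2 * (cmod (g x - h x))^2" for x
      using cmod_add_sq[of "f x - g x" "g x - h x"] by simp
  qed (use i in simp)
  then show ?thesis using i by simp
qed

lemma sqint_zero: "sqint (\<lambda>x. 0)" by (simp add: sqint_def)

lemma L2on_add:
  assumes [measurable]: "A \<in> sets borel" "f \<in> borel_measurable borel" "g \<in> borel_measurable borel"
    and i: "L2int A f" "L2int A g"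
  shows "L2int A (\<lambda>x. f x + g x)" "L2on A (\<lambda>x. f x + g x) \<le> 2 * L2on A f + 2 * L2on A g"
proof -
  have b: "indicator A x * (cmod (f x + g x))^2 \<le> 2 * (indicator A x * (cmod (f x))^2) + 2 * (indicator A x * (cmod (g x))^2)" for x
    using cmod_add_sq[of "f x" "g x"] by (simp add: indicator_def)
  have s: "integrable lborel (\<lambda>x. 2 * (indicator A x * (cmod (f x))^2) + 2 * (indicator A x * (cmod (g x))^2))" using i by simp
  show l: "L2int A (\<lambda>x. f x + g x)" by (rule integrable_bound[OF s]) (use b in auto)
  have "L2on A (\<lambda>x. f x + g x) \<le> (LBINT x. 2 * (indicator A x * (cmod (f x))^2) + 2 * (indicator A x * (cmod (g x))^2))"
    by (rule integral_mono[OF l s b])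
  then show "L2on A (\<lambda>x. f x + g x) \<le> 2 * L2on A f + 2 * L2on A g" using i by simp
qed

lemma L2on_subset:
  assumes "A \<subseteq> B" and [measurable]: "A \<in> sets borel" and f: "L2int B f"
  shows "L2int A f" "L2on A f \<le> L2on B f"
proof -
  have "integrable lborel (\<lambda>x. indicator A x *\<^sub>R (indicator B x * (cmod (f x))^2))"
    by (rule integrable_mult_indicator[OF _ f]) simp
  also have "(\<lambda>x. indicator A x *\<^sub>R (indicator B x * (cmod (f x))^2)) = (\<lambda>x. indicator A x * (cmod (f x))^2)"
    using assms(1) by (auto simp: indicator_def fun_eq_iff)
  finally show i: "L2int A f" .
  show "L2on A f \<le> L2on B f" by (rule integral_mono[OF i f]) (use assms(1) in \<open>auto simp: indicator_def\<close>)
qed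

text \<open>Moves mass bounds from an approximating function to the solution and back. The error is
  measured on the fixed larger set \<open>B\<close>, so that one limit serves all
  \<open>A\<close>.\<close>

lemma L2on_perturb:
  assumes m: "A \<subseteq> B" "A \<in> sets borel" "B \<in> sets borel" "f \<in> borel_measurable borel" "g \<in> borel_measurable borel"
    and i: "L2int B f" "L2int B g"
  shows "L2int B (\<lambda>x. f x - g x)"
    "L2on A f \<le> 2 * L2on A g + 2 * L2on B (\<lambda>x. f x - g x)" "L2on A g \<le> 2 * L2on A f + 2 * L2on B (\<lambda>x. f x - g x)"
proof -
  note [measurable] = m(4,5)
  have d: "(\<lambda>x. f x - g x) \<in> borel_measurable borel" "(\<lambda>x. - g x) \<in> borel_measurable borel" "(\<lambda>x. g x - f x) \<in> borel_measurable borel" by measurable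
  show j: "L2int B (\<lambda>x. f x - g x)" using L2on_add(1)[OF m(3,4) d(2) i(1)] i(2) by simp
  then have j': "L2int B (\<lambda>x. g x - f x)" by (simp add: norm_minus_commute)
  note s = L2on_subset[OF m(1,2)]
  show "L2on A f \<le> 2 * L2on A g + 2 * L2on B (\<lambda>x. f x - g x)"
    using L2on_add(2)[OF m(2,5) d(1) s(1)[OF i(2)] s(1)[OF j]] s(2)[OF j] by simp
  show "L2on A g \<le> 2 * L2on A f + 2 * L2on B (\<lambda>x. f x - g x)"
    using L2on_add(2)[OF m(2,4) d(3) s(1)[OF i(1)] s(1)[OF j']] s(2)[OF j] by (simp add: norm_minus_commute)
qed

lemma L2on_le_L2sq:
  assumes [measurable]: "A \<in> sets borel" "f \<in> borel_measurable borel" and g: "sqint g"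
    and e: "AE x in lborel. x \<in> A \<longrightarrow> f x = g x"
  shows "L2int A f" "L2on A f \<le> L2sq g"
proof -
  have le: "AE x in lborel. indicator A x * (cmod (f x))^2 \<le> (cmod (g x))^2"
    using e by eventually_elim (simp add: indicator_def)
  show i: "L2int A f" by (rule integrable_bound[OF sqint_int[OF g]]) (use le in auto)
  show "L2on A f \<le> L2sq g" by (rule integral_mono_AE[OF i sqint_int[OF g] le])
qed

section \<open>Energy estimates\<close>

definition gsq :: "('a::euclidean_space \<Rightarrow> real) \<Rightarrow> 'a \<Rightarrow> real" where
  "gsq u x = (\<Sum>b\<in>Basis. (pd b u x)^2)"

definition gdot :: "('a::euclidean_space \<Rightarrow> real) \<Rightarrow> ('a \<Rightarrow> real) \<Rightarrow> 'a \<Rightarrow> real" where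
  "gdot u v x = (\<Sum>b\<in>Basis. pd b u x * pd b v x)"

lemma gsq_nonneg: "0 \<le> gsq u x" unfolding gsq_def by (intro sum_nonneg) auto

lemma gdot_sq: "(gdot u v x)^2 \<le> gsq u x * gsq v x"
  unfolding gsq_def gdot_def by (rule Cauchy_Schwarz_ineq_sum)

lemma gsq_continuous: "C1_on S u \<Longrightarrow> continuous_on S (gsq u)"
  unfolding gsq_def by (intro continuous_on_sum continuous_on_power C1_on_continuous_pd)
lemma lap_mult_real:
  fixes f g :: "'a::euclidean_space \<Rightarrow> real"
  assumes "open S" "C2_on S f" "C2_on S g" "x \<in> S"
  shows "lap (\<lambda>x. f x * g x) x = f x * lap g x + 2 * gdot f g x + lap f x * g x"
  using lap_mult[OF assms] by (simp add: gdot_def)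

lemma integrable_bounded_times_continuous:
  fixes m f :: "'a::euclidean_space \<Rightarrow> real"
  assumes m: "m \<in> borel_measurable borel" "\<And>x. \<bar>m x\<bar> \<le> B" "\<And>x. x \<notin> ball 0 R \<Longrightarrow> m x = 0"
    and f: "continuous_on UNIV f"
  shows "integrable lborel (\<lambda>x. m x * f x)"
proof (rule integrable_bound)
  have "integrable lborel (\<lambda>x. indicator (cball 0 R) x *\<^sub>R (B * f x))"
    by (intro borel_integrable_compact) (auto intro!: continuous_intros continuous_on_subset[OF f])
  then show "integrable lborel (\<lambda>x. indicator (cball 0 R) x *\<^sub>R (B * f x))" .
  show "(\<lambda>x. m x * f x) \<in> borel_measurable lborel"
    using m(1) borel_measurable_continuous_onI[OF f] by measurable
  show "AE x in lborel. norm (m x * f x) \<le> norm (indicator (cball 0 R) x *\<^sub>R (B * f x))"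
  proof (rule AE_I2)
    fix x :: 'a
    have "B \<ge> 0" using m(2)[of x] by linarith
    then show "norm (m x * f x) \<le> norm (indicator (cball 0 R) x *\<^sub>R (B * f x))"
      using m(2,3)[of x] by (cases "x \<in> ball 0 R") (auto simp: abs_mult intro!: mult_right_mono)
  qed
qed

lemma integral_divergence_zero:
  fixes F :: "'a::euclidean_space \<Rightarrow> 'a \<Rightarrow> real"
  assumes F: "\<And>b. b \<in> Basis \<Longrightarrow> C1_on UNIV (F b)" "\<And>b x. b \<in> Basis \<Longrightarrow> x \<notin> ball 0 R \<Longrightarrow> F b x = 0"
  shows "integrable lborel (\<lambda>x. \<Sum>b\<in>Basis. pd b (F b) x)" "(LBINT x. (\<Sum>b\<in>Basis. pd b (F b) x)) = 0"
proof -
  have z: "pd b (F b) x = 0" if "b \<in> Basis" "x \<notin> ball 0 (R+1)" for b x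
    by (rule pd_zero_outside[of "cball 0 R"]) (use that F(2)[OF that(1)] in auto)
  have i: "integrable lborel (pd b (F b))" if "b \<in> Basis" for b
    by (rule integrable_compact_support[OF C1_on_continuous_pd[OF F(1)[OF that] that], of "R+1"]) (rule z[OF that])
  show "integrable lborel (\<lambda>x. \<Sum>b\<in>Basis. pd b (F b) x)" using i by (rule Bochner_Integration.integrable_sum)
  have "(LBINT x. (\<Sum>b\<in>Basis. pd b (F b) x)) = (\<Sum>b\<in>Basis. LBINT x. pd b (F b) x)"
    using i by (rule Bochner_Integration.integral_sum)
  also have "\<dots> = 0"
    by (intro sum.neutral ballI) (rule integral_pd_zero[OF F(1) F(2)])
  finally show "(LBINT x. (\<Sum>b\<in>Basis. pd b (F b) x)) = 0" .
qed

text \<open>\<open>\<beta>\<close> plays the role of \<open>\<zeta>^2 w\<close>, \<open>\<alpha>\<close> of \<open>\<zeta> w\<close> and \<open>m\<close> of \<open>1_A w\<close> for a cut-off \<open>\<zeta>\<close> supported in \<open>A\<close> and a weight \<open>w\<close>.\<close>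

lemma energy_estimate:
  fixes u \<alpha> \<beta> m :: "'a::euclidean_space \<Rightarrow> real"
  assumes u: "C2_on UNIV u" and \<beta>: "C2_on UNIV \<beta>" and \<alpha>: "C1_on UNIV \<alpha>"
    and supp: "\<And>x. x \<notin> ball 0 R \<Longrightarrow> \<alpha> x = 0" "\<And>x. x \<notin> ball 0 R \<Longrightarrow> \<beta> x = 0" "\<And>x. x \<notin> ball 0 R \<Longrightarrow> m x = 0"
    and m: "m \<in> borel_measurable borel" "\<And>x. 0 \<le> m x" "\<And>x. m x \<le> B" and L: "L > 0"
    and p: "\<And>x. gsq \<beta> x \<le> (L * \<alpha> x)^2" "\<And>x. gsq \<alpha> x \<le> (L * m x)^2" "\<And>x. \<bar>lap \<beta> x\<bar> \<le> L^2 * m x"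
      "\<And>x. (\<alpha> x)^2 \<le> \<beta> x * m x"
  defines "A \<equiv> (LBINT x. (\<beta> x)^2 * (lap u x)^2)" and "M \<equiv> (LBINT x. (m x)^2 * (u x)^2)"
  shows "L^2 * (LBINT x. (\<alpha> x)^2 * gsq u x) \<le> A + 5 * L^4 * M"
    and "(LBINT x. (lap (\<lambda>x. \<beta> x * u x) x)^2) \<le> 15 * A + 63 * L^4 * M"
    and "integrable lborel (\<lambda>x. (m x)^2 * (u x)^2)"
proof -
  note cu = C2_on_continuous[OF u] C2_on_continuous_lap[OF u] gsq_continuous[OF C2_C1[OF u]]
  note c\<beta> = C2_on_continuous[OF \<beta>] C2_on_continuous_lap[OF \<beta>]
  note c\<alpha> = C1_on_continuous[OF \<alpha>]
  define G where "G = (LBINT x. (\<alpha> x)^2 * gsq u x)"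
  have iA: "integrable lborel (\<lambda>x. (\<beta> x)^2 * (lap u x)^2)"
    by (rule integrable_compact_support[of _ R]) (auto intro!: continuous_intros cu c\<beta> simp: supp)
  have iG: "integrable lborel (\<lambda>x. (\<alpha> x)^2 * gsq u x)"
    by (rule integrable_compact_support[of _ R]) (auto intro!: continuous_intros cu c\<alpha> simp: supp)
  show iM: "integrable lborel (\<lambda>x. (m x)^2 * (u x)^2)"
  proof (rule integrable_bounded_times_continuous)
    show "(\<lambda>x. (m x)^2) \<in> borel_measurable borel" using m(1) by measurable
    show "\<bar>(m x)^2\<bar> \<le> B^2" for x using m(2,3)[of x] by (simp add: power_mono)
  qed (use supp cu in \<open>auto intro!: continuous_intros\<close>)
  \<comment> \<open>The field \<alpha>^2 u grad u: its divergence integrates to zero and contains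
    \<open>(\<alpha> x)^2 * gsq u x\<close>, the term to be bounded.\<close>
  define F where "F b x = (\<alpha> x * \<alpha> x) * (u x * pd b u x)" for b x
  have F1: "C1_on UNIV (F b)" if "b \<in> Basis" for b
    unfolding F_def by (intro C1_on_mult \<alpha> C2_C1[OF u] C2_C1_pd[OF u that] open_UNIV)
  have F0: "F b x = 0" if "x \<notin> ball 0 R" for b x using supp(1)[OF that] by (simp add: F_def)
  note div = integral_divergence_zero[OF F1 F0]
  have du: "u differentiable at x" "\<alpha> differentiable at x" "b \<in> Basis \<Longrightarrow> pd b u differentiable at x" for x b
    using C1_onD[OF \<alpha>] C2_onD[OF u] by auto
  have pF: "pd b (F b) x = (\<alpha> x)^2 * (u x * pd b (pd b u) x) + (\<alpha> x)^2 * (pd b u x)^2 + 2 * \<alpha> x * u x * (pd b \<alpha> x * pd b u x)"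
    if "b \<in> Basis" for b x
  proof -
    have "(\<lambda>x. \<alpha> x * \<alpha> x) differentiable at x" "(\<lambda>x. u x * pd b u x) differentiable at x"
      using du that by (auto intro: differentiable_mult)
    then show ?thesis unfolding F_def
      by (simp add: pd_mult du that algebra_simps power2_eq_square)
  qed
  have divF: "(\<Sum>b\<in>Basis. pd b (F b) x) = (\<alpha> x)^2 * (u x * lap u x) + (\<alpha> x)^2 * gsq u x + 2 * \<alpha> x * u x * gdot \<alpha> u x" for x
    by (simp add: pF sum.distrib lap_def gsq_def gdot_def sum_distrib_left)
  \<comment> \<open>Cross terms are split by the arithmetic-geometric mean inequality.
    \<open>t\<close> carries the Laplacian, \<open>s\<close> the zeroth-order term, and
    \<open>(\<alpha> x)^2 \<le> \<beta> x * m x\<close> distributes the weight between them. Twice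
    the divergence gives two copies of \<open>(\<alpha> x)^2 * gsq u x\<close>; one of them pays for
    the term with the gradient of \<alpha>.\<close>
  have pw: "(\<alpha> x)^2 * gsq u x \<le> 2 * (\<Sum>b\<in>Basis. pd b (F b) x) + (\<beta> x)^2 * (lap u x)^2 / L^2 + 5 * L^2 * ((m x)^2 * (u x)^2)" for x
  proof -
    define t where "t = \<beta> x * \<bar>lap u x\<bar> / L"
    define s where "s = L * m x * \<bar>u x\<bar>"
    have "\<bar>(\<alpha> x)^2 * (u x * lap u x)\<bar> \<le> (\<beta> x * m x) * (\<bar>u x\<bar> * \<bar>lap u x\<bar>)"
      unfolding abs_mult using p(4)[of x] order_trans[OF zero_le_power2 p(4)[of x]] by (intro mult_mono) auto
    also have "\<dots> = t * s" using L by (simp add: t_def s_def)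
    also have "2 * (t * s) \<le> t^2 + s^2" using sum_squares_bound[of t s] by simp
    finally have 1: "2 * \<bar>(\<alpha> x)^2 * (u x * lap u x)\<bar> \<le> t^2 + s^2" by simp
    define g where "g = gdot \<alpha> u x"
    have "g^2 \<le> (L * m x)^2 * gsq u x"
      unfolding g_def using gdot_sq[of \<alpha> u x] p(2)[of x] gsq_nonneg[of u x] mult_right_mono order_trans by blast
    then have "(\<alpha> x * u x * g)^2 \<le> ((\<alpha> x)^2 * gsq u x) * s^2"
      unfolding s_def power_mult_distrib power2_abs using mult_left_mono[of "g^2" _ "(\<alpha> x)^2 * (u x)^2"]
      by (fastforce simp: algebra_simps)
    moreover have "4 * sqrt (((\<alpha> x)^2 * gsq u x) * s^2) \<le> (\<alpha> x)^2 * gsq u x + 4 * s^2"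
      using arith_geo_mean_sqrt[of "(\<alpha> x)^2 * gsq u x" "4 * s^2"] gsq_nonneg[of u x]
      by (simp add: real_sqrt_mult)
    ultimately have 2: "4 * \<bar>\<alpha> x * u x * g\<bar> \<le> (\<alpha> x)^2 * gsq u x + 4 * s^2"
      using real_le_rsqrt[of "\<bar>\<alpha> x * u x * g\<bar>" "((\<alpha> x)^2 * gsq u x) * s^2"] by simp
    have 3: "t^2 = (\<beta> x)^2 * (lap u x)^2 / L^2" "s^2 = L^2 * ((m x)^2 * (u x)^2)"
      by (simp_all add: t_def s_def power_mult_distrib power_divide)
    have 4: "2 * \<alpha> x * u x * g = 2 * (\<alpha> x * u x * g)" by simp
    have 5: "5 * L^2 * ((m x)^2 * (u x)^2) = 5 * s^2" unfolding 3(2) by simp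
    have arith: "Q \<le> 2 * (X + Q + 2 * Y) + T + 5 * S" if "2 * \<bar>X\<bar> \<le> T + S" "4 * \<bar>Y\<bar> \<le> Q + 4 * S" for X Y Q S T :: real
      using that abs_ge_minus_self[of X] abs_ge_minus_self[of Y] unfolding distrib_left by linarith
    show ?thesis unfolding divF g_def[symmetric] 3(1)[symmetric] 4 5 by (rule arith[OF 1 2])
  qed
  have "G \<le> (LBINT x. 2 * (\<Sum>b\<in>Basis. pd b (F b) x) + (\<beta> x)^2 * (lap u x)^2 / L^2 + 5 * L^2 * ((m x)^2 * (u x)^2))"
    unfolding G_def using div(1) iA iG iM pw by (intro integral_mono) auto
  also have "\<dots> = A / L^2 + 5 * L^2 * M"
    using div iA iM by (simp add: A_def M_def)
  finally have "L^2 * G \<le> L^2 * (A / L^2 + 5 * L^2 * M)" using L by (simp add: mult_left_mono)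
  also have "\<dots> = A + 5 * L^4 * M" using L by (simp add: field_simps power2_eq_square power4_eq_xxxx)
  finally show main: "L^2 * (LBINT x. (\<alpha> x)^2 * gsq u x) \<le> A + 5 * L^4 * M" unfolding G_def .
  \<comment> \<open>The mixed term 2 grad \<beta> . grad u is the reason for the first estimate:
    \<open>gsq \<beta> x \<le> (L * \<alpha> x)^2\<close> reduces it to the quantity just
    bounded.\<close>
  have pw2: "(lap (\<lambda>x. \<beta> x * u x) x)^2 \<le> 3 * ((\<beta> x)^2 * (lap u x)^2) + 12 * L^2 * ((\<alpha> x)^2 * gsq u x) + 3 * L^4 * ((m x)^2 * (u x)^2)" for x
  proof -
    have e: "lap (\<lambda>x. \<beta> x * u x) x = \<beta> x * lap u x + 2 * gdot \<beta> u x + lap \<beta> x * u x"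
      by (rule lap_mult_real[OF open_UNIV \<beta> u]) simp
    have sq: "(a + b + c)^2 \<le> 3 * a^2 + 3 * b^2 + 3 * c^2" for a b c :: real
      using sum_squares_bound[of a b] sum_squares_bound[of a c] sum_squares_bound[of b c]
      by (simp add: power2_eq_square algebra_simps)
    have "(gdot \<beta> u x)^2 \<le> (L * \<alpha> x)^2 * gsq u x"
      using gdot_sq[of \<beta> u x] p(1)[of x] gsq_nonneg[of u x] mult_right_mono order_trans by blast
    then have 1: "3 * (2 * gdot \<beta> u x)^2 \<le> 12 * L^2 * ((\<alpha> x)^2 * gsq u x)"
      by (simp add: power_mult_distrib)
    have "(lap \<beta> x)^2 \<le> (L^2 * m x)^2"
      using p(3)[of x] by (metis abs_ge_zero power2_abs power_mono)
    then have "3 * (lap \<beta> x * u x)^2 \<le> 3 * ((L^2 * m x)^2 * (u x)^2)"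
      unfolding power_mult_distrib by (simp add: mult_right_mono)
    then have 2: "3 * (lap \<beta> x * u x)^2 \<le> 3 * L^4 * ((m x)^2 * (u x)^2)"
      by (simp add: power_mult_distrib power2_eq_square power4_eq_xxxx mult_ac)
    have "(lap (\<lambda>x. \<beta> x * u x) x)^2 \<le> 3 * (\<beta> x * lap u x)^2 + 3 * (2 * gdot \<beta> u x)^2 + 3 * (lap \<beta> x * u x)^2"
      unfolding e by (rule sq)
    then show ?thesis using 1 2 unfolding power_mult_distrib[of "\<beta> x" "lap u x"] by linarith
  qed
  have cp: "continuous_on UNIV (lap (\<lambda>x. \<beta> x * u x))"
    by (intro C2_on_continuous_lap C2_on_mult \<beta> u open_UNIV)
  have zp: "lap (\<lambda>x. \<beta> x * u x) x = 0" if "x \<notin> ball 0 (R+1)" for x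
    by (rule lap_zero_outside[of "cball 0 R"]) (use that supp in auto)
  have "(LBINT x. (lap (\<lambda>x. \<beta> x * u x) x)^2) \<le> (LBINT x. 3 * ((\<beta> x)^2 * (lap u x)^2) + 12 * L^2 * ((\<alpha> x)^2 * gsq u x) + 3 * L^4 * ((m x)^2 * (u x)^2))"
  proof (intro integral_mono pw2)
    show "integrable lborel (\<lambda>x. (lap (\<lambda>x. \<beta> x * u x) x)^2)"
      by (rule integrable_compact_support[of _ "R+1"]) (auto intro!: continuous_intros cp simp: zp)
  qed (use iA iG iM in auto)
  also have "\<dots> = 3 * A + 12 * (L^2 * G) + 3 * L^4 * M"
    using iA iG iM by (simp add: A_def M_def G_def)
  \<comment> \<open>15 = 3 + 12 and 63 = 3 + 12 * 5.\<close>
  also have "\<dots> \<le> 15 * A + 63 * L^4 * M" using main unfolding G_def[symmetric] by (simp add: algebra_simps)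
  finally show "(LBINT x. (lap (\<lambda>x. \<beta> x * u x) x)^2) \<le> 15 * A + 63 * L^4 * M" .
qed

section \<open>Radial functions and cut-offs\<close>

text \<open>Radial functions are written in the logarithmic variable \<open>t = ln |x|\<close>; the value at \<open>0\<close> is junk.\<close>

definition rad :: "(real \<Rightarrow> real) \<Rightarrow> 'a::euclidean_space \<Rightarrow> real" where
  "rad h x = h (ln (norm x))"

definition smooth2 :: "(real \<Rightarrow> real) \<Rightarrow> (real \<Rightarrow> real) \<Rightarrow> (real \<Rightarrow> real) \<Rightarrow> bool" where
  "smooth2 h h1 h2 \<longleftrightarrow> (\<forall>t. (h has_real_derivative h1 t) (at t)) \<and>
     (\<forall>t. (h1 has_real_derivative h2 t) (at t)) \<and> continuous_on UNIV h2"

lemma rad_has_derivative: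
  fixes x :: "'a::euclidean_space"
  assumes "(h has_real_derivative d) (at (ln (norm x)))" "x \<noteq> 0"
  shows "(rad h has_derivative (\<lambda>v. d * ((x \<bullet> v) / (norm x)^2))) (at x)"
proof -
  have "((\<lambda>x. ln (norm x)) has_derivative (\<lambda>v. (x \<bullet> v) / (norm x)^2)) (at x)"
  proof -
    have "(ln has_real_derivative 1 / norm x) (at (norm x))"
      using assms(2) by (auto intro!: derivative_eq_intros)
    from has_derivative_compose[OF has_derivative_norm[OF assms(2)] this[unfolded has_field_derivative_def]]
    show ?thesis by (simp add: sgn_div_norm power2_eq_square inner_commute divide_inverse mult_ac)
  qed
  from has_derivative_compose[OF this assms(1)[unfolded has_field_derivative_def]] show ?thesis
    unfolding rad_def .
qed

lemma pd_rad:
  fixes x :: "'a::euclidean_space"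
  assumes "(h has_real_derivative d) (at (ln (norm x)))" "x \<noteq> 0"
  shows "pd b (rad h) x = d * ((x \<bullet> b) / (norm x)^2)" "rad h differentiable (at x)"
  using pd_eqI[OF rad_has_derivative[OF assms]] rad_has_derivative[OF assms] by (auto simp: differentiable_def)

lemma rad_continuous:
  "continuous_on UNIV h \<Longrightarrow> continuous_on (-{0::'a::euclidean_space}) (rad h)"
  unfolding rad_def by (rule continuous_on_compose2[of UNIV h])
    (auto intro!: continuous_on_ln continuous_on_norm continuous_on_id)

lemma C1_on_rad:
  assumes h: "\<And>t. (h has_real_derivative h1 t) (at t)" and c: "continuous_on UNIV h1"
  shows "C1_on (-{0::'a::euclidean_space}) (rad h)"
  unfolding C1_on_def
proof (intro conjI ballI)
  fix b :: 'a
  have "continuous_on (-{0}) (\<lambda>x. rad h1 x * ((x \<bullet> b) / (norm x)^2))"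
    by (intro continuous_intros rad_continuous c) auto
  then show "continuous_on (-{0}) (pd b (rad h))"
    by (rule continuous_on_eq) (simp add: pd_rad(1)[OF h] rad_def)
qed (use h pd_rad(2) in blast)

lemma exp_ln_norm_2: "x \<noteq> 0 \<Longrightarrow> exp (- (2 * ln (norm x))) = 1 / (norm (x::'a::euclidean_space))^2"
  by (simp add: exp_minus exp_double divide_inverse)

text \<open>The factor 1 / |x|^2 in the gradient is written as exp (- 2 t). Then the first
  derivative is a coordinate times another radial function, and the radial chain rule applies a
  second time.\<close>

lemma pd_rad2:
  assumes s: "smooth2 h h1 h2" and x: "x \<noteq> (0::'a::euclidean_space)"
  shows "pd b (rad h) x = (x \<bullet> b) * rad (\<lambda>t. h1 t * exp (- (2 * t))) x"
    and "pd c (pd b (rad h)) x = (c \<bullet> b) * rad (\<lambda>t. h1 t * exp (- (2 * t))) x +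
      (x \<bullet> b) * (x \<bullet> c) * ((rad h2 x - 2 * rad h1 x) / (norm x)^4)"
    and "pd b (rad h) differentiable (at x)"
proof -
  have d1: "(h has_real_derivative h1 t) (at t)" "(h1 has_real_derivative h2 t) (at t)" for t
    using s by (auto simp: smooth2_def)
  define k where "k = (\<lambda>t. h1 t * exp (- (2 * t)))"
  have p: "pd b (rad h) x = (x \<bullet> b) * rad k x" if "x \<noteq> 0" for x b
    using that by (simp add: pd_rad[OF d1(1) that] k_def rad_def exp_ln_norm_2)
  then show "pd b (rad h) x = (x \<bullet> b) * rad (\<lambda>t. h1 t * exp (- (2 * t))) x" using x by (simp add: k_def)
  have k': "(k has_real_derivative (h2 t - 2 * h1 t) * exp (- (2 * t))) (at t)" for t
    unfolding k_def by (auto intro!: derivative_eq_intros d1 simp: algebra_simps)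
  have dk: "rad k differentiable (at x)" by (rule pd_rad(2)[OF k' x])
  have i: "pd c (\<lambda>x. x \<bullet> b) x = c \<bullet> b" "(\<lambda>x. x \<bullet> b) differentiable (at x)"
  proof -
    have "((\<lambda>x. x \<bullet> b) has_derivative (\<lambda>v. v \<bullet> b)) (at x)" by (auto intro!: derivative_eq_intros)
    then show "pd c (\<lambda>x. x \<bullet> b) x = c \<bullet> b" "(\<lambda>x. x \<bullet> b) differentiable (at x)"
      using pd_eqI by (fastforce simp: differentiable_def)+
  qed
  have "pd c (pd b (rad h)) x = pd c (\<lambda>x. (x \<bullet> b) * rad k x) x"
    by (rule pd_cong_open(1)[of "-{0}"]) (use x p in auto)
  also have "\<dots> = (x \<bullet> b) * pd c (rad k) x + (c \<bullet> b) * rad k x"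
    by (simp add: pd_mult[OF i(2) dk] i)
  also have "pd c (rad k) x = (x \<bullet> c) * ((rad h2 x - 2 * rad h1 x) / (norm x)^4)"
    using x by (simp add: pd_rad(1)[OF k' x] exp_ln_norm_2 rad_def field_simps power2_eq_square power4_eq_xxxx)
  finally show "pd c (pd b (rad h)) x = (c \<bullet> b) * rad (\<lambda>t. h1 t * exp (- (2 * t))) x +
      (x \<bullet> b) * (x \<bullet> c) * ((rad h2 x - 2 * rad h1 x) / (norm x)^4)" by (simp add: k_def)
  have "(\<lambda>x. (x \<bullet> b) * rad k x) differentiable (at x)"
    using i(2) dk by (rule differentiable_mult)
  then show "pd b (rad h) differentiable (at x)"
    using pd_cong_open(2)[of "-{0}" x "pd b (rad h)" "\<lambda>x. (x \<bullet> b) * rad k x"] p x by auto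
qed

lemma C2_on_rad:
  assumes s: "smooth2 h h1 h2"
  shows "C2_on (-{0::'a::euclidean_space}) (rad h)"
  unfolding C2_on_def
proof (intro conjI ballI)
  have d1: "(h has_real_derivative h1 t) (at t)" "(h1 has_real_derivative h2 t) (at t)" for t
    using s by (auto simp: smooth2_def)
  have c: "continuous_on UNIV h1" "continuous_on UNIV h2"
    using d1(2) s by (auto simp: smooth2_def intro!: DERIV_continuous_on)
  show "C1_on (-{0::'a}) (rad h)" by (rule C1_on_rad[OF d1(1) c(1)])
  show "pd b (pd c (rad h)) x = pd c (pd b (rad h)) x" if "x \<in> - {0}" for b c x :: 'a
    using that by (simp add: pd_rad2[OF s] inner_commute)
  show "C1_on (-{0}) (pd b (rad h))" for b :: 'a
    unfolding C1_on_def
  proof (intro conjI ballI)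
    show "pd b (rad h) differentiable at x" if "x \<in> -{0}" for x using pd_rad2(3)[OF s] that by auto
    fix e :: 'a
    have "continuous_on (-{0}) (\<lambda>x. (e \<bullet> b) * rad (\<lambda>t. h1 t * exp (- (2 * t))) x +
      (x \<bullet> b) * (x \<bullet> e) * ((rad h2 x - 2 * rad h1 x) / (norm x)^4))"
      by (intro continuous_intros rad_continuous c) auto
    then show "continuous_on (-{0}) (pd e (pd b (rad h)))"
      by (rule continuous_on_eq) (simp add: pd_rad2[OF s])
  qed
qed

text \<open>In t = ln |x|, the Laplacian times |x|^2 is d^2/dt^2 + (n - 2) d/dt plus the spherical
  Laplacian, which kills radial functions; the gradient of a radial function is (h1 / |x|^2)
  x.\<close>

lemma rad_identities:
  assumes s: "smooth2 h h1 h2" and x: "x \<noteq> (0::'a::euclidean_space)"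
  shows "lap (rad h) x = (rad h2 x + (real DIM('a) - 2) * rad h1 x) / (norm x)^2"
    and "gsq (rad h) x = (rad h1 x)^2 / (norm x)^2"
    and "gdot (rad h) u x = rad h1 x * (\<Sum>b\<in>Basis. (x \<bullet> b) * pd b u x) / (norm x)^2"
proof -
  have n2: "(\<Sum>b\<in>Basis. (x \<bullet> b)^2) = (norm x)^2"
    unfolding power2_norm_eq_inner by (subst euclidean_inner[of x x]) (simp only: power2_eq_square)
  have r: "rad (\<lambda>t. h1 t * exp (- (2 * t))) x = rad h1 x / (norm x)^2"
    using x by (simp add: rad_def exp_ln_norm_2)
  have "lap (rad h) x = (\<Sum>b\<in>Basis. rad h1 x / (norm x)^2 + (x \<bullet> b)^2 * ((rad h2 x - 2 * rad h1 x) / (norm x)^4))"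
    unfolding lap_def by (intro sum.cong refl) (simp only: pd_rad2(2)[OF s x] r power2_eq_square inner_same_Basis mult_1)
  also have "\<dots> = real DIM('a) * (rad h1 x / (norm x)^2) + (norm x)^2 * ((rad h2 x - 2 * rad h1 x) / (norm x)^4)"
    unfolding sum.distrib sum_distrib_right[symmetric] n2 by simp
  also have "\<dots> = (rad h2 x + (real DIM('a) - 2) * rad h1 x) / (norm x)^2"
  proof -
    have "d * (p / N^2) + N^2 * ((q - 2 * p) / N^4) = (q + (d - 2) * p) / N^2" if "N \<noteq> 0" for d p q N :: real
    proof -
      have "N^4 = N^2 * N^2" by (simp add: power2_eq_square power4_eq_xxxx)
      then have "N^2 * ((q - 2 * p) / N^4) = (q - 2 * p) / N^2"
        using that by (metis mult_divide_mult_cancel_left power_not_zero times_divide_eq_right)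
      then show ?thesis by (simp add: algebra_simps add_divide_distrib diff_divide_distrib)
    qed
    then show ?thesis using x by simp
  qed
  finally show "lap (rad h) x = (rad h2 x + (real DIM('a) - 2) * rad h1 x) / (norm x)^2" .
  have "gsq (rad h) x = (\<Sum>b\<in>Basis. (x \<bullet> b)^2 * (rad h1 x / (norm x)^2)^2)"
    unfolding gsq_def by (intro sum.cong refl) (simp only: pd_rad2(1)[OF s x] r power_mult_distrib)
  also have "\<dots> = (norm x)^2 * (rad h1 x / (norm x)^2)^2" unfolding sum_distrib_right[symmetric] n2 ..
  finally show "gsq (rad h) x = (rad h1 x)^2 / (norm x)^2"
    using x by (simp add: field_simps power2_eq_square)
  show "gdot (rad h) u x = rad h1 x * (\<Sum>b\<in>Basis. (x \<bullet> b) * pd b u x) / (norm x)^2"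
    unfolding gdot_def pd_rad2(1)[OF s x] r sum_distrib_left sum_divide_distrib
    by (intro sum.cong refl) simp
qed

text \<open>Constant continuation to the left of a critical point: at the junction the difference
  quotient is either that of \<open>p\<close>, which tends to 0, or 0 itself.\<close>

lemma DERIV_max_0:
  fixes p p' :: "real \<Rightarrow> real"
  assumes p: "\<And>t. (p has_real_derivative p' t) (at t)" and "p' 0 = 0"
  shows "((\<lambda>t. p (max 0 t)) has_real_derivative p' (max 0 t)) (at t)"
proof -
  consider "t > 0" | "t < 0" | "t = 0" by linarith
  then show ?thesis
  proof cases
    case 1
    have "((\<lambda>t. p (max 0 t)) has_real_derivative p' t) (at t)"
      by (rule has_field_derivative_transform_within_open[OF p, of "{0<..}"]) (use 1 in auto)
    then show ?thesis using 1 by simp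
  next
    case 2
    have "((\<lambda>t. p (max 0 t)) has_real_derivative 0) (at t)"
      by (rule has_field_derivative_transform_within_open[of "\<lambda>t. p 0" _ _ "{..<0}"]) (use 2 in auto)
    then show ?thesis using 2 assms(2) by simp
  next
    case 3
    have "(\<lambda>h. (p h - p 0) / h) \<midarrow>0\<rightarrow> 0" using p[of 0] assms(2) by (simp add: DERIV_def)
    then have "(\<lambda>h. (p (max 0 h) - p 0) / h) \<midarrow>0\<rightarrow> 0"
      by (rule Lim_null_comparison[rotated, OF tendsto_norm_zero]) (auto simp: eventually_at_filter max_def intro!: always_eventually divide_nonneg_neg order_trans[OF divide_nonneg_neg])
    then show ?thesis using 3 assms(2) by (simp add: DERIV_def)
  qed
qed

text \<open>The upper end is reduced to the lower one by the reflection s = 1 - t.\<close>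

lemma DERIV_clamp:
  fixes p p' :: "real \<Rightarrow> real"
  assumes p: "\<And>t. (p has_real_derivative p' t) (at t)" and "p' 0 = 0" "p' 1 = 0"
  shows "((\<lambda>t. p (min 1 (max 0 t))) has_real_derivative p' (min 1 (max 0 t))) (at t)"
proof -
  have m: "((\<lambda>s. 1 - s) has_real_derivative -1) (at t)" for t :: real
    by (auto intro!: derivative_eq_intros)
  have 1: "((\<lambda>s. p (1 - max 0 s)) has_real_derivative - p' (1 - max 0 s)) (at s)" for s
  proof (rule DERIV_max_0[of "\<lambda>s. p (1 - s)" "\<lambda>s. - p' (1 - s)"])
    show "((\<lambda>s. p (1 - s)) has_real_derivative - p' (1 - t)) (at t)" for t
      using DERIV_chain2[OF p[of "1 - t"] m[of t]] by simp
  qed (simp add: assms(3))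
  have mm: "1 - max 0 (1 - t) = min 1 t" for t :: real by (simp add: max_def min_def)
  have 2: "((\<lambda>t. p (min 1 t)) has_real_derivative p' (min 1 t)) (at t)" for t
    using DERIV_chain2[OF 1[of "1 - t"] m[of t]] unfolding mm by simp
  show ?thesis
    by (rule DERIV_max_0[of "\<lambda>t. p (min 1 t)" "\<lambda>t. p' (min 1 t)", OF 2]) (simp add: assms(2))
qed

text \<open>A polynomial step from \<open>1\<close> (for \<open>t \<le> 0\<close>) to \<open>0\<close> (for \<open>t \<ge> 1\<close>) that is twice continuously differentiable.\<close>

definition sstep :: "real \<Rightarrow> real" where
  "sstep t = (\<lambda>t. 1 - (6 * t^5 - 15 * t^4 + 10 * t^3)) (min 1 (max 0 t))"
definition sstep1 :: "real \<Rightarrow> real" where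
  "sstep1 t = (\<lambda>t. - (30 * t^4 - 60 * t^3 + 30 * t^2)) (min 1 (max 0 t))"
definition sstep2 :: "real \<Rightarrow> real" where
  "sstep2 t = (\<lambda>t. - (120 * t^3 - 180 * t^2 + 60 * t)) (min 1 (max 0 t))"

lemma sstep_smooth2: "smooth2 sstep sstep1 sstep2"
  unfolding smooth2_def
proof (intro conjI allI)
  show "(sstep has_real_derivative sstep1 t) (at t)" for t
    unfolding sstep_def[abs_def] sstep1_def
    by (rule DERIV_clamp[of "\<lambda>t. 1 - (6 * t^5 - 15 * t^4 + 10 * t^3)" "\<lambda>t. - (30 * t^4 - 60 * t^3 + 30 * t^2)"])
      (auto intro!: derivative_eq_intros simp: algebra_simps)
  show "(sstep1 has_real_derivative sstep2 t) (at t)" for t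
    unfolding sstep1_def[abs_def] sstep2_def
    by (rule DERIV_clamp[of "\<lambda>t. - (30 * t^4 - 60 * t^3 + 30 * t^2)" "\<lambda>t. - (120 * t^3 - 180 * t^2 + 60 * t)"])
      (auto intro!: derivative_eq_intros simp: algebra_simps)
  show "continuous_on UNIV sstep2" unfolding sstep2_def[abs_def] by (intro continuous_intros)
qed

lemma clamp_eq: "t \<le> 0 \<Longrightarrow> min 1 (max 0 t) = (0::real)" "t \<ge> 1 \<Longrightarrow> min 1 (max 0 t) = (1::real)"
  by (auto simp: max_def min_def)

lemma sstep_le_0: "t \<le> 0 \<Longrightarrow> sstep t = 1" "t \<le> 0 \<Longrightarrow> sstep1 t = 0" "t \<le> 0 \<Longrightarrow> sstep2 t = 0"
  unfolding sstep_def sstep1_def sstep2_def by (simp_all only: clamp_eq) simp_all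
lemma sstep_ge_1: "t \<ge> 1 \<Longrightarrow> sstep t = 0" "t \<ge> 1 \<Longrightarrow> sstep1 t = 0" "t \<ge> 1 \<Longrightarrow> sstep2 t = 0"
  unfolding sstep_def sstep1_def sstep2_def by (simp_all only: clamp_eq) simp_all

lemma sstep_bounds: "0 \<le> sstep t" "sstep t \<le> 1" "\<bar>sstep1 t\<bar> \<le> 360" "\<bar>sstep2 t\<bar> \<le> 360"
proof -
  define c where "c = min 1 (max 0 t)"
  have c: "0 \<le> c" "c \<le> 1" by (auto simp: c_def)
  have pw: "0 \<le> c^n" "c^n \<le> 1" for n using c by (auto simp: power_le_one)
  \<comment> \<open>The polynomial has a triple root at 0, and one minus it a triple root at 1; the
    remaining quadratic factors are positive on the unit interval.\<close>
  have "6 * c^5 - 15 * c^4 + 10 * c^3 = c^3 * (6 * (c - 1)^2 + 3 * (1 - c) + 1)" by algebra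
  moreover have "0 \<le> c^3 * (6 * (c - 1)^2 + 3 * (1 - c) + 1)"
    using c by (intro mult_nonneg_nonneg add_nonneg_nonneg) auto
  ultimately show "sstep t \<le> 1" unfolding sstep_def c_def[symmetric] by simp
  have "1 - (6 * c^5 - 15 * c^4 + 10 * c^3) = (1 - c)^3 * (6 * c^2 + 3 * c + 1)" by algebra
  moreover have "0 \<le> (1 - c)^3 * (6 * c^2 + 3 * c + 1)" using c by simp
  ultimately show "0 \<le> sstep t" unfolding sstep_def c_def[symmetric] by simp
  \<comment> \<open>360 = 120 + 180 + 60 is the sum of the coefficients of \<open>sstep2\<close>;
    for \<open>sstep1\<close> the sum is only 120, and one number serves both.\<close>
  show "\<bar>sstep1 t\<bar> \<le> 360" "\<bar>sstep2 t\<bar> \<le> 360"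
    unfolding sstep1_def sstep2_def c_def[symmetric]
    using pw(1)[of 4] pw(1)[of 3] pw(1)[of 2] pw(2)[of 4] pw(2)[of 3] pw(2)[of 2] c
    unfolding abs_le_iff by linarith+
qed

section \<open>The Carleman inequality\<close>

text \<open>The Euler field x . grad, which is d/dt in the variable t = ln |x|.\<close>

definition eul :: "('a::euclidean_space \<Rightarrow> real) \<Rightarrow> 'a \<Rightarrow> real" where
  "eul u x = (\<Sum>b\<in>Basis. (x \<bullet> b) * pd b u x)"

lemma pd_inner: "pd c (\<lambda>x. x \<bullet> b) x = c \<bullet> b" "(\<lambda>x. x \<bullet> b) differentiable (at x)"
proof -
  have "((\<lambda>x. x \<bullet> b) has_derivative (\<lambda>v. v \<bullet> b)) (at x)" by (auto intro!: derivative_eq_intros)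
  then show "pd c (\<lambda>x. x \<bullet> b) x = c \<bullet> b" "(\<lambda>x. x \<bullet> b) differentiable (at x)"
    using pd_eqI by (fastforce simp: differentiable_def)+
qed

lemma C1_on_inner: "C1_on S (\<lambda>x. x \<bullet> b)"
  unfolding C1_on_def
proof (intro conjI ballI)
  have "pd c (\<lambda>x. x \<bullet> b) = (\<lambda>x. c \<bullet> b)" for c using pd_inner(1) by blast
  then show "continuous_on S (pd c (\<lambda>x. x \<bullet> b))" for c by simp
qed (rule pd_inner(2))

lemma C1_on_sum:
  assumes "open S" "finite I" "\<And>i. i \<in> I \<Longrightarrow> C1_on S (f i)"
  shows "C1_on S (\<lambda>x. \<Sum>i\<in>I. f i x)"
  using assms(2,3) by (induction I rule: finite_induct) (auto intro!: C1_on_const C1_on_add assms(1))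

lemma pd_sum:
  assumes "finite I" "\<And>i. i \<in> I \<Longrightarrow> f i differentiable (at x)"
  shows "pd b (\<lambda>x. \<Sum>i\<in>I. f i x) x = (\<Sum>i\<in>I. pd b (f i) x)"
proof -
  have "((\<lambda>x. \<Sum>i\<in>I. f i x) has_derivative (\<lambda>h. \<Sum>i\<in>I. frechet_derivative (f i) (at x) h)) (at x)"
    by (intro has_derivative_sum) (use assms in \<open>simp add: frechet_derivative_works\<close>)
  from pd_eqI[OF this] show ?thesis by (simp add: pd_def)
qed

lemma sum_basis_norm: "(\<Sum>b\<in>Basis. (x \<bullet> b) * (x \<bullet> b)) = (norm (x::'a::euclidean_space))^2"
  unfolding power2_norm_eq_inner by (subst euclidean_inner[of x x]) simp

text \<open>A Rellich-Pohozaev identity with free radial coefficients: \<open>F b\<close> is the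
  component along \<open>b\<close> of -4 A (x . grad v) grad v + 2 A |grad v|^2 x - 2 B v grad v + Q
  v^2 x. The two terms with \<open>A\<close> are balanced so that second derivatives survive only in
  the form of the Laplacian.\<close>

lemma carleman_divergence:
  fixes v :: "'a::euclidean_space \<Rightarrow> real"
  assumes v: "C2_on UNIV v" and x: "x \<noteq> 0"
    and A: "\<And>t. (A has_real_derivative A' t) (at t)" and B: "\<And>t. (B has_real_derivative B' t) (at t)"
    and Q: "\<And>t. (Q has_real_derivative Q' t) (at t)"
  defines "F \<equiv> \<lambda>b x. (-4) * (rad A x * (eul v x * pd b v x)) + 2 * (rad A x * ((x \<bullet> b) * gsq v x))
      + ((-2) * (rad B x * (v x * pd b v x)) + rad Q x * ((x \<bullet> b) * (v x * v x)))"
  shows "(\<Sum>b\<in>Basis. pd b (F b) x) =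
     - 4 * (rad A' x / (norm x)^2) * (eul v x)^2 - 4 * rad A x * gsq v x - 4 * rad A x * eul v x * lap v x
     + 2 * rad A' x * gsq v x + 2 * real DIM('a) * rad A x * gsq v x
     - 2 * (rad B' x / (norm x)^2) * v x * eul v x - 2 * rad B x * gsq v x - 2 * rad B x * v x * lap v x
     + (rad Q' x + real DIM('a) * rad Q x) * (v x)^2 + 2 * rad Q x * v x * eul v x"
proof -
  have dr: "rad A differentiable (at x)" "rad B differentiable (at x)" "rad Q differentiable (at x)"
    using pd_rad(2)[OF A x] pd_rad(2)[OF B x] pd_rad(2)[OF Q x] .
  have pr: "pd b (rad A) x = rad A' x * ((x \<bullet> b) / (norm x)^2)" "pd b (rad B) x = rad B' x * ((x \<bullet> b) / (norm x)^2)"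
     "pd b (rad Q) x = rad Q' x * ((x \<bullet> b) / (norm x)^2)" for b
    using pd_rad(1)[OF A x] pd_rad(1)[OF B x] pd_rad(1)[OF Q x] by (simp_all add: rad_def)
  have dv: "v differentiable (at x)" "c \<in> Basis \<Longrightarrow> pd c v differentiable (at x)" for c
    using C2_onD[OF v] by auto
  have deul: "eul v differentiable (at x)"
    unfolding eul_def[abs_def] by (intro differentiable_sum differentiable_mult pd_inner dv ballI finite_Basis)
  have peul: "pd b (eul v) x = pd b v x + (\<Sum>c\<in>Basis. (x \<bullet> c) * pd b (pd c v) x)" if b: "b \<in> Basis" for b
  proof -
    have "pd b (eul v) x = (\<Sum>c\<in>Basis. pd b (\<lambda>x. (x \<bullet> c) * pd c v x) x)"
      unfolding eul_def[abs_def] by (rule pd_sum) (auto intro!: differentiable_mult pd_inner dv)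
    also have "\<dots> = (\<Sum>c\<in>Basis. (x \<bullet> c) * pd b (pd c v) x + (b \<bullet> c) * pd c v x)"
      by (intro sum.cong refl) (simp add: pd_mult pd_inner dv)
    also have "\<dots> = (\<Sum>c\<in>Basis. (b \<bullet> c) * pd c v x) + (\<Sum>c\<in>Basis. (x \<bullet> c) * pd b (pd c v) x)"
      by (simp add: sum.distrib)
    also have "(\<Sum>c\<in>Basis. (b \<bullet> c) * pd c v x) = (\<Sum>c\<in>Basis. if c = b then pd c v x else 0)"
      by (intro sum.cong refl) (use b in \<open>auto simp: inner_Basis\<close>)
    finally show ?thesis using b by simp
  qed
  have dgs: "gsq v differentiable (at x)"
    unfolding gsq_def[abs_def] by (intro differentiable_sum differentiable_power dv ballI finite_Basis)
  have pgs: "pd b (gsq v) x = 2 * (\<Sum>c\<in>Basis. pd c v x * pd b (pd c v) x)" for b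
  proof -
    have "pd b (gsq v) x = (\<Sum>c\<in>Basis. pd b (\<lambda>x. pd c v x * pd c v x) x)"
      unfolding gsq_def[abs_def] power2_eq_square by (rule pd_sum) (auto intro!: differentiable_mult dv)
    also have "\<dots> = (\<Sum>c\<in>Basis. 2 * (pd c v x * pd b (pd c v) x))"
      by (intro sum.cong refl) (simp add: pd_mult dv)
    finally show ?thesis by (simp add: sum_distrib_left)
  qed
  define k l :: real where "k = -4" and "l = -2"
  have pF: "pd b (F b) x =
      k * (rad A x * (eul v x * pd b (pd b v) x + pd b (eul v) x * pd b v x) + pd b (rad A) x * (eul v x * pd b v x))
      + 2 * (rad A x * ((x \<bullet> b) * pd b (gsq v) x + gsq v x) + pd b (rad A) x * ((x \<bullet> b) * gsq v x))
      + (l * (rad B x * (v x * pd b (pd b v) x + pd b v x * pd b v x) + pd b (rad B) x * (v x * pd b v x))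
      + (rad Q x * ((x \<bullet> b) * (2 * v x * pd b v x) + v x * v x) + pd b (rad Q) x * ((x \<bullet> b) * (v x * v x))))"
    if b: "b \<in> Basis" for b
    unfolding F_def k_def[symmetric] l_def[symmetric] using b
    by (simp add: pd_add pd_mult pd_inner dv dr deul dgs differentiable_mult differentiable_add inner_same_Basis)
  \<comment> \<open>The Hessian of \<open>v\<close> paired with x and grad v. By symmetry of second
    derivatives both fields with \<open>A\<close> produce it, with factors -4 and 2 * 2, so it
    cancels.\<close>
  define T where "T = (\<Sum>b\<in>Basis. \<Sum>c\<in>Basis. (x \<bullet> c) * pd b v x * pd b (pd c v) x)"
  have T': "(\<Sum>b\<in>Basis. \<Sum>c\<in>Basis. (x \<bullet> b) * pd c v x * pd b (pd c v) x) = T"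
    unfolding T_def by (subst sum.swap) (intro sum.cong refl, simp add: C2_sym[OF v])
  have s1: "(\<Sum>b\<in>Basis. pd b (eul v) x * pd b v x) = gsq v x + T"
    unfolding T_def gsq_def sum.distrib[symmetric]
    by (intro sum.cong refl) (simp add: peul algebra_simps power2_eq_square sum_distrib_left)
  have s2: "(\<Sum>b\<in>Basis. (x \<bullet> b) * pd b (gsq v) x) = 2 * T"
    unfolding T'[symmetric] sum_distrib_left
    by (intro sum.cong refl) (simp add: pgs sum_distrib_left algebra_simps)
  have s3: "(\<Sum>b\<in>Basis. pd b (rad h) x * (c * pd b v x)) = k / (norm x)^2 * c * eul v x"
    if "\<And>b. pd b (rad h) x = k * ((x \<bullet> b) / (norm x)^2)" for h c k
    unfolding eul_def sum_distrib_left by (intro sum.cong refl) (simp add: that)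
  have s4: "(\<Sum>b\<in>Basis. pd b (rad h) x * ((x \<bullet> b) * c)) = k * c"
    if "\<And>b. pd b (rad h) x = k * ((x \<bullet> b) / (norm x)^2)" for h c k
  proof -
    have "(\<Sum>b\<in>Basis. pd b (rad h) x * ((x \<bullet> b) * c)) = (\<Sum>b\<in>Basis. (k * c / (norm x)^2) * ((x \<bullet> b) * (x \<bullet> b)))"
      by (intro sum.cong refl) (simp add: that)
    also have "\<dots> = (k * c / (norm x)^2) * (norm x)^2" unfolding sum_distrib_left[symmetric] sum_basis_norm ..
    finally show ?thesis using x by simp
  qed
  have s5: "(\<Sum>b\<in>Basis. pd b v x * pd b v x) = gsq v x" by (simp add: gsq_def power2_eq_square)
  have s6: "(\<Sum>b\<in>Basis. (x \<bullet> b) * (2 * v x * pd b v x)) = 2 * v x * eul v x"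
    unfolding eul_def sum_distrib_left by (intro sum.cong refl) simp
  have s7: "(\<Sum>b\<in>(Basis::'a set). c) = real DIM('a) * c" for c :: real by simp
  have "(\<Sum>b\<in>Basis. pd b (F b) x) =
      k * (rad A x * (eul v x * (\<Sum>b\<in>Basis. pd b (pd b v) x) + (\<Sum>b\<in>Basis. pd b (eul v) x * pd b v x)) + (\<Sum>b\<in>Basis. pd b (rad A) x * (eul v x * pd b v x)))
      + 2 * (rad A x * ((\<Sum>b\<in>Basis. (x \<bullet> b) * pd b (gsq v) x) + (\<Sum>b\<in>(Basis::'a set). gsq v x)) + (\<Sum>b\<in>Basis. pd b (rad A) x * ((x \<bullet> b) * gsq v x)))
      + (l * (rad B x * (v x * (\<Sum>b\<in>Basis. pd b (pd b v) x) + (\<Sum>b\<in>Basis. pd b v x * pd b v x)) + (\<Sum>b\<in>Basis. pd b (rad B) x * (v x * pd b v x)))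
      + (rad Q x * ((\<Sum>b\<in>Basis. (x \<bullet> b) * (2 * v x * pd b v x)) + (\<Sum>b\<in>(Basis::'a set). v x * v x)) + (\<Sum>b\<in>Basis. pd b (rad Q) x * ((x \<bullet> b) * (v x * v x)))))"
    unfolding sum_distrib_left sum.distrib[symmetric] by (intro sum.cong refl) (rule pF)
  also have "\<dots> = k * (rad A x * (eul v x * lap v x + (gsq v x + T)) + rad A' x / (norm x)^2 * eul v x * eul v x)
      + 2 * (rad A x * (2 * T + real DIM('a) * gsq v x) + rad A' x * gsq v x)
      + (l * (rad B x * (v x * lap v x + gsq v x) + rad B' x / (norm x)^2 * v x * eul v x)
      + (rad Q x * (2 * v x * eul v x + real DIM('a) * (v x * v x)) + rad Q' x * (v x * v x)))"
    unfolding s1 s2 s3[OF pr(1)] s3[OF pr(2)] s4[OF pr(1)] s4[OF pr(3)] s5 s6 s7 lap_def[symmetric] ..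
  finally show ?thesis by (simp add: k_def l_def algebra_simps power2_eq_square)
qed

definition cw :: "real \<Rightarrow> 'a::euclidean_space \<Rightarrow> real" where
  "cw \<tau> x = rad (\<lambda>t. exp (- (real DIM('a) * t) + 2 * \<tau> * (exp t - t))) x"

lemma integrable_annulus:
  fixes f :: "'a::euclidean_space \<Rightarrow> real"
  assumes "continuous_on (-{0}) f" "e > 0" "\<And>x. norm x < e \<or> norm x > R \<Longrightarrow> f x = 0"
  shows "integrable lborel f"
proof -
  let ?K = "cball 0 R - ball 0 e"
  have "integrable lborel (\<lambda>x. indicator ?K x *\<^sub>R f x)"
    using assms(2) by (intro borel_integrable_compact compact_diff) (auto intro: continuous_on_subset[OF assms(1)])
  also have "(\<lambda>x. indicator ?K x *\<^sub>R f x) = f"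
    using assms(3) by (force simp: fun_eq_iff indicator_def not_less not_le)
  finally show ?thesis .
qed

lemma cw_continuous: "continuous_on (-{0}) (cw \<tau>)"
  unfolding cw_def[abs_def] by (intro rad_continuous continuous_intros)

lemma cw_pos: "cw \<tau> x > 0" by (simp add: cw_def rad_def)

text \<open>With \<open>v = e^(\<tau> (e^t - t)) u\<close> the conjugated operator splits as \<open>S - M\<close>, where \<open>S\<close> is symmetric and \<open>M\<close> antisymmetric
  for the measure \<open>|x|^(-n) dx\<close>. The left-hand side is \<open>-2 S v M v\<close>; on the right stand the divergence of \<open>carleman_divergence\<close>
  and a positive quadratic form. Here \<open>d\<close>, \<open>g\<close>, \<open>L\<close>, \<open>R\<close> stand for \<open>x \<bullet> \<nabla>v\<close>, \<open>|\<nabla>v|^2\<close>, \<open>\<Delta>v\<close>, \<open>|x|^2\<close>.\<close>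

lemma carleman_scalar:
  fixes p p1 n \<kappa> d g L v R \<rho> :: real
  assumes "R \<noteq> 0" "n = 2 * \<kappa> + 2"
  shows "-2 * (\<rho> / R) * ((R * L - 2 * \<kappa> * d + (p^2 - \<kappa>^2) * v) * (2 * p * d + p1 * v)) =
     (- 4 * (((p1 + (2 - n) * p) * \<rho>) / R) * d^2 - 4 * (p * \<rho>) * g - 4 * (p * \<rho>) * d * L
     + 2 * ((p1 + (2 - n) * p) * \<rho>) * g + 2 * n * (p * \<rho>) * g
     - 2 * (((p1 + (2 - n) * p1) * \<rho>) / R) * v * d - 2 * (p1 * \<rho>) * g - 2 * (p1 * \<rho>) * v * L
     + (((p1 - 2 * p1 * (p^2 - \<kappa>^2) - 4 * p^2 * p1) - n * (p1 - 2 * p * (p^2 - \<kappa>^2))) * (\<rho> / R)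
        + n * ((p1 - 2 * p * (p^2 - \<kappa>^2)) * (\<rho> / R))) * v^2
     + 2 * ((p1 - 2 * p * (p^2 - \<kappa>^2)) * (\<rho> / R)) * v * d)
     + (\<rho> / R) * (4 * p1 * d^2 + (4 * p^2 * p1 - p1) * v^2)"
proof -
  define q where "q = \<rho> / R"
  have r: "\<rho> = q * R" and d: "x * \<rho> / R = x * q" for x using assms(1) by (simp_all add: q_def)
  show ?thesis unfolding d q_def[symmetric] unfolding r assms(2) by algebra
qed

text \<open>With n = 2 \<kappa> + 2, the Laplacian times |x|^2 is (d/dt + \<kappa>)^2 - \<kappa>^2
  plus the spherical Laplacian. Conjugation with the exponential \<open>E\<close> replaces d/dt by
  d/dt - \<psi>, so the operator depends on the phase only through \<open>p\<close> = \<psi> -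
  \<kappa>. The gain comes from its derivative \<open>p1\<close> = \<tau> |x|.\<close>

theorem carleman:
  fixes u :: "'a::euclidean_space \<Rightarrow> real"
  assumes u: "C2_on UNIV u" and \<tau>: "\<tau> \<ge> 4" and e: "e > 0"
    and supp: "\<And>x. norm x < e \<or> norm x > 1/2 \<Longrightarrow> u x = 0"
  shows "\<tau>^3 / 8 * (LBINT x. norm x * cw \<tau> x * (u x)^2) \<le> (LBINT x. (norm x)^4 * cw \<tau> x * (lap u x)^2)"
proof -
  define n where "n = real DIM('a)"
  define \<kappa> where "\<kappa> = (n - 2) / 2"
  define \<psi> where "\<psi> t = \<tau> * (exp t - 1)" for t :: real
  define E where "E t = exp (\<tau> * (exp t - t))" for t :: real
  define p where "p t = \<tau> * (exp t - 1) - \<kappa>" for t :: real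
  define p1 where "p1 t = \<tau> * exp t" for t :: real
  define \<rho> where "\<rho> t = exp ((2 - n) * t)" for t :: real
  have dE: "smooth2 E (\<lambda>t. \<psi> t * E t) (\<lambda>t. (p1 t + (\<psi> t)^2) * E t)"
    unfolding smooth2_def
  proof (intro conjI allI)
    show "(E has_real_derivative \<psi> t * E t) (at t)" for t
      unfolding E_def \<psi>_def by (auto intro!: derivative_eq_intros simp: algebra_simps)
    then show "((\<lambda>t. \<psi> t * E t) has_real_derivative (p1 t + (\<psi> t)^2) * E t) (at t)" for t
      unfolding \<psi>_def p1_def by (auto intro!: derivative_eq_intros simp: algebra_simps power2_eq_square)
    show "continuous_on UNIV (\<lambda>t. (p1 t + (\<psi> t)^2) * E t)"
      unfolding E_def \<psi>_def p1_def by (intro continuous_intros)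
  qed
  define v where "v x = rad E x * u x" for x
  let ?K = "cball 0 (1/2) - ball 0 e :: 'a set"
  have K: "closed ?K" "?K \<subseteq> -{0}" "x \<notin> ?K \<Longrightarrow> norm x < e \<or> norm x > 1/2" for x :: 'a using e by auto
  have v2: "C2_on UNIV v"
  proof (rule C2_on_UNIV_extend[OF _ _ K(1,2)])
    show "C2_on (-{0}) v" unfolding v_def[abs_def]
      by (intro C2_on_mult C2_on_rad[OF dE] C2_on_subset[OF u]) auto
    show "v x = 0" if "x \<notin> ?K" for x using supp[OF K(3)[OF that]] by (simp add: v_def)
  qed auto
  have v0: "v x = 0" if "x \<notin> ?K" for x using supp[OF K(3)[OF that]] by (simp add: v_def)
  have u0: "u x = 0" if "x \<notin> ?K" for x using supp[OF K(3)[OF that]] .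
  \<comment> \<open>These coefficients are dictated by integrating -2 S v M v by parts against
    |x|^(-n) dx, with M = 2 p d/dt + p1: the first term of M against the Laplacian gives
    \<open>A\<close>, the second gives \<open>B\<close>, and the remaining products of v with its
    radial derivative give \<open>Q\<close>.\<close>
  define A where "A t = p t * \<rho> t" for t
  define B where "B t = p1 t * \<rho> t" for t
  define Q where "Q t = (p1 t - 2 * p t * ((p t)^2 - \<kappa>^2)) * exp (- n * t)" for t
  define A' where "A' t = (p1 t + (2 - n) * p t) * \<rho> t" for t
  define B' where "B' t = (p1 t + (2 - n) * p1 t) * \<rho> t" for t
  define Q' where "Q' t = ((p1 t - 2 * p1 t * ((p t)^2 - \<kappa>^2) - 4 * (p t)^2 * p1 t) - n * (p1 t - 2 * p t * ((p t)^2 - \<kappa>^2))) * exp (- n * t)" for t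
  have dp: "(p has_real_derivative p1 t) (at t)" "(p1 has_real_derivative p1 t) (at t)" "(\<rho> has_real_derivative (2 - n) * \<rho> t) (at t)" for t
    unfolding p_def p1_def \<rho>_def by (auto intro!: derivative_eq_intros)
  have dA: "(A has_real_derivative A' t) (at t)" for t
    unfolding A_def A'_def by (auto intro!: derivative_eq_intros dp simp: algebra_simps)
  have dB: "(B has_real_derivative B' t) (at t)" for t
    unfolding B_def B'_def by (auto intro!: derivative_eq_intros dp simp: algebra_simps)
  have dQ: "(Q has_real_derivative Q' t) (at t)" for t
    unfolding Q_def Q'_def by (auto intro!: derivative_eq_intros dp simp: algebra_simps power2_eq_square)
  have cont: "continuous_on UNIV A'" "continuous_on UNIV B'" "continuous_on UNIV Q'"
    unfolding A'_def B'_def Q'_def p_def p1_def \<rho>_def by (intro continuous_intros)+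
  define F where "F = (\<lambda>b x. (-4) * (rad A x * (eul v x * pd b v x)) + 2 * (rad A x * ((x \<bullet> b) * gsq v x))
      + ((-2) * (rad B x * (v x * pd b v x)) + rad Q x * ((x \<bullet> b) * (v x * v x))))"
  have pv0: "pd b v x = 0" if "x \<notin> ?K" for b x by (rule pd_zero_outside[OF K(1) v0 that])
  have F0: "F b x = 0" if "x \<notin> ?K" for b x
    using v0[OF that] pv0[OF that] by (simp add: F_def gsq_def)
  have F1: "C1_on UNIV (F b)" if b: "b \<in> Basis" for b
  proof (rule C1_on_UNIV_extend[OF _ _ K(1,2) F0])
    have cv: "C1_on (-{0}) v" "c \<in> Basis \<Longrightarrow> C1_on (-{0}) (pd c v)" for c
      using C1_on_subset[OF C2_C1[OF v2]] C1_on_subset[OF C2_C1_pd[OF v2]] by auto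
    have "C1_on (-{0}) (eul v)" unfolding eul_def[abs_def]
      by (intro C1_on_sum C1_on_mult C1_on_inner cv) auto
    moreover have "C1_on (-{0}) (gsq v)" unfolding gsq_def[abs_def] power2_eq_square
      by (intro C1_on_sum C1_on_mult cv) auto
    moreover have "C1_on (-{0::'a}) (rad A)" "C1_on (-{0::'a}) (rad B)" "C1_on (-{0::'a}) (rad Q)"
      using C1_on_rad[OF dA cont(1)] C1_on_rad[OF dB cont(2)] C1_on_rad[OF dQ cont(3)] .
    ultimately show "C1_on (-{0}) (F b)" unfolding F_def
      by (intro C1_on_add C1_on_mult C1_on_inner C1_on_const cv(1) cv(2)[OF b]) auto
  qed auto
  have div: "integrable lborel (\<lambda>x. \<Sum>b\<in>Basis. pd b (F b) x)" "(LBINT x. (\<Sum>b\<in>Basis. pd b (F b) x)) = 0"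
    by (rule integral_divergence_zero[of F 1]; use F1 F0 in auto)+
  have pw: "\<tau>^3 / 8 * (norm x * cw \<tau> x * (u x)^2) + (\<Sum>b\<in>Basis. pd b (F b) x) \<le> (norm x)^4 * cw \<tau> x * (lap u x)^2" for x
  proof (cases "x \<in> ?K")
    case False
    have "pd b (F b) x = 0" for b by (rule pd_zero_outside[OF K(1) F0 False])
    then show ?thesis using u0[OF False] cw_pos[of \<tau> x] by simp
  next
    case True
    then have x: "x \<noteq> 0" and nx: "norm x \<le> 1/2" using e by auto
    define t where "t = ln (norm x)"
    define R where "R = (norm x)^2"
    have R: "R > 0" using x by (simp add: R_def)
    have et: "exp t = norm x" using x by (simp add: t_def)
    have en: "exp (- n * t) = \<rho> t / R"
    proof -
      have "\<rho> t = exp (- n * t) * (exp t * exp t)"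
        unfolding \<rho>_def exp_add[symmetric] by (simp add: algebra_simps)
      then show ?thesis using x by (simp add: R_def et power2_eq_square)
    qed
    have rd: "rad h x = h t" for h by (simp add: rad_def t_def)
    have open0: "open (-{0::'a})" "x \<in> -{0}" using x by auto
    have dEx: "rad E differentiable (at x)" by (rule pd_rad(2)[OF _ x]) (use dE in \<open>auto simp: smooth2_def\<close>)
    have dux: "u differentiable (at x)" by (rule C2_onD(1)[OF u]) simp
    have lv: "lap v x = E t * lap u x + 2 * (\<psi> t * E t * eul u x / R) + ((p1 t + (\<psi> t)^2) * E t + (n - 2) * (\<psi> t * E t)) / R * u x"
      unfolding v_def[abs_def]
      by (subst lap_mult_real[OF open0(1) C2_on_rad[OF dE] C2_on_subset[OF u] open0(2)])
         (simp_all add: rad_identities[OF dE x] rd R_def n_def eul_def)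
    have ee: "eul (rad E) x = \<psi> t * E t"
    proof -
      have "eul (rad E) x = (\<Sum>b\<in>Basis. (\<psi> t * E t / R) * ((x \<bullet> b) * (x \<bullet> b)))"
        unfolding eul_def using dE by (intro sum.cong refl, subst pd_rad(1)[OF _ x]) (auto simp: smooth2_def t_def R_def)
      then show ?thesis using R unfolding sum_distrib_left[symmetric] sum_basis_norm R_def[symmetric] by simp
    qed
    have ev: "eul v x = E t * (eul u x + \<psi> t * u x)"
    proof -
      have "eul v x = (\<Sum>b\<in>Basis. (x \<bullet> b) * (rad E x * pd b u x + pd b (rad E) x * u x))"
        unfolding eul_def v_def[abs_def] by (intro sum.cong refl) (simp add: pd_mult[OF dEx dux])
      also have "\<dots> = rad E x * eul u x + eul (rad E) x * u x"
        unfolding eul_def sum_distrib_left sum_distrib_right sum.distrib[symmetric]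
        by (intro sum.cong refl) (simp add: algebra_simps)
      finally show ?thesis by (simp add: ee rd algebra_simps)
    qed
    have vx: "v x = E t * u x" by (simp add: v_def rd)
    define S where "S = R * lap v x - 2 * \<kappa> * eul v x + ((p t)^2 - \<kappa>^2) * v x"
    define M where "M = 2 * p t * eul v x + p1 t * v x"
    have psi: "\<psi> t = p t + \<kappa>" by (simp add: \<psi>_def p_def)
    have n\<kappa>: "n = 2 * \<kappa> + 2" by (simp add: \<kappa>_def field_simps)
    have SM: "R * (E t * lap u x) = S - M"
    proof -
      have "R * lap v x = R * (E t * lap u x) + 2 * (\<psi> t * E t * eul u x) + ((p1 t + (\<psi> t)^2) * E t + (n - 2) * (\<psi> t * E t)) * u x"
        unfolding lv using R by (simp add: distrib_left)
      then show ?thesis unfolding S_def M_def ev vx psi n\<kappa> by algebra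
    qed
    have cwx: "cw \<tau> x = (\<rho> t / R) * (E t)^2"
    proof -
      have "cw \<tau> x = exp (- n * t) * exp (2 * (\<tau> * (exp t - t)))"
        unfolding cw_def rd n_def[symmetric] exp_add[symmetric] by simp
      then show ?thesis unfolding exp_double en E_def .
    qed
    have "(norm x)^4 * cw \<tau> x * (lap u x)^2 = (\<rho> t / R) * (R * (E t * lap u x))^2"
    proof -
      have "(norm x)^4 = R^2" by (simp add: R_def)
      then show ?thesis unfolding cwx by (simp add: power_mult_distrib)
    qed
    also have "\<dots> = (\<rho> t / R) * (S - M)^2" unfolding SM ..
    \<comment> \<open>S^2 + M^2 is dropped. Only the cross term is kept, whose integral is a
      commutator of the symmetric and the antisymmetric part.\<close>
    also have "\<dots> \<ge> -2 * (\<rho> t / R) * (S * M)"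
    proof -
      have "-2 * (S * M) \<le> (S - M)^2" by (simp add: power2_diff)
      then have "(\<rho> t / R) * (-2 * (S * M)) \<le> (\<rho> t / R) * (S - M)^2"
        by (rule mult_left_mono) (use R in \<open>simp add: \<rho>_def\<close>)
      then show ?thesis by (simp add: algebra_simps)
    qed
    also have "-2 * (\<rho> t / R) * (S * M) = (\<Sum>b\<in>Basis. pd b (F b) x) + (\<rho> t / R) * (4 * p1 t * (eul v x)^2 + (4 * (p t)^2 * p1 t - p1 t) * (v x)^2)"
      unfolding F_def carleman_divergence[OF v2 x dA dB dQ] rd S_def M_def A_def B_def Q_def A'_def B'_def Q'_def en R_def[symmetric] n_def[symmetric]
      by (rule carleman_scalar[OF less_imp_neq[OF R, symmetric] n\<kappa>])
    finally have 1: "(\<Sum>b\<in>Basis. pd b (F b) x) + (\<rho> t / R) * (4 * p1 t * (eul v x)^2 + (4 * (p t)^2 * p1 t - p1 t) * (v x)^2) \<le> (norm x)^4 * cw \<tau> x * (lap u x)^2" .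
    \<comment> \<open>Here |x| <= 1/2 and \<tau> >= 4 enter: \<psi> <= -\<tau>/2 and -\<kappa> <=
      1/2. The resulting p^2 >= \<tau>^2/16 makes 4 p^2 - 1 at least \<tau>^2/8, which absorbs the
      negative contribution \<open>- p1 t\<close> to the quadratic form.\<close>
    have p4: "p t \<le> - (\<tau> / 4)"
    proof -
      have "\<tau> * norm x \<le> \<tau> * (1/2)" using nx \<tau> by (intro mult_left_mono) auto
      moreover have "n \<ge> 1" unfolding n_def using DIM_positive[where 'a='a] by linarith
      moreover have "p t = \<tau> * norm x - \<tau> - (n - 2) / 2" by (simp add: p_def et \<kappa>_def algebra_simps)
      moreover have "P \<le> - (\<tau> / 4)" if "y \<le> \<tau> * (1/2)" "1 \<le> n" "P = y - \<tau> - (n - 2) / 2" for y P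
        using that \<tau> by (simp add: field_simps)
      ultimately show ?thesis by blast
    qed
    have "(\<tau> / 4)^2 \<le> (- p t)^2" using p4 \<tau> by (intro power_mono) auto
    then have "4 * (p t)^2 - 1 \<ge> \<tau>^2 / 8"
      using power_mono[OF \<tau>, of 2] by (simp add: power_divide)
    then have "\<tau> * norm x * (\<tau>^2 / 8) \<le> p1 t * (4 * (p t)^2 - 1)"
      unfolding p1_def et using \<tau> by (intro mult_left_mono) auto
    also have "\<tau> * norm x * (\<tau>^2 / 8) = \<tau>^3 / 8 * norm x" by (simp add: power2_eq_square power3_eq_cube)
    finally have "\<tau>^3 / 8 * norm x * (v x)^2 \<le> p1 t * (4 * (p t)^2 - 1) * (v x)^2"
      by (rule mult_right_mono) simp
    moreover have "0 \<le> 4 * p1 t * (eul v x)^2" using \<tau> by (simp add: p1_def)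
    ultimately have "\<tau>^3 / 8 * norm x * (v x)^2 \<le> 4 * p1 t * (eul v x)^2 + (4 * (p t)^2 * p1 t - p1 t) * (v x)^2"
      by (simp add: algebra_simps)
    then have "(\<rho> t / R) * (\<tau>^3 / 8 * norm x * (v x)^2) \<le> (\<rho> t / R) * (4 * p1 t * (eul v x)^2 + (4 * (p t)^2 * p1 t - p1 t) * (v x)^2)"
      by (rule mult_left_mono) (use R in \<open>simp add: \<rho>_def\<close>)
    moreover have "(\<rho> t / R) * (\<tau>^3 / 8 * norm x * (v x)^2) = \<tau>^3 / 8 * (norm x * cw \<tau> x * (u x)^2)"
      unfolding cwx vx by (simp add: power_mult_distrib mult_ac)
    ultimately show ?thesis using 1 by linarith
  qed
  have lu0: "lap u x = 0" if "x \<notin> ?K" for x by (rule lap_zero_outside[OF K(1) u0 that])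
  have i1: "integrable lborel (\<lambda>x. norm x * cw \<tau> x * (u x)^2)"
    by (rule integrable_annulus[OF _ e, of _ "1/2"])
       (auto intro!: continuous_intros cw_continuous continuous_on_subset[OF C2_on_continuous[OF u]] simp: supp)
  have i2: "integrable lborel (\<lambda>x. (norm x)^4 * cw \<tau> x * (lap u x)^2)"
  proof (rule integrable_annulus[OF _ e, of _ "1/2"])
    show "norm x ^ 4 * cw \<tau> x * (lap u x)^2 = 0" if "norm x < e \<or> 1 / 2 < norm x" for x
      using lu0[of x] that by auto
  qed (auto intro!: continuous_intros cw_continuous continuous_on_subset[OF C2_on_continuous_lap[OF u]])
  have "(LBINT x. \<tau>^3 / 8 * (norm x * cw \<tau> x * (u x)^2) + (\<Sum>b\<in>Basis. pd b (F b) x)) \<le> (LBINT x. (norm x)^4 * cw \<tau> x * (lap u x)^2)"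
    using i1 i2 div(1) pw by (intro integral_mono) auto
  also have "(LBINT x. \<tau>^3 / 8 * (norm x * cw \<tau> x * (u x)^2) + (\<Sum>b\<in>Basis. pd b (F b) x)) = \<tau>^3 / 8 * (LBINT x. norm x * cw \<tau> x * (u x)^2)"
    using i1 div by simp
  finally show ?thesis .
qed

section \<open>Complex-valued functions\<close>

definition gsqc :: "('a::euclidean_space \<Rightarrow> complex) \<Rightarrow> 'a \<Rightarrow> real" where
  "gsqc u x = (\<Sum>b\<in>Basis. (cmod (pd b u x))^2)"

lemma gsqc_nonneg: "0 \<le> gsqc u x" unfolding gsqc_def by (intro sum_nonneg) auto

lemma C2_complex_parts:
  fixes u :: "'a::euclidean_space \<Rightarrow> complex"
  assumes u: "C2_on UNIV u"
  shows "C2_on UNIV (\<lambda>x. Re (u x))" "C2_on UNIV (\<lambda>x. Im (u x))"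
    "lap (\<lambda>x. Re (u x)) x = Re (lap u x)" "lap (\<lambda>x. Im (u x)) x = Im (lap u x)"
    "gsqc u x = gsq (\<lambda>x. Re (u x)) x + gsq (\<lambda>x. Im (u x)) x"
proof -
  note re = C2_on_linear[OF open_UNIV u bounded_linear_Re]
  note im = C2_on_linear[OF open_UNIV u bounded_linear_Im]
  show "C2_on UNIV (\<lambda>x. Re (u x))" "C2_on UNIV (\<lambda>x. Im (u x))" by (rule re(1), rule im(1))
  show "lap (\<lambda>x. Re (u x)) x = Re (lap u x)" "lap (\<lambda>x. Im (u x)) x = Im (lap u x)"
    by (rule re(3), simp, rule im(3), simp)
  have d: "u differentiable (at x)" by (rule C2_onD(1)[OF u]) simp
  show "gsqc u x = gsq (\<lambda>x. Re (u x)) x + gsq (\<lambda>x. Im (u x)) x"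
    unfolding gsqc_def gsq_def sum.distrib[symmetric]
    by (simp add: pd_linear[OF bounded_linear_Re d] pd_linear[OF bounded_linear_Im d] cmod_power2)
qed

lemma gsqc_continuous: "C1_on S u \<Longrightarrow> continuous_on S (gsqc u)"
  unfolding gsqc_def by (intro continuous_on_sum continuous_on_power continuous_on_norm C1_on_continuous_pd)

lemma lap_scaleR_complex:
  fixes f :: "'a::euclidean_space \<Rightarrow> real" and u :: "'a \<Rightarrow> complex"
  assumes "C2_on UNIV f" "C2_on UNIV u"
  shows "Re (lap (\<lambda>x. f x *\<^sub>R u x) x) = lap (\<lambda>x. f x * Re (u x)) x"
    "Im (lap (\<lambda>x. f x *\<^sub>R u x) x) = lap (\<lambda>x. f x * Im (u x)) x"
  using C2_complex_parts(3,4)[OF C2_on_scaleR[OF open_UNIV assms], of x] by simp_all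

text \<open>All cut-offs are real, so the real estimate applies to real and imaginary parts
  separately and the results add up.\<close>

lemma energy_complex:
  fixes u :: "'a::euclidean_space \<Rightarrow> complex" and \<alpha> \<beta> m :: "'a \<Rightarrow> real"
  assumes u: "C2_on UNIV u" and \<beta>: "C2_on UNIV \<beta>" and \<alpha>: "C1_on UNIV \<alpha>"
    and supp: "\<And>x. x \<notin> ball 0 R \<Longrightarrow> \<alpha> x = 0" "\<And>x. x \<notin> ball 0 R \<Longrightarrow> \<beta> x = 0" "\<And>x. x \<notin> ball 0 R \<Longrightarrow> m x = 0"
    and m: "m \<in> borel_measurable borel" "\<And>x. 0 \<le> m x" "\<And>x. m x \<le> B" and L: "L > 0"
    and p: "\<And>x. gsq \<beta> x \<le> (L * \<alpha> x)^2" "\<And>x. gsq \<alpha> x \<le> (L * m x)^2" "\<And>x. \<bar>lap \<beta> x\<bar> \<le> L^2 * m x"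
      "\<And>x. (\<alpha> x)^2 \<le> \<beta> x * m x"
  defines "A \<equiv> (LBINT x. (\<beta> x)^2 * (cmod (lap u x))^2)" and "M \<equiv> (LBINT x. (m x)^2 * (cmod (u x))^2)"
  shows "L^2 * (LBINT x. (\<alpha> x)^2 * gsqc u x) \<le> A + 5 * L^4 * M"
    and "L2sq (\<lambda>x. lap (\<lambda>x. \<beta> x *\<^sub>R u x) x) \<le> 15 * A + 63 * L^4 * M"
    and "integrable lborel (\<lambda>x. (m x)^2 * (cmod (u x))^2)"
    and "integrable lborel (\<lambda>x. (\<beta> x)^2 * (cmod (lap u x))^2)"
    and "integrable lborel (\<lambda>x. (\<alpha> x)^2 * gsqc u x)"
proof -
  note cp = C2_complex_parts[OF u]
  note eR = energy_estimate[OF cp(1) \<beta> \<alpha> supp m L p]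
  note eI = energy_estimate[OF cp(2) \<beta> \<alpha> supp m L p]
  note c\<beta> = C2_on_continuous[OF \<beta>]
  have icont: "integrable lborel (\<lambda>x. (g x)^2 * f x)" if "continuous_on UNIV f" "continuous_on UNIV g" "\<And>x. x \<notin> ball 0 R \<Longrightarrow> g x = 0" for f g :: "'a \<Rightarrow> real"
    by (rule integrable_compact_support[of _ R]) (use that in \<open>auto intro!: continuous_intros\<close>)
  have ig: "integrable lborel (\<lambda>x. (\<alpha> x)^2 * gsq w x)" if "C2_on UNIV w" for w
    by (rule icont[OF gsq_continuous[OF C2_C1[OF that]] C1_on_continuous[OF \<alpha>] supp(1)])
  have il: "integrable lborel (\<lambda>x. (\<beta> x)^2 * (lap w x)^2)" if "C2_on UNIV w" for w :: "'a \<Rightarrow> real"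
    by (rule icont[OF _ c\<beta> supp(2)]) (intro continuous_intros C2_on_continuous_lap that)
  have sA: "(\<beta> x)^2 * (cmod (lap u x))^2 = (\<beta> x)^2 * (lap (\<lambda>x. Re (u x)) x)^2 + (\<beta> x)^2 * (lap (\<lambda>x. Im (u x)) x)^2" for x
    unfolding cp(3,4) by (simp add: cmod_power2 distrib_left)
  have sM: "(m x)^2 * (cmod (u x))^2 = (m x)^2 * (Re (u x))^2 + (m x)^2 * (Im (u x))^2" for x
    by (simp add: cmod_power2 distrib_left)
  have A: "A = (LBINT x. (\<beta> x)^2 * (lap (\<lambda>x. Re (u x)) x)^2) + (LBINT x. (\<beta> x)^2 * (lap (\<lambda>x. Im (u x)) x)^2)"
    unfolding A_def sA using il[OF cp(1)] il[OF cp(2)] by (rule Bochner_Integration.integral_add)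
  have M: "M = (LBINT x. (m x)^2 * (Re (u x))^2) + (LBINT x. (m x)^2 * (Im (u x))^2)"
    unfolding M_def sM using eR(3) eI(3) by (rule Bochner_Integration.integral_add)
  show "integrable lborel (\<lambda>x. (m x)^2 * (cmod (u x))^2)"
    unfolding sM using eR(3) eI(3) by (rule Bochner_Integration.integrable_add)
  show "integrable lborel (\<lambda>x. (\<beta> x)^2 * (cmod (lap u x))^2)"
    unfolding sA using il[OF cp(1)] il[OF cp(2)] by (rule Bochner_Integration.integrable_add)
  show "integrable lborel (\<lambda>x. (\<alpha> x)^2 * gsqc u x)"
    unfolding cp(5) distrib_left using ig[OF cp(1)] ig[OF cp(2)] by (rule Bochner_Integration.integrable_add)
  have "(LBINT x. (\<alpha> x)^2 * gsqc u x) = (LBINT x. (\<alpha> x)^2 * gsq (\<lambda>x. Re (u x)) x) + (LBINT x. (\<alpha> x)^2 * gsq (\<lambda>x. Im (u x)) x)"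
    unfolding cp(5) distrib_left using ig[OF cp(1)] ig[OF cp(2)] by (rule Bochner_Integration.integral_add)
  then show "L^2 * (LBINT x. (\<alpha> x)^2 * gsqc u x) \<le> A + 5 * L^4 * M"
    using eR(1)[of R] eI(1)[of R] unfolding A M by (simp add: distrib_left)
  have iL: "integrable lborel (\<lambda>x. (lap (\<lambda>x. \<beta> x * w x) x)^2)" if "C2_on UNIV w" for w :: "'a \<Rightarrow> real"
  proof (rule integrable_compact_support[of _ "R+1"])
    show "continuous_on UNIV (\<lambda>x. (lap (\<lambda>x. \<beta> x * w x) x)^2)"
      by (intro continuous_intros C2_on_continuous_lap C2_on_mult \<beta> that open_UNIV)
    show "(lap (\<lambda>x. \<beta> x * w x) x)^2 = 0" if "x \<notin> ball 0 (R+1)" for x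
      using lap_zero_outside[of "cball 0 R" "\<lambda>x. \<beta> x * w x" x] that supp(2) by auto
  qed
  have "L2sq (\<lambda>x. lap (\<lambda>x. \<beta> x *\<^sub>R u x) x) = (LBINT x. (lap (\<lambda>x. \<beta> x * Re (u x)) x)^2) + (LBINT x. (lap (\<lambda>x. \<beta> x * Im (u x)) x)^2)"
    unfolding cmod_power2 lap_scaleR_complex[OF \<beta> u] using iL[OF cp(1)] iL[OF cp(2)]
    by (rule Bochner_Integration.integral_add)
  then show "L2sq (\<lambda>x. lap (\<lambda>x. \<beta> x *\<^sub>R u x) x) \<le> 15 * A + 63 * L^4 * M"
    using eR(2)[of R] eI(2)[of R] unfolding A M by (simp add: distrib_left)
qed

text \<open>The junk value of \<open>rad\<close> at the origin is replaced by \<open>c\<close>,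
  meant to be the constant value of the profile near minus infinity; then the function is smooth
  across the origin.\<close>

definition radc :: "real \<Rightarrow> (real \<Rightarrow> real) \<Rightarrow> 'a::euclidean_space \<Rightarrow> real" where
  "radc c h x = (if x = 0 then c else h (ln (norm x)))"

lemma radc:
  assumes s: "smooth2 h h1 h2" and c: "\<And>t. t \<le> t0 \<Longrightarrow> h t = c"
  shows "C2_on UNIV (radc c h :: 'a::euclidean_space \<Rightarrow> real)"
    and "x \<noteq> (0::'a) \<Longrightarrow> lap (radc c h) x = (rad h2 x + (real DIM('a) - 2) * rad h1 x) / (norm x)^2"
    and "x \<noteq> (0::'a) \<Longrightarrow> gsq (radc c h) x = (rad h1 x)^2 / (norm x)^2"
    and "lap (radc c h) (0::'a) = 0" and "gsq (radc c h) (0::'a) = 0"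
proof -
  have e1: "rad h x = radc c h x" if "x \<in> - {0}" for x :: 'a using that by (simp add: rad_def radc_def)
  have e2: "c = radc c h x" if "x \<in> ball 0 (exp t0)" for x :: 'a
  proof (cases "x = 0")
    case False
    then have "ln (norm x) \<le> t0" using that by (metis dist_0_norm exp_gt_zero less_imp_le ln_exp ln_le_cancel_iff mem_ball zero_less_norm_iff)
    then show ?thesis using c False by (simp add: radc_def)
  qed (simp add: radc_def)
  have o: "open (- {0::'a})" "open (ball (0::'a) (exp t0))" by auto
  have "C2_on (- {0} \<union> ball 0 (exp t0)) (radc c h :: 'a \<Rightarrow> real)"
    by (rule C2_on_Un[OF o C2_on_cong[OF o(1) e1 C2_on_rad[OF s]] C2_on_cong[OF o(2) e2 C2_on_const]])
  moreover have "- {0} \<union> ball 0 (exp t0) = (UNIV::'a set)" by auto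
  ultimately show "C2_on UNIV (radc c h :: 'a \<Rightarrow> real)" by simp
  have p: "pd b (radc c h) x = pd b (rad h) x" if "x \<in> -{0}" for b x :: 'a
    by (rule pd_cong_open(1)[OF o(1) that]) (simp add: e1)
  have pp: "pd b (pd b (radc c h)) x = pd b (pd b (rad h)) x" if "x \<in> -{0}" for b x :: 'a
    by (rule pd_cong_open(1)[OF o(1) that]) (rule p)
  show "lap (radc c h) x = (rad h2 x + (real DIM('a) - 2) * rad h1 x) / (norm x)^2" if "x \<noteq> (0::'a)"
    using rad_identities(1)[OF s that] that unfolding lap_def by (simp add: pp)
  show "gsq (radc c h) x = (rad h1 x)^2 / (norm x)^2" if "x \<noteq> (0::'a)"
    using rad_identities(2)[OF s that] that unfolding gsq_def by (simp add: p)
  have q: "pd b (radc c h) x = 0" if "x \<in> ball 0 (exp t0)" for b x :: 'a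
  proof -
    have "pd b (radc c h) x = pd b (\<lambda>x. c) x"
      by (rule pd_cong_open(1)[OF o(2) that]) (use e2 in metis)
    then show ?thesis by simp
  qed
  have qq: "pd b (pd b (radc c h)) (0::'a) = 0" for b :: 'a
  proof -
    have "pd b (pd b (radc c h)) (0::'a) = pd b (\<lambda>x. 0) 0"
      by (rule pd_cong_open(1)[OF o(2)]) (use q in auto)
    then show ?thesis by simp
  qed
  show "lap (radc c h) (0::'a) = 0" unfolding lap_def by (simp add: qq)
  show "gsq (radc c h) (0::'a) = 0" unfolding gsq_def by (simp add: q)
qed

lemma smooth2_shift: "smooth2 h h1 h2 \<Longrightarrow> smooth2 (\<lambda>t. h (t + a)) (\<lambda>t. h1 (t + a)) (\<lambda>t. h2 (t + a))"
  unfolding smooth2_def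
  by (auto intro: DERIV_shift[THEN iffD1] intro!: continuous_on_compose2[of UNIV h2] continuous_intros)

lemma smooth2_mult:
  assumes "smooth2 f f1 f2" "smooth2 g g1 g2"
  shows "smooth2 (\<lambda>t. f t * g t) (\<lambda>t. f1 t * g t + f t * g1 t) (\<lambda>t. f2 t * g t + 2 * f1 t * g1 t + f t * g2 t)"
proof -
  have d: "(f has_real_derivative f1 t) (at t)" "(f1 has_real_derivative f2 t) (at t)"
    "(g has_real_derivative g1 t) (at t)" "(g1 has_real_derivative g2 t) (at t)" for t
    using assms by (auto simp: smooth2_def)
  have c: "continuous_on UNIV f" "continuous_on UNIV g" "continuous_on UNIV f1" "continuous_on UNIV g1"
    by (auto intro!: DERIV_continuous_on d)
  show ?thesis unfolding smooth2_def
  proof (intro conjI allI)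
    show "((\<lambda>t. f t * g t) has_real_derivative f1 t * g t + f t * g1 t) (at t)" for t
      by (auto intro!: derivative_eq_intros d)
    show "((\<lambda>t. f1 t * g t + f t * g1 t) has_real_derivative f2 t * g t + 2 * f1 t * g1 t + f t * g2 t) (at t)" for t
      by (auto intro!: derivative_eq_intros d simp: algebra_simps)
    show "continuous_on UNIV (\<lambda>t. f2 t * g t + 2 * f1 t * g1 t + f t * g2 t)"
      using c assms by (auto simp: smooth2_def intro!: continuous_intros)
  qed
qed

lemma smooth2_diff_const: "smooth2 h h1 h2 \<Longrightarrow> smooth2 (\<lambda>t. 1 - h t) (\<lambda>t. - h1 t) (\<lambda>t. - h2 t)"
  unfolding smooth2_def by (auto intro!: derivative_eq_intros continuous_intros)

text \<open>The step has unit length in ln |x|. This is the origin of the ratio \<open>exp 1\<close>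
  between the radii of all nested balls below.\<close>

definition bump :: "real \<Rightarrow> 'a::euclidean_space \<Rightarrow> real" where
  "bump r = radc 1 (\<lambda>t. sstep (t + - ln r))"

lemma bump_smooth2: "smooth2 (\<lambda>t. sstep (t + - ln r)) (\<lambda>t. sstep1 (t + - ln r)) (\<lambda>t. sstep2 (t + - ln r))"
  by (rule smooth2_shift[OF sstep_smooth2])

lemma bump:
  assumes r: "r > 0"
  shows "C2_on UNIV (bump r :: 'a::euclidean_space \<Rightarrow> real)"
    and "0 \<le> bump r (x::'a)" "bump r x \<le> 1"
    and "norm x \<le> r \<Longrightarrow> bump r x = 1" "norm x \<ge> exp 1 * r \<Longrightarrow> bump r x = 0"
    and "\<bar>lap (bump r) x\<bar> \<le> 360 * (1 + real DIM('a)) / r^2 * indicator (cball 0 (exp 1 * r) - ball 0 r) x"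
    and "gsq (bump r) x \<le> (360 / r)^2 * indicator (cball 0 (exp 1 * r) - ball 0 r) x"
proof -
  have c1: "sstep (t + - ln r) = 1" if "t \<le> ln r" for t using sstep_le_0(1)[of "t - ln r"] that by simp
  note rb = radc[OF bump_smooth2 c1, folded bump_def]
  show "C2_on UNIV (bump r :: 'a \<Rightarrow> real)" by (rule rb(1))
  show "0 \<le> bump r x" "bump r x \<le> 1" using sstep_bounds by (auto simp: bump_def radc_def)
  show "norm x \<le> r \<Longrightarrow> bump r x = 1" using c1 r by (auto simp: bump_def radc_def)
  have l: "ln (norm x) - ln r \<ge> 1" if "norm x \<ge> exp 1 * r"
  proof -
    have "ln (exp 1 * r) \<le> ln (norm x)" using that r by (intro ln_mono) auto
    then show ?thesis using r by (simp add: ln_mult)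
  qed
  have x0: "x \<noteq> 0" if "norm x \<ge> exp 1 * r" using that r by (auto simp: mult_le_0_iff not_le[symmetric])
  show "norm x \<ge> exp 1 * r \<Longrightarrow> bump r x = 0" using sstep_ge_1(1)[OF l] x0 by (auto simp: bump_def radc_def)
  have z: "sstep1 (ln (norm x) + - ln r) = 0 \<and> sstep2 (ln (norm x) + - ln r) = 0" if zz: "x \<notin> cball 0 (exp 1 * r) - ball 0 r" "x \<noteq> 0"
  proof -
    consider "norm x < r" | "norm x \<ge> exp 1 * r" using zz(1) by (force simp: not_le not_less)
    then show ?thesis
    proof cases
      case 1
      then have "ln (norm x) \<le> ln r" using zz(2) by (intro ln_mono) auto
      then show ?thesis using sstep_le_0[of "ln (norm x) - ln r"] by simp
    next
      case 2
      then show ?thesis using sstep_ge_1[OF l] by simp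
    qed
  qed
  have D2: "\<bar>real DIM('a) - 2\<bar> \<le> real DIM('a)"
  proof -
    have "1 \<le> real DIM('a)" using DIM_positive[where 'a='a] by linarith
    then show ?thesis by (simp add: abs_le_iff)
  qed
  have nb: "(norm x)^2 \<ge> r^2" if "x \<in> cball 0 (exp 1 * r) - ball 0 r" using that r by (intro power_mono) auto
  show "\<bar>lap (bump r) x\<bar> \<le> 360 * (1 + real DIM('a)) / r^2 * indicator (cball 0 (exp 1 * r) - ball 0 r) x"
  proof (cases "x \<in> cball 0 (exp 1 * r) - ball 0 r")
    case True
    then have x: "x \<noteq> 0" using r by auto
    let ?s1 = "sstep1 (ln (norm x) + - ln r)" and ?s2 = "sstep2 (ln (norm x) + - ln r)"
    have "\<bar>?s2 + (real DIM('a) - 2) * ?s1\<bar> \<le> \<bar>?s2\<bar> + \<bar>real DIM('a) - 2\<bar> * \<bar>?s1\<bar>"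
      by (metis abs_mult abs_triangle_ineq)
    also have "\<dots> \<le> 360 + real DIM('a) * 360"
      using sstep_bounds(3,4)[of "ln (norm x) + - ln r"] D2 by (intro add_mono mult_mono) auto
    finally have "\<bar>?s2 + (real DIM('a) - 2) * ?s1\<bar> / (norm x)^2 \<le> 360 * (1 + real DIM('a)) / r^2"
      using nb[OF True] r by (intro frac_le) auto
    then show ?thesis using True x by (simp add: rb(2) rad_def)
  next
    case False
    show ?thesis
    proof (cases "x = 0")
      case True then show ?thesis using rb(4)[where 'a='a, of "ln r"] r by simp
    next
      case 2: False
      then show ?thesis using z[OF False] by (simp add: rb(2) rad_def False)
    qed
  qed
  show "gsq (bump r) x \<le> (360 / r)^2 * indicator (cball 0 (exp 1 * r) - ball 0 r) x"
  proof (cases "x \<in> cball 0 (exp 1 * r) - ball 0 r")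
    case True
    then have x: "x \<noteq> 0" using r by auto
    let ?s1 = "sstep1 (ln (norm x) + - ln r)"
    have "?s1^2 \<le> 360^2"
      using sstep_bounds(3)[of "ln (norm x) + - ln r"] by (metis abs_ge_zero power2_abs power_mono)
    then have "?s1^2 / (norm x)^2 \<le> 360^2 / r^2"
      using nb[OF True] r by (intro frac_le) auto
    then show ?thesis using True x by (simp add: rb(3) rad_def power_divide)
  next
    case False
    show ?thesis
    proof (cases "x = 0")
      case True then show ?thesis using rb(5)[where 'a='a, of "ln r"] r by simp
    next
      case 2: False
      then show ?thesis using z[OF False] by (simp add: rb(3) rad_def False)
    qed
  qed
qed

text \<open>The hypotheses of \<open>energy_estimate\<close> for \<alpha> = \<open>bump r\<close>,
  \<beta> = its square and m = the indicator of the ball that carries them. Squaring makes the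
  gradient of \<beta> proportional to \<alpha>. \<open>L\<close> is a generous multiple of
  1/r.\<close>

lemma ball_cutoff:
  assumes r: "r > 0"
  defines "L \<equiv> 1000 * (1 + real DIM('a)) / r"
  shows "C2_on UNIV (\<lambda>x::'a::euclidean_space. bump r x * bump r x)"
    and "gsq (\<lambda>x::'a. bump r x * bump r x) x \<le> (L * bump r x)^2"
    and "gsq (bump r :: 'a \<Rightarrow> real) x \<le> (L * indicator (cball 0 (exp 1 * r)) x)^2"
    and "\<bar>lap (\<lambda>x::'a. bump r x * bump r x) x\<bar> \<le> L^2 * indicator (cball 0 (exp 1 * r)) x"
    and "(bump r x)^2 \<le> (bump r x * bump r x) * indicator (cball 0 (exp 1 * r)) (x::'a)"
proof -
  note b = bump[OF r, where 'a='a]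
  define n where "n = real DIM('a)"
  have n: "n \<ge> 1" unfolding n_def using DIM_positive[where 'a='a] by linarith
  have d: "bump r differentiable (at x)" for x :: 'a by (rule C2_onD(1)[OF b(1)]) simp
  show "C2_on UNIV (\<lambda>x::'a. bump r x * bump r x)" by (intro C2_on_mult b open_UNIV)
  have LL: "L^2 \<ge> (720 / r)^2" "L^2 \<ge> (720 * (1 + n) + 2 * 360^2) / r^2"
  proof -
    have "720^2 \<le> (1000 * (1 + n))^2" using n by (intro power_mono) auto
    then show "L^2 \<ge> (720 / r)^2" using r unfolding L_def n_def[symmetric] power_divide by (intro divide_right_mono) auto
    have "720 * (1 + n) + 2 * 360^2 \<le> 1000000 * (1 + n)" using n by simp
    also have "\<dots> \<le> 1000000 * ((1 + n) * (1 + n))" using n by (intro mult_left_mono) auto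
    also have "\<dots> = (1000 * (1 + n))^2" by algebra
    finally show "L^2 \<ge> (720 * (1 + n) + 2 * 360^2) / r^2"
      using r unfolding L_def n_def[symmetric] power_divide by (intro divide_right_mono) auto
  qed
  have i1: "indicator (cball 0 (exp 1 * r) - ball 0 r) x \<le> (indicator (cball 0 (exp 1 * r)) x :: real)" for x :: 'a
    by (auto simp: indicator_def)
  have g: "gsq (bump r) x \<le> (360 / r)^2 * indicator (cball 0 (exp 1 * r)) x" for x :: 'a
    using b(7)[of x] mult_left_mono[OF i1[of x], of "(360/r)^2"] by simp
  have "gsq (\<lambda>x. bump r x * bump r x) x = (2 * bump r x)^2 * gsq (bump r) x" for x :: 'a
    unfolding gsq_def sum_distrib_left by (intro sum.cong refl) (simp add: pd_mult[OF d d] power2_eq_square algebra_simps)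
  also have "(2 * bump r x)^2 * gsq (bump r) x \<le> (2 * bump r x)^2 * (360 / r)^2"
    using g[of x] by (intro mult_left_mono) (auto simp: indicator_def split: if_splits intro: order_trans)
  also have "\<dots> = (720 / r)^2 * (bump r x)^2" by (simp add: power_mult_distrib power_divide)
  also have "\<dots> \<le> L^2 * (bump r x)^2" by (intro mult_right_mono LL) simp
  finally show "gsq (\<lambda>x::'a. bump r x * bump r x) x \<le> (L * bump r x)^2" by (simp add: power_mult_distrib)
  have "(360 / r)^2 \<le> L^2" using LL(1) r by (simp add: power_divide divide_le_eq)
  then have "(360 / r)^2 * indicator (cball 0 (exp 1 * r)) x \<le> L^2 * indicator (cball 0 (exp 1 * r)) x"
    by (rule mult_right_mono) simp
  then show "gsq (bump r :: 'a \<Rightarrow> real) x \<le> (L * indicator (cball 0 (exp 1 * r)) x)^2"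
    using g[of x] by (cases "norm x \<le> exp 1 * r") (auto simp: power_mult_distrib)
  show "\<bar>lap (\<lambda>x::'a. bump r x * bump r x) x\<bar> \<le> L^2 * indicator (cball 0 (exp 1 * r)) x"
  proof -
    have "lap (\<lambda>x::'a. bump r x * bump r x) x = 2 * (bump r x * lap (bump r) x) + 2 * gsq (bump r) x"
      by (subst lap_mult_real[OF open_UNIV b(1) b(1)]) (simp_all add: gdot_def gsq_def power2_eq_square)
    moreover have "\<bar>bump r x * lap (bump r) x\<bar> \<le> 1 * (360 * (1 + n) / r^2 * indicator (cball 0 (exp 1 * r)) x)"
      unfolding abs_mult
    proof (rule mult_mono)
      show "\<bar>lap (bump r) x\<bar> \<le> 360 * (1 + n) / r^2 * indicator (cball 0 (exp 1 * r)) x"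
        using b(6)[of x] mult_left_mono[OF i1[of x], of "360 * (1 + n) / r^2"] n by (simp add: n_def)
    qed (use b(2,3)[of x] in auto)
    ultimately have "\<bar>lap (\<lambda>x::'a. bump r x * bump r x) x\<bar> \<le> 2 * (360 * (1 + n) / r^2 * indicator (cball 0 (exp 1 * r)) x)
       + 2 * ((360 / r)^2 * indicator (cball 0 (exp 1 * r)) x)"
      using g[of x] gsq_nonneg[of "bump r" x] by linarith
    also have "\<dots> = (720 * (1 + n) + 2 * 360^2) / r^2 * indicator (cball 0 (exp 1 * r)) x"
      by (simp add: power_divide add_divide_distrib distrib_right)
    also have "\<dots> \<le> L^2 * indicator (cball 0 (exp 1 * r)) x"
      by (intro mult_right_mono LL) simp
    finally show ?thesis .
  qed
  show "(bump r x)^2 \<le> (bump r x * bump r x) * indicator (cball 0 (exp 1 * r)) (x::'a)"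
    using b(5)[of x] by (auto simp: indicator_def power2_eq_square)
qed

section \<open>Caccioppoli inequality\<close>

lemma integrable_cball:
  fixes f :: "'a::euclidean_space \<Rightarrow> real"
  shows "continuous_on UNIV f \<Longrightarrow> integrable lborel (\<lambda>x. indicator (cball 0 s) x * f x)"
  using borel_integrable_compact[of "cball 0 s" f] continuous_on_subset[of UNIV f] by simp

text \<open>The radius \<open>3\<close> leaves room for cut-off functions that equal \<open>1\<close> on the unit ball.\<close>

locale potential_bound =
  fixes V :: "'a::euclidean_space \<Rightarrow> complex" and K \<delta> :: real
  assumes V_meas [measurable]: "V \<in> borel_measurable borel" and K: "K \<ge> 0" and \<delta>: "\<delta> > 0"
    and VB: "\<And>\<tau> v. \<tau> \<ge> 1 \<Longrightarrow> C2_on UNIV v \<Longrightarrow> (\<And>x. x \<notin> ball 0 3 \<Longrightarrow> v x = 0) \<Longrightarrow>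
      integrable lborel (\<lambda>x. (cmod (V x))^2 * (cmod (v x))^2) \<and>
      (LBINT x. (cmod (V x))^2 * (cmod (v x))^2) \<le>
        K * \<tau> powr (- 4 * \<delta>) * (L2sq (lap v) / \<tau> + \<tau>^3 * L2sq v)"
begin

text \<open>The defect of \<open>u\<close> as a solution. It accompanies every estimate because only
  C2 functions that solve the equation approximately are at hand.\<close>

definition err :: "('a \<Rightarrow> complex) \<Rightarrow> 'a \<Rightarrow> complex" where
  "err u x = lap u x - V x * u x"

lemma C2_borel: "C2_on UNIV (u::'a\<Rightarrow>complex) \<Longrightarrow> u \<in> borel_measurable borel" "C2_on UNIV u \<Longrightarrow> lap u \<in> borel_measurable borel"
   "C2_on UNIV u \<Longrightarrow> gsqc u \<in> borel_measurable borel"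
  using C2_on_continuous C2_on_continuous_lap gsqc_continuous C2_C1 borel_measurable_continuous_onI by blast+

lemma integrable_ball_V:
  assumes u: "C2_on UNIV u" and s: "s \<le> 1"
  shows "L2int (cball 0 s) (\<lambda>x. V x * u x)"
    and "L2int (cball 0 s) (err u)"
proof -
  note [measurable] = C2_borel[OF u]
  have [measurable]: "cball 0 s \<in> sets (borel :: 'a measure)" by simp
  have c: "C2_on UNIV (\<lambda>x. bump 1 x *\<^sub>R u x)" by (intro C2_on_scaleR bump u) auto
  have z: "bump 1 x *\<^sub>R u x = 0" if "x \<notin> ball 0 3" for x :: 'a
    using bump(5)[of 1 x] exp_le that by simp
  have i: "integrable lborel (\<lambda>x. (cmod (V x))^2 * (cmod (bump 1 x *\<^sub>R u x))^2)"
    using VB[of 1, OF _ c z] by simp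
  show 1: "L2int (cball 0 s) (\<lambda>x. V x * u x)"
  proof (rule integrable_bound[OF i])
    have "norm (indicator (cball 0 s) x * (cmod (V x * u x))^2) \<le> norm ((cmod (V x))^2 * (cmod (bump 1 x *\<^sub>R u x))^2)" for x
    proof (cases "norm x \<le> s")
      case True
      then have "bump 1 x = 1" using s by (intro bump(4)) auto
      then show ?thesis using True by (simp add: norm_mult power_mult_distrib)
    qed simp
    then show "AE x in lborel. norm (indicator (cball 0 s) x * (cmod (V x * u x))^2) \<le> norm ((cmod (V x))^2 * (cmod (bump 1 x *\<^sub>R u x))^2)"
      by (rule AE_I2)
  qed measurable
  have 2: "L2int (cball 0 s) (lap u)"
    by (intro integrable_cball continuous_intros C2_on_continuous_lap u)
  have m: "lap u \<in> borel_measurable borel" "(\<lambda>x. - (V x * u x)) \<in> borel_measurable borel" by measurable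
  show "L2int (cball 0 s) (err u)"
    using L2on_add(1)[OF _ m 2, of] 1 by (simp add: err_def)
qed

text \<open>The energy estimate bounds the Laplacian of the cut-off function by \<beta> times the
  Laplacian of \<open>u\<close>, that is by \<beta> (err + V u). The bound for V acting on \<beta> u
  returns the first quantity with a small factor, and it is absorbed. The Laplacian bound serves the
  doubling estimate, the gradient bound the Carleman cut-off.\<close>

lemma caccioppoli:
  obtains C where "C \<ge> 0"
    "\<And>u r. C2_on UNIV u \<Longrightarrow> 0 < r \<Longrightarrow> exp 1 * r \<le> 1 \<Longrightarrow>
      r^4 * L2sq (\<lambda>x. lap (\<lambda>x. (bump r x * bump r x) *\<^sub>R u x) x) \<le>
        C * (L2on (cball 0 (exp 1 * r)) u + L2on (cball 0 (exp 1 * r)) (err u)) \<and>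
      r^2 * (LBINT x. indicator (cball 0 r) x * gsqc u x) \<le>
        C * (L2on (cball 0 (exp 1 * r)) u + L2on (cball 0 (exp 1 * r)) (err u))"
proof -
  define c where "c = 1000 * (1 + real DIM('a))"
  \<comment> \<open>The quantity \<open>X\<close> comes back with factor 15 * 2 * K / \<tau> = 30 K
    / \<tau>; this choice makes it at most 1/2.\<close>
  define \<tau> where "\<tau> = 1 + 60 * K"
  have \<tau>: "\<tau> \<ge> 1" using K by (simp add: \<tau>_def)
  have c1: "c \<ge> 1" by (simp add: c_def)
  define C1 where "C1 = 60 + 60 * K * \<tau>^3 + 126 * c^4"
  define C where "C = C1 + (2 + 2 * K * (C1 + \<tau>^3) + 5 * c^4)"
  have C1: "C1 \<ge> 0" using K \<tau> c1 by (simp add: C1_def)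
  have C2: "2 + 2 * K * (C1 + \<tau>^3) + 5 * c^4 \<ge> 0" using K \<tau> c1 C1 by simp
  have C: "C \<ge> 0" using C1 C2 by (simp add: C_def)
  have "r^4 * L2sq (\<lambda>x. lap (\<lambda>x. (bump r x * bump r x) *\<^sub>R u x) x) \<le>
        C * (L2on (cball 0 (exp 1 * r)) u + L2on (cball 0 (exp 1 * r)) (err u)) \<and>
      r^2 * (LBINT x. indicator (cball 0 r) x * gsqc u x) \<le>
        C * (L2on (cball 0 (exp 1 * r)) u + L2on (cball 0 (exp 1 * r)) (err u))"
    if u: "C2_on UNIV u" and r: "0 < r" and er: "exp 1 * r \<le> 1" for u :: "'a \<Rightarrow> complex" and r
  proof -
    note [measurable] = C2_borel[OF u]
    let ?m = "indicator (cball 0 (exp 1 * r)) :: 'a \<Rightarrow> real"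
    let ?\<beta> = "\<lambda>x::'a. bump r x * bump r x"
    define L where "L = c / r"
    have L: "L > 0" using c1 r by (simp add: L_def)
    have r1: "r \<le> 1" using er r order_trans[OF mult_right_mono[of 1 "exp 1" r] er] by auto
    note bc = ball_cutoff[OF r, where 'a='a, folded c_def L_def]
    have s: "bump r x = 0" "?\<beta> x = 0" "?m x = 0" if "x \<notin> ball 0 2" for x :: 'a
      using bump(5)[OF r, of x] that er by (auto simp: indicator_def)
    have cb [measurable]: "cball 0 (exp 1 * r) \<in> sets (borel :: 'a measure)" by simp
    have m: "?m \<in> borel_measurable borel" "\<And>x. 0 \<le> ?m x" "\<And>x. ?m x \<le> 1" by auto
    note E = energy_complex[OF u bc(1) C2_C1[OF bump(1)[OF r]] s m L bc(2-5)]
    define A where "A = (LBINT x. (?\<beta> x)^2 * (cmod (lap u x))^2)"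
    define N where "N = (LBINT x. ?m x * (cmod (u x))^2)"
    define Fn where "Fn = (LBINT x. ?m x * (cmod (err u x))^2)"
    define X where "X = L2sq (\<lambda>x. lap (\<lambda>x. ?\<beta> x *\<^sub>R u x) x)"
    define G where "G = (LBINT x. (bump r x)^2 * gsqc u x)"
    have mm: "(?m x)^2 = ?m x" for x by (auto simp: indicator_def)
    have iA: "integrable lborel (\<lambda>x. (?\<beta> x)^2 * (cmod (lap u x))^2)" by (rule E(4)) auto
    have iG: "integrable lborel (\<lambda>x. (bump r x)^2 * gsqc u x)" by (rule E(5)) auto
    have iN: "integrable lborel (\<lambda>x. ?m x * (cmod (u x))^2)" using E(3)[of 2] unfolding mm by simp
    have E1: "L^2 * G \<le> A + 5 * L^4 * N" using E(1)[of 2] unfolding mm A_def N_def G_def by simp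
    have E2: "X \<le> 15 * A + 63 * L^4 * N" using E(2)[of 2] unfolding mm A_def N_def X_def by simp
    note iF = integrable_ball_V(2)[OF u er]
    have N0: "N \<ge> 0" and F0: "Fn \<ge> 0" and X0: "X \<ge> 0" and A0: "A \<ge> 0"
      unfolding N_def Fn_def X_def A_def by (auto intro!: integral_nonneg_AE)
    have c\<beta>: "C2_on UNIV (\<lambda>x. ?\<beta> x *\<^sub>R u x)" by (intro C2_on_scaleR bc u open_UNIV)
    have z\<beta>: "?\<beta> x *\<^sub>R u x = 0" if "x \<notin> ball 0 3" for x using s(2)[of x] that by auto
    have b1: "0 \<le> ?\<beta> x" "?\<beta> x \<le> ?m x" "(?\<beta> x)^2 \<le> ?m x" for x
    proof -
      show "0 \<le> ?\<beta> x" by simp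
      have "?\<beta> x \<le> 1" using mult_mono[OF bump(3)[OF r, of x] bump(3)[OF r, of x]] bump(2)[OF r, of x] by simp
      then show "?\<beta> x \<le> ?m x" using bump(5)[OF r, of x] by (auto simp: indicator_def)
      have "(?\<beta> x)^2 \<le> 1" using \<open>?\<beta> x \<le> 1\<close> \<open>0 \<le> ?\<beta> x\<close> by (simp add: power_le_one)
      then show "(?\<beta> x)^2 \<le> ?m x" using bump(5)[OF r, of x] by (auto simp: indicator_def)
    qed
    define Y where "Y = (LBINT x. (cmod (V x))^2 * (cmod (?\<beta> x *\<^sub>R u x))^2)"
    have iY: "integrable lborel (\<lambda>x. (cmod (V x))^2 * (cmod (?\<beta> x *\<^sub>R u x))^2)"
      and Y: "Y \<le> K * \<tau> powr (- 4 * \<delta>) * (X / \<tau> + \<tau>^3 * L2sq (\<lambda>x. ?\<beta> x *\<^sub>R u x))"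
      using VB[OF \<tau> c\<beta> z\<beta>] unfolding Y_def X_def by auto
    have bN: "L2sq (\<lambda>x. ?\<beta> x *\<^sub>R u x) \<le> N"
      unfolding N_def
    proof (rule integral_mono[OF _ iN])
      show "integrable lborel (\<lambda>x. (cmod (?\<beta> x *\<^sub>R u x))^2)"
        by (rule integrable_compact_support[of _ 3]) (use z\<beta> in \<open>auto intro!: continuous_intros C2_on_continuous[OF u] C2_on_continuous[OF bump(1)[OF r]]\<close>)
      show "(cmod (?\<beta> x *\<^sub>R u x))^2 \<le> ?m x * (cmod (u x))^2" for x
        using mult_right_mono[OF b1(3)[of x], of "(cmod (u x))^2"] by (simp add: norm_mult power_mult_distrib)
    qed
    have "\<tau> powr (- 4 * \<delta>) \<le> 1" using \<tau> \<delta> powr_mono[of "- 4 * \<delta>" 0 \<tau>] by simp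
    then have "K * \<tau> powr (- 4 * \<delta>) \<le> K * 1" using K by (intro mult_left_mono) auto
    then have "Y \<le> K * (X / \<tau> + \<tau>^3 * N)"
      using Y bN X0 N0 \<tau> K
      by (intro order_trans[OF Y] mult_mono add_mono mult_left_mono) (auto intro!: integral_nonneg_AE add_nonneg_nonneg)
    then have Y1: "Y \<le> K * (X / \<tau>) + K * \<tau>^3 * N" by (simp add: algebra_simps)
    have KX: "30 * (K * (X / \<tau>)) \<le> X / 2"
    proof -
      have "60 * K * X \<le> \<tau> * X" using X0 by (intro mult_right_mono) (simp_all add: \<tau>_def)
      then show ?thesis using \<tau> by (simp add: field_simps)
    qed
    have A1: "A \<le> 2 * Fn + 2 * Y"
    proof -
      have "A \<le> (LBINT x. 2 * (?m x * (cmod (err u x))^2) + 2 * ((cmod (V x))^2 * (cmod (?\<beta> x *\<^sub>R u x))^2))"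
        unfolding A_def
      proof (rule integral_mono[OF iA])
        show "integrable lborel (\<lambda>x. 2 * (?m x * (cmod (err u x))^2) + 2 * ((cmod (V x))^2 * (cmod (?\<beta> x *\<^sub>R u x))^2))"
          using iF iY by simp
        fix x
        have "lap u x = err u x - (- (V x * u x))" by (simp add: err_def)
        then have "(cmod (lap u x))^2 \<le> 2 * (cmod (err u x))^2 + 2 * (cmod (V x * u x))^2"
          using cmod_diff_sq[of "err u x" "- (V x * u x)"] by simp
        then have "(?\<beta> x)^2 * (cmod (lap u x))^2 \<le> (?\<beta> x)^2 * (2 * (cmod (err u x))^2 + 2 * (cmod (V x * u x))^2)"
          by (rule mult_left_mono) simp
        also have "\<dots> = 2 * ((?\<beta> x)^2 * (cmod (err u x))^2) + 2 * ((cmod (V x))^2 * (cmod (?\<beta> x *\<^sub>R u x))^2)"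
          by (simp add: norm_mult power_mult_distrib algebra_simps)
        also have "\<dots> \<le> 2 * (?m x * (cmod (err u x))^2) + 2 * ((cmod (V x))^2 * (cmod (?\<beta> x *\<^sub>R u x))^2)"
          using mult_right_mono[OF b1(3)[of x], of "(cmod (err u x))^2"] by simp
        finally show "(?\<beta> x)^2 * (cmod (lap u x))^2 \<le> \<dots>" .
      qed
      also have "\<dots> = 2 * Fn + 2 * Y" using iF iY by (simp add: Fn_def Y_def)
      finally show ?thesis .
    qed
    have r4: "r^4 \<le> 1" "0 \<le> r^4" using r r1 by (auto simp: power_le_one)
    have rL: "r^4 * L^4 = c^4" "r^4 * L^2 = c^2 * r^2" using r by (simp_all add: L_def power_divide power2_eq_square power4_eq_xxxx)
    have "X \<le> 60 * Fn + 60 * (K * \<tau>^3 * N) + 126 * L^4 * N"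
      using E2 A1 Y1 KX by linarith
    then have "r^4 * X \<le> r^4 * (60 * Fn + 60 * (K * \<tau>^3 * N) + 126 * L^4 * N)"
      by (rule mult_left_mono[OF _ r4(2)])
    also have "\<dots> = r^4 * (60 * Fn + 60 * (K * \<tau>^3 * N)) + r^4 * (126 * L^4 * N)"
      by (rule distrib_left)
    also have "r^4 * (60 * Fn + 60 * (K * \<tau>^3 * N)) \<le> 1 * (60 * Fn + 60 * (K * \<tau>^3 * N))"
      using r4 N0 F0 K \<tau> by (intro mult_right_mono) auto
    also have "r^4 * (126 * L^4 * N) = 126 * c^4 * N" using rL(1) by (simp add: mult_ac)
    finally have "r^4 * X \<le> 60 * Fn + 60 * K * \<tau>^3 * N + 126 * c^4 * N" by simp
    also have "\<dots> \<le> C1 * (N + Fn)"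
      unfolding C1_def distrib_left distrib_right using N0 F0 K \<tau> c1 by simp
    finally have XX: "r^4 * X \<le> C1 * (N + Fn)" .
    have "Y \<le> K * X + K * \<tau>^3 * N"
    proof -
      have "X / \<tau> \<le> X" using X0 \<tau> by (simp add: divide_le_eq mult_le_cancel_left1)
      then have "K * (X / \<tau>) \<le> K * X" using K by (intro mult_left_mono)
      then show ?thesis using Y1 by linarith
    qed
    then have "r^4 * A \<le> r^4 * (2 * Fn + 2 * (K * X + K * \<tau>^3 * N))" using A1 r4 by (intro mult_left_mono) auto
    also have "\<dots> = r^4 * (2 * Fn + 2 * (K * \<tau>^3 * N)) + 2 * K * (r^4 * X)" by (simp add: algebra_simps)
    also have "\<dots> \<le> 1 * (2 * Fn + 2 * (K * \<tau>^3 * N)) + 2 * K * (C1 * (N + Fn))"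
      using r4 N0 F0 K \<tau> XX by (intro add_mono mult_right_mono mult_left_mono) auto
    finally have AA: "r^4 * A \<le> 2 * Fn + 2 * (K * \<tau>^3 * N) + 2 * K * (C1 * (N + Fn))" by simp
    have "G \<ge> 0" unfolding G_def by (auto intro!: integral_nonneg_AE mult_nonneg_nonneg gsqc_nonneg)
    then have "1 * (r^2 * G) \<le> c^2 * (r^2 * G)" using c1 by (intro mult_right_mono) (simp_all add: one_le_power)
    then have "r^2 * G \<le> c^2 * (r^2 * G)" by simp
    also have "\<dots> = r^4 * (L^2 * G)" using rL(2) by (simp add: mult_ac)
    also have "\<dots> \<le> r^4 * (A + 5 * L^4 * N)" by (rule mult_left_mono[OF E1 r4(2)])
    also have "\<dots> = r^4 * A + 5 * c^4 * N" using rL(1) by (simp add: algebra_simps)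
    also have "\<dots> \<le> (2 + 2 * K * (C1 + \<tau>^3) + 5 * c^4) * (N + Fn)"
    proof -
      have "0 \<le> Fn * (K * (2 * \<tau> ^ 3))" "0 \<le> Fn * (5 * c ^ 4)"
        using F0 K \<tau> c1 by auto
      then show ?thesis using AA N0 by (simp add: algebra_simps)
    qed
    finally have GG: "r^2 * G \<le> (2 + 2 * K * (C1 + \<tau>^3) + 5 * c^4) * (N + Fn)" .
    have G1: "(LBINT x. indicator (cball 0 r) x * gsqc u x) \<le> G"
      unfolding G_def
    proof (rule integral_mono[OF _ iG])
      show "integrable lborel (\<lambda>x. indicator (cball 0 r) x * gsqc u x)"
        by (intro integrable_cball gsqc_continuous C2_C1 u)
      show "indicator (cball 0 r) x * gsqc u x \<le> (bump r x)^2 * gsqc u x" for x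
        using bump(4)[OF r, of x] gsqc_nonneg[of u x] by (auto simp: indicator_def)
    qed
    have "C1 * (N + Fn) \<le> C * (N + Fn)" "(2 + 2 * K * (C1 + \<tau>^3) + 5 * c^4) * (N + Fn) \<le> C * (N + Fn)"
      using C1 C2 N0 F0 unfolding C_def by (intro mult_right_mono; simp)+
    then show ?thesis
      using XX GG mult_left_mono[OF G1, of "r^2"] unfolding X_def N_def Fn_def by auto
  qed
  then show ?thesis using that[OF C] by blast
qed

end

section \<open>Carleman inequality with the potential\<close>

text \<open>In the variable \<open>t = ln |x| + i\<close> this is the cut-off of the \<open>i\<close>-th dyadic shell: it is \<open>1\<close> on \<open>[-1, 0]\<close> and \<open>0\<close> outside \<open>[-2, 1]\<close>.\<close>

definition zc :: "real \<Rightarrow> real" where "zc t = sstep t * (1 - sstep (t + 2))"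
definition zc1 :: "real \<Rightarrow> real" where "zc1 t = sstep1 t * (1 - sstep (t + 2)) + sstep t * (- sstep1 (t + 2))"
definition zc2 :: "real \<Rightarrow> real" where
  "zc2 t = sstep2 t * (1 - sstep (t + 2)) + 2 * sstep1 t * (- sstep1 (t + 2)) + sstep t * (- sstep2 (t + 2))"

lemma zc_smooth2: "smooth2 zc zc1 zc2"
  using smooth2_mult[OF sstep_smooth2 smooth2_diff_const[OF smooth2_shift[OF sstep_smooth2, of 2]]]
  unfolding zc_def[abs_def] zc1_def[abs_def] zc2_def[abs_def] .

lemma zc_facts:
  "0 \<le> zc t" "zc t \<le> 1" "\<bar>zc1 t\<bar> \<le> 720" "\<bar>zc2 t\<bar> \<le> 300000"
  "t \<ge> 1 \<or> t \<le> -2 \<Longrightarrow> zc t = 0" "t \<ge> 1 \<or> t \<le> -2 \<Longrightarrow> zc1 t = 0" "t \<ge> 1 \<or> t \<le> -2 \<Longrightarrow> zc2 t = 0"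
  "-1 \<le> t \<Longrightarrow> t \<le> 0 \<Longrightarrow> zc t = 1"
proof -
  note b = sstep_bounds[of t] sstep_bounds[of "t + 2"]
  have s: "0 \<le> 1 - sstep (t + 2)" "1 - sstep (t + 2) \<le> 1" using b by auto
  show "0 \<le> zc t" "zc t \<le> 1" unfolding zc_def using s b by (auto intro: mult_le_one)
  have p: "\<bar>x * y\<bar> \<le> c" if "\<bar>x\<bar> \<le> c" "\<bar>y\<bar> \<le> 1" for x y c :: real
    using mult_mono[OF that] that by (simp add: abs_mult)
  have q: "\<bar>x * y\<bar> \<le> c" if "\<bar>x\<bar> \<le> 1" "\<bar>y\<bar> \<le> c" for x y c :: real
    using p[OF that(2,1)] by (simp add: mult.commute)
  have s': "\<bar>1 - sstep (t + 2)\<bar> \<le> 1" "\<bar>sstep t\<bar> \<le> 1" using s b by auto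
  have 1: "\<bar>sstep1 t * (1 - sstep (t + 2))\<bar> \<le> 360" "\<bar>sstep t * (- sstep1 (t + 2))\<bar> \<le> 360"
    "\<bar>sstep2 t * (1 - sstep (t + 2))\<bar> \<le> 360" "\<bar>sstep t * (- sstep2 (t + 2))\<bar> \<le> 360"
    using b s' by (intro p q; simp)+
  show "\<bar>zc1 t\<bar> \<le> 720" unfolding zc1_def using 1(1,2) by linarith
  have "\<bar>2 * sstep1 t * (- sstep1 (t + 2))\<bar> \<le> 2 * 360 * 360"
    unfolding abs_mult using b by (intro mult_mono) auto
  then show "\<bar>zc2 t\<bar> \<le> 300000" unfolding zc2_def using 1(3,4) by linarith
  have "sstep t = 0 \<and> sstep1 t = 0 \<and> sstep2 t = 0 \<or> sstep (t + 2) = 1 \<and> sstep1 (t + 2) = 0 \<and> sstep2 (t + 2) = 0" if "t \<ge> 1 \<or> t \<le> -2"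
    using that sstep_ge_1[of t] sstep_le_0[of "t + 2"] by auto
  then show "t \<ge> 1 \<or> t \<le> -2 \<Longrightarrow> zc t = 0" "t \<ge> 1 \<or> t \<le> -2 \<Longrightarrow> zc1 t = 0" "t \<ge> 1 \<or> t \<le> -2 \<Longrightarrow> zc2 t = 0"
    unfolding zc_def zc1_def zc2_def by auto
  show "zc t = 1" if "-1 \<le> t" "t \<le> 0" unfolding zc_def using sstep_le_0[of t] sstep_ge_1[of "t + 2"] that by simp
qed

definition shell :: "nat \<Rightarrow> 'a::euclidean_space set" where
  "shell i = {x. x \<noteq> 0 \<and> -2 \<le> ln (norm x) + real i \<and> ln (norm x) + real i \<le> 1}"

lemma shell_borel [measurable]: "shell i \<in> sets borel"
  unfolding shell_def by measurable

lemma shell_norm: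
  assumes "x \<in> shell i"
  shows "1 / norm x \<le> exp (2 + real i)" "norm x * exp (real i) \<le> 3" "norm x \<noteq> 0" "norm x < 3"
proof -
  have x: "x \<noteq> 0" "-2 \<le> ln (norm x) + real i" "ln (norm x) + real i \<le> 1" using assms by (auto simp: shell_def)
  have e: "norm x = exp (ln (norm x))" using x by simp
  show "norm x \<noteq> 0" using x by simp
  have "1 / norm x = exp (- ln (norm x))" using x by (simp add: exp_minus divide_inverse)
  also have "\<dots> \<le> exp (2 + real i)" using x by simp
  finally show "1 / norm x \<le> exp (2 + real i)" .
  have "norm x * exp (real i) = exp (ln (norm x) + real i)" using x by (simp add: exp_add)
  also have "\<dots> \<le> exp 1" using x by simp
  also have "exp (1::real) < 3" using e_less_272 by simp
  finally have 3: "norm x * exp (real i) < 3" .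
  then show "norm x * exp (real i) \<le> 3" by simp
  note 3
  moreover have "norm x * 1 \<le> norm x * exp (real i)" by (intro mult_left_mono) auto
  ultimately show "norm x < 3" by simp
qed

text \<open>Admissible indices lie in the interval [- 2 - t, 1 - t], whose length 3 leaves room for
  at most four integers.\<close>

lemma shell_overlap:
  fixes x :: "'a::euclidean_space"
  shows "(\<Sum>i\<le>N. indicator (shell i) x) \<le> (4::real)"
proof -
  define t where "t = ln (norm x)"
  define k where "k = nat \<lceil>- 2 - t\<rceil>"
  have "{i. i \<le> N \<and> x \<in> shell i} \<subseteq> {k..k+3}"
  proof
    fix i assume "i \<in> {i. i \<le> N \<and> x \<in> shell i}"
    then have i: "- 2 - t \<le> real i" "real i \<le> 1 - t" by (auto simp: shell_def t_def)
    have "\<lceil>- 2 - t\<rceil> \<le> int i" using i(1) by (simp add: ceiling_le_iff)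
    moreover have "int i \<le> \<lceil>- 2 - t\<rceil> + 3" using i(2) by linarith
    moreover have "z \<le> int i \<Longrightarrow> int i \<le> z + 3 \<Longrightarrow> i \<in> {nat z..nat z + 3}" for z by auto
    ultimately show "i \<in> {k..k+3}" unfolding k_def by blast
  qed
  then have "card {i. i \<le> N \<and> x \<in> shell i} \<le> card {k..k+3}" by (intro card_mono) auto
  then have "real (card {i. i \<le> N \<and> x \<in> shell i}) \<le> 4" by simp
  moreover have "(\<Sum>i\<le>N. indicator (shell i) x) = (\<Sum>i\<in>{i. i \<le> N \<and> x \<in> shell i}. (1::real))"
    by (rule sum.mono_neutral_cong_right) (auto simp: indicator_def)
  ultimately show ?thesis by simp
qed

text \<open>The square root of the weight \<open>|x|^4 cw \<tau> x\<close>, as a function of \<open>t = ln |x|\<close>.\<close>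

definition om :: "nat \<Rightarrow> real \<Rightarrow> real \<Rightarrow> real" where
  "om n \<tau> t = exp (2 * t - real n / 2 * t + \<tau> * (exp t - t))"
definition om1 :: "nat \<Rightarrow> real \<Rightarrow> real \<Rightarrow> real" where
  "om1 n \<tau> t = 2 - real n / 2 + \<tau> * (exp t - 1)"

lemma om_smooth2: "smooth2 (om n \<tau>) (\<lambda>t. om1 n \<tau> t * om n \<tau> t) (\<lambda>t. ((om1 n \<tau> t)^2 + \<tau> * exp t) * om n \<tau> t)"
  unfolding smooth2_def
proof (intro conjI allI)
  show 1: "(om n \<tau> has_real_derivative om1 n \<tau> t * om n \<tau> t) (at t)" for t
    unfolding om_def[abs_def] om1_def by (auto intro!: derivative_eq_intros simp: algebra_simps)
  show "((\<lambda>t. om1 n \<tau> t * om n \<tau> t) has_real_derivative ((om1 n \<tau> t)^2 + \<tau> * exp t) * om n \<tau> t) (at t)" for t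
  proof -
    have "(om1 n \<tau> has_real_derivative \<tau> * exp t) (at t)"
      unfolding om1_def[abs_def] by (auto intro!: derivative_eq_intros)
    from DERIV_mult[OF this 1] show ?thesis
      by (rule DERIV_cong) (simp add: algebra_simps power2_eq_square)
  qed
  show "continuous_on UNIV (\<lambda>t. ((om1 n \<tau> t)^2 + \<tau> * exp t) * om n \<tau> t)"
    unfolding om_def om1_def by (intro continuous_intros)
qed

lemma om_pos: "om n \<tau> t > 0" by (simp add: om_def)

lemma om_sq: "x \<noteq> 0 \<Longrightarrow> (om DIM('a) \<tau> (ln (norm x)))^2 = (norm x)^4 * cw \<tau> (x::'a::euclidean_space)"
proof -
  assume x: "x \<noteq> 0"
  let ?t = "ln (norm x)"
  have "(om DIM('a) \<tau> ?t)^2 = exp (4 * ?t + (- (real DIM('a) * ?t) + 2 * \<tau> * (exp ?t - ?t)))"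
    unfolding om_def power2_eq_square exp_add[symmetric] by (simp add: algebra_simps)
  also have "\<dots> = exp (4 * ?t) * cw \<tau> x" unfolding cw_def rad_def exp_add ..
  also have "exp (4 * ?t) = (norm x)^4"
    using x exp_of_nat_mult[of 4 ?t] by simp
  finally show ?thesis .
qed

text \<open>Here \<open>a\<close>, \<open>a1\<close>, \<open>a2\<close> are the cut-off and its
  derivatives, \<open>w\<close> is the logarithmic derivative of \<open>om\<close>, and
  \<open>s\<close> is \<tau> e^t. The bounded expressions come from differentiating zc * om and zc^2
  * om in t, with \<open>om\<close> (and in the second line one factor \<open>a\<close>) divided
  out. Each t-derivative costs O(\<tau>) uniformly in the shell, because t <= 1 on all
  shells.\<close>

lemma dyadic_scalar:
  fixes a a1 a2 w n \<tau> s :: real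
  assumes a: "0 \<le> a" "a \<le> 1" "\<bar>a1\<bar> \<le> 720" "\<bar>a2\<bar> \<le> 300000" and w: "\<bar>w\<bar> \<le> (n + 4) * \<tau>"
    and s: "0 \<le> s" "s \<le> 3 * \<tau>" and \<tau>: "\<tau> \<ge> 1" and n: "n \<ge> 1"
  shows "\<bar>a1 + a * w\<bar> \<le> (1444 + n) * \<tau>"
    and "\<bar>2 * a1 + a * w\<bar> \<le> (1444 + n) * \<tau>"
    and "\<bar>a2 * a + 2 * a1 * (a1 + a * w) + a * (a2 + 2 * a1 * w + a * (w^2 + s))\<bar> \<le>
      (600000 + 1440 * (1444 + n) + 1440 * (n + 4) + (n + 4)^2 + 3) * \<tau>^2"
proof -
  have aw: "\<bar>a * w\<bar> \<le> (n + 4) * \<tau>"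
    using mult_mono[of "\<bar>a\<bar>" 1 "\<bar>w\<bar>" "(n + 4) * \<tau>"] a w by (simp add: abs_mult)
  have t: "1440 \<le> 1440 * \<tau>" using \<tau> by simp
  have "(1444 + n) * \<tau> = 1440 * \<tau> + (n + 4) * \<tau>" by (simp add: algebra_simps)
  then show 1: "\<bar>a1 + a * w\<bar> \<le> (1444 + n) * \<tau>" and "\<bar>2 * a1 + a * w\<bar> \<le> (1444 + n) * \<tau>"
    using aw a(3) t by linarith+
  have tt: "1 \<le> \<tau>^2" "\<tau> \<le> \<tau>^2" using one_le_power[OF \<tau>, of 2] mult_left_mono[of 1 \<tau> \<tau>] \<tau> by (simp_all add: power2_eq_square)
  have p1: "\<bar>a2 * a\<bar> \<le> 300000 * \<tau>^2"
    using mult_mono[of "\<bar>a2\<bar>" 300000 "\<bar>a\<bar>" 1] a tt by (simp add: abs_mult)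
  have p2: "\<bar>2 * a1 * (a1 + a * w)\<bar> \<le> 1440 * (1444 + n) * \<tau>^2"
  proof -
    have "\<bar>2 * a1 * (a1 + a * w)\<bar> \<le> 1440 * ((1444 + n) * \<tau>)"
      unfolding abs_mult using a 1 by (intro mult_mono) auto
    also have "\<dots> \<le> 1440 * ((1444 + n) * \<tau>^2)" using tt n by (intro mult_left_mono) auto
    finally show ?thesis by (simp only: mult.assoc)
  qed
  have w2: "w^2 \<le> ((n + 4) * \<tau>)^2" using w by (metis abs_ge_zero power2_abs power_mono)
  have q1: "\<bar>2 * a1 * w\<bar> \<le> 1440 * (n + 4) * \<tau>^2"
  proof -
    have "\<bar>2 * a1 * w\<bar> \<le> 1440 * ((n + 4) * \<tau>)" unfolding abs_mult using a w by (intro mult_mono) auto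
    also have "\<dots> \<le> 1440 * ((n + 4) * \<tau>^2)" using tt n by (intro mult_left_mono) auto
    finally show ?thesis by (simp only: mult.assoc)
  qed
  have q2: "\<bar>a * (w^2 + s)\<bar> \<le> (n + 4)^2 * \<tau>^2 + 3 * \<tau>^2"
  proof -
    have "\<bar>a * (w^2 + s)\<bar> \<le> 1 * (((n + 4) * \<tau>)^2 + 3 * \<tau>)"
      unfolding abs_mult using a w2 s by (intro mult_mono) auto
    then show ?thesis using tt by (simp add: power_mult_distrib)
  qed
  have q3: "\<bar>a2\<bar> \<le> 300000 * \<tau>^2" using a(4) tt by linarith
  have "\<bar>a2 + 2 * a1 * w + a * (w^2 + s)\<bar> \<le> 300000 * \<tau>^2 + 1440 * (n + 4) * \<tau>^2 + ((n + 4)^2 * \<tau>^2 + 3 * \<tau>^2)"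
    using q1 q2 q3 by linarith
  then have "\<bar>a * (a2 + 2 * a1 * w + a * (w^2 + s))\<bar> \<le> 1 * (300000 * \<tau>^2 + 1440 * (n + 4) * \<tau>^2 + ((n + 4)^2 * \<tau>^2 + 3 * \<tau>^2))"
    unfolding abs_mult[of a] using a by (intro mult_mono) auto
  moreover have "\<bar>x + y + z\<bar> \<le> X + Y + 1 * Z" if "\<bar>x\<bar> \<le> X" "\<bar>y\<bar> \<le> Y" "\<bar>z\<bar> \<le> 1 * Z" for x y z X Y Z :: real
    using that by linarith
  ultimately have "\<bar>a2 * a + 2 * a1 * (a1 + a * w) + a * (a2 + 2 * a1 * w + a * (w^2 + s))\<bar> \<le>
      300000 * \<tau>^2 + 1440 * (1444 + n) * \<tau>^2 + 1 * (300000 * \<tau>^2 + 1440 * (n + 4) * \<tau>^2 + ((n + 4)^2 * \<tau>^2 + 3 * \<tau>^2))"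
    using p1 p2 by blast
  then show "\<bar>a2 * a + 2 * a1 * (a1 + a * w) + a * (a2 + 2 * a1 * w + a * (w^2 + s))\<bar> \<le>
      (600000 + 1440 * (1444 + n) + 1440 * (n + 4) + (n + 4)^2 + 3) * \<tau>^2"
    by (simp add: algebra_simps)
qed

text \<open>The functions \<open>\<alpha>\<close>, \<open>\<beta>\<close>, \<open>m\<close> of \<open>energy_estimate\<close> for the \<open>i\<close>-th shell.\<close>

definition da :: "real \<Rightarrow> nat \<Rightarrow> 'a::euclidean_space \<Rightarrow> real" where
  "da \<tau> i = radc 0 (\<lambda>t. zc (t + real i) * om DIM('a) \<tau> t)"
definition db :: "real \<Rightarrow> nat \<Rightarrow> 'a::euclidean_space \<Rightarrow> real" where
  "db \<tau> i = radc 0 (\<lambda>t. zc (t + real i) * (zc (t + real i) * om DIM('a) \<tau> t))"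
definition dm :: "real \<Rightarrow> nat \<Rightarrow> 'a::euclidean_space \<Rightarrow> real" where
  "dm \<tau> i x = indicator (shell i) x * om DIM('a) \<tau> (ln (norm x))"

text \<open>The bracket collects the constants of \<open>dyadic_scalar\<close> for first and second
  derivatives; exp 2 stems from 1 / |x| <= exp (2 + i) on the shell.\<close>

definition dyc :: "nat \<Rightarrow> real" where
  "dyc n = exp 2 * (1444 + real n + (600000 + 1440 * (1444 + real n) + 1440 * (real n + 4) + (real n + 4)^2 + 3) + real n * (1444 + real n))"

text \<open>A derivative in x is 1 / |x| times one in t. The latter costs O(\<tau>) and the former
  exp (2 + i), whence the form of \<open>L\<close>. The cut-off appears squared in
  \<open>db\<close>, once in \<open>da\<close> and not at all in \<open>dm\<close>, which gives the
  chain of inequalities that \<open>energy_estimate\<close> asks for.\<close>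

lemma dyadic_cutoff:
  fixes x :: "'a::euclidean_space" and i :: nat
  assumes \<tau>: "\<tau> \<ge> 1"
  defines "L \<equiv> dyc DIM('a) * \<tau> * exp (real i)"
  shows "C2_on UNIV (da \<tau> i :: 'a \<Rightarrow> real)" "C2_on UNIV (db \<tau> i :: 'a \<Rightarrow> real)"
    and "x \<notin> shell i \<Longrightarrow> da \<tau> i x = 0" "x \<notin> shell i \<Longrightarrow> db \<tau> i x = 0" "x \<notin> shell i \<Longrightarrow> dm \<tau> i x = 0"
    and "gsq (db \<tau> i) x \<le> (L * da \<tau> i x)^2" "gsq (da \<tau> i) x \<le> (L * dm \<tau> i x)^2"
    and "\<bar>lap (db \<tau> i) x\<bar> \<le> L^2 * dm \<tau> i x" "(da \<tau> i x)^2 \<le> db \<tau> i x * dm \<tau> i x"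
    and "0 \<le> db \<tau> i x" "db \<tau> i x \<le> dm \<tau> i x"
proof -
  define n where "n = DIM('a)"
  have n: "real n \<ge> 1" unfolding n_def using DIM_positive[where 'a='a] by linarith
  define O' where "O' = om n \<tau>"
  note zs = smooth2_shift[OF zc_smooth2, of "real i"]
  note sa = smooth2_mult[OF zs om_smooth2[of n \<tau>]]
  note sb = smooth2_mult[OF zs sa]
  have z0: "zc (t + real i) * om n \<tau> t = 0" "zc (t + real i) * (zc (t + real i) * om n \<tau> t) = 0" if "t \<le> -2 - real i" for t
    using zc_facts(5)[of "t + real i"] that by simp_all
  note ra = radc[OF sa z0(1), where 'a='a, folded da_def[where 'a='a, folded n_def]]
  note rb = radc[OF sb z0(2), where 'a='a, folded db_def[where 'a='a, folded n_def]]
  show C2: "C2_on UNIV (da \<tau> i :: 'a \<Rightarrow> real)" "C2_on UNIV (db \<tau> i :: 'a \<Rightarrow> real)"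
    using ra(1)[of "-2 - real i"] rb(1)[of "-2 - real i"] by simp_all
  define c3 where "c3 = 600000 + 1440 * (1444 + real n) + 1440 * (real n + 4) + (real n + 4)^2 + 3"
  define C0 where "C0 = 1444 + real n + c3 + real n * (1444 + real n)"
  have c3: "c3 \<ge> 0" using n by (simp add: c3_def)
  have C0: "1 \<le> C0" "1444 + real n \<le> C0" "c3 + real n * (1444 + real n) \<le> C0" using n c3 by (simp_all add: C0_def)
  have L: "L = C0 * \<tau> * exp (2 + real i)" by (simp add: L_def dyc_def C0_def c3_def n_def[symmetric] exp_add)
  show out: "da \<tau> i x = 0" "db \<tau> i x = 0" "dm \<tau> i x = 0" if "x \<notin> shell i"
    using that zc_facts(5)[of "ln (norm x) + real i"] by (auto simp: da_def db_def dm_def radc_def shell_def)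
  have zz: "zc (ln (norm x) + real i) = 0" "zc1 (ln (norm x) + real i) = 0" "zc2 (ln (norm x) + real i) = 0" if "x \<notin> shell i" "x \<noteq> 0"
    using that zc_facts(5-7)[of "ln (norm x) + real i"] by (auto simp: shell_def)
  have dout: "gsq (da \<tau> i) x = 0 \<and> gsq (db \<tau> i) x = 0 \<and> lap (db \<tau> i) x = 0" if "x \<notin> shell i"
  proof (cases "x = 0")
    case True
    then show ?thesis using ra(5) rb(4,5) by blast
  next
    case False
    then show ?thesis using zz[OF that False] by (simp add: ra(3) rb(2,3) rad_def)
  qed
  have main: "gsq (db \<tau> i) x \<le> (L * da \<tau> i x)^2 \<and> gsq (da \<tau> i) x \<le> (L * dm \<tau> i x)^2 \<and>
     \<bar>lap (db \<tau> i) x\<bar> \<le> L^2 * dm \<tau> i x \<and> (da \<tau> i x)^2 \<le> db \<tau> i x * dm \<tau> i x \<and> 0 \<le> db \<tau> i x \<and> db \<tau> i x \<le> dm \<tau> i x"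
  proof (cases "x \<in> shell i")
    case False
    then show ?thesis using out[OF False] dout[OF False] by simp
  next
    case True
    note sh = shell_norm[OF True]
    have x: "x \<noteq> 0" using sh by auto
    define t where "t = ln (norm x)"
    have t1: "t \<le> 1" using True by (auto simp: shell_def t_def)
    have et: "exp t \<le> 3" using t1 exp_le_cancel_iff[of t 1] exp_le by linarith
    define a where "a = zc (t + real i)"
    define a1 where "a1 = zc1 (t + real i)"
    define a2 where "a2 = zc2 (t + real i)"
    define w where "w = om1 n \<tau> t"
    define Q where "Q = om n \<tau> t"
    define s where "s = \<tau> * exp t"
    have Q: "Q > 0" by (simp add: Q_def om_pos)
    have a: "0 \<le> a" "a \<le> 1" "\<bar>a1\<bar> \<le> 720" "\<bar>a2\<bar> \<le> 300000" unfolding a_def a1_def a2_def by (rule zc_facts)+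
    have s: "0 \<le> s" "s \<le> 3 * \<tau>" using \<tau> et by (simp_all add: s_def mult.commute)
    have w: "\<bar>w\<bar> \<le> (real n + 4) * \<tau>"
    proof -
      have "\<bar>\<tau> * (exp t - 1)\<bar> \<le> \<tau> * 2" unfolding abs_mult using \<tau> et exp_ge_zero[of t] by (intro mult_mono) (auto simp: abs_le_iff simp del: exp_ge_zero)
      moreover have "\<bar>2 - real n / 2\<bar> \<le> (real n + 2) * 1" by auto
      moreover have "(real n + 2) * 1 \<le> (real n + 2) * \<tau>" using \<tau> by (intro mult_left_mono) auto
      ultimately have "\<bar>w\<bar> \<le> (real n + 2) * \<tau> + \<tau> * 2" unfolding w_def om1_def by linarith
      then show ?thesis by (simp add: algebra_simps)
    qed
    note S = dyadic_scalar[OF a w s \<tau> n]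
    have dax: "da \<tau> i x = a * Q" and dbx: "db \<tau> i x = a * (a * Q)" and dmx: "dm \<tau> i x = Q"
      using x True by (simp_all add: da_def db_def dm_def radc_def a_def Q_def t_def n_def)
    have inv: "1 / norm x \<le> exp (2 + real i)" by (rule sh(1))
    have bnd: "\<bar>y * Q\<bar> / norm x \<le> L * (b * Q)" if "\<bar>y\<bar> \<le> b * (1444 + real n) * \<tau>" "b \<ge> 0" for y b
    proof -
      have "\<bar>y * Q\<bar> / norm x = \<bar>y\<bar> * Q * (1 / norm x)" using Q by (simp add: abs_mult)
      also have "\<dots> \<le> (b * (1444 + real n) * \<tau>) * Q * exp (2 + real i)"
        using that Q inv n \<tau> by (intro mult_mono) auto
      also have "\<dots> \<le> (b * C0 * \<tau>) * Q * exp (2 + real i)"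
        using that C0(2) Q \<tau> by (intro mult_right_mono mult_left_mono) auto
      finally show ?thesis by (simp add: L mult_ac)
    qed
    have ga: "gsq (da \<tau> i) x = (\<bar>(a1 + a * w) * Q\<bar> / norm x)^2"
      unfolding ra(3)[OF _ x, of "-2 - real i", simplified] by (simp add: rad_def t_def[symmetric] a_def a1_def w_def Q_def power_divide algebra_simps)
    have gb: "gsq (db \<tau> i) x = (\<bar>a * (2 * a1 + a * w) * Q\<bar> / norm x)^2"
      unfolding rb(3)[OF _ x, of "-2 - real i", simplified] by (simp add: rad_def t_def[symmetric] a_def a1_def w_def Q_def power_divide algebra_simps)
    have "\<bar>(a1 + a * w) * Q\<bar> / norm x \<le> L * (1 * Q)" by (rule bnd) (use S in auto)
    then have 1: "gsq (da \<tau> i) x \<le> (L * dm \<tau> i x)^2" unfolding ga dmx by (intro power_mono) auto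
    have "\<bar>a * (2 * a1 + a * w)\<bar> \<le> a * (1444 + real n) * \<tau>"
      using S(2) a by (simp add: abs_mult mult_left_mono mult.assoc)
    then have "\<bar>a * (2 * a1 + a * w) * Q\<bar> / norm x \<le> L * (a * Q)" by (rule bnd) (use a in auto)
    then have 2: "gsq (db \<tau> i) x \<le> (L * da \<tau> i x)^2" unfolding gb dax by (intro power_mono) auto
    define Y where "Y = a2 * a + 2 * a1 * (a1 + a * w) + a * (a2 + 2 * a1 * w + a * (w^2 + s))"
    have lb: "lap (db \<tau> i) x = ((Y + (real n - 2) * (a * (2 * a1 + a * w))) * Q) * (1 / norm x)^2"
    proof -
      have "lap (db \<tau> i) x = ((Y + (real n - 2) * (a * (2 * a1 + a * w))) * Q) / (norm x)^2"
        unfolding rb(2)[OF _ x, of "-2 - real i", simplified] Y_def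
        by (intro arg_cong2[where f="(/)"] refl)
          (simp add: rad_def t_def[symmetric] a_def a1_def a2_def w_def Q_def s_def n_def[symmetric] algebra_simps power2_eq_square)
      then show ?thesis by (simp add: power_divide)
    qed
    have "\<bar>Y + (real n - 2) * (a * (2 * a1 + a * w))\<bar> \<le> c3 * \<tau>^2 + real n * (1 * ((1444 + real n) * \<tau>))"
    proof -
      have "\<bar>(real n - 2) * (a * (2 * a1 + a * w))\<bar> \<le> real n * (1 * ((1444 + real n) * \<tau>))"
        unfolding abs_mult using S(2) a n \<tau> by (intro mult_mono) (auto simp: abs_mult)
      then show ?thesis using S(3) unfolding Y_def c3_def by linarith
    qed
    also have "\<dots> \<le> c3 * \<tau>^2 + real n * (1444 + real n) * \<tau>^2"
      using \<tau> n by (simp add: power2_eq_square mult_left_mono)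
    also have "\<dots> \<le> C0 * \<tau>^2" using mult_right_mono[OF C0(3), of "\<tau>^2"] by (simp add: distrib_right)
    also have "\<dots> \<le> (C0 * \<tau>)^2"
      unfolding power_mult_distrib using C0(1) by (intro mult_right_mono) (auto simp: power2_eq_square)
    finally have Yb: "\<bar>Y + (real n - 2) * (a * (2 * a1 + a * w))\<bar> \<le> (C0 * \<tau>)^2" .
    have "\<bar>lap (db \<tau> i) x\<bar> = \<bar>Y + (real n - 2) * (a * (2 * a1 + a * w))\<bar> * Q * (1 / norm x)^2"
      unfolding lb using Q by (simp add: abs_mult)
    also have "\<dots> \<le> (C0 * \<tau>)^2 * Q * (exp (2 + real i))^2"
      using Yb Q inv by (intro mult_mono power_mono) auto
    also have "\<dots> = L^2 * dm \<tau> i x" unfolding L dmx by (simp add: power_mult_distrib)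
    finally have 3: "\<bar>lap (db \<tau> i) x\<bar> \<le> L^2 * dm \<tau> i x" .
    have "a * (a * Q) \<le> 1 * (1 * Q)" using a Q by (intro mult_mono) auto
    then show ?thesis using 1 2 3 a Q unfolding dax dbx dmx by (simp add: power2_eq_square mult_ac)
  qed
  then show "gsq (db \<tau> i) x \<le> (L * da \<tau> i x)^2" "gsq (da \<tau> i) x \<le> (L * dm \<tau> i x)^2"
    "\<bar>lap (db \<tau> i) x\<bar> \<le> L^2 * dm \<tau> i x" "(da \<tau> i x)^2 \<le> db \<tau> i x * dm \<tau> i x"
    "0 \<le> db \<tau> i x" "db \<tau> i x \<le> dm \<tau> i x" by blast+
qed

section \<open>The Carleman inequality for complex functions, and the potential in the Carleman
  norm\<close>

abbreviation carl4 :: "real \<Rightarrow> ('a::euclidean_space \<Rightarrow> complex) \<Rightarrow> real" where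
  "carl4 \<tau> f \<equiv> LBINT x. (norm x)^4 * cw \<tau> x * (cmod (f x))^2"

abbreviation carl4_int :: "real \<Rightarrow> ('a::euclidean_space \<Rightarrow> complex) \<Rightarrow> bool" where
  "carl4_int \<tau> f \<equiv> integrable lborel (\<lambda>x. (norm x)^4 * cw \<tau> x * (cmod (f x))^2)"

abbreviation carl1 :: "real \<Rightarrow> ('a::euclidean_space \<Rightarrow> complex) \<Rightarrow> real" where
  "carl1 \<tau> f \<equiv> LBINT x. norm x * cw \<tau> x * (cmod (f x))^2"

abbreviation carl1_int :: "real \<Rightarrow> ('a::euclidean_space \<Rightarrow> complex) \<Rightarrow> bool" where
  "carl1_int \<tau> f \<equiv> integrable lborel (\<lambda>x. norm x * cw \<tau> x * (cmod (f x))^2)"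

lemma carleman_complex:
  fixes u :: "'a::euclidean_space \<Rightarrow> complex"
  assumes u: "C2_on UNIV u" and \<tau>: "\<tau> \<ge> 4" and e: "e > 0"
    and supp: "\<And>x. norm x < e \<or> norm x > 1/2 \<Longrightarrow> u x = 0"
  shows "\<tau>^3 / 8 * carl1 \<tau> u \<le> carl4 \<tau> (lap u)"
    and "carl1_int \<tau> u"
    and "carl4_int \<tau> u"
    and "carl4_int \<tau> (lap u)"
proof -
  note cp = C2_complex_parts[OF u]
  have int: "integrable lborel (\<lambda>x. f x * cw \<tau> x * (g x)^2)"
    if "continuous_on UNIV f" "continuous_on UNIV g" "\<And>x. norm x < e \<or> norm x > 1/2 \<Longrightarrow> g x = 0" for f g :: "'a \<Rightarrow> real"
    by (rule integrable_annulus[OF _ e, of _ "1/2"])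
       (use that(3) in \<open>auto intro!: continuous_intros cw_continuous continuous_on_subset[OF that(1)] continuous_on_subset[OF that(2)]\<close>)
  have l0: "lap w x = 0" if "\<And>x. norm x < e \<or> norm x > 1/2 \<Longrightarrow> w x = 0" "norm x < e \<or> norm x > 1/2"
    for w :: "'a \<Rightarrow> 'b::real_normed_vector" and x
    by (rule lap_zero_outside[of "cball 0 (1/2) - ball 0 e"]) (use that in auto)
  have cu: "continuous_on UNIV (\<lambda>x. cmod (u x))" "continuous_on UNIV (\<lambda>x. cmod (lap u x))"
    by (intro continuous_intros C2_on_continuous C2_on_continuous_lap u)+
  show "carl1_int \<tau> u"
    by (rule int) (auto intro!: cu continuous_intros simp: supp)
  show "carl4_int \<tau> u"
    by (rule int) (auto intro!: cu continuous_intros simp: supp)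
  show "carl4_int \<tau> (lap u)"
    by (rule int) (auto intro!: cu continuous_intros l0[OF supp])
  have c: "\<tau>^3 / 8 * (LBINT x. norm x * cw \<tau> x * (w x)^2) \<le> (LBINT x. (norm x)^4 * cw \<tau> x * (lap w x)^2)
      \<and> integrable lborel (\<lambda>x. norm x * cw \<tau> x * (w x)^2) \<and> integrable lborel (\<lambda>x. (norm x)^4 * cw \<tau> x * (lap w x)^2)"
    if w: "C2_on UNIV w" "\<And>x. norm x < e \<or> norm x > 1/2 \<Longrightarrow> w x = 0" for w :: "'a \<Rightarrow> real"
  proof (intro conjI)
    show "\<tau>^3 / 8 * (LBINT x. norm x * cw \<tau> x * (w x)^2) \<le> (LBINT x. (norm x)^4 * cw \<tau> x * (lap w x)^2)"
      by (rule carleman[OF w(1) \<tau> e w(2)])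
    show "integrable lborel (\<lambda>x. norm x * cw \<tau> x * (w x)^2)"
      by (rule int[OF _ C2_on_continuous[OF w(1)] w(2)]) (intro continuous_intros)
    show "integrable lborel (\<lambda>x. (norm x)^4 * cw \<tau> x * (lap w x)^2)"
      by (rule int[OF _ C2_on_continuous_lap[OF w(1)] l0[OF w(2)]]) (intro continuous_intros)
  qed
  have R: "norm x < e \<or> norm x > 1/2 \<Longrightarrow> Re (u x) = 0" "norm x < e \<or> norm x > 1/2 \<Longrightarrow> Im (u x) = 0" for x
    using supp by auto
  note cR = c[OF cp(1) R(1)] and cI = c[OF cp(2) R(2)]
  have 1: "carl1 \<tau> u = (LBINT x. norm x * cw \<tau> x * (Re (u x))^2) + (LBINT x. norm x * cw \<tau> x * (Im (u x))^2)"
    unfolding cmod_power2 distrib_left by (rule Bochner_Integration.integral_add) (use cR cI in auto)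
  have 2: "carl4 \<tau> (lap u) = (LBINT x. (norm x)^4 * cw \<tau> x * (lap (\<lambda>x. Re (u x)) x)^2) + (LBINT x. (norm x)^4 * cw \<tau> x * (lap (\<lambda>x. Im (u x)) x)^2)"
    unfolding cmod_power2 distrib_left cp(3,4)[symmetric] by (rule Bochner_Integration.integral_add) (use cR cI in auto)
  show "\<tau>^3 / 8 * carl1 \<tau> u \<le> carl4 \<tau> (lap u)"
    unfolding 1 2 distrib_left using cR cI by (intro add_mono) auto
qed

context potential_bound
begin

text \<open>V is bounded only globally on functions, not inside a weighted integral. On one shell
  the root of the weight, cut off smoothly, can be multiplied into \<open>u\<close> before V acts;
  the price is the energy estimate for that shell. The parameter grows with the shell so that the
  errors fit the two sides of the Carleman inequality after summation.\<close>

lemma carleman_potential: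
  obtains C where "C \<ge> 0"
    "\<And>u \<tau> e. C2_on UNIV u \<Longrightarrow> \<tau> \<ge> 4 \<Longrightarrow> e > 0 \<Longrightarrow> (\<And>x. norm x < e \<or> norm x > 1/2 \<Longrightarrow> u x = 0) \<Longrightarrow>
      carl4_int \<tau> (\<lambda>x. V x * u x) \<and>
      carl4 \<tau> (\<lambda>x. V x * u x) \<le>
        C * \<tau> powr (- 4 * \<delta>) * carl4 \<tau> (lap u)"
proof -
  define c where "c = dyc DIM('a)"
  have c0: "c > 0" unfolding c_def dyc_def by (intro mult_pos_pos) (auto intro!: add_pos_nonneg)
  \<comment> \<open>60 = 15 * 4 and 864 = 27 * 32, where 4 is the overlap of the shells and 32 = 4 *
    8 also contains the constant of the Carleman inequality.\<close>
  define C where "C = K * (60 + 864 * (63 * c^4 + 1))"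
  have C: "C \<ge> 0" using K c0 by (simp add: C_def)
  have "carl4_int \<tau> (\<lambda>x. V x * u x) \<and>
      carl4 \<tau> (\<lambda>x. V x * u x) \<le>
        C * \<tau> powr (- 4 * \<delta>) * carl4 \<tau> (lap u)"
    if u: "C2_on UNIV u" and \<tau>: "\<tau> \<ge> 4" and e: "e > 0" and supp: "\<And>x. norm x < e \<or> norm x > 1/2 \<Longrightarrow> u x = 0"
    for u :: "'a \<Rightarrow> complex" and \<tau> e
  proof -
    note [measurable] = C2_borel[OF u]
    note CC = carleman_complex[OF u \<tau> e supp]
    have \<tau>1: "\<tau> \<ge> 1" using \<tau> by simp
    \<comment> \<open>The function vanishes for |x| < e, so finitely many shells reach its
      support.\<close>
    define N where "N = nat \<lceil>- ln e\<rceil>"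
    let ?W4 = "\<lambda>x::'a. (norm x)^4 * cw \<tau> x"
    define A where "A = (LBINT x. ?W4 x * (cmod (lap u x))^2)"
    define B where "B = carl1 \<tau> u"
    have A0: "A \<ge> 0" and B0: "B \<ge> 0" unfolding A_def B_def
      by (auto intro!: integral_nonneg_AE mult_nonneg_nonneg less_imp_le[OF cw_pos])
    define P where "P = \<tau> powr (- 4 * \<delta>)"
    have P: "P \<ge> 0" by (simp add: P_def)
    have isub: "integrable lborel (\<lambda>x. indicator (shell i) x * f x)" if "integrable lborel f" for i and f :: "'a \<Rightarrow> real"
      using integrable_real_mult_indicator[OF _ that, of "shell i"] by (simp add: mult.commute)
    define a where "a i = (LBINT x. indicator (shell i) x * (?W4 x * (cmod (lap u x))^2))" for i
    define b where "b i = (LBINT x. indicator (shell i) x * (norm x * cw \<tau> x * (cmod (u x))^2))" for i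
    define y where "y i = (LBINT x. (cmod (V x))^2 * (cmod (db \<tau> i x *\<^sub>R u x))^2)" for i
    have dmsq: "(dm \<tau> i x)^2 = indicator (shell i) x * ?W4 x" for i and x :: 'a
      using om_sq[of x \<tau>] by (cases "x \<in> shell i") (auto simp: dm_def shell_def)
    have per: "integrable lborel (\<lambda>x. (cmod (V x))^2 * (cmod (db \<tau> i x *\<^sub>R u x))^2) \<and>
        y i \<le> K * P * (15 * a i / \<tau> + 27 * (63 * c^4 + 1) * \<tau>^3 * b i)" for i
    proof -
      define L where "L = c * \<tau> * exp (real i)"
      define T where "T = \<tau> * exp (real i)"
      have T: "T \<ge> \<tau>" "T \<ge> 1" proof -
        show "T \<ge> \<tau>" using \<tau>1 mult_left_mono[of 1 "exp (real i)" \<tau>] by (simp add: T_def)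
        then show "T \<ge> 1" using \<tau>1 by linarith
      qed
      have L: "L > 0" using c0 \<tau>1 by (simp add: L_def)
      note dc = dyadic_cutoff[OF \<tau>1, where 'a='a and i=i, folded c_def, folded L_def]
      have out: "x \<notin> shell i" if "x \<notin> ball 0 3" for x :: 'a using shell_norm(4)[of x i] that by auto
      have s: "da \<tau> i x = 0" "db \<tau> i x = 0" "dm \<tau> i x = 0" if "x \<notin> ball 0 3" for x :: 'a
        using dc(3-5)[OF out[OF that]] by auto
      have m1: "dm \<tau> i \<in> borel_measurable (borel :: 'a measure)"
        unfolding dm_def[abs_def] om_def by measurable
      have m2: "0 \<le> dm \<tau> i x" for x :: 'a using om_pos by (simp add: dm_def less_imp_le)
      obtain Bd where Bd: "dm \<tau> i x \<le> Bd" for x :: 'a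
      proof -
        have "compact (om DIM('a) \<tau> ` {-2 - real i..1 - real i})"
          by (intro compact_continuous_image) (auto simp: om_def[abs_def] intro!: continuous_intros)
        then obtain Bd where Bd: "\<forall>y\<in>om DIM('a) \<tau> ` {-2 - real i..1 - real i}. norm y \<le> Bd"
          using compact_imp_bounded bounded_iff by metis
        have "dm \<tau> i x \<le> max Bd 0" for x :: 'a
        proof (cases "x \<in> shell i")
          case True
          then have "ln (norm x) \<in> {-2 - real i..1 - real i}" by (auto simp: shell_def)
          then have "norm (om DIM('a) \<tau> (ln (norm x))) \<le> Bd" using Bd by blast
          then show ?thesis using True by (simp add: dm_def)
        qed (simp add: dm_def)
        then show ?thesis using that by blast
      qed
      note E = energy_complex[OF u dc(2) C2_C1[OF dc(1)] s m1 m2 Bd L dc(6-9)]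
      define X where "X = L2sq (\<lambda>x. lap (\<lambda>x. db \<tau> i x *\<^sub>R u x) x)"
      define Ai where "Ai = (LBINT x. (db \<tau> i x)^2 * (cmod (lap u x))^2)"
      define Mi where "Mi = (LBINT x. (dm \<tau> i x)^2 * (cmod (u x))^2)"
      define Bi where "Bi = L2sq (\<lambda>x. db \<tau> i x *\<^sub>R u x)"
      have X: "X \<le> 15 * Ai + 63 * L^4 * Mi" using E(2)[of 3] unfolding X_def Ai_def Mi_def by simp
      have iM: "integrable lborel (\<lambda>x. (dm \<tau> i x)^2 * (cmod (u x))^2)" using E(3)[of 3] by simp
      have iA: "integrable lborel (\<lambda>x. (db \<tau> i x)^2 * (cmod (lap u x))^2)" using E(4)[of 3] by simp
      have z: "db \<tau> i x *\<^sub>R u x = 0" if "x \<notin> ball 0 3" for x using s(2)[OF that] by simp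
      have c2: "C2_on UNIV (\<lambda>x. db \<tau> i x *\<^sub>R u x)" by (intro C2_on_scaleR dc u open_UNIV)
      have VBi: "integrable lborel (\<lambda>x. (cmod (V x))^2 * (cmod (db \<tau> i x *\<^sub>R u x))^2)"
        "y i \<le> K * T powr (- 4 * \<delta>) * (X / T + T^3 * Bi)"
        using VB[OF T(2) c2 z] unfolding y_def X_def Bi_def by auto
      have db2: "(db \<tau> i x)^2 \<le> (dm \<tau> i x)^2" for x :: 'a by (intro power_mono dc)
      have Bi: "Bi \<le> Mi" unfolding Bi_def Mi_def
      proof (rule integral_mono[OF _ iM])
        show "integrable lborel (\<lambda>x. (cmod (db \<tau> i x *\<^sub>R u x))^2)"
          by (rule integrable_compact_support[of _ 3]) (use z in \<open>auto intro!: continuous_intros C2_on_continuous[OF u] C2_on_continuous[OF dc(2)]\<close>)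
        show "(cmod (db \<tau> i x *\<^sub>R u x))^2 \<le> (dm \<tau> i x)^2 * (cmod (u x))^2" for x
          using mult_right_mono[OF db2[of x], of "(cmod (u x))^2"] by (simp add: power_mult_distrib)
      qed
      have Ai: "Ai \<le> a i" unfolding Ai_def a_def
      proof (rule integral_mono[OF iA isub[OF CC(4)]])
        show "(db \<tau> i x)^2 * (cmod (lap u x))^2 \<le> indicator (shell i) x * (?W4 x * (cmod (lap u x))^2)" for x
          using mult_right_mono[OF db2[of x], of "(cmod (lap u x))^2"] unfolding dmsq by (simp add: mult.assoc)
      qed
      \<comment> \<open>The matching of powers: T^3 |x|^4 = (|x| e^i)^3 \<tau>^3 |x|, and |x| e^i <=
        3 on the shell, hence the factor 27.\<close>
      have Mb: "T^3 * Mi \<le> 27 * \<tau>^3 * b i"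
      proof -
        have "T^3 * Mi = (LBINT x. T^3 * ((dm \<tau> i x)^2 * (cmod (u x))^2))" by (simp add: Mi_def)
        also have "\<dots> \<le> (LBINT x. 27 * \<tau>^3 * (indicator (shell i) x * (norm x * cw \<tau> x * (cmod (u x))^2)))"
        proof (rule integral_mono)
          show "integrable lborel (\<lambda>x. T^3 * ((dm \<tau> i x)^2 * (cmod (u x))^2))" using iM by simp
          show "integrable lborel (\<lambda>x. 27 * \<tau>^3 * (indicator (shell i) x * (norm x * cw \<tau> x * (cmod (u x))^2)))"
            using isub[OF CC(2)] by simp
          show "T^3 * ((dm \<tau> i x)^2 * (cmod (u x))^2) \<le> 27 * \<tau>^3 * (indicator (shell i) x * (norm x * cw \<tau> x * (cmod (u x))^2))" for x
          proof (cases "x \<in> shell i")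
            case True
            have "(norm x * exp (real i))^3 \<le> 3^3" by (intro power_mono shell_norm(2)[OF True]) auto
            then have "(norm x * exp (real i))^3 * (\<tau>^3 * (norm x * cw \<tau> x * (cmod (u x))^2)) \<le> 27 * (\<tau>^3 * (norm x * cw \<tau> x * (cmod (u x))^2))"
              using \<tau>1 less_imp_le[OF cw_pos[of \<tau> x]] by (intro mult_right_mono) auto
            moreover have "T^3 * (?W4 x * (cmod (u x))^2) = (norm x * exp (real i))^3 * (\<tau>^3 * (norm x * cw \<tau> x * (cmod (u x))^2))"
            proof -
              have "T^3 * (norm x)^4 = (norm x * exp (real i))^3 * (\<tau>^3 * norm x)"
                by (simp add: T_def power_mult_distrib power4_eq_xxxx power3_eq_cube mult_ac)
              then have "(T^3 * (norm x)^4) * (cw \<tau> x * (cmod (u x))^2) = ((norm x * exp (real i))^3 * (\<tau>^3 * norm x)) * (cw \<tau> x * (cmod (u x))^2)"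
                by simp
              then show ?thesis by (simp only: mult.assoc)
            qed
            moreover have i1: "indicator (shell i) x = (1::real)" using True by simp
            ultimately show ?thesis unfolding dmsq i1 by (simp only: mult.assoc mult_1_left)
          qed (simp add: dmsq)
        qed
        finally show ?thesis by (simp add: b_def)
      qed
      have M0: "Mi \<ge> 0" and X0: "X \<ge> 0" and Bi0: "Bi \<ge> 0" and a0: "a i \<ge> 0" unfolding Mi_def X_def Bi_def a_def
        by (auto intro!: integral_nonneg_AE mult_nonneg_nonneg less_imp_le[OF cw_pos])
      \<comment> \<open>The zeroth-order term of the energy estimate, divided by \<open>T\<close>,
        has the same size as the explicit term T^3 in the bound for V; both are then handled
        together.\<close>
      have LT: "L^4 / T = c^4 * T^3"
      proof -
        have "L = c * T" by (simp add: L_def T_def)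
        then show ?thesis using T by (simp add: power_mult_distrib power4_eq_xxxx power3_eq_cube)
      qed
      have "X / T \<le> (15 * Ai + 63 * L^4 * Mi) / T" using X T by (intro divide_right_mono) auto
      also have "\<dots> = 15 * Ai / T + 63 * (L^4 / T) * Mi" by (simp add: add_divide_distrib)
      also have "\<dots> \<le> 15 * a i / \<tau> + 63 * c^4 * (T^3 * Mi)"
        unfolding LT using Ai T \<tau>1 a0 by (intro add_mono frac_le) (auto simp: mult_ac)
      finally have XT: "X / T \<le> 15 * a i / \<tau> + 63 * c^4 * (T^3 * Mi)" .
      have "T^3 * Bi \<le> T^3 * Mi" using Bi T by (intro mult_left_mono) auto
      then have "X / T + T^3 * Bi \<le> 15 * a i / \<tau> + (63 * c^4 + 1) * (T^3 * Mi)"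
        using XT by (simp add: distrib_right)
      also have "(63 * c^4 + 1) * (T^3 * Mi) \<le> (63 * c^4 + 1) * (27 * \<tau>^3 * b i)"
        using Mb c0 by (intro mult_left_mono) auto
      finally have XB: "X / T + T^3 * Bi \<le> 15 * a i / \<tau> + 27 * (63 * c^4 + 1) * \<tau>^3 * b i" by (simp add: mult_ac)
      have TP: "T powr (- 4 * \<delta>) \<le> P" unfolding P_def using T \<tau>1 \<delta> by (intro powr_mono2') auto
      have "K * T powr (- 4 * \<delta>) * (X / T + T^3 * Bi) \<le> K * P * (15 * a i / \<tau> + 27 * (63 * c^4 + 1) * \<tau>^3 * b i)"
        using TP XB K P X0 Bi0 T by (intro mult_mono mult_left_mono) (auto intro!: add_nonneg_nonneg)
      then show ?thesis using VBi by linarith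
    qed
    have cover: "?W4 x * (cmod (V x * u x))^2 \<le> (\<Sum>i\<le>N. (cmod (V x))^2 * (cmod (db \<tau> i x *\<^sub>R u x))^2)" for x
    proof (cases "u x = 0")
      case False
      then have nx: "e \<le> norm x" "norm x \<le> 1/2" using supp[of x] by force+
      then have x: "x \<noteq> 0" using e by auto
      define t where "t = ln (norm x)"
      have t: "ln e \<le> t" "t < 0" unfolding t_def using nx e x by (auto intro!: ln_mono ln_less_zero)
      \<comment> \<open>With this index t + i lies in [-1, 0], where the cut-off equals 1; thus
        every point of the support is fully covered by one shell.\<close>
      define i where "i = nat \<lfloor>- t\<rfloor>"
      have "real i = of_int \<lfloor>- t\<rfloor>" using t by (simp add: i_def)
      then have i: "real i \<le> - t" "- t < real i + 1" by linarith+
      have "real i \<le> - ln e" using i t by linarith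
      then have iN: "i \<le> N" unfolding N_def by linarith
      have z1: "zc (t + real i) = 1" using i by (intro zc_facts(8)) auto
      have "(db \<tau> i x)^2 = ?W4 x"
        using x z1 om_sq[OF x, of \<tau>] by (simp add: db_def radc_def t_def)
      then have "?W4 x * (cmod (V x * u x))^2 = (cmod (V x))^2 * (cmod (db \<tau> i x *\<^sub>R u x))^2"
        by (simp add: norm_mult power_mult_distrib)
      also have "\<dots> \<le> (\<Sum>i\<le>N. (cmod (V x))^2 * (cmod (db \<tau> i x *\<^sub>R u x))^2)"
        by (rule member_le_sum) (use iN in auto)
      finally show ?thesis .
    qed (simp add: sum_nonneg)
    have iS: "integrable lborel (\<lambda>x. \<Sum>i\<le>N. (cmod (V x))^2 * (cmod (db \<tau> i x *\<^sub>R u x))^2)"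
      using per by (intro Bochner_Integration.integrable_sum) auto
    have cwm [measurable]: "cw \<tau> \<in> borel_measurable (borel :: 'a measure)"
      unfolding cw_def[abs_def] rad_def by measurable
    have i1: "integrable lborel (\<lambda>x. ?W4 x * (cmod (V x * u x))^2)"
    proof (rule integrable_bound[OF iS])
      show "(\<lambda>x. ?W4 x * (cmod (V x * u x))^2) \<in> borel_measurable lborel" by measurable
      show "AE x in lborel. norm (?W4 x * (cmod (V x * u x))^2) \<le> norm (\<Sum>i\<le>N. (cmod (V x))^2 * (cmod (db \<tau> i x *\<^sub>R u x))^2)"
      proof (rule AE_I2)
        fix x
        have nn: "0 \<le> ?W4 x * (cmod (V x * u x))^2"
          by (intro mult_nonneg_nonneg less_imp_le[OF cw_pos]) auto
        show "norm (?W4 x * (cmod (V x * u x))^2) \<le> norm (\<Sum>i\<le>N. (cmod (V x))^2 * (cmod (db \<tau> i x *\<^sub>R u x))^2)"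
          unfolding real_norm_def abs_of_nonneg[OF nn] by (rule order_trans[OF cover abs_ge_self])
      qed
    qed
    have "(LBINT x. ?W4 x * (cmod (V x * u x))^2) \<le> (LBINT x. (\<Sum>i\<le>N. (cmod (V x))^2 * (cmod (db \<tau> i x *\<^sub>R u x))^2))"
      by (rule integral_mono[OF i1 iS cover])
    also have "\<dots> = (\<Sum>i\<le>N. y i)" unfolding y_def using per by (intro Bochner_Integration.integral_sum) auto
    also have "\<dots> \<le> (\<Sum>i\<le>N. K * P * (15 * a i / \<tau> + 27 * (63 * c^4 + 1) * \<tau>^3 * b i))"
      using per by (intro sum_mono) auto
    also have "\<dots> = K * P * (15 / \<tau> * (\<Sum>i\<le>N. a i) + 27 * (63 * c^4 + 1) * \<tau>^3 * (\<Sum>i\<le>N. b i))"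
      unfolding sum_distrib_left sum.distrib[symmetric] by (intro sum.cong refl) simp
    also have "\<dots> \<le> K * P * (15 * (4 * A) + 27 * (63 * c^4 + 1) * (32 * A))"
    proof (intro mult_left_mono add_mono)
      have ov: "(\<Sum>i\<le>N. LBINT x. indicator (shell i) x * f x) \<le> 4 * (LBINT x. f x)"
        if f: "integrable lborel f" "\<And>x. f x \<ge> 0" for f :: "'a \<Rightarrow> real"
      proof -
        have "(\<Sum>i\<le>N. LBINT x. indicator (shell i) x * f x) = (LBINT x. (\<Sum>i\<le>N. indicator (shell i) x * f x))"
          using isub[OF f(1)] by (intro Bochner_Integration.integral_sum[symmetric]) auto
        also have "\<dots> \<le> (LBINT x. 4 * f x)"
        proof (rule integral_mono)
          show "integrable lborel (\<lambda>x. \<Sum>i\<le>N. indicator (shell i) x * f x)"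
            by (rule Bochner_Integration.integrable_sum) (rule isub[OF f(1)])
          show "integrable lborel (\<lambda>x. 4 * f x)" using f(1) by simp
          show "(\<Sum>i\<le>N. indicator (shell i) x * f x) \<le> 4 * f x" for x
            unfolding sum_distrib_right[symmetric] by (rule mult_right_mono[OF shell_overlap f(2)])
        qed
        finally show ?thesis by simp
      qed
      have sa: "(\<Sum>i\<le>N. a i) \<le> 4 * A" unfolding a_def A_def
        by (rule ov[OF CC(4)]) (auto intro!: mult_nonneg_nonneg less_imp_le[OF cw_pos])
      have sb: "(\<Sum>i\<le>N. b i) \<le> 4 * B" unfolding b_def B_def
        by (rule ov[OF CC(2)]) (auto intro!: mult_nonneg_nonneg less_imp_le[OF cw_pos])
      have "15 / \<tau> * (\<Sum>i\<le>N. a i) \<le> 15 / \<tau> * (4 * A)" using sa \<tau>1 by (intro mult_left_mono) auto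
      also have "\<dots> \<le> 15 * (4 * A)" using A0 \<tau>1 by (intro mult_right_mono) (auto simp: divide_le_eq)
      finally show "15 / \<tau> * (\<Sum>i\<le>N. a i) \<le> 15 * (4 * A)" .
      have "\<tau>^3 * (\<Sum>i\<le>N. b i) \<le> \<tau>^3 * (4 * B)" using sb \<tau>1 by (intro mult_left_mono) auto
      also have "\<dots> \<le> 32 * A" using CC(1) unfolding A_def B_def by simp
      finally show "27 * (63 * c^4 + 1) * \<tau>^3 * (\<Sum>i\<le>N. b i) \<le> 27 * (63 * c^4 + 1) * (32 * A)"
        using c0 unfolding mult.assoc[of _ "\<tau>^3"] by (intro mult_left_mono) auto
    qed (use K P in auto)
    also have "\<dots> = C * P * A" by (simp add: C_def algebra_simps)
    finally show ?thesis using i1 by (simp add: A_def P_def)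
  qed
  then show ?thesis using that[OF C] by blast
qed

end

section \<open>Vanishing to infinite order\<close>

definition cwr :: "nat \<Rightarrow> real \<Rightarrow> real \<Rightarrow> real" where
  "cwr n \<tau> r = exp (- (real n * ln r) + 2 * \<tau> * (r - ln r))"

lemma cw_cwr: "x \<noteq> 0 \<Longrightarrow> cw \<tau> x = cwr DIM('a) \<tau> (norm (x::'a::euclidean_space))"
  by (simp add: cw_def rad_def cwr_def)

lemma cwr_pos: "cwr n \<tau> r > 0" by (simp add: cwr_def)

lemma ln_diff_bound: "0 < r \<Longrightarrow> r \<le> s \<Longrightarrow> s \<le> 1 \<Longrightarrow> s - ln s \<le> r - ln (r::real)"
proof -
  assume a: "0 < r" "r \<le> s" "s \<le> 1"
  have "ln (r / s) \<le> r / s - 1" using a by (intro ln_le_minus_one) auto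
  moreover have "s - r \<le> (s - r) / s" using a by (simp add: le_divide_eq mult_left_le)
  moreover have "(s - r) / s = 1 - r / s" using a by (simp add: field_simps)
  ultimately show ?thesis using a by (simp add: ln_div)
qed

text \<open>Both the phase r - ln r and the powers of r decrease on (0, 1]. For the second part one
  power of r is cancelled against r^(-n), which needs n >= 1.\<close>

lemma cwr_antimono:
  assumes "0 < r" "r \<le> s" "s \<le> 1" "\<tau> \<ge> 0"
  shows "cwr n \<tau> s \<le> cwr n \<tau> r" "n \<ge> 1 \<Longrightarrow> s * cwr n \<tau> s \<le> r * cwr n \<tau> r"
proof -
  have l: "ln r \<le> ln s" using assms by (intro ln_mono) auto
  have d: "2 * \<tau> * (s - ln s) \<le> 2 * \<tau> * (r - ln r)" using ln_diff_bound[OF assms(1-3)] assms(4) by (intro mult_left_mono) auto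
  have "real n * ln r \<le> real n * ln s" using l by (intro mult_left_mono) auto
  then show "cwr n \<tau> s \<le> cwr n \<tau> r" unfolding cwr_def using d by simp
  assume n: "n \<ge> 1"
  have *: "y * cwr n \<tau> y = exp (- (real (n - 1) * ln y) + 2 * \<tau> * (y - ln y))" if "y > 0" for y
  proof -
    have "y * cwr n \<tau> y = exp (ln y) * cwr n \<tau> y" using that by simp
    also have "\<dots> = exp (- (real (n - 1) * ln y) + 2 * \<tau> * (y - ln y))"
      unfolding cwr_def exp_add[symmetric] using n by (simp add: of_nat_diff algebra_simps)
    finally show ?thesis .
  qed
  have "real (n - 1) * ln r \<le> real (n - 1) * ln s" using l by (intro mult_left_mono) auto
  then show "s * cwr n \<tau> s \<le> r * cwr n \<tau> r" using d assms by (simp add: *)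
qed

text \<open>Near the origin the weight grows like r^(-n - 2 \<tau>). This is how vanishing of high
  order defeats the inner boundary term.\<close>

lemma cwr_le: "0 < r \<Longrightarrow> r \<le> 1 \<Longrightarrow> \<tau> \<ge> 0 \<Longrightarrow> real n + 2 * \<tau> \<le> real k \<Longrightarrow> cwr n \<tau> r * r ^ k \<le> exp (2 * \<tau>)"
proof -
  assume a: "0 < r" "r \<le> 1" "\<tau> \<ge> 0" "real n + 2 * \<tau> \<le> real k"
  have "r ^ k = exp (real k * ln r)" using a by (simp add: exp_of_nat_mult)
  then have "cwr n \<tau> r * r ^ k = exp ((real k - real n - 2 * \<tau>) * ln r + 2 * \<tau> * r)"
    unfolding cwr_def by (simp add: exp_add[symmetric] algebra_simps)
  also have "\<dots> \<le> exp (2 * \<tau>)"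
  proof -
    have "(real k - real n - 2 * \<tau>) * ln r \<le> 0" using a by (intro mult_nonneg_nonpos) auto
    moreover have "2 * \<tau> * r \<le> 2 * \<tau> * 1" using a by (intro mult_left_mono) auto
    ultimately show ?thesis by simp
  qed
  finally show ?thesis .
qed

lemma gradient_product_bound:
  fixes g :: "'a::euclidean_space \<Rightarrow> real" and w :: "'a \<Rightarrow> complex"
  shows "(cmod (\<Sum>b\<in>Basis. pd b g x *\<^sub>R pd b w x))^2 \<le> gsq g x * gsqc w x"
proof -
  have "cmod (\<Sum>b\<in>Basis. pd b g x *\<^sub>R pd b w x) \<le> (\<Sum>b\<in>Basis. \<bar>pd b g x\<bar> * cmod (pd b w x))"
    by (rule order_trans[OF norm_sum]) simp
  then have "(cmod (\<Sum>b\<in>Basis. pd b g x *\<^sub>R pd b w x))^2 \<le> (\<Sum>b\<in>Basis. \<bar>pd b g x\<bar> * cmod (pd b w x))^2"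
    by (intro power_mono) auto
  also have "\<dots> \<le> (\<Sum>b\<in>Basis. \<bar>pd b g x\<bar>^2) * (\<Sum>b\<in>Basis. (cmod (pd b w x))^2)"
    by (rule Cauchy_Schwarz_ineq_sum)
  finally show ?thesis by (simp add: gsq_def gsqc_def)
qed

lemma norm_add3_sq: "(norm (a + b + c))^2 \<le> 3 * (norm a)^2 + 3 * (norm b)^2 + 3 * (norm (c::'a::real_normed_vector))^2"
proof -
  have "norm (a + b + c) \<le> norm a + norm b + norm c" by (metis add_mono norm_triangle_ineq norm_triangle_mono order_refl)
  then have "(norm (a + b + c))^2 \<le> (norm a + norm b + norm c)^2" by (intro power_mono) auto
  also have "\<dots> \<le> 3 * (norm a)^2 + 3 * (norm b)^2 + 3 * (norm c)^2"
    using sum_squares_bound[of "norm a" "norm b"] sum_squares_bound[of "norm a" "norm c"] sum_squares_bound[of "norm b" "norm c"]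
    by (simp add: power2_eq_square algebra_simps)
  finally show ?thesis .
qed

definition acut :: "real \<Rightarrow> 'a::euclidean_space \<Rightarrow> real" where
  "acut \<epsilon> x = (1 - bump \<epsilon> x) * bump (1/8) x"

definition ring_ind :: "real \<Rightarrow> 'a::euclidean_space \<Rightarrow> real" where
  "ring_ind r x = indicator (cball 0 (exp 1 * r) - ball 0 r) x"

text \<open>Derivatives of the cut-off live on two rings, around radii \<epsilon> and 1/8. They are
  estimated separately because the Carleman weight is of quite different size there.\<close>

lemma annular_cutoff:
  fixes x :: "'a::euclidean_space"
  assumes \<epsilon>: "0 < \<epsilon>" "exp 1 * \<epsilon> < 1/8"
  shows "C2_on UNIV (acut \<epsilon> :: 'a \<Rightarrow> real)" "0 \<le> acut \<epsilon> x" "acut \<epsilon> x \<le> 1" "norm x \<le> \<epsilon> \<Longrightarrow> acut \<epsilon> x = 0" "norm x \<ge> exp 1 / 8 \<Longrightarrow> acut \<epsilon> x = 0"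
    "exp 1 * \<epsilon> \<le> norm x \<Longrightarrow> norm x \<le> 1/8 \<Longrightarrow> acut \<epsilon> x = 1"
    "gsq (acut \<epsilon>) x \<le> 2 * (360 / \<epsilon>)^2 * ring_ind \<epsilon> x + 2 * (360 / (1/8))^2 * ring_ind (1/8) x"
    "(lap (acut \<epsilon>) x)^2 \<le> (360 * (1 + real DIM('a)) / \<epsilon>^2)^2 * ring_ind \<epsilon> x + (360 * (1 + real DIM('a)) / (1/8)^2)^2 * ring_ind (1/8) x"
proof -
  define g :: "'a \<Rightarrow> real" where g0: "g = acut \<epsilon>"
  have g_def: "g = (\<lambda>x. (1 - bump \<epsilon> x) * bump (1/8) x)" by (simp add: g0 acut_def fun_eq_iff)
  define I :: "real \<Rightarrow> 'a \<Rightarrow> real" where I0: "I = ring_ind"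
  have I_def: "I = (\<lambda>r x. indicator (cball 0 (exp 1 * r) - ball 0 r) x)" by (simp add: I0 ring_ind_def fun_eq_iff)
  note b = bump[OF \<epsilon>(1), where 'a='a]
  have d: "C2_on UNIV (bump (1/8) :: 'a \<Rightarrow> real)" "0 \<le> bump (1/8) x" "bump (1/8) x \<le> 1"
     "norm x \<le> 1/8 \<Longrightarrow> bump (1/8) x = 1" "norm x \<ge> exp 1 * (1/8) \<Longrightarrow> bump (1/8) x = 0"
     "\<bar>lap (bump (1/8)) x\<bar> \<le> 360 * (1 + real DIM('a)) / (1/8)^2 * I (1/8) x"
     "gsq (bump (1/8)) x \<le> (360 / (1/8))^2 * I (1/8) x" for x :: 'a
    unfolding I_def by (intro bump; simp)+
  define \<theta> where "\<theta> x = 1 + (- bump \<epsilon> x)" for x :: 'a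
  have um: "bounded_linear (uminus :: real \<Rightarrow> real)" by (rule bounded_linear_minus[OF bounded_linear_ident])
  note nb = C2_on_linear[OF open_UNIV b(1) um]
  have \<theta>2: "C2_on UNIV \<theta>" unfolding \<theta>_def[abs_def] by (intro C2_on_add C2_on_const nb(1) open_UNIV)
  have g: "g = (\<lambda>x. \<theta> x * bump (1/8) x)" by (simp add: g_def \<theta>_def)
  show "C2_on UNIV (acut \<epsilon> :: 'a \<Rightarrow> real)" unfolding g0[symmetric] unfolding g by (intro C2_on_mult \<theta>2 d open_UNIV)
  have \<theta>: "0 \<le> \<theta> x" "\<theta> x \<le> 1" for x using b(2,3)[of x] by (auto simp: \<theta>_def)
  show "0 \<le> acut \<epsilon> x" "acut \<epsilon> x \<le> 1" unfolding g0[symmetric] g using \<theta>[of x] d(2,3)[of x] by (auto intro: mult_le_one)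
  show "norm x \<le> \<epsilon> \<Longrightarrow> acut \<epsilon> x = 0" using b(4)[of x] by (simp add: acut_def)
  show "norm x \<ge> exp 1 / 8 \<Longrightarrow> acut \<epsilon> x = 0" using d(5)[of x] by (simp add: acut_def)
  show "exp 1 * \<epsilon> \<le> norm x \<Longrightarrow> norm x \<le> 1/8 \<Longrightarrow> acut \<epsilon> x = 1" using b(5)[of x] d(4)[of x] by (simp add: acut_def)
  have db: "bump r differentiable (at x)" if "r > 0" for r and x :: 'a by (rule C2_onD(1)[OF bump(1)[OF that]]) simp
  have p\<theta>: "pd c \<theta> x = - pd c (bump \<epsilon>) x" for c x
  proof -
    have "pd c \<theta> x = pd c (\<lambda>x. 1) x + pd c (\<lambda>x. - bump \<epsilon> x) x"
      unfolding \<theta>_def[abs_def] by (rule pd_add) (use C2_onD(1)[OF nb(1)] in auto)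
    then show ?thesis using pd_linear[OF um db[OF \<epsilon>(1)]] by simp
  qed
  have l\<theta>: "lap \<theta> x = - lap (bump \<epsilon>) x" for x
  proof -
    have "lap \<theta> x = lap (\<lambda>x. 1) x + lap (\<lambda>x. - bump \<epsilon> x) x"
      unfolding \<theta>_def[abs_def] by (rule lap_add[OF open_UNIV C2_on_const nb(1)]) simp
    then show ?thesis using nb(3)[of x] by (simp add: lap_def)
  qed
  have g\<theta>: "gsq \<theta> x \<le> (360 / \<epsilon>)^2 * I \<epsilon> x" using b(7)[of x] by (simp add: gsq_def p\<theta> I_def)
  have lb: "\<bar>lap \<theta> x\<bar> \<le> 360 * (1 + real DIM('a)) / \<epsilon>^2 * I \<epsilon> x" using b(6)[of x] by (simp add: l\<theta> I_def)
  have d\<theta>: "\<theta> differentiable (at x)" by (rule C2_onD(1)[OF \<theta>2]) simp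
  have d\<chi>: "bump (1/8) differentiable (at x)" by (rule db) simp
  have "gsq g x = (\<Sum>c\<in>Basis. (\<theta> x * pd c (bump (1/8)) x + pd c \<theta> x * bump (1/8) x)^2)"
    unfolding gsq_def g by (simp add: pd_mult[OF d\<theta> d\<chi>])
  also have "\<dots> \<le> (\<Sum>c\<in>Basis. 2 * (pd c (bump (1/8)) x)^2 + 2 * (pd c \<theta> x)^2)"
  proof (rule sum_mono)
    fix c :: 'a
    have sq: "(p + q)^2 \<le> 2 * p^2 + 2 * q^2" for p q :: real
      using sum_squares_bound[of p q] by (simp add: power2_sum)
    have "(\<theta> x * pd c (bump (1/8)) x)^2 \<le> 1 * (pd c (bump (1/8)) x)^2" "(pd c \<theta> x * bump (1/8) x)^2 \<le> (pd c \<theta> x)^2 * 1"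
      unfolding power_mult_distrib using \<theta>[of x] d(2,3)[of x] by (intro mult_right_mono mult_left_mono power_le_one; simp)+
    then show "(\<theta> x * pd c (bump (1/8)) x + pd c \<theta> x * bump (1/8) x)^2 \<le> 2 * (pd c (bump (1/8)) x)^2 + 2 * (pd c \<theta> x)^2"
      using sq[of "\<theta> x * pd c (bump (1/8)) x" "pd c \<theta> x * bump (1/8) x"] by linarith
  qed
  also have "\<dots> = 2 * gsq (bump (1/8)) x + 2 * gsq \<theta> x" by (simp add: sum.distrib gsq_def sum_distrib_left)
  finally show "gsq (acut \<epsilon>) x \<le> 2 * (360 / \<epsilon>)^2 * ring_ind \<epsilon> x + 2 * (360 / (1/8))^2 * ring_ind (1/8) x"
    unfolding g0[symmetric] I0[symmetric] using g\<theta> d(7)[of x] by linarith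
  \<comment> \<open>exp 1 * \<epsilon> < 1/8 separates the rings, so at each point only one of the
    two factors varies and the mixed gradient term vanishes.\<close>
  have disj: "I \<epsilon> x = 0 \<or> I (1/8) x = 0" using \<epsilon>(2) by (auto simp: I_def indicator_def)
  have I01: "I \<epsilon> x = 0 \<or> I \<epsilon> x = 1" "I (1/8) x = 0 \<or> I (1/8) x = 1" by (auto simp: I_def indicator_def)
  have gd: "gdot \<theta> (bump (1/8)) x = 0"
  proof -
    have "gsq \<theta> x = 0 \<or> gsq (bump (1/8)) x = 0"
      using disj g\<theta> d(7)[of x] gsq_nonneg[of \<theta> x] gsq_nonneg[of "bump (1/8)" x] by fastforce
    then have "(gdot \<theta> (bump (1/8)) x)^2 \<le> 0" using gdot_sq[of \<theta> "bump (1/8)" x] by auto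
    then show ?thesis by simp
  qed
  have lg: "lap g x = \<theta> x * lap (bump (1/8)) x + lap \<theta> x * bump (1/8) x"
    unfolding g by (subst lap_mult_real[OF open_UNIV \<theta>2 d(1)]) (simp_all add: gd)
  have sqb: "y^2 \<le> k^2" if "\<bar>y\<bar> \<le> k" for y k :: real using that by (metis abs_ge_zero power2_abs power_mono)
  have m1: "\<bar>\<theta> x * lap (bump (1/8)) x\<bar> \<le> 1 * \<bar>lap (bump (1/8)) x\<bar>" "\<bar>lap \<theta> x * bump (1/8) x\<bar> \<le> \<bar>lap \<theta> x\<bar> * 1"
    unfolding abs_mult using \<theta>[of x] d(2,3)[of x] by (intro mult_right_mono mult_left_mono; simp)+
  have lgs: "(lap g x)^2 \<le> (360 * (1 + real DIM('a)) / \<epsilon>^2)^2 * I \<epsilon> x + (360 * (1 + real DIM('a)) / (1/8)^2)^2 * I (1/8) x"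
    using disj
  proof
    assume I: "I \<epsilon> x = 0"
    then have "\<bar>lap g x\<bar> \<le> 360 * (1 + real DIM('a)) / (1/8)^2 * I (1/8) x"
      using m1(1) d(6)[of x] lb unfolding lg by simp
    then have "(lap g x)^2 \<le> (360 * (1 + real DIM('a)) / (1/8)^2 * I (1/8) x)^2" by (rule sqb)
    also have "\<dots> = (360 * (1 + real DIM('a)) / (1/8)^2)^2 * I (1/8) x" using I01(2) by auto
    finally show ?thesis using I by simp
  next
    assume I: "I (1/8) x = 0"
    then have "\<bar>lap g x\<bar> \<le> 360 * (1 + real DIM('a)) / \<epsilon>^2 * I \<epsilon> x"
      using m1(2) d(6)[of x] lb unfolding lg by simp
    then have "(lap g x)^2 \<le> (360 * (1 + real DIM('a)) / \<epsilon>^2 * I \<epsilon> x)^2" by (rule sqb)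
    also have "\<dots> = (360 * (1 + real DIM('a)) / \<epsilon>^2)^2 * I \<epsilon> x" using I01(1) by auto
    finally show ?thesis using I by simp
  qed
  then show "(lap (acut \<epsilon>) x)^2 \<le> (360 * (1 + real DIM('a)) / \<epsilon>^2)^2 * ring_ind \<epsilon> x + (360 * (1 + real DIM('a)) / (1/8)^2)^2 * ring_ind (1/8) x"
    unfolding g0[symmetric] I0[symmetric] .
qed

context potential_bound
begin

text \<open>For large \<tau> the potential term is at most a quarter of \<open>A\<close>, so A <= 2
  E + 2 Y gives A <= 4 E; the constant 8 of the Carleman inequality thereby becomes 32.\<close>

lemma carleman_err:
  obtains \<tau>0 where "\<tau>0 \<ge> 4"
    "\<And>u \<tau> e. C2_on UNIV u \<Longrightarrow> \<tau> \<ge> \<tau>0 \<Longrightarrow> e > 0 \<Longrightarrow> (\<And>x. norm x < e \<or> norm x > 1/2 \<Longrightarrow> u x = 0) \<Longrightarrow>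
      \<tau>^3 / 32 * carl1 \<tau> u \<le> carl4 \<tau> (err u) \<and>
      carl4_int \<tau> (err u)"
proof -
  obtain C where C: "C \<ge> 0" and cp: "\<And>u \<tau> e. C2_on UNIV u \<Longrightarrow> \<tau> \<ge> 4 \<Longrightarrow> e > 0 \<Longrightarrow> (\<And>x. norm x < e \<or> norm x > 1/2 \<Longrightarrow> u x = 0) \<Longrightarrow>
      carl4_int \<tau> (\<lambda>x. V x * u x) \<and>
      carl4 \<tau> (\<lambda>x. V x * u x) \<le>
        C * \<tau> powr (- 4 * \<delta>) * carl4 \<tau> (lap u)"
    using carleman_potential by blast
  have "((\<lambda>\<tau>. C * \<tau> powr (- 4 * \<delta>)) \<longlongrightarrow> C * 0) at_top"
    using \<delta> by (intro tendsto_mult tendsto_const tendsto_neg_powr filterlim_ident) auto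
  then have "\<forall>\<^sub>F \<tau> in at_top. C * \<tau> powr (- 4 * \<delta>) < 1/4"
    by (intro order_tendstoD) auto
  then obtain \<tau>1 where \<tau>1: "\<And>\<tau>. \<tau> \<ge> \<tau>1 \<Longrightarrow> C * \<tau> powr (- 4 * \<delta>) < 1/4"
    unfolding eventually_at_top_linorder by blast
  define \<tau>0 where "\<tau>0 = max \<tau>1 4"
  have main: "\<tau>^3 / 32 * carl1 \<tau> u \<le> carl4 \<tau> (err u)
    \<and> carl4_int \<tau> (err u)"
    if u: "C2_on UNIV u" and \<tau>: "\<tau> \<ge> \<tau>0" and e: "e > 0" and supp: "\<And>x. norm x < e \<or> norm x > 1/2 \<Longrightarrow> u x = 0" for u \<tau> e
  proof -
    note [measurable] = C2_borel[OF u]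
    have t4: "\<tau> \<ge> 4" and t1: "\<tau> \<ge> \<tau>1" using \<tau> by (auto simp: \<tau>0_def)
    note CC = carleman_complex[OF u t4 e supp]
    let ?W4 = "\<lambda>x::'a. (norm x)^4 * cw \<tau> x"
    define A where "A = (LBINT x. ?W4 x * (cmod (lap u x))^2)"
    define E where "E = (LBINT x. ?W4 x * (cmod (err u x))^2)"
    define Y where "Y = (LBINT x. ?W4 x * (cmod (V x * u x))^2)"
    have W0: "?W4 x \<ge> 0" for x :: 'a by (intro mult_nonneg_nonneg less_imp_le[OF cw_pos]) auto
    have A0: "A \<ge> 0" unfolding A_def by (intro integral_nonneg_AE AE_I2 mult_nonneg_nonneg less_imp_le[OF cw_pos]) auto
    have iY: "integrable lborel (\<lambda>x. ?W4 x * (cmod (V x * u x))^2)" and Y: "Y \<le> C * \<tau> powr (- 4 * \<delta>) * A"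
      using cp[OF u t4 e supp] by (auto simp: Y_def A_def)
    have Y1: "Y \<le> 1/4 * A" using Y mult_right_mono[OF less_imp_le[OF \<tau>1[OF t1]] A0] by linarith
    have cwm [measurable]: "cw \<tau> \<in> borel_measurable (borel :: 'a measure)"
      unfolding cw_def[abs_def] rad_def by measurable
    have iE: "integrable lborel (\<lambda>x. ?W4 x * (cmod (err u x))^2)"
    proof (rule integrable_bound)
      show "integrable lborel (\<lambda>x. 2 * (?W4 x * (cmod (lap u x))^2) + 2 * (?W4 x * (cmod (V x * u x))^2))"
        using CC(4) iY by simp
      show "(\<lambda>x. ?W4 x * (cmod (err u x))^2) \<in> borel_measurable lborel" unfolding err_def by measurable
      show "AE x in lborel. norm (?W4 x * (cmod (err u x))^2) \<le> norm (2 * (?W4 x * (cmod (lap u x))^2) + 2 * (?W4 x * (cmod (V x * u x))^2))"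
      proof (rule AE_I2)
        fix x
        have "?W4 x * (cmod (err u x))^2 \<le> ?W4 x * (2 * (cmod (lap u x))^2 + 2 * (cmod (V x * u x))^2)"
          unfolding err_def by (intro mult_left_mono cmod_diff_sq W0)
        also have "\<dots> = 2 * (?W4 x * (cmod (lap u x))^2) + 2 * (?W4 x * (cmod (V x * u x))^2)"
          by (simp only: distrib_left mult.left_commute)
        finally have "?W4 x * (cmod (err u x))^2 \<le> \<dots>" .
        moreover have "0 \<le> ?W4 x * (cmod (err u x))^2" by (intro mult_nonneg_nonneg[OF W0]) auto
        ultimately show "norm (?W4 x * (cmod (err u x))^2) \<le> norm (2 * (?W4 x * (cmod (lap u x))^2) + 2 * (?W4 x * (cmod (V x * u x))^2))"
          unfolding real_norm_def by linarith
      qed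
    qed
    have "A \<le> (LBINT x. 2 * (?W4 x * (cmod (err u x))^2) + 2 * (?W4 x * (cmod (V x * u x))^2))"
      unfolding A_def
    proof (rule integral_mono[OF CC(4)])
      show "integrable lborel (\<lambda>x. 2 * (?W4 x * (cmod (err u x))^2) + 2 * (?W4 x * (cmod (V x * u x))^2))"
        using iE iY by simp
      fix x
      have l: "lap u x = err u x - (- (V x * u x))" by (simp add: err_def)
      have "?W4 x * (cmod (lap u x))^2 \<le> ?W4 x * (2 * (cmod (err u x))^2 + 2 * (cmod (- (V x * u x)))^2)"
        unfolding l by (intro mult_left_mono cmod_diff_sq W0)
      then show "?W4 x * (cmod (lap u x))^2 \<le> 2 * (?W4 x * (cmod (err u x))^2) + 2 * (?W4 x * (cmod (V x * u x))^2)"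
        by (simp only: distrib_left mult.left_commute norm_minus_cancel)
    qed
    also have "\<dots> = 2 * E + 2 * Y" using iE iY by (simp add: E_def Y_def)
    finally have "A \<le> 4 * E" using Y1 by linarith
    then show ?thesis using CC(1) iE unfolding A_def E_def by simp
  qed
  have "\<tau>0 \<ge> 4" by (simp add: \<tau>0_def)
  then show ?thesis using that main by blast
qed

text \<open>Multiplication by V commutes with multiplication by \<open>g\<close>, so only terms with
  derivatives of \<open>g\<close> are added to g times the defect.\<close>

lemma err_product:
  assumes g: "C2_on UNIV (g :: 'a \<Rightarrow> real)" and w: "C2_on UNIV w"
  shows "(cmod (err (\<lambda>x. g x *\<^sub>R w x) x))^2 \<le> 3 * ((g x)^2 * (cmod (err w x))^2) + 12 * (gsq g x * gsqc w x) + 3 * ((lap g x)^2 * (cmod (w x))^2)"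
proof -
  have e: "err (\<lambda>x. g x *\<^sub>R w x) x = g x *\<^sub>R err w x + 2 *\<^sub>R (\<Sum>b\<in>Basis. pd b g x *\<^sub>R pd b w x) + lap g x *\<^sub>R w x"
    unfolding err_def by (subst lap_scaleR[OF open_UNIV g w]) (simp_all add: scaleR_diff_right)
  have "(cmod (err (\<lambda>x. g x *\<^sub>R w x) x))^2 \<le> 3 * (cmod (g x *\<^sub>R err w x))^2 + 3 * (cmod (2 *\<^sub>R (\<Sum>b\<in>Basis. pd b g x *\<^sub>R pd b w x)))^2 + 3 * (cmod (lap g x *\<^sub>R w x))^2"
    unfolding e by (rule norm_add3_sq)
  also have "\<dots> = 3 * ((g x)^2 * (cmod (err w x))^2) + 12 * (cmod (\<Sum>b\<in>Basis. pd b g x *\<^sub>R pd b w x))^2 + 3 * ((lap g x)^2 * (cmod (w x))^2)"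
    by (simp add: power_mult_distrib)
  finally show ?thesis using gradient_product_bound[of g x w] by linarith
qed

text \<open>\<open>carleman_err\<close> applied to \<open>acut \<epsilon>\<close> times
  \<open>w\<close>. The commutator terms on the rings contain gradients, which Caccioppoli turns
  into masses on balls larger by the factor e. The main term is kept on the region where the cut-off
  is 1 and compared with the weight at its outer radius 1/8.\<close>

lemma carleman_cutoff:
  obtains D \<tau>0 where "D \<ge> 0" "\<tau>0 \<ge> 4"
    "\<And>w \<tau> \<epsilon>. C2_on UNIV w \<Longrightarrow> \<tau> \<ge> \<tau>0 \<Longrightarrow> 0 < \<epsilon> \<Longrightarrow> exp 1 * \<epsilon> < 1/8 \<Longrightarrow>
      \<tau>^3 / 32 * (1/8 * cwr DIM('a) \<tau> (1/8) * L2on (cball 0 (1/8) - ball 0 (exp 1 * \<epsilon>)) w) \<le>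
        D * (cwr DIM('a) \<tau> \<epsilon> * L2on (cball 0 1) (err w)
           + cwr DIM('a) \<tau> \<epsilon> * L2on (cball 0 (exp 1 * (exp 1 * \<epsilon>))) w
           + cwr DIM('a) \<tau> (1/8) * L2on (cball 0 1) w)"
proof -
  obtain C where C: "C \<ge> 0" and cac2: "\<And>u r. C2_on UNIV u \<Longrightarrow> 0 < r \<Longrightarrow> exp 1 * r \<le> 1 \<Longrightarrow>
      r^4 * L2sq (\<lambda>x. lap (\<lambda>x. (bump r x * bump r x) *\<^sub>R u x) x) \<le>
        C * (L2on (cball 0 (exp 1 * r)) u + L2on (cball 0 (exp 1 * r)) (err u)) \<and>
      r^2 * (LBINT x. indicator (cball 0 r) x * gsqc u x) \<le>
        C * (L2on (cball 0 (exp 1 * r)) u + L2on (cball 0 (exp 1 * r)) (err u))"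
    by (rule caccioppoli) (rule that)
  note cac = cac2[THEN conjunct2]
  obtain \<tau>0 where \<tau>0: "\<tau>0 \<ge> 4" and ce2: "\<And>u \<tau> e. C2_on UNIV u \<Longrightarrow> \<tau> \<ge> \<tau>0 \<Longrightarrow> e > 0 \<Longrightarrow> (\<And>x. norm x < e \<or> norm x > 1/2 \<Longrightarrow> u x = 0) \<Longrightarrow>
      \<tau>^3 / 32 * carl1 \<tau> u \<le> carl4 \<tau> (err u) \<and>
      carl4_int \<tau> (err u)"
    by (rule carleman_err) (rule that, assumption, blast)
  note ce = ce2[THEN conjunct1] and cei = ce2[THEN conjunct2]
  define n where "n = real DIM('a)"
  \<comment> \<open>81 = 3^4 comes from |x| <= 3 r on a ring, 24 = 12 * 2 from
    \<open>err_product\<close> and the gradient of the cut-off; in \<open>k2\<close> the 3 is the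
    Laplacian coefficient of \<open>err_product\<close>.\<close>
  define k1 where "k1 = 81 * 24 * (360::real)^2"
  define k2 where "k2 = 81 * 3 * (360 * (1 + n))^2"
  have k: "k1 \<ge> 0" "k2 \<ge> 0" by (auto simp: k1_def k2_def)
  define D where "D = 3 + 2 * (k1 * C) + k2"
  have D: "D \<ge> 0" using k C by (simp add: D_def)
  have n1: "DIM('a) \<ge> 1" using DIM_positive[where 'a='a] by linarith
  have e3: "exp 1 < (3::real)" using e_less_272 by simp
  have "\<tau>^3 / 32 * (1/8 * cwr DIM('a) \<tau> (1/8) * L2on (cball 0 (1/8) - ball 0 (exp 1 * \<epsilon>)) w) \<le>
        D * (cwr DIM('a) \<tau> \<epsilon> * L2on (cball 0 1) (err w)
           + cwr DIM('a) \<tau> \<epsilon> * L2on (cball 0 (exp 1 * (exp 1 * \<epsilon>))) w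
           + cwr DIM('a) \<tau> (1/8) * L2on (cball 0 1) w)"
    if w: "C2_on UNIV w" and \<tau>: "\<tau> \<ge> \<tau>0" and \<epsilon>: "0 < \<epsilon>" "exp 1 * \<epsilon> < 1/8" for w :: "'a \<Rightarrow> complex" and \<tau> \<epsilon>
  proof -
    note [measurable] = C2_borel[OF w]
    have t0: "\<tau> \<ge> 0" using \<tau> \<tau>0 by simp
    define g :: "'a \<Rightarrow> real" where "g = acut \<epsilon>"
    define I :: "real \<Rightarrow> 'a \<Rightarrow> real" where "I = ring_ind"
    note G = annular_cutoff[OF \<epsilon>, where 'a='a, folded g_def I_def]
    define v where "v = (\<lambda>x. g x *\<^sub>R w x)"
    have v2: "C2_on UNIV v" unfolding v_def by (intro C2_on_scaleR G w open_UNIV)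
    have g0: "g x = 0" if "norm x < \<epsilon> \<or> norm x > 1/2" for x
    proof (cases "norm x \<le> \<epsilon>")
      case False
      then have "norm x \<ge> exp 1 / 8" using that e3 by linarith
      then show ?thesis by (rule G(5))
    qed (rule G(4))
    have vs: "v x = 0" if "norm x < \<epsilon> \<or> norm x > 1/2" for x using g0[OF that] by (simp add: v_def)
    note car = ce[OF v2 \<tau> \<epsilon>(1) vs]
    note icar = cei[OF v2 \<tau> \<epsilon>(1) vs]
    let ?W = "cwr DIM('a) \<tau>"
    have W0: "?W r \<ge> 0" for r by (simp add: cwr_pos less_imp_le)
    define Er where "Er = L2on (cball 0 1) (err w)"
    define N where "N r = L2on (cball 0 r) w" for r
    define Q where "Q r = (LBINT x. indicator (cball 0 r) x * gsqc w x)" for r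
    have iN: "integrable lborel (\<lambda>x::'a. indicator (cball 0 r) x * (cmod (w x))^2)" for r
      by (intro integrable_cball continuous_intros C2_on_continuous w)
    have iQ: "integrable lborel (\<lambda>x::'a. indicator (cball 0 r) x * gsqc w x)" for r
      by (intro integrable_cball gsqc_continuous C2_C1 w)
    have iE: "L2int (cball 0 1) (err w)"
      by (rule integrable_ball_V(2)[OF w]) simp
    have pw: "(norm x)^4 * cw \<tau> x * (cmod (err v x))^2 \<le>
        3 * ?W \<epsilon> * (indicator (cball 0 1) x * (cmod (err w x))^2)
        + ((k1 * ?W \<epsilon> * \<epsilon>^2) * (indicator (cball 0 (exp 1 * \<epsilon>)) x * gsqc w x) + (k2 * ?W \<epsilon>) * (indicator (cball 0 (exp 1 * \<epsilon>)) x * (cmod (w x))^2))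
        + ((k1 * ?W (1/8) * (1/8)^2) * (indicator (cball 0 (exp 1 * (1/8))) x * gsqc w x) + (k2 * ?W (1/8)) * (indicator (cball 0 (exp 1 * (1/8))) x * (cmod (w x))^2))" for x
    proof -
      have f0: "0 \<le> gsqc w x" "0 \<le> (cmod (w x))^2" by (auto simp: gsqc_nonneg)
      define U where "U = (norm x)^4 * cw \<tau> x"
      have U0: "U \<ge> 0" unfolding U_def by (intro mult_nonneg_nonneg less_imp_le[OF cw_pos]) auto
      \<comment> \<open>On a ring the weight \<open>cw\<close> is largest at the inner radius,
        whereas |x|^4 is largest at the outer one. The factor r^4 compensates the powers 1/r^2 and
        1/r^4 of the derivatives of the cut-off.\<close>
      have UI: "U * I r x \<le> 81 * r^4 * ?W r * indicator (cball 0 (exp 1 * r)) x" if r: "0 < r" "exp 1 * r \<le> 1" for r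
      proof (cases "I r x = 0")
        case True
        then show ?thesis using r W0[of r] by simp
      next
        case False
        then have nx: "r \<le> norm x" "norm x \<le> exp 1 * r" and I1: "I r x = 1" by (auto simp: I_def ring_ind_def indicator_def split: if_splits)
        have x0: "x \<noteq> 0" using nx r by auto
        have "(norm x)^4 \<le> (3 * r)^4" using nx e3 r by (intro power_mono) (auto intro: order_trans[OF nx(2)])
        moreover have "cw \<tau> x \<le> ?W r" unfolding cw_cwr[OF x0] using nx r t0 by (intro cwr_antimono) auto
        ultimately have "U \<le> (3 * r)^4 * ?W r" unfolding U_def by (intro mult_mono) (auto simp: less_imp_le[OF cw_pos])
        then show ?thesis using I1 nx by (simp add: power_mult_distrib)
      qed
      have "U * (cmod (err v x))^2 \<le> U * (3 * ((g x)^2 * (cmod (err w x))^2) + 12 * (gsq g x * gsqc w x) + 3 * ((lap g x)^2 * (cmod (w x))^2))"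
        unfolding v_def by (rule mult_left_mono[OF err_product[OF G(1) w] U0])
      also have "\<dots> = 3 * ((U * (g x)^2) * (cmod (err w x))^2) + 12 * ((U * gsq g x) * gsqc w x) + 3 * ((U * (lap g x)^2) * (cmod (w x))^2)"
        by (simp add: algebra_simps)
      finally have 1: "U * (cmod (err v x))^2 \<le> \<dots>" .
      have 2: "U * (g x)^2 \<le> ?W \<epsilon> * indicator (cball 0 1) x"
      proof (cases "norm x < \<epsilon> \<or> norm x > 1/2")
        case True
        then show ?thesis using g0[OF True] W0[of \<epsilon>] by simp
      next
        case False
        then have nx: "\<epsilon> \<le> norm x" "norm x \<le> 1/2" by auto
        have x0: "x \<noteq> 0" using nx \<epsilon> by auto
        have "(norm x)^4 \<le> 1" using nx by (intro power_le_one) auto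
        moreover have "cw \<tau> x \<le> ?W \<epsilon>" unfolding cw_cwr[OF x0] using nx \<epsilon> t0 by (intro cwr_antimono) auto
        ultimately have "U \<le> 1 * ?W \<epsilon>" unfolding U_def by (intro mult_mono) (auto simp: less_imp_le[OF cw_pos])
        moreover have "(g x)^2 \<le> 1" using G(2,3)[of x] by (intro power_le_one) auto
        ultimately have "U * (g x)^2 \<le> ?W \<epsilon> * 1" using U0 W0[of \<epsilon>] by (intro mult_mono) auto
        then show ?thesis using nx by simp
      qed
      have ee: "exp 1 * \<epsilon> \<le> 1" "exp 1 * (1/8) \<le> (1::real)" using \<epsilon>(2) e3 by auto
      note UIe = UI[OF \<epsilon>(1) ee(1)] and UIr = UI[of "1/8", OF _ ee(2), simplified]
      let ?je = "indicator (cball 0 (exp 1 * \<epsilon>)) x :: real" and ?jr = "indicator (cball 0 (exp 1 * (1/8))) x :: real"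
      have UIr: "U * I (1/8) x \<le> 81 * (1/8)^4 * ?W (1/8) * ?jr" by (rule UI[OF _ ee(2)]) simp
      have 3: "12 * (U * gsq g x) \<le> k1 * ?W \<epsilon> * \<epsilon>^2 * ?je + k1 * ?W (1/8) * (1/8)^2 * ?jr"
      proof -
        have "U * gsq g x \<le> U * (2 * (360 / \<epsilon>)^2 * I \<epsilon> x + 2 * (360 / (1/8))^2 * I (1/8) x)"
          by (rule mult_left_mono[OF G(7) U0])
        also have "\<dots> = 2 * (360 / \<epsilon>)^2 * (U * I \<epsilon> x) + 2 * (360 / (1/8))^2 * (U * I (1/8) x)" by (simp add: algebra_simps)
        also have "\<dots> \<le> 2 * (360 / \<epsilon>)^2 * (81 * \<epsilon>^4 * ?W \<epsilon> * ?je) + 2 * (360 / (1/8))^2 * (81 * (1/8)^4 * ?W (1/8) * ?jr)"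
          by (intro add_mono mult_left_mono UIe UIr) auto
        finally have a: "12 * (U * gsq g x) \<le> 12 * (2 * (360 / \<epsilon>)^2 * (81 * \<epsilon>^4 * ?W \<epsilon> * ?je)) + 12 * (2 * (360 / (1/8))^2 * (81 * (1/8)^4 * ?W (1/8) * ?jr))" by linarith
        have "12 * (2 * (360 / r)^2 * (81 * r^4 * W * j)) = k1 * W * r^2 * j" if "r > 0" for r W j :: real
          using that by (simp add: k1_def power_divide power2_eq_square power4_eq_xxxx)
        from this[OF \<epsilon>(1), of "?W \<epsilon>" ?je] this[of "1/8" "?W (1/8)" ?jr] show ?thesis using a by linarith
      qed
      have 4: "3 * (U * (lap g x)^2) \<le> k2 * ?W \<epsilon> * ?je + k2 * ?W (1/8) * ?jr"
      proof -
        have "U * (lap g x)^2 \<le> U * ((360 * (1 + n) / \<epsilon>^2)^2 * I \<epsilon> x + (360 * (1 + n) / (1/8)^2)^2 * I (1/8) x)"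
          unfolding n_def by (rule mult_left_mono[OF G(8) U0])
        also have "\<dots> = (360 * (1 + n) / \<epsilon>^2)^2 * (U * I \<epsilon> x) + (360 * (1 + n) / (1/8)^2)^2 * (U * I (1/8) x)" by (simp only: distrib_left mult.left_commute)
        also have "\<dots> \<le> (360 * (1 + n) / \<epsilon>^2)^2 * (81 * \<epsilon>^4 * ?W \<epsilon> * ?je) + (360 * (1 + n) / (1/8)^2)^2 * (81 * (1/8)^4 * ?W (1/8) * ?jr)"
          by (intro add_mono mult_left_mono UIe UIr) auto
        finally have a: "3 * (U * (lap g x)^2) \<le> 3 * ((360 * (1 + n) / \<epsilon>^2)^2 * (81 * \<epsilon>^4 * ?W \<epsilon> * ?je)) + 3 * ((360 * (1 + n) / (1/8)^2)^2 * (81 * (1/8)^4 * ?W (1/8) * ?jr))" by linarith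
        have "3 * ((360 * (1 + n) / r^2)^2 * (81 * r^4 * W * j)) = k2 * W * j" if "r > 0" for r W j :: real
        proof -
          have "(360 * (1 + n) / r^2)^2 = (360 * (1 + n))^2 / r^4" by (simp add: power_divide)
          then show ?thesis using that by (simp add: k2_def)
        qed
        from this[OF \<epsilon>(1), of "?W \<epsilon>" ?je] this[of "1/8" "?W (1/8)" ?jr] show ?thesis using a by linarith
      qed
      have "3 * ((U * (g x)^2) * (cmod (err w x))^2) \<le> 3 * ((?W \<epsilon> * indicator (cball 0 1) x) * (cmod (err w x))^2)"
        using mult_right_mono[OF 2, of "(cmod (err w x))^2"] by simp
      moreover note mult_right_mono[OF 3 f0(1)] mult_right_mono[OF 4 f0(2)]
      ultimately show ?thesis using 1 unfolding U_def[symmetric]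
        by (simp only: distrib_right mult.assoc)
    qed
    define R where "R = (\<lambda>x. 3 * ?W \<epsilon> * (indicator (cball 0 1) x * (cmod (err w x))^2)
        + ((k1 * ?W \<epsilon> * \<epsilon>^2) * (indicator (cball 0 (exp 1 * \<epsilon>)) x * gsqc w x) + (k2 * ?W \<epsilon>) * (indicator (cball 0 (exp 1 * \<epsilon>)) x * (cmod (w x))^2))
        + ((k1 * ?W (1/8) * (1/8)^2) * (indicator (cball 0 (exp 1 * (1/8))) x * gsqc w x) + (k2 * ?W (1/8)) * (indicator (cball 0 (exp 1 * (1/8))) x * (cmod (w x))^2)))"
    have "carl4 \<tau> (err v) \<le> (LBINT x. R x)"
    proof (rule integral_mono[OF icar])
      show "integrable lborel R" unfolding R_def
        by (intro Bochner_Integration.integrable_add integrable_mult_right iE iN iQ)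
      show "(norm x)^4 * cw \<tau> x * (cmod (err v x))^2 \<le> R x" for x unfolding R_def by (rule pw)
    qed
    also have "(LBINT x. R x) = 3 * ?W \<epsilon> * Er + ((k1 * ?W \<epsilon> * \<epsilon>^2) * Q (exp 1 * \<epsilon>) + (k2 * ?W \<epsilon>) * N (exp 1 * \<epsilon>))
        + ((k1 * ?W (1/8) * (1/8)^2) * Q (exp 1 * (1/8)) + (k2 * ?W (1/8)) * N (exp 1 * (1/8)))"
      unfolding R_def Er_def Q_def N_def
      by (subst Bochner_Integration.integral_add Bochner_Integration.integral_mult_right_zero |
          intro Bochner_Integration.integrable_add integrable_mult_right iE iN iQ)+ simp
    also have "\<dots> \<le> D * (?W \<epsilon> * Er + ?W \<epsilon> * N (exp 1 * (exp 1 * \<epsilon>)) + ?W (1/8) * N 1)"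
    proof -
      have F0: "Er \<ge> 0" "N r \<ge> 0" for r unfolding Er_def N_def by (auto intro!: integral_nonneg_AE)
      have Nm: "N r \<le> N s" if "r \<le> s" for r s
        unfolding N_def using that by (intro integral_mono iN) (auto simp: indicator_def)
      have Em: "L2on (cball 0 r) (err w) \<le> Er" if "r \<le> 1" for r
        unfolding Er_def using that by (intro integral_mono integrable_ball_V(2)[OF w]) (auto simp: indicator_def)
      \<comment> \<open>The outer ring reaches to radius e/8, and the Caccioppoli inequality needs
        the ball of radius e^2/8 inside the unit ball. This holds since e^2 < 8.\<close>
      have e8: "exp 1 * (exp 1 * (1/8)) \<le> (1::real)"
      proof -
        have "exp 1 * exp 1 \<le> (272/100) * (272/100 :: real)" using e_less_272 by (intro mult_mono) auto
        then show ?thesis by simp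
      qed
      have QQ: "r^2 * Q (exp 1 * r) \<le> C * (N (exp 1 * (exp 1 * r)) + Er)" if r: "0 < r" "exp 1 * (exp 1 * r) \<le> 1" for r
      proof -
        have Q0: "Q (exp 1 * r) \<ge> 0" unfolding Q_def by (intro integral_nonneg_AE AE_I2 mult_nonneg_nonneg gsqc_nonneg) auto
        have "r^2 * Q (exp 1 * r) \<le> (exp 1 * r)^2 * Q (exp 1 * r)"
          using r Q0 by (intro mult_right_mono power_mono) auto
        also have "\<dots> \<le> C * (N (exp 1 * (exp 1 * r)) + L2on (cball 0 (exp 1 * (exp 1 * r))) (err w))"
          unfolding Q_def N_def by (rule cac[OF w]) (use r in auto)
        also have "\<dots> \<le> C * (N (exp 1 * (exp 1 * r)) + Er)"
          using Em[OF r(2)] C by (intro mult_left_mono) auto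
        finally show ?thesis .
      qed
      have ee: "exp 1 * (exp 1 * \<epsilon>) \<le> 1"
      proof -
        have "exp 1 * (exp 1 * \<epsilon>) \<le> 3 * (1/8)" using \<epsilon> e3 by (intro mult_mono) auto
        then show ?thesis by simp
      qed
      define N2 where "N2 = N (exp 1 * (exp 1 * \<epsilon>))"
      have Qe: "\<epsilon>^2 * Q (exp 1 * \<epsilon>) \<le> C * (N2 + Er)" unfolding N2_def by (rule QQ[OF \<epsilon>(1) ee])
      have "(1/8)^2 * Q (exp 1 * (1/8)) \<le> C * (N (exp 1 * (exp 1 * (1/8))) + Er)" by (rule QQ[OF _ e8]) simp
      also have "\<dots> \<le> C * (N 1 + Er)" using Nm[OF e8] C by (intro mult_left_mono) auto
      finally have Q8: "(1/8)^2 * Q (exp 1 * (1/8)) \<le> C * (N 1 + Er)" .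
      have N2: "N (exp 1 * \<epsilon>) \<le> N2" unfolding N2_def using \<epsilon> by (intro Nm) simp
      have N1: "N (exp 1 * (1/8)) \<le> N 1" by (rule Nm) (use e3 in simp)
      \<comment> \<open>The defect enters from both rings; the smaller outer weight is estimated by
        the inner one to collect it in a single term.\<close>
      have W8: "?W (1/8) \<le> ?W \<epsilon>"
      proof -
        have "1 * \<epsilon> \<le> exp 1 * \<epsilon>" using \<epsilon> by (intro mult_right_mono) auto
        then have "\<epsilon> \<le> 1/8" using \<epsilon>(2) by linarith
        then show ?thesis using \<epsilon> t0 by (intro cwr_antimono) auto
      qed
      have "3 * ?W \<epsilon> * Er + ((k1 * ?W \<epsilon> * \<epsilon>^2) * Q (exp 1 * \<epsilon>) + (k2 * ?W \<epsilon>) * N (exp 1 * \<epsilon>))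
        + ((k1 * ?W (1/8) * (1/8)^2) * Q (exp 1 * (1/8)) + (k2 * ?W (1/8)) * N (exp 1 * (1/8)))
        = 3 * ?W \<epsilon> * Er + ((k1 * ?W \<epsilon>) * (\<epsilon>^2 * Q (exp 1 * \<epsilon>)) + (k2 * ?W \<epsilon>) * N (exp 1 * \<epsilon>))
        + ((k1 * ?W (1/8)) * ((1/8)^2 * Q (exp 1 * (1/8))) + (k2 * ?W (1/8)) * N (exp 1 * (1/8)))"
        by (simp only: mult.assoc)
      also have "\<dots> \<le> 3 * ?W \<epsilon> * Er + ((k1 * ?W \<epsilon>) * (C * (N2 + Er)) + (k2 * ?W \<epsilon>) * N2)
        + ((k1 * ?W (1/8)) * (C * (N 1 + Er)) + (k2 * ?W (1/8)) * N 1)"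
        using k W0 by (intro add_mono mult_left_mono order_refl Qe Q8 N2 N1 mult_nonneg_nonneg)
      also have "\<dots> = (3 + k1 * C) * (?W \<epsilon> * Er) + (k1 * C) * (?W (1/8) * Er) + (k1 * C + k2) * (?W \<epsilon> * N2) + (k1 * C + k2) * (?W (1/8) * N 1)"
        by (simp add: algebra_simps)
      also have "\<dots> \<le> (3 + k1 * C) * (?W \<epsilon> * Er) + (k1 * C) * (?W \<epsilon> * Er) + D * (?W \<epsilon> * N2) + D * (?W (1/8) * N 1)"
        using k C W0 F0 W8 unfolding N2_def D_def by (intro add_mono mult_left_mono mult_right_mono order_refl mult_nonneg_nonneg) auto
      also have "\<dots> = (3 + 2 * (k1 * C)) * (?W \<epsilon> * Er) + D * (?W \<epsilon> * N2) + D * (?W (1/8) * N 1)"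
        by (simp add: algebra_simps)
      also have "\<dots> \<le> D * (?W \<epsilon> * Er) + D * (?W \<epsilon> * N2) + D * (?W (1/8) * N 1)"
      proof -
        have "(3 + 2 * (k1 * C)) * (?W \<epsilon> * Er) \<le> D * (?W \<epsilon> * Er)"
          by (rule mult_right_mono) (use k W0 F0 in \<open>auto simp: D_def\<close>)
        then show ?thesis by linarith
      qed
      finally show ?thesis unfolding N2_def by (simp only: distrib_left)
    qed
    finally have up: "carl4 \<tau> (err v) \<le> D * (?W \<epsilon> * Er + ?W \<epsilon> * N (exp 1 * (exp 1 * \<epsilon>)) + ?W (1/8) * N 1)" .
    have low: "1/8 * ?W (1/8) * L2on (cball 0 (1/8) - ball 0 (exp 1 * \<epsilon>)) w \<le> carl1 \<tau> v"
    proof -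
      have t4: "\<tau> \<ge> 4" using \<tau> \<tau>0 by simp
      have "1/8 * ?W (1/8) * L2on (cball 0 (1/8) - ball 0 (exp 1 * \<epsilon>)) w
        = (LBINT x. 1/8 * ?W (1/8) * (indicator (cball 0 (1/8) - ball 0 (exp 1 * \<epsilon>)) x * (cmod (w x))^2))" by simp
      also have "\<dots> \<le> carl1 \<tau> v"
      proof (rule integral_mono'[OF carleman_complex(2)[OF v2 t4 \<epsilon>(1) vs]])
        show "0 \<le> norm x * cw \<tau> x * (cmod (v x))^2" for x
          by (intro mult_nonneg_nonneg less_imp_le[OF cw_pos]) auto
        then show "1/8 * ?W (1/8) * (indicator (cball 0 (1/8) - ball 0 (exp 1 * \<epsilon>)) x * (cmod (w x))^2) \<le> norm x * cw \<tau> x * (cmod (v x))^2" for x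
        proof (cases "x \<in> cball 0 (1/8) - ball 0 (exp 1 * \<epsilon>)")
          case True
          then have nx: "exp 1 * \<epsilon> \<le> norm x" "norm x \<le> 1/8" by auto
          moreover have "0 < exp 1 * \<epsilon>" using \<epsilon> by simp
          ultimately have n0: "norm x > 0" by linarith
          then have x0: "x \<noteq> 0" by auto
          have "g x = 1" by (rule G(6)[OF nx])
          then have "v x = w x" by (simp add: v_def)
          moreover have "1/8 * ?W (1/8) \<le> norm x * cw \<tau> x"
            unfolding cw_cwr[OF x0] using n0 nx t0 n1 by (intro cwr_antimono(2)) auto
          then have "1/8 * ?W (1/8) * (cmod (w x))^2 \<le> norm x * cw \<tau> x * (cmod (w x))^2" by (rule mult_right_mono) simp
          ultimately show ?thesis using True by simp
        qed simp
      qed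
      finally show ?thesis .
    qed
    have "\<tau>^3 / 32 * (1/8 * ?W (1/8) * L2on (cball 0 (1/8) - ball 0 (exp 1 * \<epsilon>)) w) \<le> \<tau>^3 / 32 * carl1 \<tau> v"
      using low t0 by (intro mult_left_mono) auto
    then show ?thesis using car up unfolding Er_def N_def by linarith
  qed
  then show ?thesis using that[OF D \<tau>0] by blast
qed

text \<open>A locally integrable solution enters only through smooth approximate solutions \<open>u j\<close>.\<close>

definition approximates :: "(nat \<Rightarrow> 'a \<Rightarrow> complex) \<Rightarrow> ('a \<Rightarrow> complex) \<Rightarrow> bool" where
  "approximates u \<Psi> \<longleftrightarrow> \<Psi> \<in> borel_measurable borel \<and> L2int (cball 0 1) \<Psi> \<and> (\<forall>j. C2_on UNIV (u j)) \<and>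
    (\<lambda>j. L2on (cball 0 1) (\<lambda>x. u j x - \<Psi> x)) \<longlonglongrightarrow> 0 \<and> (\<lambda>j. L2on (cball 0 1) (err (u j))) \<longlonglongrightarrow> 0"

text \<open>The order of the three limits matters. First j tends to infinity, since the defect is
  multiplied by the huge inner weight; then \<epsilon> tends to 0 for fixed \<tau>, with an order of
  vanishing chosen depending on \<tau>; last \<tau> tends to infinity.\<close>

lemma vanish_near_zero:
  assumes ap: "approximates u \<Psi>"
    and vanish: "\<And>k. \<exists>c. \<forall>e. 0 < e \<and> e < 1 \<longrightarrow> L2on (ball 0 e) \<Psi> \<le> c * e ^ k"
  shows "AE x in lborel. x \<in> ball 0 (1/8) \<longrightarrow> \<Psi> x = 0"
proof -
  have \<Psi>: "L2int (cball 0 1) \<Psi>" and \<Psi>m: "\<Psi> \<in> borel_measurable borel" and u: "C2_on UNIV (u j)"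
    and conv: "(\<lambda>j. L2on (cball 0 1) (\<lambda>x. u j x - \<Psi> x)) \<longlonglongrightarrow> 0" "(\<lambda>j. L2on (cball 0 1) (err (u j))) \<longlonglongrightarrow> 0" for j
    using ap by (auto simp: approximates_def)
  note [measurable] = \<Psi>m C2_borel[OF u]
  obtain D \<tau>0 where D: "D \<ge> 0" and \<tau>0: "\<tau>0 \<ge> 4" and cc: "\<And>w \<tau> \<epsilon>. C2_on UNIV w \<Longrightarrow> \<tau> \<ge> \<tau>0 \<Longrightarrow> 0 < \<epsilon> \<Longrightarrow> exp 1 * \<epsilon> < 1/8 \<Longrightarrow>
      \<tau>^3 / 32 * (1/8 * cwr DIM('a) \<tau> (1/8) * L2on (cball 0 (1/8) - ball 0 (exp 1 * \<epsilon>)) w) \<le>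
        D * (cwr DIM('a) \<tau> \<epsilon> * L2on (cball 0 1) (err w)
           + cwr DIM('a) \<tau> \<epsilon> * L2on (cball 0 (exp 1 * (exp 1 * \<epsilon>))) w
           + cwr DIM('a) \<tau> (1/8) * L2on (cball 0 1) w)"
    by (rule carleman_cutoff) (rule that)
  let ?W = "cwr DIM('a)"
  define M where "M A = L2on A \<Psi>" for A
  define d where "d j = L2on (cball 0 1) (\<lambda>x. u j x - \<Psi> x)" for j
  define er where "er j = L2on (cball 0 1) (err (u j))" for j
  have e3: "exp 1 < (3::real)" using e_less_272 by simp
  have cb [measurable]: "cball 0 r \<in> sets (borel :: 'a measure)" "ball 0 r \<in> sets (borel :: 'a measure)" for r by auto
  note isub = L2on_subset(1)[OF _ _ \<Psi>]
  have iu: "L2int (cball 0 1) (u j)" for j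
    by (intro integrable_cball continuous_intros C2_on_continuous u)
  have sub1: "L2on A (u j) \<le> 2 * M A + 2 * d j" and sub2: "M A \<le> 2 * L2on A (u j) + 2 * d j"
    if "A \<subseteq> cball 0 1" "A \<in> sets borel" for A j
    unfolding M_def d_def using L2on_perturb(2,3)[OF that _ C2_borel(1)[OF u] \<Psi>m iu \<Psi>] by simp_all
  have d0: "d \<longlonglongrightarrow> 0" and er0: "er \<longlonglongrightarrow> 0" using conv unfolding d_def[abs_def] er_def[abs_def] by auto
  have lim1: "\<tau>^3 / 32 * (1/8 * ?W \<tau> (1/8) * (M (cball 0 (1/8) - ball 0 (exp 1 * \<epsilon>)) / 2)) \<le>
      D * (?W \<tau> \<epsilon> * (2 * M (cball 0 (exp 1 * (exp 1 * \<epsilon>)))) + ?W \<tau> (1/8) * (2 * M (cball 0 1)))"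
    if \<tau>: "\<tau> \<ge> \<tau>0" and \<epsilon>: "0 < \<epsilon>" "exp 1 * \<epsilon> < 1/8" for \<tau> \<epsilon>
  proof -
    let ?A = "cball 0 (1/8) - ball 0 (exp 1 * \<epsilon>) :: 'a set" and ?B = "cball 0 (exp 1 * (exp 1 * \<epsilon>)) :: 'a set"
    have "exp 1 * (exp 1 * \<epsilon>) \<le> 3 * (1/8)" using \<epsilon> e3 by (intro mult_mono) auto
    then have AB: "?A \<subseteq> cball 0 1" "?B \<subseteq> cball 0 1" by auto
    have W0: "?W \<tau> r \<ge> 0" for r by (simp add: cwr_pos less_imp_le)
    have t0: "\<tau>^3 / 32 * (1/8 * ?W \<tau> (1/8)) \<ge> 0" using \<tau> \<tau>0 W0 by auto
    have ineq: "\<tau>^3 / 32 * (1/8 * ?W \<tau> (1/8)) * (M ?A / 2 - d j) \<le>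
       D * (?W \<tau> \<epsilon> * er j + ?W \<tau> \<epsilon> * (2 * M ?B + 2 * d j) + ?W \<tau> (1/8) * (2 * M (cball 0 1) + 2 * d j))" for j
    proof -
      have "\<tau>^3 / 32 * (1/8 * ?W \<tau> (1/8)) * (M ?A / 2 - d j) \<le> \<tau>^3 / 32 * (1/8 * ?W \<tau> (1/8)) * L2on ?A (u j)"
        using sub2[OF AB(1), of j] by (intro mult_left_mono t0) simp
      also have "\<dots> \<le> D * (?W \<tau> \<epsilon> * er j + ?W \<tau> \<epsilon> * L2on ?B (u j)
           + ?W \<tau> (1/8) * L2on (cball 0 1) (u j))"
        using cc[OF u \<tau> \<epsilon>, of j] by (simp only: er_def mult.assoc)
      also have "\<dots> \<le> D * (?W \<tau> \<epsilon> * er j + ?W \<tau> \<epsilon> * (2 * M ?B + 2 * d j) + ?W \<tau> (1/8) * (2 * M (cball 0 1) + 2 * d j))"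
        by (intro mult_left_mono add_mono order_refl D W0 sub1 AB) auto
      finally show ?thesis .
    qed
    have "\<tau>^3 / 32 * (1/8 * ?W \<tau> (1/8)) * (M ?A / 2 - 0) \<le>
       D * (?W \<tau> \<epsilon> * 0 + ?W \<tau> \<epsilon> * (2 * M ?B + 2 * 0) + ?W \<tau> (1/8) * (2 * M (cball 0 1) + 2 * 0))"
    proof (rule LIMSEQ_le)
      show "(\<lambda>j. \<tau>^3 / 32 * (1/8 * ?W \<tau> (1/8)) * (M ?A / 2 - d j)) \<longlonglongrightarrow> \<tau>^3 / 32 * (1/8 * ?W \<tau> (1/8)) * (M ?A / 2 - 0)"
        by (intro tendsto_mult tendsto_diff tendsto_const d0)
      show "(\<lambda>j. D * (?W \<tau> \<epsilon> * er j + ?W \<tau> \<epsilon> * (2 * M ?B + 2 * d j) + ?W \<tau> (1/8) * (2 * M (cball 0 1) + 2 * d j))) \<longlonglongrightarrow>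
        D * (?W \<tau> \<epsilon> * 0 + ?W \<tau> \<epsilon> * (2 * M ?B + 2 * 0) + ?W \<tau> (1/8) * (2 * M (cball 0 1) + 2 * 0))"
        by (intro tendsto_mult tendsto_add tendsto_const d0 er0)
    qed (use ineq in blast)
    then show ?thesis by (simp add: mult.assoc)
  qed
  have W0: "?W \<tau> r > 0" for \<tau> r by (simp add: cwr_pos)
  \<comment> \<open>1024 = 32 * 8 * 2 * 2: the constants of the Carleman estimate and one factor 2
    on each side for replacing approximants by the solution. The weight at 1/8 cancels.\<close>
  have lim2: "\<tau>^3 * M (cball 0 (1/8)) \<le> 1024 * D * M (cball 0 1)" if \<tau>: "\<tau> \<ge> \<tau>0" for \<tau>
  proof -
    define \<epsilon> where "\<epsilon> m = (1/100) * inverse (real (Suc m))" for m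
    have \<epsilon>: "0 < \<epsilon> m" "\<epsilon> m \<le> 1/100" for m by (auto simp: \<epsilon>_def field_simps)
    have \<epsilon>0: "\<epsilon> \<longlonglongrightarrow> 0" unfolding \<epsilon>_def[abs_def] by (rule tendsto_mult_right_zero[OF LIMSEQ_inverse_real_of_nat])
    have e\<epsilon>: "exp 1 * \<epsilon> m < 1/8" for m
    proof -
      have "exp 1 * \<epsilon> m \<le> 3 * (1/100)" using \<epsilon>[of m] e3 by (intro mult_mono) auto
      then show ?thesis by simp
    qed
    \<comment> \<open>For this order the inner weight times \<epsilon>^k stays below exp (2 \<tau>);
      vanishing to order \<open>Suc k\<close> leaves a further factor \<epsilon>, which tends to
      0.\<close>
    obtain k :: nat where k: "real DIM('a) + 2 * \<tau> \<le> real k" using real_arch_simple by blast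
    obtain c where c: "\<And>e. 0 < e \<Longrightarrow> e < 1 \<Longrightarrow> M (ball 0 e) \<le> c * e ^ Suc k"
      using vanish[of "Suc k"] unfolding M_def by blast
    have small: "?W \<tau> (\<epsilon> m) * (2 * M (cball 0 (exp 1 * (exp 1 * \<epsilon> m)))) \<le> (2 * (exp (2 * \<tau>) * \<bar>c\<bar> * 10 ^ Suc k)) * \<epsilon> m" for m
    proof -
      have "exp 1 * (exp 1 * \<epsilon> m) \<le> 3 * (3 * \<epsilon> m)" using e3 \<epsilon>[of m] by (intro mult_mono) auto
      then have "exp 1 * (exp 1 * \<epsilon> m) < 10 * \<epsilon> m" using \<epsilon>[of m] by linarith
      then have sb: "cball 0 (exp 1 * (exp 1 * \<epsilon> m)) \<subseteq> (ball 0 (10 * \<epsilon> m) :: 'a set)" by auto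
      have b1: "ball 0 (10 * \<epsilon> m) \<subseteq> (cball 0 1 :: 'a set)" using \<epsilon>[of m] by auto
      have "M (cball 0 (exp 1 * (exp 1 * \<epsilon> m))) \<le> M (ball 0 (10 * \<epsilon> m))"
        unfolding M_def by (rule L2on_subset(2)[OF sb _ isub[OF b1]]) auto
      also have "\<dots> \<le> c * (10 * \<epsilon> m) ^ Suc k" using \<epsilon>[of m] by (intro c) auto
      also have "\<dots> \<le> \<bar>c\<bar> * (10 * \<epsilon> m) ^ Suc k" using \<epsilon>[of m] by (intro mult_right_mono) auto
      finally have "M (cball 0 (exp 1 * (exp 1 * \<epsilon> m))) \<le> \<bar>c\<bar> * 10 ^ Suc k * \<epsilon> m * \<epsilon> m ^ k" by (simp add: power_mult_distrib mult_ac)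
      then have "?W \<tau> (\<epsilon> m) * (2 * M (cball 0 (exp 1 * (exp 1 * \<epsilon> m)))) \<le> ?W \<tau> (\<epsilon> m) * (2 * (\<bar>c\<bar> * 10 ^ Suc k * \<epsilon> m * \<epsilon> m ^ k))"
        using W0[of \<tau> "\<epsilon> m"] by (intro mult_left_mono) auto
      also have "\<dots> = (2 * (\<bar>c\<bar> * 10 ^ Suc k * \<epsilon> m)) * (?W \<tau> (\<epsilon> m) * \<epsilon> m ^ k)" by (simp add: mult_ac)
      also have "\<dots> \<le> (2 * (\<bar>c\<bar> * 10 ^ Suc k * \<epsilon> m)) * exp (2 * \<tau>)"
        using \<epsilon>[of m] \<tau> \<tau>0 k by (intro mult_left_mono cwr_le) auto
      finally show ?thesis by (simp add: mult_ac)
    qed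
    \<comment> \<open>The annuli exhaust the ball except for its centre, a null set.\<close>
    have MA: "(\<lambda>m. M (cball 0 (1/8) - ball 0 (exp 1 * \<epsilon> m))) \<longlonglongrightarrow> M (cball 0 (1/8))"
      unfolding M_def
    proof (rule integral_dominated_convergence[where w="\<lambda>x. indicator (cball 0 1) x * (cmod (\<Psi> x))^2"])
      show "AE x in lborel. (\<lambda>m. indicator (cball 0 (1/8) - ball 0 (exp 1 * \<epsilon> m)) x * (cmod (\<Psi> x))^2) \<longlonglongrightarrow> indicator (cball 0 (1/8)) x * (cmod (\<Psi> x))^2"
        using AE_lborel_singleton[of 0]
      proof eventually_elim
        case (elim x)
        have "(\<lambda>m. exp 1 * \<epsilon> m) \<longlonglongrightarrow> exp 1 * 0" by (intro tendsto_intros \<epsilon>0)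
        then have "\<forall>\<^sub>F m in sequentially. exp 1 * \<epsilon> m < norm x" using elim by (intro order_tendstoD(2)[where y=0]) auto
        then have "\<forall>\<^sub>F m in sequentially. indicator (cball 0 (1/8) - ball 0 (exp 1 * \<epsilon> m)) x * (cmod (\<Psi> x))^2 = indicator (cball 0 (1/8)) x * (cmod (\<Psi> x))^2"
          by eventually_elim (auto simp: indicator_def)
        then show ?case by (rule tendsto_eventually)
      qed
    qed (use \<Psi> in \<open>auto simp: indicator_def\<close>)
    have "\<tau>^3 / 32 * (1/8 * ?W \<tau> (1/8) * (M (cball 0 (1/8)) / 2)) \<le> D * ((2 * (exp (2 * \<tau>) * \<bar>c\<bar> * 10 ^ Suc k)) * 0 + ?W \<tau> (1/8) * (2 * M (cball 0 1)))"
    proof (rule LIMSEQ_le)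
      show "(\<lambda>m. \<tau>^3 / 32 * (1/8 * ?W \<tau> (1/8) * (M (cball 0 (1/8) - ball 0 (exp 1 * \<epsilon> m)) / 2))) \<longlonglongrightarrow> \<tau>^3 / 32 * (1/8 * ?W \<tau> (1/8) * (M (cball 0 (1/8)) / 2))"
        by (intro tendsto_intros MA) simp
      show "(\<lambda>m. D * ((2 * (exp (2 * \<tau>) * \<bar>c\<bar> * 10 ^ Suc k)) * \<epsilon> m + ?W \<tau> (1/8) * (2 * M (cball 0 1)))) \<longlonglongrightarrow> D * ((2 * (exp (2 * \<tau>) * \<bar>c\<bar> * 10 ^ Suc k)) * 0 + ?W \<tau> (1/8) * (2 * M (cball 0 1)))"
        by (intro tendsto_intros \<epsilon>0)
      have "\<tau>^3 / 32 * (1/8 * ?W \<tau> (1/8) * (M (cball 0 (1/8) - ball 0 (exp 1 * \<epsilon> m)) / 2)) \<le> D * ((2 * (exp (2 * \<tau>) * \<bar>c\<bar> * 10 ^ Suc k)) * \<epsilon> m + ?W \<tau> (1/8) * (2 * M (cball 0 1)))" for m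
        by (rule order_trans[OF lim1[OF \<tau> \<epsilon>(1) e\<epsilon>]]) (intro mult_left_mono add_mono small order_refl D)
      then show "\<exists>N. \<forall>m\<ge>N. \<tau>^3 / 32 * (1/8 * ?W \<tau> (1/8) * (M (cball 0 (1/8) - ball 0 (exp 1 * \<epsilon> m)) / 2)) \<le> D * ((2 * (exp (2 * \<tau>) * \<bar>c\<bar> * 10 ^ Suc k)) * \<epsilon> m + ?W \<tau> (1/8) * (2 * M (cball 0 1)))"
        by blast
    qed
    then have "?W \<tau> (1/8) * (\<tau>^3 * M (cball 0 (1/8))) \<le> ?W \<tau> (1/8) * (1024 * D * M (cball 0 1))"
      by (simp add: algebra_simps)
    then show ?thesis using W0[of \<tau> "1/8"] by simp
  qed
  have M0: "M A \<ge> 0" for A unfolding M_def by (auto intro!: integral_nonneg_AE)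
  have "M (cball 0 (1/8)) = 0"
  proof (rule ccontr)
    assume "M (cball 0 (1/8)) \<noteq> 0"
    then have p: "M (cball 0 (1/8)) > 0" using M0[of "cball 0 (1/8)"] by simp
    define \<tau> where "\<tau> = max \<tau>0 (1024 * D * M (cball 0 1) / M (cball 0 (1/8)) + 1)"
    have t: "\<tau> \<ge> \<tau>0" "\<tau> > 1024 * D * M (cball 0 1) / M (cball 0 (1/8))" "\<tau> \<ge> 1" using \<tau>0 by (auto simp: \<tau>_def)
    have "\<tau> \<le> \<tau>^3" using t(3) by (simp add: self_le_power)
    then have "\<tau> * M (cball 0 (1/8)) \<le> 1024 * D * M (cball 0 1)"
      using lim2[OF t(1)] mult_right_mono[OF \<open>\<tau> \<le> \<tau>^3\<close> M0[of "cball 0 (1/8)"]] by linarith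
    then show False using t(2) p by (simp add: divide_less_eq)
  qed
  moreover have "L2int (cball 0 (1/8)) \<Psi>"
    by (rule isub) auto
  ultimately have "AE x in lborel. indicator (cball 0 (1/8)) x * (cmod (\<Psi> x))^2 = 0"
    unfolding M_def by (subst (asm) integral_nonneg_eq_0_iff_AE) auto
  then show ?thesis by eventually_elim (auto simp: indicator_def split: if_splits)
qed

end

section \<open>Plancherel theorem\<close>

lemma sqint_dense:
  fixes f :: "'a::euclidean_space \<Rightarrow> complex"
  assumes f: "sqint f" and "\<eta> > 0"
  obtains g R where "continuous_on UNIV g" "\<And>x. x \<notin> ball 0 R \<Longrightarrow> g x = 0" "L2sq (\<lambda>x. f x - g x) < \<eta>"
proof -
  note [measurable] = sqint_meas[OF f]
  \<comment> \<open>Truncation in space and in value at once: the function becomes bounded with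
    bounded support, as the second dominated convergence requires.\<close>
  define A where "A n = {x. norm x \<le> real n \<and> cmod (f x) \<le> real n}" for n :: nat
  have A [measurable]: "A n \<in> sets borel" for n unfolding A_def by measurable
  have "(\<lambda>n. L2sq (\<lambda>x. f x - indicator (A n) x * f x)) \<longlonglongrightarrow> (\<integral>x. 0 \<partial>(lborel :: 'a measure))"
  proof (rule integral_dominated_convergence[where w="\<lambda>x. (cmod (f x))^2"])
    show "AE x in lborel. (\<lambda>n. (cmod (f x - indicator (A n) x * f x))^2) \<longlonglongrightarrow> 0"
    proof (rule AE_I2)
      fix x
      obtain N :: nat where N: "max (norm x) (cmod (f x)) \<le> real N" using real_arch_simple by blast
      have "\<forall>n\<ge>N. (cmod (f x - indicator (A n) x * f x))^2 = 0"
        using N by (auto simp: A_def indicator_def)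
      then show "(\<lambda>n. (cmod (f x - indicator (A n) x * f x))^2) \<longlonglongrightarrow> 0"
        by (intro tendsto_eventually) (auto simp: eventually_sequentially)
    qed
    show "AE x in lborel. norm ((cmod (f x - indicator (A n) x * f x))^2) \<le> (cmod (f x))^2" for n
      by (auto simp: indicator_def)
  qed (use f in \<open>auto simp: sqint_int\<close>)
  then have "\<forall>\<^sub>F n in sequentially. L2sq (\<lambda>x. f x - indicator (A n) x * f x) < \<eta> / 4"
    using \<open>\<eta> > 0\<close> by (intro order_tendstoD(2)) auto
  then obtain n where n: "L2sq (\<lambda>x. f x - indicator (A n) x * f x) < \<eta> / 4"
    by (auto simp: eventually_sequentially)
  define h where "h x = indicator (A n) x * f x" for x
  have h: "sqint h" unfolding h_def by (rule sqint_indicator[OF f A])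
  note [measurable] = sqint_meas[OF h]
  have hb: "cmod (h x) \<le> real n" "norm x > real n \<Longrightarrow> h x = 0" for x by (auto simp: h_def A_def indicator_def)
  define b where "b = real n + 1"
  have b: "b \<ge> 1" "b > 0" "real n \<le> b" by (auto simp: b_def)
  have "h measurable_on UNIV"
    by (rule lebesgue_measurable_imp_measurable_on) (auto intro: measurable_completion)
  then obtain N G where N: "negligible N" and G: "\<And>m. continuous_on UNIV (G m)" "\<And>x. x \<notin> N \<Longrightarrow> (\<lambda>m. G m x) \<longlonglongrightarrow> h x"
    unfolding measurable_on_def by auto
  \<comment> \<open>Radial retraction onto the disc of radius \<open>b\<close>. It makes the
    continuous approximants uniformly bounded and fixes all values of \<open>h\<close>, so the
    pointwise limit is unchanged.\<close>
  define cl where "cl z = (1 / max 1 (cmod z / b)) *\<^sub>R z" for z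
  have cl_cont: "continuous_on UNIV cl" unfolding cl_def by (intro continuous_intros) (use b in auto)
  have cl_b: "cmod (cl z) \<le> b" for z
  proof (cases "cmod z \<le> b")
    case True then show ?thesis using b by (simp add: cl_def max_def divide_le_eq)
  next
    case False then show ?thesis using b by (simp add: cl_def max_def)
  qed
  have cl_id: "cl z = z" if "cmod z \<le> b" for z using that b by (simp add: cl_def max_def divide_le_eq)
  define k where "k m x = bump b x *\<^sub>R cl (G m x)" for m x
  have kc: "continuous_on UNIV (k m)" for m unfolding k_def
    by (intro continuous_on_scaleR C2_on_continuous bump b continuous_on_compose2[OF cl_cont G(1)]) auto
  have k0: "k m x = 0" if "x \<notin> ball 0 (exp 1 * b)" for m x
    using bump(5)[OF b(2), of x] that by (simp add: k_def)
  have km: "k m \<in> borel_measurable borel" for m by (rule borel_measurable_continuous_onI[OF kc])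
  have kl: "(\<lambda>m. k m x) \<longlonglongrightarrow> h x" if "x \<notin> N" for x
  proof -
    have "(\<lambda>m. k m x) \<longlonglongrightarrow> bump b x *\<^sub>R cl (h x)"
      unfolding k_def by (intro tendsto_intros continuous_on_tendsto_compose[OF cl_cont G(2)[OF that]]) auto
    also have "cl (h x) = h x" using hb(1)[of x] b by (intro cl_id) auto
    also have "bump b x *\<^sub>R h x = h x" using bump(4)[OF b(2), of x] hb(2)[of x] b by (cases "norm x \<le> b") auto
    finally show ?thesis .
  qed
  have "(\<lambda>m. L2sq (\<lambda>x. h x - k m x)) \<longlonglongrightarrow> (\<integral>x. 0 \<partial>(lborel :: 'a measure))"
  proof (rule integral_dominated_convergence[where w="\<lambda>x. (2 * b)^2 * indicator (cball 0 (exp 1 * b)) x"])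
    have "AE x in lebesgue. x \<notin> N" using N by (rule AE_not_in[OF iffD1[OF negligible_iff_null_sets]])
    then have "AE x in lborel. x \<notin> N" by (simp add: AE_completion_iff)
    then show "AE x in lborel. (\<lambda>m. (cmod (h x - k m x))^2) \<longlonglongrightarrow> 0"
    proof eventually_elim
      case (elim x)
      have "(\<lambda>m. (cmod (h x - k m x))^2) \<longlonglongrightarrow> (cmod (h x - h x))^2" by (intro tendsto_intros kl elim)
      then show ?case by simp
    qed
    show "integrable lborel (\<lambda>x::'a. (2 * b)^2 * indicator (cball 0 (exp 1 * b)) x)"
      using emeasure_lborel_cball_finite by (intro integrable_mult_right integrable_real_indicator) auto
    show "AE x in lborel. norm ((cmod (h x - k m x))^2) \<le> (2 * b)^2 * indicator (cball 0 (exp 1 * b)) x" for m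
    proof (rule AE_I2)
      fix x
      show "norm ((cmod (h x - k m x))^2) \<le> (2 * b)^2 * indicator (cball 0 (exp 1 * b)) x"
      proof (cases "x \<in> cball 0 (exp 1 * b)")
        case True
        have "cmod (k m x) \<le> 1 * b"
          unfolding k_def norm_scaleR using bump(2,3)[OF b(2), of x] cl_b b by (intro mult_mono) auto
        then have "cmod (h x - k m x) \<le> 2 * b" using hb(1)[of x] b norm_triangle_ineq4[of "h x" "k m x"] by linarith
        then have "(cmod (h x - k m x))^2 \<le> (2 * b)^2" by (intro power_mono) auto
        then show ?thesis using True by simp
      next
        case False
        have "1 * b \<le> exp 1 * b" using b by (intro mult_right_mono) auto
        moreover have "exp 1 * b < norm x" using False by simp
        ultimately have "real n < norm x" using b by linarith
        then have "h x = 0" by (rule hb(2))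
        moreover have "k m x = 0" using False by (intro k0) auto
        ultimately show ?thesis by simp
      qed
    qed
  qed (use km in measurable)
  then have "\<forall>\<^sub>F m in sequentially. L2sq (\<lambda>x. h x - k m x) < \<eta> / 4"
    using \<open>\<eta> > 0\<close> by (intro order_tendstoD(2)) auto
  then obtain m where m: "L2sq (\<lambda>x. h x - k m x) < \<eta> / 4"
    by (auto simp: eventually_sequentially)
  have sk: "sqint (k m)" by (rule sqint_cont[OF kc k0])
  have "L2sq (\<lambda>x. f x - k m x) \<le> 2 * L2sq (\<lambda>x. f x - h x) + 2 * L2sq (\<lambda>x. h x - k m x)"
    by (rule L2_triangle[OF f h sk])
  also have "\<dots> < \<eta>" using n m unfolding h_def by linarith
  finally show ?thesis using that kc k0 by blast
qed

lemma sqint_translation_continuous: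
  fixes f :: "'a::euclidean_space \<Rightarrow> complex"
  assumes f: "sqint f" and z: "z \<longlonglongrightarrow> 0"
  shows "(\<lambda>m::nat. L2sq (\<lambda>x. f (x + z m) - f x)) \<longlonglongrightarrow> 0"
proof (rule LIMSEQ_I)
  fix \<eta> :: real assume \<eta>: "\<eta> > 0"
  obtain g R where g: "continuous_on UNIV g" "\<And>x. x \<notin> ball 0 R \<Longrightarrow> g x = 0" "L2sq (\<lambda>x. f x - g x) < \<eta> / 24"
    using sqint_dense[OF f, of "\<eta> / 24"] \<eta> by auto
  have sg: "sqint g" by (rule sqint_cont[OF g(1,2)])
  obtain B where B: "B \<ge> 0" "\<And>x. cmod (g x) \<le> B" using compact_support_bounded[OF g(1,2)] by blast
  note [measurable] = sqint_meas[OF sg]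
  obtain Z where Z: "\<And>m. norm (z m) \<le> Z" using convergent_imp_Bseq[of z] z by (auto simp: convergent_def Bseq_def)
  have "(\<lambda>m. L2sq (\<lambda>x. g (x + z m) - g x)) \<longlonglongrightarrow> (\<integral>x. 0 \<partial>(lborel :: 'a measure))"
  proof (rule integral_dominated_convergence[where w="\<lambda>x. (2 * B)^2 * indicator (ball 0 (R + Z + 1)) x"])
    show "AE x in lborel. (\<lambda>m. (cmod (g (x + z m) - g x))^2) \<longlonglongrightarrow> 0"
    proof (rule AE_I2)
      fix x
      have "(\<lambda>m. x + z m) \<longlonglongrightarrow> x + 0" by (intro tendsto_intros z)
      then have "(\<lambda>m. g (x + z m)) \<longlonglongrightarrow> g (x + 0)"
        by (intro continuous_on_tendsto_compose[OF g(1)]) auto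
      then have "(\<lambda>m. (cmod (g (x + z m) - g x))^2) \<longlonglongrightarrow> (cmod (g (x + 0) - g x))^2" by (intro tendsto_intros)
      then show "(\<lambda>m. (cmod (g (x + z m) - g x))^2) \<longlonglongrightarrow> 0" by simp
    qed
    show "integrable lborel (\<lambda>x::'a. (2 * B)^2 * indicator (ball 0 (R + Z + 1)) x)"
      using emeasure_lborel_ball_finite by (intro integrable_mult_right integrable_real_indicator) auto
    show "AE x in lborel. norm ((cmod (g (x + z m) - g x))^2) \<le> (2 * B)^2 * indicator (ball 0 (R + Z + 1)) x" for m
    proof (rule AE_I2)
      fix x
      show "norm ((cmod (g (x + z m) - g x))^2) \<le> (2 * B)^2 * indicator (ball 0 (R + Z + 1)) x"
      proof (cases "x \<in> ball 0 (R + Z + 1)")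
        case True
        have "cmod (g (x + z m) - g x) \<le> 2 * B"
          using B(2)[of x] B(2)[of "x + z m"] norm_triangle_ineq4[of "g (x + z m)" "g x"] by linarith
        then have "(cmod (g (x + z m) - g x))^2 \<le> (2 * B)^2" by (intro power_mono) auto
        then show ?thesis using True by simp
      next
        case False
        have "norm x \<le> norm (x + z m) + norm (z m)" using norm_triangle_ineq4[of "x + z m" "z m"] by simp
        moreover have "norm x \<ge> R + Z + 1" using False by (simp add: not_less)
        ultimately have "norm (x + z m) \<ge> R" "norm x \<ge> R" using Z[of m] norm_ge_zero[of "z m"] by linarith+
        then have "g x = 0" "g (x + z m) = 0" using g(2) by auto
        then show ?thesis by simp
      qed
    qed
  qed measurable
  then have "\<forall>\<^sub>F m in sequentially. L2sq (\<lambda>x. g (x + z m) - g x) < \<eta> / 8"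
    using \<eta> by (intro order_tendstoD(2)) auto
  then obtain N where N: "\<And>m. m \<ge> N \<Longrightarrow> L2sq (\<lambda>x. g (x + z m) - g x) < \<eta> / 8"
    by (auto simp: eventually_sequentially)
  have "norm (L2sq (\<lambda>x. f (x + z m) - f x) - 0) < \<eta>" if "m \<ge> N" for m
  proof -
    note t = sqint_translate[OF f, of "z m"] sqint_translate[OF sg, of "z m"]
    have "L2sq (\<lambda>x. f (x + z m) - g (x + z m)) = L2sq (\<lambda>x. f x - g x)"
      by (rule integral_translate(1)[of "\<lambda>x. (cmod (f x - g x))^2"])
    moreover have "L2sq (\<lambda>x. g x - f x) = L2sq (\<lambda>x. f x - g x)" by (simp only: norm_minus_commute)
    ultimately have "L2sq (\<lambda>x. f (x + z m) - f x) < \<eta>"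
      using L2_triangle[OF t f] L2_triangle[OF t(2) sg f] g(3) N[OF that] \<eta> by linarith
    moreover have "L2sq (\<lambda>x. f (x + z m) - f x) \<ge> 0" by (auto intro!: integral_nonneg_AE)
    ultimately show ?thesis by simp
  qed
  then show "\<exists>N. \<forall>m\<ge>N. norm (L2sq (\<lambda>x. f (x + z m) - f x) - 0) < \<eta>" by blast
qed

section \<open>Dilations and the Fourier transform of Gaussians\<close>

lemma integral_scale:
  fixes f :: "'a::euclidean_space \<Rightarrow> 'b::{banach, second_countable_topology}"
  assumes c: "c \<noteq> 0" and f: "f \<in> borel_measurable borel"
  shows "(LBINT x. f x) = \<bar>c\<bar> ^ DIM('a) *\<^sub>R (LBINT x. f (c *\<^sub>R x))"
    and "integrable lborel (\<lambda>x. f (c *\<^sub>R x)) \<longleftrightarrow> integrable lborel f"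
proof -
  note [measurable] = f
  have e: "(lborel :: 'a measure) = density (distr lborel borel (\<lambda>x. 0 + c *\<^sub>R x)) (\<lambda>_. ennreal (\<bar>c\<bar>^DIM('a)))"
    using lborel_affine[OF c, of "0::'a"] by (simp add: ennreal_power)
  show "(LBINT x. f x) = \<bar>c\<bar> ^ DIM('a) *\<^sub>R (LBINT x. f (c *\<^sub>R x))"
    by (subst e) (simp add: integral_density integral_distr)
  show "integrable lborel (\<lambda>x. f (c *\<^sub>R x)) \<longleftrightarrow> integrable lborel f"
  proof -
    have "integrable lborel f \<longleftrightarrow> integrable lborel (\<lambda>x. \<bar>c\<bar> ^ DIM('a) *\<^sub>R f (c *\<^sub>R x))"
      by (subst e) (simp add: integrable_density integrable_distr_eq)
    moreover have "integrable lborel (\<lambda>x. (1 / \<bar>c\<bar> ^ DIM('a)) *\<^sub>R (\<bar>c\<bar> ^ DIM('a) *\<^sub>R f (c *\<^sub>R x)))"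
      if "integrable lborel (\<lambda>x. \<bar>c\<bar> ^ DIM('a) *\<^sub>R f (c *\<^sub>R x))"
      using that by (rule integrable_scaleR_right)
    ultimately show ?thesis using c by auto
  qed
qed

text \<open>Up to the factor sqrt (2 pi) the integral is the characteristic function of the standard
  normal distribution.\<close>

lemma gaussian_real:
  "integrable lborel (\<lambda>x. exp (- (x^2) / 2) :: real)"
  "(LBINT x. cis (- (t * x)) * complex_of_real (exp (- (x^2) / 2))) = complex_of_real (sqrt (2 * pi) * exp (- (t^2) / 2))"
proof -
  have d: "exp (- (x^2) / 2) = sqrt (2 * pi) * std_normal_density x" for x
    by (simp add: std_normal_density_def)
  have i: "integrable lborel std_normal_density" by simp
  then show "integrable lborel (\<lambda>x. exp (- (x^2) / 2) :: real)" unfolding d by simp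
  have "char std_normal_distribution (- t) = (LBINT x. std_normal_density x *\<^sub>R iexp (- t * x))"
    unfolding char_def by (rule integral_density) (auto simp: normal_density_nonneg)
  also have "\<dots> = (LBINT x. cis (- (t * x)) * complex_of_real (std_normal_density x))"
    by (intro integral_cong refl) (simp add: cis_conv_exp scaleR_conv_of_real mult.commute)
  finally have c: "(LBINT x. cis (- (t * x)) * complex_of_real (std_normal_density x)) = complex_of_real (exp (- (t^2) / 2))"
    by (simp add: char_std_normal_distribution)
  have "(LBINT x. cis (- (t * x)) * complex_of_real (exp (- (x^2) / 2))) = (LBINT x. complex_of_real (sqrt (2 * pi)) * (cis (- (t * x)) * complex_of_real (std_normal_density x)))"
    unfolding d by (intro integral_cong refl) simp
  also have "\<dots> = complex_of_real (sqrt (2 * pi)) * complex_of_real (exp (- (t^2) / 2))"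
    by (subst Bochner_Integration.integral_mult_right_zero) (simp only: c)
  finally show "(LBINT x. cis (- (t * x)) * complex_of_real (exp (- (x^2) / 2))) = complex_of_real (sqrt (2 * pi) * exp (- (t^2) / 2))" by simp
qed

text \<open>\<open>(2 \<pi>)^(n/2)\<close>\<close>

definition gc :: "'a::euclidean_space itself \<Rightarrow> real" where "gc _ = sqrt (2 * pi) ^ DIM('a)"

definition FT :: "('a::euclidean_space \<Rightarrow> complex) \<Rightarrow> 'a \<Rightarrow> complex" where
  "FT f k = (LBINT x. cis (- (k \<bullet> x)) * f x)"

text \<open>The inverse transform without its constant. The factor (2 pi)^(-n) appears below as
  division by \<open>C\<close>, the square of \<open>gc\<close>.\<close>

definition IF :: "('a::euclidean_space \<Rightarrow> complex) \<Rightarrow> 'a \<Rightarrow> complex" where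
  "IF h x = (LBINT k. cis (k \<bullet> x) * h k)"

definition gauss :: "'a::euclidean_space \<Rightarrow> real" where "gauss x = exp (- ((norm x)^2) / 2)"

lemma gauss_prod: "gauss (\<Sum>b\<in>Basis. f b *\<^sub>R b :: 'a::euclidean_space) = (\<Prod>b\<in>(Basis::'a set). exp (- ((f b)^2) / 2))"
proof -
  have "(norm (\<Sum>b\<in>Basis. f b *\<^sub>R b :: 'a))^2 = (\<Sum>b\<in>(Basis::'a set). (f b)^2)"
    unfolding sum_basis_norm[symmetric] by (simp add: power2_eq_square)
  then show ?thesis unfolding gauss_def
    by (simp add: exp_sum[symmetric] sum_negf sum_divide_distrib)
qed

lemma gauss_borel [measurable]: "gauss \<in> borel_measurable borel" unfolding gauss_def[abs_def] by measurable

lemma gauss_FT: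
  fixes k :: "'a::euclidean_space"
  shows "integrable lborel (gauss :: 'a \<Rightarrow> real)"
    and "FT (\<lambda>x. complex_of_real (gauss x)) k = complex_of_real (gc TYPE('a) * gauss k)"
proof -
  interpret product_sigma_finite "\<lambda>_::'a. lborel :: real measure"
    by standard
  let ?P = "\<Pi>\<^sub>M b\<in>(Basis::'a set). (lborel :: real measure)"
  let ?T = "\<lambda>f. (\<Sum>b\<in>(Basis::'a set). f b *\<^sub>R b)"
  have T: "?T \<in> measurable ?P borel" by measurable
  have m: "(\<lambda>x. cis (- (k \<bullet> x)) * complex_of_real (gauss x)) \<in> borel_measurable borel"
    unfolding cis_conv_exp by measurable
  have "integrable ?P (\<lambda>f. \<Prod>b\<in>(Basis::'a set). exp (- ((f b)^2) / 2))"
    by (rule product_integrable_prod[OF finite_Basis gaussian_real(1)])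
  then have "integrable (distr ?P borel ?T) (gauss :: 'a \<Rightarrow> real)"
    by (subst integrable_distr_eq[OF T]) (auto simp: gauss_prod)
  then show "integrable lborel (gauss :: 'a \<Rightarrow> real)" by (subst lborel_eq)
  have "FT (\<lambda>x. complex_of_real (gauss x)) k = (\<integral>f. cis (- (k \<bullet> ?T f)) * complex_of_real (gauss (?T f)) \<partial>?P)"
    unfolding FT_def by (subst lborel_eq) (rule integral_distr[OF T m])
  also have "\<dots> = (\<integral>f. (\<Prod>b\<in>(Basis::'a set). cis (- ((k \<bullet> b) * f b)) * complex_of_real (exp (- ((f b)^2) / 2))) \<partial>?P)"
  proof (intro integral_cong refl)
    fix f :: "'a \<Rightarrow> real"
    have "cis (- (k \<bullet> ?T f)) = (\<Prod>b\<in>(Basis::'a set). cis (- ((k \<bullet> b) * f b)))"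
      unfolding cis_conv_exp by (simp add: exp_sum[symmetric] inner_sum_right sum_negf sum_distrib_left mult_ac)
    then show "cis (- (k \<bullet> ?T f)) * complex_of_real (gauss (?T f)) = (\<Prod>b\<in>(Basis::'a set). cis (- ((k \<bullet> b) * f b)) * complex_of_real (exp (- ((f b)^2) / 2)))"
      unfolding gauss_prod prod.distrib by simp
  qed
  also have "\<dots> = (\<Prod>b\<in>(Basis::'a set). LBINT x. cis (- ((k \<bullet> b) * x)) * complex_of_real (exp (- (x^2) / 2)))"
  proof (rule product_integral_prod)
    fix b :: 'a
    have "(\<lambda>x. cis (- ((k \<bullet> b) * x)) * complex_of_real (exp (- (x^2) / 2))) \<in> borel_measurable lborel"
      unfolding cis_conv_exp by measurable
    then show "integrable lborel (\<lambda>x. cis (- ((k \<bullet> b) * x)) * complex_of_real (exp (- (x^2) / 2)))"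
      by (rule integrable_bound[OF gaussian_real(1)]) (simp add: norm_mult)
  qed simp
  also have "\<dots> = (\<Prod>b\<in>(Basis::'a set). complex_of_real (sqrt (2 * pi) * exp (- ((k \<bullet> b)^2) / 2)))"
    unfolding gaussian_real(2) ..
  also have "\<dots> = complex_of_real (gc TYPE('a) * (\<Prod>b\<in>(Basis::'a set). exp (- ((k \<bullet> b)^2) / 2)))"
    by (simp add: gc_def prod.distrib of_real_prod)
  also have "(\<Prod>b\<in>(Basis::'a set). exp (- ((k \<bullet> b)^2) / 2)) = gauss (\<Sum>b\<in>Basis. (k \<bullet> b) *\<^sub>R b)"
    by (rule gauss_prod[symmetric])
  also have "(\<Sum>b\<in>Basis. (k \<bullet> b) *\<^sub>R b) = k" by (rule euclidean_representation)
  finally show "FT (\<lambda>x. complex_of_real (gauss x)) k = complex_of_real (gc TYPE('a) * gauss k)" .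
qed

lemma gc_pos: "gc TYPE('a::euclidean_space) > 0" by (simp add: gc_def)

lemma gauss_integral: "(LBINT x. gauss (x::'a)) = gc TYPE('a::euclidean_space)"
proof -
  have "complex_of_real (LBINT x. gauss (x::'a)) = FT (\<lambda>x. complex_of_real (gauss x)) (0::'a)"
    by (simp add: FT_def)
  also have "\<dots> = complex_of_real (gc TYPE('a))" unfolding gauss_FT(2) by (simp add: gauss_def)
  finally show ?thesis by (simp only: of_real_eq_iff)
qed

lemma cis_borel [measurable]: "f \<in> borel_measurable M \<Longrightarrow> (\<lambda>x. cis (f x)) \<in> borel_measurable M"
  unfolding cis_conv_exp by measurable

lemma cnj_borel [measurable]: "f \<in> borel_measurable M \<Longrightarrow> (\<lambda>x. cnj (f x)) \<in> borel_measurable M"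
  using borel_measurable_continuous_on[OF continuous_on_cnj[OF continuous_on_id], of f M] by simp

lemma integrable_cis:
  assumes f: "integrable lborel f" and [measurable]: "g \<in> borel_measurable borel"
  shows "integrable lborel (\<lambda>x. cis (g x) * f x)"
  by (rule integrable_bound[OF f]) (use borel_measurable_integrable[OF f] in \<open>auto simp: norm_mult\<close>)

lemma FT_borel:
  fixes f :: "'a::euclidean_space \<Rightarrow> complex"
  assumes "integrable lborel f"
  shows "FT f \<in> borel_measurable borel" "IF f \<in> borel_measurable borel" "cmod (FT f k) \<le> (LBINT x. cmod (f x))"
    "cmod (IF f k) \<le> (LBINT x. cmod (f x))"
proof -
  have [measurable]: "f \<in> borel_measurable borel" using borel_measurable_integrable[OF assms] by simp
  show "FT f \<in> borel_measurable borel" unfolding FT_def[abs_def]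
    by (rule sigma_finite_measure.borel_measurable_lebesgue_integral[OF sigma_finite_lborel]) measurable
  show "IF f \<in> borel_measurable borel" unfolding IF_def[abs_def]
    by (rule sigma_finite_measure.borel_measurable_lebesgue_integral[OF sigma_finite_lborel]) measurable
  show "cmod (FT f k) \<le> (LBINT x. cmod (f x))" unfolding FT_def
    by (rule order_trans[OF integral_norm_bound]) (simp add: norm_mult)
  show "cmod (IF f k) \<le> (LBINT x. cmod (f x))" unfolding IF_def
    by (rule order_trans[OF integral_norm_bound]) (simp add: norm_mult)
qed

lemma FT_adjoint:
  fixes f h :: "'a::euclidean_space \<Rightarrow> complex"
  assumes f: "integrable lborel f" and h: "integrable lborel h"
  shows "(LBINT k. FT f k * cnj (h k)) = (LBINT x. f x * cnj (IF h x))"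
proof -
  have [measurable]: "f \<in> borel_measurable borel" "h \<in> borel_measurable borel"
    using borel_measurable_integrable f h by auto
  have i: "integrable (lborel \<Otimes>\<^sub>M lborel) (\<lambda>(k, x). cis (- (k \<bullet> x)) * f x * cnj (h k))"
  proof (rule integrable_bound)
    show "integrable (lborel \<Otimes>\<^sub>M lborel) (\<lambda>(k, x). cmod (h k) *\<^sub>R cmod (f x))"
      using f h by (intro lborel_pair.Fubini_integrable) auto
    show "AE p in lborel \<Otimes>\<^sub>M lborel. norm (case p of (k, x) \<Rightarrow> cis (- (k \<bullet> x)) * f x * cnj (h k)) \<le> norm (case p of (k, x) \<Rightarrow> cmod (h k) *\<^sub>R cmod (f x))"
      by (auto simp: norm_mult)
  qed measurable
  have "(LBINT k. FT f k * cnj (h k)) = (LBINT k. (LBINT x. cis (- (k \<bullet> x)) * f x * cnj (h k)))"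
    unfolding FT_def by simp
  also have "\<dots> = (LBINT x. (LBINT k. cis (- (k \<bullet> x)) * f x * cnj (h k)))"
    using lborel_pair.Fubini_integral[OF i] by simp
  also have "\<dots> = (LBINT x. f x * cnj (IF h x))"
  proof (intro integral_cong refl)
    fix x
    have "cnj (IF h x) = (LBINT k. cnj (cis (k \<bullet> x) * h k))" unfolding IF_def by (rule Bochner_Integration.integral_cnj[symmetric])
    then show "(LBINT k. cis (- (k \<bullet> x)) * f x * cnj (h k)) = f x * cnj (IF h x)"
      by (simp add: cis_cnj mult_ac flip: Bochner_Integration.integral_mult_right_zero)
  qed
  finally show ?thesis .
qed

lemma gauss_scale_FT:
  fixes z :: "'a::euclidean_space"
  assumes s: "s > 0"
  shows "integrable lborel (\<lambda>k::'a. gauss (s *\<^sub>R k))"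
    "(LBINT k. cis (- (z \<bullet> k)) * complex_of_real (gauss (s *\<^sub>R k))) = complex_of_real (gc TYPE('a) * gauss ((1/s) *\<^sub>R z) / s ^ DIM('a))"
proof -
  show "integrable lborel (\<lambda>k::'a. gauss (s *\<^sub>R k))"
    using integral_scale(2)[of s "gauss :: 'a \<Rightarrow> real"] s gauss_FT(1) by simp
  let ?f = "\<lambda>k. cis (- (((1/s) *\<^sub>R z) \<bullet> k)) * complex_of_real (gauss k)"
  have "complex_of_real (gc TYPE('a) * gauss ((1/s) *\<^sub>R z)) = (LBINT k. ?f k)"
    using gauss_FT(2)[of "(1/s) *\<^sub>R z"] by (simp add: FT_def)
  also have "\<dots> = \<bar>s\<bar> ^ DIM('a) *\<^sub>R (LBINT k. ?f (s *\<^sub>R k))"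
    by (rule integral_scale(1)) (use s in auto)
  also have "(\<lambda>k. ?f (s *\<^sub>R k)) = (\<lambda>k. cis (- (z \<bullet> k)) * complex_of_real (gauss (s *\<^sub>R k)))"
    using s by simp
  finally have "complex_of_real (gc TYPE('a) * gauss ((1/s) *\<^sub>R z)) = complex_of_real (s ^ DIM('a)) * (LBINT k. cis (- (z \<bullet> k)) * complex_of_real (gauss (s *\<^sub>R k)))"
    using s by (simp add: scaleR_conv_of_real)
  then show "(LBINT k. cis (- (z \<bullet> k)) * complex_of_real (gauss (s *\<^sub>R k))) = complex_of_real (gc TYPE('a) * gauss ((1/s) *\<^sub>R z) / s ^ DIM('a))"
    using s by (simp add: field_simps)
qed

lemma gauss_bounds: "0 < gauss x" "gauss x \<le> 1" "gauss (- x) = gauss x"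
  by (auto simp: gauss_def)

lemma integrable_times_bounded:
  fixes f g :: "'a::euclidean_space \<Rightarrow> complex"
  assumes f: "integrable lborel f" and g: "g \<in> borel_measurable borel" "\<And>x. cmod (g x) \<le> B"
  shows "integrable lborel (\<lambda>x. f x * g x)"
proof (rule integrable_bound)
  note [measurable] = g(1)
  show "integrable lborel (\<lambda>x. B * cmod (f x))" using f by simp
  show "(\<lambda>x. f x * g x) \<in> borel_measurable lborel" using borel_measurable_integrable[OF f] by simp
  show "AE x in lborel. norm (f x * g x) \<le> norm (B * cmod (f x))"
  proof (rule AE_I2)
    fix x
    have "cmod (f x) * cmod (g x) \<le> cmod (f x) * B" by (intro mult_left_mono g) simp
    moreover have "B \<ge> 0" using g(2)[of x] norm_ge_zero order_trans by blast
    ultimately show "norm (f x * g x) \<le> norm (B * cmod (f x))" by (simp add: norm_mult mult.commute)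
  qed
qed

text \<open>The Gaussian factor makes Fubini applicable; removing it (\<open>s \<rightarrow> 0\<close>) yields the Plancherel identity.\<close>

lemma FT_regularised:
  fixes f :: "'a::euclidean_space \<Rightarrow> complex"
  assumes f: "integrable lborel f" and f2: "sqint f" and s: "s > 0"
  shows "integrable lborel (\<lambda>k. gauss (s *\<^sub>R k) * (cmod (FT f k))^2)"
    and "(LBINT k. gauss (s *\<^sub>R k) * (cmod (FT f k))^2) =
      gc TYPE('a) * (LBINT z. gauss z * (L2sq f - L2sq (\<lambda>x. f (x + s *\<^sub>R z) - f x) / 2))"
proof -
  note [measurable] = sqint_meas[OF f2] FT_borel(1,2)[OF f]
  define B where "B = (LBINT x. cmod (f x))"
  have FB: "cmod (FT f k) \<le> B" for k unfolding B_def by (rule FT_borel(3)[OF f])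
  define g where "g k = complex_of_real (gauss (s *\<^sub>R k))" for k :: 'a
  have ig: "integrable lborel g" unfolding g_def using gauss_scale_FT(1)[OF s, where 'a='a] by (simp add: complex_of_real_integrable_eq)
  define h where "h k = g k * FT f k" for k
  have ih: "integrable lborel h" unfolding h_def by (rule integrable_times_bounded[OF ig _ FB]) measurable
  have hc: "FT f k * cnj (h k) = complex_of_real (gauss (s *\<^sub>R k) * (cmod (FT f k))^2)" for k
    unfolding h_def g_def by (simp add: complex_norm_square[symmetric] mult_ac)
  have ihc: "integrable lborel (\<lambda>k. cnj (h k) * FT f k)" by (rule integrable_times_bounded[OF _ _ FB]) (use ih in auto)
  have "integrable lborel (\<lambda>k. complex_of_real (gauss (s *\<^sub>R k) * (cmod (FT f k))^2))"
    using ihc unfolding hc[symmetric] by (simp add: mult.commute)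
  then show "integrable lborel (\<lambda>k. gauss (s *\<^sub>R k) * (cmod (FT f k))^2)" using complex_of_real_integrable_eq by blast
  let ?J = "LBINT k. gauss (s *\<^sub>R k) * (cmod (FT f k))^2"
  have "complex_of_real ?J = (LBINT k. FT f k * cnj (h k))" unfolding hc by (rule integral_complex_of_real[symmetric])
  also have "\<dots> = (LBINT x. f x * cnj (IF h x))" by (rule FT_adjoint[OF f ih])
  finally have J1: "complex_of_real ?J = (LBINT x. f x * cnj (IF h x))" .
  \<comment> \<open>The inverse transform of a Gaussian times \<open>FT f\<close> is an average of
    translates of \<open>f\<close>. Inversion is not presupposed: the modulated Gaussian
    \<open>hx\<close> is paired with \<open>FT f\<close> through \<open>FT_adjoint\<close>, and its
    transform is explicit.\<close>
  have IFh: "IF h x = complex_of_real (gc TYPE('a)) * (LBINT z. f (x + s *\<^sub>R z) * complex_of_real (gauss z))" for x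
  proof -
    define hx where "hx k = cis (- (k \<bullet> x)) * g k" for k
    have ihx: "integrable lborel hx" unfolding hx_def by (rule integrable_cis[OF ig]) measurable
    have IFx: "IF hx y = complex_of_real (gc TYPE('a) * gauss ((1/s) *\<^sub>R (x - y)) / s ^ DIM('a))" for y
    proof -
      have "IF hx y = (LBINT k. cis (- ((x - y) \<bullet> k)) * complex_of_real (gauss (s *\<^sub>R k)))"
        unfolding IF_def hx_def g_def by (simp add: mult.assoc[symmetric] cis_mult inner_diff_left inner_diff_right inner_commute)
      then show ?thesis using gauss_scale_FT(2)[OF s] by simp
    qed
    have "IF h x = (LBINT k. FT f k * cnj (hx k))"
      unfolding IF_def h_def hx_def g_def by (simp add: cis_cnj mult_ac)
    also have "\<dots> = (LBINT y. f y * cnj (IF hx y))" by (rule FT_adjoint[OF f ihx])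
    also have "\<dots> = (LBINT y. f y * complex_of_real (gc TYPE('a) * gauss ((1/s) *\<^sub>R (x - y)) / s ^ DIM('a)))"
      unfolding IFx by simp
    also have "\<dots> = (LBINT y. f (y + x) * complex_of_real (gc TYPE('a) * gauss ((1/s) *\<^sub>R (x - (y + x))) / s ^ DIM('a)))"
      by (rule integral_translate(1)[symmetric])
    also have "\<dots> = \<bar>s\<bar> ^ DIM('a) *\<^sub>R (LBINT z. f (s *\<^sub>R z + x) * complex_of_real (gc TYPE('a) * gauss ((1/s) *\<^sub>R (x - (s *\<^sub>R z + x))) / s ^ DIM('a)))"
      by (rule integral_scale(1)) (use s in auto)
    also have "(\<lambda>z. f (s *\<^sub>R z + x) * complex_of_real (gc TYPE('a) * gauss ((1/s) *\<^sub>R (x - (s *\<^sub>R z + x))) / s ^ DIM('a)))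
       = (\<lambda>z. complex_of_real (gc TYPE('a) / s ^ DIM('a)) * (f (x + s *\<^sub>R z) * complex_of_real (gauss z)))"
      using s by (simp add: fun_eq_iff gauss_bounds add.commute)
    finally show ?thesis using s by (simp add: scaleR_conv_of_real)
  qed
  define N where "N = L2sq f"
  define D where "D w = L2sq (\<lambda>x. f (x + w) - f x)" for w
  have J2: "complex_of_real ?J = complex_of_real (gc TYPE('a)) * (LBINT x. (LBINT z. f x * cnj (f (x + s *\<^sub>R z)) * complex_of_real (gauss z)))"
  proof -
    have "f x * cnj (IF h x) = complex_of_real (gc TYPE('a)) * (LBINT z. f x * cnj (f (x + s *\<^sub>R z)) * complex_of_real (gauss z))" for x
    proof -
      have "cnj (LBINT z. f (x + s *\<^sub>R z) * complex_of_real (gauss z)) = (LBINT z. cnj (f (x + s *\<^sub>R z)) * complex_of_real (gauss z))"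
        by (simp flip: Bochner_Integration.integral_cnj)
      then have "f x * cnj (IF h x) = complex_of_real (gc TYPE('a)) * (f x * (LBINT z. cnj (f (x + s *\<^sub>R z)) * complex_of_real (gauss z)))"
        unfolding IFh complex_cnj_mult complex_cnj_complex_of_real by simp
      also have "f x * (LBINT z. cnj (f (x + s *\<^sub>R z)) * complex_of_real (gauss z)) = (LBINT z. f x * cnj (f (x + s *\<^sub>R z)) * complex_of_real (gauss z))"
        unfolding mult.assoc by (rule integral_mult_right_zero[symmetric])
      finally show ?thesis .
    qed
    then show ?thesis unfolding J1 by simp
  qed
  \<comment> \<open>Polarisation: the real part of f times the conjugate of its translate is half of
    |f|^2 plus the square of the translate minus the square of the difference, and the translate has
    the same norm as \<open>f\<close>.\<close>
  have A: "integrable lborel (\<lambda>x. f x * cnj (f (x + w)))" "Re (LBINT x. f x * cnj (f (x + w))) = N - D w / 2"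
    "(LBINT x. cmod (f x * cnj (f (x + w)))) \<le> N" "D w \<le> 4 * N" "D w \<ge> 0" for w
  proof -
    have fw: "sqint (\<lambda>x. f (x + w))" by (rule sqint_translate[OF f2])
    show i: "integrable lborel (\<lambda>x. f x * cnj (f (x + w)))" by (rule sqint_mult_integrable(2)[OF f2 fw])
    have Nw: "L2sq (\<lambda>x. f (x + w)) = N" unfolding N_def by (rule integral_translate(1))
    note ii = sqint_int[OF f2] sqint_int[OF fw] sqint_int[OF sqint_diff[OF fw f2]]
    have "Re (LBINT x. f x * cnj (f (x + w))) = (LBINT x. Re (f x * cnj (f (x + w))))" by (rule integral_Re[OF i, symmetric])
    also have "\<dots> = (LBINT x. ((cmod (f x))^2 + (cmod (f (x + w)))^2 - (cmod (f (x + w) - f x))^2) / 2)"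
      by (intro integral_cong refl) (simp only: cmod_power2, simp add: power2_eq_square algebra_simps)
    also have "\<dots> = N - D w / 2" using ii Nw by (simp add: N_def D_def)
    finally show "Re (LBINT x. f x * cnj (f (x + w))) = N - D w / 2" .
    have "(LBINT x. cmod (f x * cnj (f (x + w)))) \<le> (LBINT x. ((cmod (f x))^2 + (cmod (f (x + w)))^2) / 2)"
    proof (rule integral_mono)
      show "cmod (f x * cnj (f (x + w))) \<le> ((cmod (f x))^2 + (cmod (f (x + w)))^2) / 2" for x
        using sum_squares_bound[of "cmod (f x)" "cmod (f (x + w))"] by (simp add: norm_mult)
    qed (use i ii in auto)
    also have "\<dots> = N" using ii Nw by (simp add: N_def)
    finally show "(LBINT x. cmod (f x * cnj (f (x + w)))) \<le> N" .
    show "D w \<le> 4 * N" using L2_triangle[OF fw sqint_zero f2] Nw by (simp add: N_def D_def)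
    show "D w \<ge> 0" unfolding D_def by (auto intro!: integral_nonneg_AE)
  qed
  define F where "F z x = f x * cnj (f (x + s *\<^sub>R z)) * complex_of_real (gauss z)" for z x
  have Fm: "case_prod F \<in> borel_measurable (lborel \<Otimes>\<^sub>M lborel)" unfolding F_def by measurable
  have iF: "integrable (lborel \<Otimes>\<^sub>M lborel) (case_prod F)"
  proof (rule lborel_pair.Fubini_integrable[OF Fm])
    have e: "(LBINT x. norm (case (z, x) of (z, x) \<Rightarrow> F z x)) = gauss z * (LBINT x. cmod (f x * cnj (f (x + s *\<^sub>R z))))" for z
      unfolding F_def by (simp add: norm_mult gauss_bounds(1) less_imp_le mult_ac)
    show "integrable lborel (\<lambda>z. LBINT x. norm (case (z, x) of (z, x) \<Rightarrow> F z x))"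
    proof (rule integrable_bound)
      show "integrable lborel (\<lambda>z::'a. N * gauss z)" using gauss_FT(1)[where 'a='a] by simp
      show "(\<lambda>z. LBINT x. norm (case (z, x) of (z, x) \<Rightarrow> F z x)) \<in> borel_measurable lborel"
        using Fm by (intro sigma_finite_measure.borel_measurable_lebesgue_integral[OF sigma_finite_lborel]) (auto simp: case_prod_beta)
      show "AE z in lborel. norm (LBINT x. norm (case (z, x) of (z, x) \<Rightarrow> F z x)) \<le> norm (N * gauss z)"
      proof (rule AE_I2)
        fix z
        have "gauss z * (LBINT x. cmod (f x * cnj (f (x + s *\<^sub>R z)))) \<le> gauss z * N"
          by (intro mult_left_mono A(3) less_imp_le gauss_bounds(1))
        moreover have "0 \<le> gauss z * (LBINT x. cmod (f x * cnj (f (x + s *\<^sub>R z))))"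
          by (intro mult_nonneg_nonneg less_imp_le[OF gauss_bounds(1)] integral_nonneg_AE) auto
        ultimately show "norm (LBINT x. norm (case (z, x) of (z, x) \<Rightarrow> F z x)) \<le> norm (N * gauss z)"
          unfolding e by (simp add: mult.commute)
      qed
    qed
    show "AE z in lborel. integrable lborel (\<lambda>x. case (z, x) of (z, x) \<Rightarrow> F z x)"
      unfolding F_def using A(1) by simp
  qed
  have "(LBINT x. (LBINT z. F z x)) = (LBINT z. (LBINT x. F z x))"
    by (rule lborel_pair.Fubini_integral[OF iF])
  moreover have iz: "integrable lborel (\<lambda>z. LBINT x. F z x)"
    using lborel_pair.integrable_fst[OF iF] .
  ultimately have "Re (LBINT x. (LBINT z. F z x)) = (LBINT z. Re (LBINT x. F z x))" by simp
  also have "\<dots> = (LBINT z. gauss z * (N - D (s *\<^sub>R z) / 2))"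
  proof (intro integral_cong refl)
    fix z
    have "(LBINT x. F z x) = (LBINT x. f x * cnj (f (x + s *\<^sub>R z))) * complex_of_real (gauss z)"
      unfolding F_def by simp
    then show "Re (LBINT x. F z x) = gauss z * (N - D (s *\<^sub>R z) / 2)"
      by (simp add: A(2))
  qed
  finally have "Re (LBINT x. (LBINT z. F z x)) = \<dots>" .
  moreover have "?J = gc TYPE('a) * Re (LBINT x. (LBINT z. F z x))"
    using arg_cong[OF J2, of Re] by (simp add: F_def)
  ultimately show "?J = gc TYPE('a) * (LBINT z. gauss z * (L2sq f - L2sq (\<lambda>x. f (x + s *\<^sub>R z) - f x) / 2))"
    by (simp add: N_def D_def)
qed

text \<open>As s decreases to 0, the right-hand side of \<open>FT_regularised\<close> converges by
  continuity of translations and dominated convergence, while the left integrand increases to |FT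
  f|^2. Monotone convergence thus gives integrability together with the value.\<close>

theorem plancherel:
  fixes f :: "'a::euclidean_space \<Rightarrow> complex"
  assumes f: "integrable lborel f" and f2: "sqint f"
  shows "sqint (FT f)" "L2sq (FT f) = (gc TYPE('a))^2 * L2sq f"
proof -
  note [measurable] = sqint_meas[OF f2] FT_borel(1,2)[OF f]
  define s where "s m = inverse (real (Suc m))" for m
  have s: "s m > 0" for m by (simp add: s_def)
  have s0: "s \<longlonglongrightarrow> 0" unfolding s_def[abs_def] by (rule LIMSEQ_inverse_real_of_nat)
  define N where "N = L2sq f"
  define D where "D w = L2sq (\<lambda>x. f (x + w) - f x)" for w
  have D0: "(\<lambda>m. D (s m *\<^sub>R z)) \<longlonglongrightarrow> 0" for z
  proof -
    have "(\<lambda>m. s m *\<^sub>R z) \<longlonglongrightarrow> 0 *\<^sub>R z" by (intro tendsto_intros s0)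
    then show ?thesis unfolding D_def using sqint_translation_continuous[OF f2] by simp
  qed
  have Db: "0 \<le> D w" "D w \<le> 4 * N" for w
  proof -
    have fw: "sqint (\<lambda>x. f (x + w))" by (rule sqint_translate[OF f2])
    have Nw: "L2sq (\<lambda>x. f (x + w)) = N" unfolding N_def by (rule integral_translate(1))
    show "0 \<le> D w" unfolding D_def by (auto intro!: integral_nonneg_AE)
    show "D w \<le> 4 * N" using L2_triangle[OF fw sqint_zero f2] Nw by (simp add: N_def D_def)
  qed
  have Dm: "(\<lambda>z. D (c *\<^sub>R z)) \<in> borel_measurable borel" for c
    unfolding D_def by (intro sigma_finite_measure.borel_measurable_lebesgue_integral[OF sigma_finite_lborel]) measurable
  define J where "J m = (LBINT k. gauss (s m *\<^sub>R k) * (cmod (FT f k))^2)" for m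
  have J: "J m = gc TYPE('a) * (LBINT z. gauss z * (N - D (s m *\<^sub>R z) / 2))" for m
    unfolding J_def N_def D_def by (rule FT_regularised(2)[OF f f2 s])
  have "(\<lambda>m. LBINT z. gauss z * (N - D (s m *\<^sub>R z) / 2)) \<longlonglongrightarrow> (LBINT z. gauss (z::'a) * N)"
  proof (rule integral_dominated_convergence[where w="\<lambda>z. gauss z * N"])
    show "integrable lborel (\<lambda>z::'a. gauss z * N)" using gauss_FT(1)[where 'a='a] by simp
    show "AE z in lborel. (\<lambda>m. gauss z * (N - D (s m *\<^sub>R z) / 2)) \<longlonglongrightarrow> gauss z * N"
    proof (rule AE_I2)
      fix z
      have "(\<lambda>m. gauss z * (N - D (s m *\<^sub>R z) / 2)) \<longlonglongrightarrow> gauss z * (N - 0 / 2)" by (intro tendsto_intros D0) simp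
      then show "(\<lambda>m. gauss z * (N - D (s m *\<^sub>R z) / 2)) \<longlonglongrightarrow> gauss z * N" by simp
    qed
    show "AE z in lborel. norm (gauss z * (N - D (s m *\<^sub>R z) / 2)) \<le> gauss z * N" for m
    proof (rule AE_I2)
      fix z
      have "\<bar>N - D (s m *\<^sub>R z) / 2\<bar> \<le> N" using Db[of "s m *\<^sub>R z"] by (auto simp: abs_le_iff)
      then show "norm (gauss z * (N - D (s m *\<^sub>R z) / 2)) \<le> gauss z * N"
        using gauss_bounds(1)[of z] by (simp add: abs_mult mult_left_mono)
    qed
  qed (use Dm in auto)
  then have "J \<longlonglongrightarrow> gc TYPE('a) * (LBINT z. gauss (z::'a) * N)" unfolding J[abs_def] by (intro tendsto_intros)
  then have Jl: "(\<lambda>m. LBINT k. gauss (s m *\<^sub>R k) * (cmod (FT f k))^2) \<longlonglongrightarrow> (gc TYPE('a))^2 * N"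
    unfolding J_def[abs_def] by (simp add: gauss_integral power2_eq_square mult_ac)
  have mono: "mono (\<lambda>m. gauss (s m *\<^sub>R k) * (cmod (FT f k))^2)" for k
  proof (rule monoI, rule mult_right_mono)
    fix m m' :: nat assume "m \<le> m'"
    then have "s m' \<le> s m" by (simp add: s_def)
    then have "norm (s m' *\<^sub>R k) \<le> norm (s m *\<^sub>R k)" using s[of m'] s[of m] by (simp add: mult_right_mono)
    then show "gauss (s m *\<^sub>R k) \<le> gauss (s m' *\<^sub>R k)" by (simp add: gauss_def power_mono)
  qed simp
  have lim: "(\<lambda>m. gauss (s m *\<^sub>R k) * (cmod (FT f k))^2) \<longlonglongrightarrow> (cmod (FT f k))^2" for k
  proof -
    have "(\<lambda>m. exp (- ((norm (s m *\<^sub>R k))^2) / 2) * (cmod (FT f k))^2) \<longlonglongrightarrow> exp (- ((norm (0 *\<^sub>R k))^2) / 2) * (cmod (FT f k))^2"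
      by (intro tendsto_intros s0) simp
    then show ?thesis by (simp add: gauss_def)
  qed
  have hb: "has_bochner_integral lborel (\<lambda>k. (cmod (FT f k))^2) ((gc TYPE('a))^2 * N)"
    by (rule has_bochner_integral_monotone_convergence[OF FT_regularised(1)[OF f f2 s] AE_I2[OF mono] AE_I2[OF lim] Jl]) measurable
  show "sqint (FT f)" "L2sq (FT f) = (gc TYPE('a))^2 * L2sq f"
    using hb by (auto simp: sqint_def has_bochner_integral_iff N_def)
qed

lemma IF_eq_FT: "IF f x = FT f (- x)"
  unfolding IF_def FT_def by (simp add: inner_commute)

lemma plancherel_IF:
  fixes h :: "'a::euclidean_space \<Rightarrow> complex"
  assumes h: "integrable lborel h" and h2: "sqint h"
  shows "sqint (IF h)" "L2sq (IF h) = (gc TYPE('a))^2 * L2sq h"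
proof -
  note s = plancherel[OF h h2]
  have m: "(\<lambda>k. (cmod (FT h k))^2) \<in> borel_measurable borel" using FT_borel(1)[OF h] by measurable
  have "integrable lborel (\<lambda>x. (cmod (FT h (- x)))^2)"
    using integral_scale(2)[OF _ m, of "-1"] sqint_int[OF s(1)] by simp
  moreover have "L2sq (\<lambda>x. FT h (- x)) = L2sq (FT h)"
    using integral_scale(1)[OF _ m, of "-1"] by simp
  ultimately show "sqint (IF h)" "L2sq (IF h) = (gc TYPE('a))^2 * L2sq h"
    using s(2) FT_borel(2)[OF h] by (simp_all add: sqint_def IF_eq_FT)
qed

lemma integral_cmod_diff_sq:
  assumes "sqint f" "sqint g"
  shows "L2sq (\<lambda>x. f x - g x) = L2sq f + L2sq g - 2 * Re (LBINT x. f x * cnj (g x))"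
proof -
  note i = sqint_mult_integrable(2)[OF assms]
  have "L2sq (\<lambda>x. f x - g x) = (LBINT x. (cmod (f x))^2 + (cmod (g x))^2 - 2 * Re (f x * cnj (g x)))"
    by (intro integral_cong refl) (simp only: cmod_power2, simp add: power2_eq_square algebra_simps)
  also have "\<dots> = (LBINT x. (cmod (f x))^2 + (cmod (g x))^2) - (LBINT x. 2 * Re (f x * cnj (g x)))"
    by (rule Bochner_Integration.integral_diff)
      (intro Bochner_Integration.integrable_add integrable_mult_right integrable_Re i sqint_int assms)+
  also have "(LBINT x. 2 * Re (f x * cnj (g x))) = 2 * Re (LBINT x. f x * cnj (g x))"
    unfolding integral_Re[OF i, symmetric] by (rule integral_mult_right_zero)
  also have "(LBINT x. (cmod (f x))^2 + (cmod (g x))^2) = L2sq f + L2sq g"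
    by (intro Bochner_Integration.integral_add sqint_int assms)
  finally show ?thesis .
qed

text \<open>A substitute for the inversion theorem: it compares \<open>v\<close> with the inverse
  transform of any \<open>h\<close> without knowing whether \<open>h\<close> equals
  \<open>FT v\<close>. Both squares are expanded; the norms agree by Plancherel and the cross terms
  by \<open>FT_adjoint\<close>.\<close>

lemma FT_isometry:
  fixes v h :: "'a::euclidean_space \<Rightarrow> complex"
  assumes v: "integrable lborel v" "sqint v" and h: "integrable lborel h" "sqint h"
  defines "C \<equiv> (gc TYPE('a))^2"
  shows "L2sq (\<lambda>x. v x - IF h x / C) = L2sq (\<lambda>k. FT v k - h k) / C"
proof -
  have C: "C > 0" using gc_pos[where 'a='a] by (simp add: C_def)
  have si: "sqint (\<lambda>x. IF h x / C)" using sqint_scale[OF plancherel_IF(1)[OF h], of "1 / C"] by simp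
  have "(LBINT x. v x * cnj (IF h x / C)) = (LBINT x. v x * cnj (IF h x)) / C" by simp
  also have "\<dots> = (LBINT k. FT v k * cnj (h k)) / C" by (simp add: FT_adjoint[OF v(1) h(1)])
  finally have a: "Re (LBINT x. v x * cnj (IF h x / C)) = Re (LBINT k. FT v k * cnj (h k)) / C"
    by (metis Re_divide_of_real)
  have n: "L2sq (\<lambda>x. IF h x / C) = L2sq h / C"
    using plancherel_IF(2)[OF h] C by (simp add: norm_divide power_divide C_def[symmetric]) (simp add: power2_eq_square)
  show ?thesis
    unfolding integral_cmod_diff_sq[OF v(2) si] integral_cmod_diff_sq[OF plancherel(1)[OF v] h(2)] plancherel(2)[OF v] a n C_def[symmetric]
    using C by (simp add: field_simps)
qed

section \<open>Differentiation and the Fourier transform\<close>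

lemma cis_taylor: "cmod (cis t - 1 - \<i> * t) \<le> t^2"
proof -
  have "2 * cmod (cis t - 1 - \<i> * t) \<le> t^2"
    using iexp_approx1[of t 1] by (simp add: cis_conv_exp algebra_simps power2_eq_square)
  then show ?thesis using norm_ge_zero[of "cis t - 1 - \<i> * t"] by linarith
qed

lemma norm_sq_Basis: "(\<Sum>b\<in>Basis. (k \<bullet> b)^2) = (norm k)^2"
  unfolding power2_norm_eq_inner euclidean_inner[of k k] by (simp add: power2_eq_square)

lemma integrable_weighted:
  fixes h :: "'a::euclidean_space \<Rightarrow> complex"
  assumes h: "integrable lborel h" "\<And>k. norm k > M \<Longrightarrow> h k = 0"
    and p: "p \<in> borel_measurable borel" "\<And>k. norm k \<le> M \<Longrightarrow> cmod (p k) \<le> B"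
  shows "integrable lborel (\<lambda>k. p k * h k)"
proof (rule integrable_bound)
  note [measurable] = p(1)
  show "integrable lborel (\<lambda>k. B * cmod (h k))" using h(1) by simp
  show "(\<lambda>k. p k * h k) \<in> borel_measurable lborel" using borel_measurable_integrable[OF h(1)] by simp
  show "AE k in lborel. norm (p k * h k) \<le> norm (B * cmod (h k))"
  proof (rule AE_I2)
    fix k show "norm (p k * h k) \<le> norm (B * cmod (h k))"
    proof (cases "norm k \<le> M")
      case True
      from p(2)[OF this] have "cmod (p k) * cmod (h k) \<le> \<bar>B\<bar> * cmod (h k)" by (intro mult_right_mono) auto
      then show ?thesis by (simp add: norm_mult abs_mult)
    qed (use h(2) in simp)
  qed
qed

text \<open>On frequencies of modulus at most \<open>M\<close> the Taylor remainder of the character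
  is at most (M |y - x|)^2, so it can be integrated against |h|.\<close>

lemma IF_has_derivative:
  fixes h :: "'a::euclidean_space \<Rightarrow> complex"
  assumes h: "integrable lborel h" "\<And>k. norm k > M \<Longrightarrow> h k = 0"
  shows "(IF h has_derivative (\<lambda>y. IF (\<lambda>k. \<i> * complex_of_real (k \<bullet> y) * h k) x)) (at x)"
proof -
  have ip: "integrable lborel (\<lambda>k. \<i> * complex_of_real (k \<bullet> y) * h k)" for y
  proof (rule integrable_weighted[OF h, where B = "M * norm y"])
    fix k :: 'a assume "norm k \<le> M"
    then have "norm k * norm y \<le> M * norm y" by (intro mult_right_mono) auto
    then show "cmod (\<i> * complex_of_real (k \<bullet> y)) \<le> M * norm y"
      using Cauchy_Schwarz_ineq2[of k y] by (simp add: norm_mult)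
  qed auto
  note ic = integrable_cis[OF ip] and ih = integrable_cis[OF h(1)]
  define B where "B = (LBINT k. cmod (h k))"
  have B: "B \<ge> 0" unfolding B_def by (auto intro!: integral_nonneg_AE)
  have bd: "cmod (IF (\<lambda>k. \<i> * complex_of_real (k \<bullet> y) * h k) x) \<le> norm y * (\<bar>M\<bar> * B)" for y
  proof -
    have "cmod (IF (\<lambda>k. \<i> * complex_of_real (k \<bullet> y) * h k) x) \<le> (LBINT k. cmod (\<i> * complex_of_real (k \<bullet> y) * h k))"
      by (rule FT_borel(4)[OF ip])
    also have "\<dots> \<le> (LBINT k. norm y * \<bar>M\<bar> * cmod (h k))"
    proof (rule integral_mono)
      fix k show "cmod (\<i> * complex_of_real (k \<bullet> y) * h k) \<le> norm y * \<bar>M\<bar> * cmod (h k)"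
      proof (cases "norm k \<le> M")
        case True
        then have "norm k * norm y \<le> \<bar>M\<bar> * norm y" by (intro mult_right_mono) auto
        then have "\<bar>k \<bullet> y\<bar> * cmod (h k) \<le> norm y * \<bar>M\<bar> * cmod (h k)"
          using Cauchy_Schwarz_ineq2[of k y] by (intro mult_right_mono) (auto simp: mult.commute)
        then show ?thesis by (simp add: norm_mult)
      qed (use h(2) in simp)
    qed (use integrable_norm[OF ip] h(1) in auto)
    finally show ?thesis by (simp add: B_def mult.assoc)
  qed
  have lin: "bounded_linear (\<lambda>y. IF (\<lambda>k. \<i> * complex_of_real (k \<bullet> y) * h k) x)"
  proof (rule bounded_linear_intro[OF _ _ bd])
    show "IF (\<lambda>k. \<i> * complex_of_real (k \<bullet> (y + z)) * h k) x = IF (\<lambda>k. \<i> * complex_of_real (k \<bullet> y) * h k) x + IF (\<lambda>k. \<i> * complex_of_real (k \<bullet> z) * h k) x" for y z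
      unfolding IF_def by (subst Bochner_Integration.integral_add[OF ic ic, symmetric]) (auto simp: inner_add_right algebra_simps)
    show "IF (\<lambda>k. \<i> * complex_of_real (k \<bullet> (r *\<^sub>R y)) * h k) x = r *\<^sub>R IF (\<lambda>k. \<i> * complex_of_real (k \<bullet> y) * h k) x" for r y
      unfolding IF_def by (subst integral_scaleR_right[symmetric]) (auto simp: scaleR_conv_of_real mult_ac)
  qed
  show ?thesis
  proof (rule has_derivativeI_sandwich[where e=1 and H="\<lambda>y. M^2 * B * norm (y - x)"])
    show "((\<lambda>y. M^2 * B * norm (y - x)) \<longlongrightarrow> 0) (at x)"
      by (intro tendsto_eq_intros) auto
    fix y assume "y \<noteq> x"
    have "cmod (IF h y - IF h x - IF (\<lambda>k. \<i> * complex_of_real (k \<bullet> (y - x)) * h k) x)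
        = cmod (LBINT k. cis (k \<bullet> x) * (cis (k \<bullet> (y - x)) - 1 - \<i> * complex_of_real (k \<bullet> (y - x))) * h k)"
    proof -
      have "IF h y - IF h x - IF (\<lambda>k. \<i> * complex_of_real (k \<bullet> (y - x)) * h k) x
        = (LBINT k. cis (k \<bullet> y) * h k - cis (k \<bullet> x) * h k - cis (k \<bullet> x) * (\<i> * complex_of_real (k \<bullet> (y - x)) * h k))"
      proof -
        have "integrable lborel (\<lambda>k. cis (k \<bullet> y) * h k)" "integrable lborel (\<lambda>k. cis (k \<bullet> x) * h k)"
          "integrable lborel (\<lambda>k. cis (k \<bullet> x) * (\<i> * complex_of_real (k \<bullet> (y - x)) * h k))"
          by (intro ih ic, measurable)+
        then show ?thesis unfolding IF_def by (simp only: Bochner_Integration.integral_diff Bochner_Integration.integrable_diff)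
      qed
      also have "\<dots> = (LBINT k. cis (k \<bullet> x) * (cis (k \<bullet> (y - x)) - 1 - \<i> * complex_of_real (k \<bullet> (y - x))) * h k)"
        by (intro integral_cong refl) (simp add: right_diff_distrib cis_mult inner_diff_right algebra_simps)
      finally show ?thesis by simp
    qed
    also have "\<dots> \<le> (LBINT k. M^2 * (norm (y - x))^2 * cmod (h k))"
    proof (rule Bochner_Integration.integral_norm_bound_integral)
      show "integrable lborel (\<lambda>k. M^2 * (norm (y - x))^2 * cmod (h k))" using h(1) by simp
      show "integrable lborel (\<lambda>k. cis (k \<bullet> x) * (cis (k \<bullet> (y - x)) - 1 - \<i> * complex_of_real (k \<bullet> (y - x))) * h k)"
      proof -
        have "integrable lborel (\<lambda>k. cis (k \<bullet> x) * (cis (k \<bullet> (y - x)) * h k - h k - \<i> * complex_of_real (k \<bullet> (y - x)) * h k))"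
          by (intro integrable_cis Bochner_Integration.integrable_diff h(1) ip) measurable
        then show ?thesis by (simp add: algebra_simps)
      qed
      fix k
      show "cmod (cis (k \<bullet> x) * (cis (k \<bullet> (y - x)) - 1 - \<i> * complex_of_real (k \<bullet> (y - x))) * h k) \<le> M^2 * (norm (y - x))^2 * cmod (h k)"
      proof (cases "norm k \<le> M")
        case True
        then have "norm k * norm (y - x) \<le> M * norm (y - x)" by (intro mult_right_mono) auto
        then have "\<bar>k \<bullet> (y - x)\<bar> \<le> M * norm (y - x)" using Cauchy_Schwarz_ineq2[of k "y - x"] by linarith
        then have "\<bar>k \<bullet> (y - x)\<bar>^2 \<le> (M * norm (y - x))^2" by (rule power_mono) simp
        then have "cmod (cis (k \<bullet> (y - x)) - 1 - \<i> * complex_of_real (k \<bullet> (y - x))) \<le> M^2 * (norm (y - x))^2"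
          using cis_taylor[of "k \<bullet> (y - x)"] by (simp add: power_mult_distrib)
        then show ?thesis by (simp add: norm_mult mult_right_mono)
      qed (use h(2) in simp)
    qed
    also have "\<dots> = M^2 * B * norm (y - x) * norm (y - x)" unfolding integral_mult_right_zero B_def[symmetric] by (simp add: power2_eq_square)
    finally show "norm (IF h y - IF h x - IF (\<lambda>k. \<i> * complex_of_real (k \<bullet> (y - x)) * h k) x) / norm (y - x) \<le> M^2 * B * norm (y - x)"
      using \<open>y \<noteq> x\<close> by (simp add: divide_le_eq)
  qed (use lin in auto)
qed

lemma IF_C2:
  fixes h :: "'a::euclidean_space \<Rightarrow> complex"
  assumes h: "integrable lborel h" "\<And>k. norm k > M \<Longrightarrow> h k = 0"
  shows "C2_on UNIV (IF h)" "lap (IF h) = IF (\<lambda>k. - complex_of_real ((norm k)^2) * h k)"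
    "integrable lborel (\<lambda>k. - complex_of_real ((norm k)^2) * h k)"
proof -
  \<comment> \<open>\<open>m b\<close> is the symbol of the partial derivative along
    \<open>b\<close>. Bounded support is preserved by it, so differentiation can be repeated, and
    second derivatives commute because the multiplications do.\<close>
  define m where "m b g k = \<i> * complex_of_real (k \<bullet> b) * g k" for b :: 'a and g :: "'a \<Rightarrow> complex" and k
  define ok where "ok g \<longleftrightarrow> integrable lborel g \<and> (\<forall>k. norm k > M \<longrightarrow> g k = 0)" for g :: "'a \<Rightarrow> complex"
  have okm: "ok (m b g)" if "ok g" for b g
  proof -
    have g: "integrable lborel g" "\<And>k. norm k > M \<Longrightarrow> g k = 0" using that by (auto simp: ok_def)
    have "integrable lborel (m b g)" unfolding m_def
    proof (rule integrable_weighted[OF g, where B = "M * norm b"])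
      fix k :: 'a assume "norm k \<le> M"
      then have "norm k * norm b \<le> M * norm b" by (intro mult_right_mono) auto
      then show "cmod (\<i> * complex_of_real (k \<bullet> b)) \<le> M * norm b"
        using Cauchy_Schwarz_ineq2[of k b] by (simp add: norm_mult)
    qed auto
    then show ?thesis using g(2) by (auto simp: ok_def m_def)
  qed
  have d: "(IF g has_derivative (\<lambda>y. IF (m y g) x)) (at x)" if "ok g" for g x
    unfolding m_def by (rule IF_has_derivative[where M=M]) (use that in \<open>auto simp: ok_def\<close>)
  have pd: "pd b (IF g) = IF (m b g)" if "ok g" for b g
    using pd_eqI[OF d[OF that]] by (rule ext)
  have df: "IF g differentiable at x" if "ok g" for g x using d[OF that] by (rule differentiableI)
  have cont: "continuous_on UNIV (IF g)" if "ok g" for g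
    using df[OF that] by (simp add: continuous_at_imp_continuous_on differentiable_imp_continuous_within)
  have C1: "C1_on UNIV (IF g)" if "ok g" for g
    unfolding C1_on_def using df[OF that] cont okm[OF that] pd[OF that] by simp
  have okh: "ok h" using h by (auto simp: ok_def)
  have mm: "m b (m c g) = m c (m b g)" for b c g by (simp add: m_def fun_eq_iff mult_ac)
  show "C2_on UNIV (IF h)" unfolding C2_on_def
    using C1[OF okh] C1 okm okh by (simp add: pd mm)
  have s: "(\<Sum>b\<in>Basis. m b (m b h) k) = - complex_of_real ((norm k)^2) * h k" for k
  proof -
    have "(\<Sum>b\<in>Basis. m b (m b h) k) = (\<Sum>b\<in>Basis. - complex_of_real ((k \<bullet> b)^2) * h k)"
      by (simp add: m_def power2_eq_square mult_ac)
    also have "\<dots> = - complex_of_real (\<Sum>b\<in>Basis. (k \<bullet> b)^2) * h k" by (simp add: sum_distrib_right sum_negf)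
    also have "(\<Sum>b\<in>Basis. (k \<bullet> b)^2) = (norm k)^2"
      by (rule norm_sq_Basis)
    finally show ?thesis .
  qed
  have im: "integrable lborel (m b (m b h))" for b using okm[OF okm[OF okh]] by (auto simp: ok_def)
  show "integrable lborel (\<lambda>k. - complex_of_real ((norm k)^2) * h k)"
    unfolding s[symmetric] by (rule Bochner_Integration.integrable_sum[OF im])
  show "lap (IF h) = IF (\<lambda>k. - complex_of_real ((norm k)^2) * h k)"
  proof
    fix x
    have "lap (IF h) x = (\<Sum>b\<in>Basis. IF (m b (m b h)) x)" unfolding lap_def by (simp add: pd okm okh)
    also have "\<dots> = (LBINT k. (\<Sum>b\<in>Basis. cis (k \<bullet> x) * m b (m b h) k))"
      unfolding IF_def by (rule Bochner_Integration.integral_sum[symmetric]) (intro integrable_cis im, measurable)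
    also have "\<dots> = IF (\<lambda>k. - complex_of_real ((norm k)^2) * h k) x"
      unfolding IF_def sum_distrib_left[symmetric] s ..
    finally show "lap (IF h) x = IF (\<lambda>k. - complex_of_real ((norm k)^2) * h k) x" .
  qed
qed

lemma FT_pd:
  fixes v :: "'a::euclidean_space \<Rightarrow> complex"
  assumes v: "C1_on UNIV v" "\<And>x. x \<notin> ball 0 R \<Longrightarrow> v x = 0" and b: "b \<in> Basis"
  shows "FT (pd b v) k = \<i> * complex_of_real (k \<bullet> b) * FT v k"
proof -
  define e where "e x = cis (- (k \<bullet> x))" for x
  have de: "(e has_derivative (\<lambda>y. - \<i> * complex_of_real (k \<bullet> y) * e x)) (at x)" for x
  proof -
    have g: "((\<lambda>x. \<i> * complex_of_real (- (k \<bullet> x))) has_derivative (\<lambda>y. \<i> * complex_of_real (- (k \<bullet> y)))) (at x)"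
      by (auto intro!: derivative_eq_intros)
    show ?thesis using has_derivative_compose[OF g DERIV_exp[unfolded has_field_derivative_def]]
      unfolding e_def cis_conv_exp by (simp add: mult_ac)
  qed
  have ee: "pd b e = (\<lambda>x. - \<i> * complex_of_real (k \<bullet> b) * e x)" for b using pd_eqI[OF de] by (rule ext)
  have ce: "continuous_on UNIV e" unfolding e_def cis_conv_exp by (intro continuous_intros)
  have C1e: "C1_on UNIV e" unfolding C1_on_def ee
    using differentiableI[OF de] ce by (auto intro!: continuous_intros)
  have z: "(LBINT x. pd b (\<lambda>x. e x * v x) x) = 0"
    by (rule integral_pd_zero[OF C1_on_mult[OF open_UNIV C1e v(1)] _ b, of R]) (use v(2) in auto)
  have cv: "continuous_on UNIV v" by (rule C1_on_continuous[OF v(1)])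
  have cp: "continuous_on UNIV (pd b v)" by (rule C1_on_continuous_pd[OF v(1) b])
  have pz: "pd b v x = 0" if "x \<notin> ball 0 (\<bar>R\<bar> + 1)" for x
    by (rule pd_zero_outside[of "cball 0 \<bar>R\<bar>"]) (use that v(2) in \<open>auto simp: dist_norm\<close>)
  have i1: "integrable lborel (\<lambda>x. e x * pd b v x)"
    by (rule integrable_compact_support[of _ "\<bar>R\<bar> + 1"]) (auto intro!: continuous_intros ce cp simp: pz)
  have i2: "integrable lborel (\<lambda>x. - \<i> * complex_of_real (k \<bullet> b) * (e x * v x))"
    by (rule integrable_compact_support[of _ R]) (auto intro!: continuous_intros ce cv simp: v(2))
  have "pd b (\<lambda>x. e x * v x) x = e x * pd b v x + - \<i> * complex_of_real (k \<bullet> b) * (e x * v x)" for x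
    using pd_mult[OF C1_onD[OF C1e] C1_onD[OF v(1)], of x b] by (simp add: ee)
  then have "(LBINT x. e x * pd b v x) + (LBINT x. - \<i> * complex_of_real (k \<bullet> b) * (e x * v x)) = 0"
    using z i1 i2 by (simp only: Bochner_Integration.integral_add)
  then show ?thesis unfolding FT_def e_def[symmetric] by (simp add: eq_neg_iff_add_eq_0)
qed

lemma FT_lap:
  fixes v :: "'a::euclidean_space \<Rightarrow> complex"
  assumes v: "C2_on UNIV v" "\<And>x. x \<notin> ball 0 R \<Longrightarrow> v x = 0"
  shows "FT (lap v) k = - complex_of_real ((norm k)^2) * FT v k"
proof -
  have pz: "pd b v x = 0" if "x \<notin> ball 0 (\<bar>R\<bar> + 1)" for x b
    by (rule pd_zero_outside[of "cball 0 \<bar>R\<bar>"]) (use that v(2) in \<open>auto simp: dist_norm\<close>)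
  have pz2: "pd b (pd b v) x = 0" if "x \<notin> ball 0 (\<bar>R\<bar> + 2)" for x b
    by (rule pd_zero_outside[of "cball 0 (\<bar>R\<bar> + 1)"]) (use that pz in \<open>auto simp: dist_norm\<close>)
  have i: "integrable lborel (\<lambda>x. cis (- (k \<bullet> x)) * pd b (pd b v) x)" if "b \<in> Basis" for b
    by (rule integrable_cis, rule integrable_compact_support[of _ "\<bar>R\<bar> + 2"])
      (use C1_on_continuous_pd[OF C2_C1_pd[OF v(1)]] that pz2 in auto)
  have "FT (lap v) k = (\<Sum>b\<in>Basis. FT (pd b (pd b v)) k)"
    unfolding FT_def lap_def sum_distrib_left by (rule Bochner_Integration.integral_sum[OF i])
  also have "\<dots> = (\<Sum>b\<in>Basis. - complex_of_real ((k \<bullet> b)^2) * FT v k)"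
  proof (rule sum.cong[OF refl])
    fix b :: 'a assume b: "b \<in> Basis"
    have "FT (pd b (pd b v)) k = \<i> * complex_of_real (k \<bullet> b) * FT (pd b v) k"
      by (rule FT_pd[OF C2_C1_pd[OF v(1) b] pz b]) simp
    also have "FT (pd b v) k = \<i> * complex_of_real (k \<bullet> b) * FT v k"
      by (rule FT_pd[OF C2_C1[OF v(1)] v(2) b])
    finally show "FT (pd b (pd b v)) k = - complex_of_real ((k \<bullet> b)^2) * FT v k"
      by (simp add: power2_eq_square mult_ac)
  qed
  also have "\<dots> = - complex_of_real (\<Sum>b\<in>Basis. (k \<bullet> b)^2) * FT v k" by (simp add: sum_distrib_right sum_negf)
  also have "(\<Sum>b\<in>Basis. (k \<bullet> b)^2) = (norm k)^2"
    by (rule norm_sq_Basis)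
  finally show ?thesis .
qed

section \<open>From Sobolev functions to smooth approximations\<close>

text \<open>The definitions of the problem allow Lebesgue measurable functions and integrate over
  \<open>lebesgue\<close>. All computation is done with Borel representatives over
  \<open>lborel\<close>, where Fubini and changes of variables operate.\<close>

lemma borel_version:
  fixes f :: "'a::euclidean_space \<Rightarrow> complex"
  assumes f: "f \<in> borel_measurable lebesgue"
  obtains g where "g \<in> borel_measurable borel" "AE x in lborel. f x = g x"
proof -
  have "(\<lambda>x. Re (f x)) \<in> borel_measurable lebesgue" "(\<lambda>x. Im (f x)) \<in> borel_measurable lebesgue" using f by measurable
  from this[THEN completion_ex_borel_measurable_real] obtain a b where
    ab: "a \<in> borel_measurable borel" "AE x in lborel. Re (f x) = a x" "b \<in> borel_measurable borel" "AE x in lborel. Im (f x) = b x"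
    by auto
  show thesis
  proof (rule that)
    show "(\<lambda>x. Complex (a x) (b x)) \<in> borel_measurable borel"
      unfolding Complex_eq using ab(1,3) by measurable
    show "AE x in lborel. f x = Complex (a x) (b x)" using ab(2,4) by eventually_elim (simp add: complex_eq_iff)
  qed
qed

lemma lborel_to_lebesgue: "f \<in> borel_measurable borel \<Longrightarrow> f \<in> borel_measurable lebesgue"
  by (rule measurable_completion) simp

lemma nn_sq: "sqint f \<Longrightarrow> (\<integral>\<^sup>+ x. ennreal ((cmod (f x))^2) \<partial>lborel) = ennreal (L2sq f)"
  by (rule nn_integral_eq_integral) (auto dest: sqint_int)

lemma sqintI: "f \<in> borel_measurable borel \<Longrightarrow> (\<integral>\<^sup>+ x. ennreal ((cmod (f x))^2) \<partial>lborel) < \<infinity> \<Longrightarrow> sqint f"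
  unfolding sqint_def by (auto intro!: integrableI_nonneg)

lemma sqint_L2: "sqint u \<Longrightarrow> L2 u"
  unfolding L2_def nn_integral_completion using nn_sq[of u] lborel_to_lebesgue[OF sqint_meas] by simp

lemma L2_sqint:
  assumes "L2 u" "u' \<in> borel_measurable borel" "AE x in lborel. u x = u' x"
  shows "sqint u'"
proof (rule sqintI[OF assms(2)])
  have "(\<integral>\<^sup>+ x. ennreal ((cmod (u' x))^2) \<partial>lborel) = (\<integral>\<^sup>+ x. ennreal ((cmod (u x))^2) \<partial>lborel)"
    by (rule nn_integral_cong_AE) (use assms(3) in auto)
  then show "(\<integral>\<^sup>+ x. ennreal ((cmod (u' x))^2) \<partial>lborel) < \<infinity>" using assms(1) by (simp add: L2_def nn_integral_completion)
qed

lemma sqint_truncate: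
  fixes u :: "'a::euclidean_space \<Rightarrow> complex"
  assumes u: "sqint u"
  shows "sqint (\<lambda>x. indicator (ball 0 R) x * u x)" "integrable lborel (\<lambda>x. indicator (ball 0 R) x * u x)"
proof -
  show "sqint (\<lambda>x. indicator (ball 0 R) x * u x)" by (rule sqint_indicator[OF u]) simp
  have "sqint (\<lambda>x::'a. indicator (ball 0 R) x :: complex)"
  proof -
    have "(\<integral>\<^sup>+ x. ennreal ((cmod (indicator (ball 0 R) (x::'a)))^2) \<partial>lborel) = (\<integral>\<^sup>+ x. indicator (ball 0 R) (x::'a) \<partial>lborel)"
      by (intro nn_integral_cong) (simp add: indicator_def)
    also have "\<dots> < \<infinity>" using emeasure_bounded_finite[OF bounded_ball] by simp
    finally show ?thesis by (intro sqintI) (rule borel_measurable_indicator, simp)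
  qed
  from sqint_mult_integrable(1)[OF this u] show "integrable lborel (\<lambda>x. indicator (ball 0 R) x * u x)" .
qed

lemma fourier_trunc_eq:
  fixes u :: "real^'n::finite \<Rightarrow> complex"
  assumes "u \<in> borel_measurable lebesgue" and u': "u' \<in> borel_measurable borel" "AE x in lborel. u x = u' x"
  shows "fourier_trunc u R k = FT (\<lambda>x. indicator (ball 0 R) x * u' x) k"
proof -
  have m: "(\<lambda>x. cis (- (k \<bullet> x)) * (indicator (ball 0 R) x * u' x)) \<in> borel_measurable lborel"
  proof -
    have [measurable]: "ball (0::real^'n) R \<in> sets borel" "u' \<in> borel_measurable borel" using u'(1) by simp_all
    show ?thesis by measurable
  qed
  note [measurable] = assms(1) lborel_to_lebesgue[OF u'(1)]
  have c [measurable]: "(\<lambda>x. cis (- (k \<bullet> x))) \<in> borel_measurable lebesgue"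
    by (intro lborel_to_lebesgue) measurable
  have [measurable]: "ball 0 R \<in> sets (lebesgue :: (real^'n) measure)" by simp
  have "fourier_trunc u R k = (\<integral>x. cis (- (k \<bullet> x)) * (indicator (ball 0 R) x * u' x) \<partial>lebesgue)"
    unfolding fourier_trunc_def set_lebesgue_integral_def
  proof (rule integral_cong_AE)
    show "(\<lambda>x. indicat_real (ball 0 R) x *\<^sub>R (cis (- (k \<bullet> x)) * u x)) \<in> borel_measurable lebesgue" by measurable
    show "(\<lambda>x. cis (- (k \<bullet> x)) * (indicator (ball 0 R) x * u' x)) \<in> borel_measurable lebesgue" by measurable
    show "AE x in lebesgue. indicat_real (ball 0 R) x *\<^sub>R (cis (- (k \<bullet> x)) * u x) = cis (- (k \<bullet> x)) * (indicator (ball 0 R) x * u' x)"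
      using u'(2) unfolding AE_completion_iff by eventually_elim (simp add: indicator_def)
  qed
  also have "\<dots> = FT (\<lambda>x. indicator (ball 0 R) x * u' x) k"
    unfolding FT_def by (rule integral_completion[OF m])
  finally show ?thesis .
qed

lemma truncation_tendsto:
  fixes u :: "'a::euclidean_space \<Rightarrow> complex"
  assumes u: "sqint u"
  shows "((\<lambda>R. L2sq (\<lambda>x. indicator (ball 0 R) x * u x - u x)) \<longlongrightarrow> 0) at_top"
proof -
  note [measurable] = sqint_meas[OF u]
  have [measurable]: "ball (0::'a) R \<in> sets borel" for R by simp
  have "((\<lambda>R. L2sq (\<lambda>x. indicator (ball 0 R) x * u x - u x)) \<longlongrightarrow> (\<integral>x. 0 \<partial>(lborel :: 'a measure))) at_top"
  proof (rule integral_dominated_convergence_at_top)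
    show "integrable lborel (\<lambda>x. (cmod (u x))^2)" by (rule sqint_int[OF u])
    show "\<forall>\<^sub>F R in at_top. AE x in lborel. norm ((cmod (indicator (ball 0 R) x * u x - u x))^2) \<le> (cmod (u x))^2"
      by (intro always_eventually allI AE_I2) (simp add: indicator_def)
    show "AE x in lborel. ((\<lambda>R. (cmod (indicator (ball 0 R) x * u x - u x))^2) \<longlongrightarrow> 0) at_top"
    proof (rule AE_I2)
      fix x :: 'a
      have "\<forall>\<^sub>F R in at_top. (cmod (indicator (ball 0 R) x * u x - u x))^2 = 0"
        using eventually_gt_at_top[of "norm x"] by eventually_elim simp
      then show "((\<lambda>R. (cmod (indicator (ball 0 R) x * u x - u x))^2) \<longlongrightarrow> 0) at_top" by (rule tendsto_eventually)
    qed
  qed measurable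
  then show ?thesis by simp
qed

text \<open>By \<open>FT_isometry\<close> the distance from the transform of a truncation of
  \<open>u\<close> to \<open>h\<close> is, up to the factor \<open>C\<close>, the distance from that
  truncation to \<open>u\<close>, which tends to 0.\<close>

lemma IF_has_L2_fourier:
  fixes h :: "real^'n::finite \<Rightarrow> complex"
  assumes h: "integrable lborel h" "sqint h"
  defines "C \<equiv> (gc TYPE(real^'n))^2"
  shows "has_L2_fourier (\<lambda>x. IF h x / C) h"
proof -
  have C: "C > 0" using gc_pos[where 'a="real^'n"] by (simp add: C_def)
  define u where "u x = IF h x / C" for x
  have su: "sqint u" using sqint_scale[OF plancherel_IF(1)[OF h], of "1 / C"] by (simp add: u_def[abs_def])
  have e: "(\<integral>\<^sup>+ k. ennreal ((cmod (fourier_trunc u R k - h k))^2) \<partial>lebesgue)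
     = ennreal (C * L2sq (\<lambda>x. indicator (ball 0 R) x * u x - u x))" for R
  proof -
    note t = sqint_truncate[OF su, of R]
    have "fourier_trunc u R k = FT (\<lambda>x. indicator (ball 0 R) x * u x) k" for k
      by (rule fourier_trunc_eq) (use sqint_meas[OF su] lborel_to_lebesgue in auto)
    then have "(\<integral>\<^sup>+ k. ennreal ((cmod (fourier_trunc u R k - h k))^2) \<partial>lebesgue)
      = (\<integral>\<^sup>+ k. ennreal ((cmod (FT (\<lambda>x. indicator (ball 0 R) x * u x) k - h k))^2) \<partial>lborel)"
      by (simp add: nn_integral_completion)
    also have "\<dots> = ennreal (L2sq (\<lambda>k. FT (\<lambda>x. indicator (ball 0 R) x * u x) k - h k))"
      by (rule nn_sq[OF sqint_diff[OF plancherel(1)[OF t(2,1)] h(2)]])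
    also have "L2sq (\<lambda>k. FT (\<lambda>x. indicator (ball 0 R) x * u x) k - h k) = C * L2sq (\<lambda>x. indicator (ball 0 R) x * u x - u x)"
      using FT_isometry[OF t(2,1) h] C by (simp add: u_def C_def[symmetric])
    finally show ?thesis .
  qed
  have "((\<lambda>R. ennreal (C * L2sq (\<lambda>x. indicator (ball 0 R) x * u x - u x))) \<longlongrightarrow> ennreal (C * 0)) at_top"
    by (intro tendsto_ennrealI tendsto_mult tendsto_const truncation_tendsto su)
  then show ?thesis unfolding u_def[symmetric] has_L2_fourier_def e
    using sqint_L2[OF su] lborel_to_lebesgue[OF sqint_meas[OF h(2)]] by simp
qed

lemma integrable_bounded_support:
  assumes h: "sqint h" "\<And>k. norm k > M \<Longrightarrow> h k = 0" shows "integrable lborel h"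
proof -
  have "(\<lambda>x. indicator (ball 0 (M + 1)) x * h x) = h" using h(2) by (auto simp: fun_eq_iff indicator_def)
  then show ?thesis using sqint_truncate(2)[OF h(1), of "M + 1"] by simp
qed

text \<open>Supplies test functions for the hypothesis on V. On frequencies between 1 and
  \<open>M\<close> the multiplier is bounded for either sign of \<open>s\<close>.\<close>

lemma IF_H2_frac:
  fixes h :: "real^'n::finite \<Rightarrow> complex"
  assumes h: "sqint h" "\<And>k. norm k > M \<Longrightarrow> h k = 0" "\<And>k. norm k < 1 \<Longrightarrow> h k = 0" and M: "M \<ge> 1"
  defines "C \<equiv> (gc TYPE(real^'n))^2"
  shows "H2 (\<lambda>x. IF h x / C)"
    "sqint (\<lambda>k. complex_of_real (norm k powr (2 * s)) * h k)"
    "is_frac_laplacian s (\<lambda>x. IF h x / C) (\<lambda>x. IF (\<lambda>k. complex_of_real (norm k powr (2 * s)) * h k) x / C)"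
proof -
  note [measurable] = sqint_meas[OF h(1)]
  have f: "has_L2_fourier (\<lambda>x. IF h x / C) h"
    unfolding C_def by (rule IF_has_L2_fourier[OF integrable_bounded_support[OF h(1), of M] h(1)]) (rule h(2))
  have b: "norm k powr (2 * s) \<le> M powr (2 * \<bar>s\<bar>)" if "1 \<le> norm k" "norm k \<le> M" for k :: "real^'n"
  proof -
    have "norm k powr (2 * s) \<le> norm k powr (2 * \<bar>s\<bar>)" using that by (intro powr_mono) auto
    also have "\<dots> \<le> M powr (2 * \<bar>s\<bar>)" using that by (intro powr_mono2) auto
    finally show ?thesis .
  qed
  show s: "sqint (\<lambda>k. complex_of_real (norm k powr (2 * s)) * h k)"
  proof (rule sqint_bound[OF h(1), where c = "M powr (2 * \<bar>s\<bar>)"])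
    fix k show "cmod (complex_of_real (norm k powr (2 * s)) * h k) \<le> M powr (2 * \<bar>s\<bar>) * cmod (h k)"
    proof (cases "1 \<le> norm k \<and> norm k \<le> M")
      case True then show ?thesis using b[of k] by (simp add: norm_mult mult_right_mono)
    next
      case False then have "h k = 0" using h(2,3)[of k] by linarith
      then show ?thesis by simp
    qed
  qed measurable
  show "is_frac_laplacian s (\<lambda>x. IF h x / C) (\<lambda>x. IF (\<lambda>k. complex_of_real (norm k powr (2 * s)) * h k) x / C)"
    unfolding is_frac_laplacian_def
  proof (rule exI[of _ h], intro conjI f)
    show "has_L2_fourier (\<lambda>x. IF (\<lambda>k. complex_of_real (norm k powr (2 * s)) * h k) x / C) (\<lambda>k. complex_of_real (norm k powr (2 * s)) * h k)"
      unfolding C_def by (rule IF_has_L2_fourier[OF integrable_bounded_support[OF s] s, of M]) (use h(2) in auto)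
  qed
  have s2: "sqint (\<lambda>k. complex_of_real (1 + (norm k)^2) * h k)"
  proof (rule sqint_bound[OF h(1), where c = "1 + M^2"])
    fix k show "cmod (complex_of_real (1 + (norm k)^2) * h k) \<le> (1 + M^2) * cmod (h k)"
    proof (cases "norm k \<le> M")
      case True
      then have "(norm k)^2 \<le> M^2" by (intro power_mono) auto
      moreover have "cmod (complex_of_real (1 + (norm k)^2)) = 1 + (norm k)^2" by (simp only: norm_of_real) simp
      ultimately show ?thesis unfolding norm_mult by (intro mult_right_mono) auto
    qed (use h(2) in simp)
  qed measurable
  have "(\<integral>\<^sup>+ k. ennreal ((1 + (norm k)^2)^2 * (cmod (h k))^2) \<partial>lebesgue) = (\<integral>\<^sup>+ k. ennreal ((cmod (complex_of_real (1 + (norm k)^2) * h k))^2) \<partial>lborel)"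
    unfolding nn_integral_completion norm_mult norm_of_real power_mult_distrib power2_abs ..
  also have "\<dots> < \<infinity>" unfolding nn_sq[OF s2] by simp
  finally show "H2 (\<lambda>x. IF h x / C)" unfolding H2_def using f by blast
qed

text \<open>A one-sided Plancherel bound for transforms that are only defined as limits:
  \<open>FT_isometry\<close> is used for the truncations of \<open>u'\<close>, and the radius then
  tends to infinity. The two triangle inequalities for squares account for the factor 4.\<close>

lemma has_L2_fourier_approx:
  fixes u :: "real^'n::finite \<Rightarrow> complex"
  assumes f: "has_L2_fourier u g" and u': "u' \<in> borel_measurable borel" "AE x in lborel. u x = u' x"
    and g': "g' \<in> borel_measurable borel" "AE x in lborel. g x = g' x"
  defines "C \<equiv> (gc TYPE(real^'n))^2"
  shows "sqint u'" "sqint g'"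
    "\<And>h. integrable lborel h \<Longrightarrow> sqint h \<Longrightarrow>
      L2sq (\<lambda>x. u' x - IF h x / C) \<le> 4 / C * L2sq (\<lambda>k. g' k - h k)"
proof -
  have C: "C > 0" using gc_pos[where 'a="real^'n"] by (simp add: C_def)
  show su: "sqint u'" by (rule L2_sqint[OF _ u']) (use f in \<open>simp add: has_L2_fourier_def\<close>)
  have um: "u \<in> borel_measurable lebesgue" using f by (simp add: has_L2_fourier_def L2_def)
  define t where "t R = (\<lambda>x. indicator (ball 0 R) x * u' x)" for R
  have st: "integrable lborel (t R)" "sqint (t R)" for R using sqint_truncate[OF su, of R] by (simp_all add: t_def)
  note sF = plancherel(1)[OF st]
  have e: "(\<integral>\<^sup>+ k. ennreal ((cmod (fourier_trunc u R k - g k))^2) \<partial>lebesgue) = (\<integral>\<^sup>+ k. ennreal ((cmod (FT (t R) k - g' k))^2) \<partial>lborel)" for R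
    unfolding fourier_trunc_eq[OF um u'] nn_integral_completion t_def
    by (rule nn_integral_cong_AE) (use g'(2) in auto)
  have l: "((\<lambda>R. \<integral>\<^sup>+ k. ennreal ((cmod (FT (t R) k - g' k))^2) \<partial>lborel) \<longlongrightarrow> 0) at_top"
    using f by (simp add: has_L2_fourier_def e)
  \<comment> \<open>Finite distance from one square-integrable transform already makes
    \<open>g'\<close> square-integrable.\<close>
  have "\<forall>\<^sub>F R in at_top. (\<integral>\<^sup>+ k. ennreal ((cmod (FT (t R) k - g' k))^2) \<partial>lborel) < 1"
    by (rule order_tendstoD(2)[OF l]) simp
  then obtain R where R: "(\<integral>\<^sup>+ k. ennreal ((cmod (FT (t R) k - g' k))^2) \<partial>lborel) < 1"
    using eventually_happens' trivial_limit_at_top_linorder by blast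
  have "sqint (\<lambda>k. FT (t R) k - g' k)"
    by (rule sqintI) (use R sqint_meas[OF sF[of R]] g'(1) in \<open>auto simp: top.not_eq_extremum elim: order_less_trans\<close>)
  from sqint_diff[OF sF[of R] this] show sg: "sqint g'" by simp
  have l': "((\<lambda>R. L2sq (\<lambda>k. FT (t R) k - g' k)) \<longlongrightarrow> 0) at_top"
    using l unfolding nn_sq[OF sqint_diff[OF sF sg]] by (subst (asm) tendsto_ennreal_iff[of _ _ 0, simplified]) auto
  fix h :: "real^'n \<Rightarrow> complex" assume h: "integrable lborel h" "sqint h"
  define v where "v x = IF h x / C" for x
  have sv: "sqint v" using sqint_scale[OF plancherel_IF(1)[OF h], of "1 / C"] by (simp add: v_def[abs_def])
  have ub: "L2sq (\<lambda>x. u' x - v x) \<le> 2 * L2sq (\<lambda>x. t R x - u' x)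
     + 2 * ((2 * L2sq (\<lambda>k. FT (t R) k - g' k) + 2 * L2sq (\<lambda>k. g' k - h k)) / C)" for R
  proof -
    have "L2sq (\<lambda>x. t R x - v x) = L2sq (\<lambda>k. FT (t R) k - h k) / C"
      unfolding v_def C_def by (rule FT_isometry[OF st h])
    also have "\<dots> \<le> (2 * L2sq (\<lambda>k. FT (t R) k - g' k) + 2 * L2sq (\<lambda>k. g' k - h k)) / C"
      using C by (intro divide_right_mono L2_triangle sF sg h) auto
    finally have a: "L2sq (\<lambda>x. t R x - v x) \<le> \<dots>" .
    have "L2sq (\<lambda>x. u' x - t R x) = L2sq (\<lambda>x. t R x - u' x)" by (simp only: norm_minus_commute)
    then show ?thesis using L2_triangle[OF su st(2)[of R] sv] a by linarith
  qed
  have "((\<lambda>R. 2 * L2sq (\<lambda>x. t R x - u' x)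
     + 2 * ((2 * L2sq (\<lambda>k. FT (t R) k - g' k) + 2 * L2sq (\<lambda>k. g' k - h k)) / C))
     \<longlongrightarrow> 2 * 0 + 2 * ((2 * 0 + 2 * L2sq (\<lambda>k. g' k - h k)) / C)) at_top"
    unfolding t_def by (intro tendsto_intros truncation_tendsto su l'[unfolded t_def]) (use C in auto)
  from tendsto_lowerbound[OF this always_eventually[OF allI[OF ub]]]
  show "L2sq (\<lambda>x. u' x - IF h x / C) \<le> 4 / C * L2sq (\<lambda>k. g' k - h k)"
    by (simp add: v_def)
qed

lemma IF_mult: "IF (\<lambda>k. c * h k) x = c * IF h x"
  unfolding IF_def by (simp add: mult.left_commute flip: integral_mult_right_zero)

text \<open>The approximants are inverse transforms of \<open>g'\<close> cut off at frequency j.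
  Their Laplacians come from cutting off |k|^2 g' in the same way, so the functions and the
  Laplacians converge simultaneously.\<close>

lemma solution_approx:
  fixes \<Psi> V :: "real^'n::finite \<Rightarrow> complex"
  assumes "solves_schroedinger V \<Psi>" "R > 0"
  obtains a b u where "sqint a" "sqint b" "AE x in lborel. x \<in> ball 0 R \<longrightarrow> a x = \<Psi> x"
    "AE x in lborel. x \<in> ball 0 R \<longrightarrow> b x = V x * \<Psi> x"
    "\<And>j::nat. C2_on UNIV (u j)" "\<And>j. sqint (u j)" "\<And>j. sqint (lap (u j))"
    "(\<lambda>j. L2sq (\<lambda>x. u j x - a x)) \<longlonglongrightarrow> 0" "(\<lambda>j. L2sq (\<lambda>x. lap (u j) x - b x)) \<longlonglongrightarrow> 0"
proof -
  define C where "C = (gc TYPE(real^'n))^2"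
  have C: "C > 0" using gc_pos[where 'a="real^'n"] by (simp add: C_def)
  obtain u w where uw: "AE x in lebesgue. x \<in> ball 0 R \<longrightarrow> u x = \<Psi> x" "is_frac_laplacian 1 u w"
    "AE x in lebesgue. x \<in> ball 0 R \<longrightarrow> w x + V x * \<Psi> x = 0"
    using assms unfolding solves_schroedinger_def by blast
  obtain g where g: "has_L2_fourier u g" "has_L2_fourier w (\<lambda>k. complex_of_real (norm k powr (2 * 1)) * g k)"
    using uw(2) unfolding is_frac_laplacian_def by blast
  have p2: "norm k powr (2 * 1) = (norm k)^2" for k :: "real^'n" by simp
  have m: "u \<in> borel_measurable lebesgue" "w \<in> borel_measurable lebesgue" "g \<in> borel_measurable lebesgue"
    using g by (auto simp: has_L2_fourier_def L2_def)
  obtain u' where u': "u' \<in> borel_measurable borel" "AE x in lborel. u x = u' x" using borel_version[OF m(1)] .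
  obtain w' where w': "w' \<in> borel_measurable borel" "AE x in lborel. w x = w' x" using borel_version[OF m(2)] .
  obtain g' where g': "g' \<in> borel_measurable borel" "AE x in lborel. g x = g' x" using borel_version[OF m(3)] .
  define G where "G k = complex_of_real ((norm k)^2) * g' k" for k
  have G: "G \<in> borel_measurable borel" "AE k in lborel. complex_of_real (norm k powr (2 * 1)) * g k = G k"
  proof -
    show "G \<in> borel_measurable borel" unfolding G_def using g'(1) by measurable
    show "AE k in lborel. complex_of_real (norm k powr (2 * 1)) * g k = G k"
      unfolding p2 G_def using g'(2) by eventually_elim simp
  qed
  note A = has_L2_fourier_approx[OF g(1) u' g'] and B = has_L2_fourier_approx[OF g(2) w' G]
  define h where "h j k = indicator (ball 0 (real j)) k * g' k" for j k
  define H where "H j k = indicator (ball 0 (real j)) k * G k" for j k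
  have h: "integrable lborel (h j)" "sqint (h j)" "integrable lborel (H j)" "sqint (H j)" for j
    unfolding h_def H_def by (rule sqint_truncate[OF A(2)] sqint_truncate[OF B(2)])+
  have hC: "integrable lborel (\<lambda>k. (1 / C) * h j k)" for j using h(1) by simp
  have hz: "(1 / C) * h j k = 0" if "norm k > real j" for j k using that by (simp add: h_def)
  define U where "U j = IF (\<lambda>k. (1 / C) * h j k)" for j
  have Ux: "U j x = IF (h j) x / C" for j x unfolding U_def IF_mult by simp
  note U2 = IF_C2[OF hC hz]
  have lapU: "lap (U j) x = - (IF (H j) x / C)" for j x
  proof -
    have "lap (U j) = IF (\<lambda>k. - complex_of_real ((norm k)^2) * ((1 / C) * h j k))"
      unfolding U_def by (rule U2(2))
    also have "(\<lambda>k. - complex_of_real ((norm k)^2) * ((1 / C) * h j k)) = (\<lambda>k. (- 1 / C) * H j k)"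
      by (simp add: fun_eq_iff h_def H_def G_def)
    finally have "lap (U j) x = IF (\<lambda>k. (- 1 / C) * H j k) x" by simp
    then show ?thesis unfolding IF_mult by simp
  qed
  have tail: "(\<lambda>j. 4 / C * L2sq (\<lambda>k. f k - indicator (ball 0 (real j)) k * f k)) \<longlonglongrightarrow> 0"
    if "sqint f" for f :: "real^'n \<Rightarrow> complex"
  proof -
    have "(\<lambda>j. L2sq (\<lambda>k. indicator (ball 0 (real j)) k * f k - f k)) \<longlonglongrightarrow> 0"
      using filterlim_compose[OF truncation_tendsto[OF that] filterlim_real_sequentially] .
    from tendsto_mult[OF tendsto_const[of "4 / C"] this] show ?thesis by (simp add: norm_minus_commute)
  qed
  \<comment> \<open>The equation reads w + V \<Psi> = 0 with w the negative Laplacian, so the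
    Laplacians converge to \<open>- w'\<close>.\<close>
  show thesis
  proof (rule that[of u' "\<lambda>x. - w' x" U])
    show "sqint u'" by (rule A(1))
    show "sqint (\<lambda>x. - w' x)" using sqint_scale[OF B(1), of "-1"] by simp
    show "AE x in lborel. x \<in> ball 0 R \<longrightarrow> u' x = \<Psi> x"
      using uw(1) u'(2) unfolding AE_completion_iff by eventually_elim auto
    show "AE x in lborel. x \<in> ball 0 R \<longrightarrow> - w' x = V x * \<Psi> x"
      using uw(3) w'(2) unfolding AE_completion_iff by eventually_elim (auto simp: add_eq_0_iff2)
    show "C2_on UNIV (U j)" for j unfolding U_def by (rule U2(1))
    show "sqint (U j)" for j unfolding Ux[abs_def] using sqint_scale[OF plancherel_IF(1)[OF h(1,2)], of "1 / C"] by simp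
    show "sqint (lap (U j))" for j unfolding lapU[abs_def] using sqint_scale[OF plancherel_IF(1)[OF h(3,4)], of "- 1 / C"] by simp
    show "(\<lambda>j. L2sq (\<lambda>x. U j x - u' x)) \<longlonglongrightarrow> 0"
    proof (rule tendsto_sandwich[OF _ _ tendsto_const tail[OF A(2)]])
      show "\<forall>\<^sub>F j in sequentially. L2sq (\<lambda>x. U j x - u' x) \<le> 4 / C * L2sq (\<lambda>k. g' k - indicator (ball 0 (real j)) k * g' k)"
        using A(3)[OF h(1,2)] by (intro always_eventually allI) (simp add: Ux norm_minus_commute h_def C_def)
    qed (auto intro!: always_eventually integral_nonneg_AE)
    show "(\<lambda>j. L2sq (\<lambda>x. lap (U j) x - (- w' x))) \<longlonglongrightarrow> 0"
    proof (rule tendsto_sandwich[OF _ _ tendsto_const tail[OF B(2)]])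
      show "\<forall>\<^sub>F j in sequentially. L2sq (\<lambda>x. lap (U j) x - (- w' x)) \<le> 4 / C * L2sq (\<lambda>k. G k - indicator (ball 0 (real j)) k * G k)"
        using B(3)[OF h(3,4)] by (intro always_eventually allI) (simp add: lapU H_def C_def)
    qed (auto intro!: always_eventually integral_nonneg_AE)
  qed
qed

text \<open>With y the modulus of a frequency, y^(3 - 4d) is \<tau>^(3 - 4d) times the same power of
  y/\<tau>, and that power is at most 1 if y <= \<tau> and at most (y/\<tau>)^4 otherwise. The
  exponents 4 and 0 correspond to the Laplacian and to the function itself.\<close>

lemma power_interpolation:
  fixes y \<tau> d s :: real
  assumes y: "y \<ge> 1" and \<tau>: "\<tau> \<ge> 1" and d: "d \<le> 3/4" "d > 0" and s: "s \<le> 3/4 - d"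
  shows "y powr (4 * s) \<le> \<tau> powr (- 4 * d) * (y^4 / \<tau> + \<tau>^3)" "1 \<le> \<tau> powr (- 4 * d) * \<tau>^3"
proof -
  have t: "\<tau> powr (3 - 4 * d) = \<tau> powr (- 4 * d) * \<tau>^3"
    using \<tau> by (simp add: powr_diff powr_minus divide_inverse mult.commute)
  show one: "1 \<le> \<tau> powr (- 4 * d) * \<tau>^3" unfolding t[symmetric] using \<tau> d by (intro ge_one_powr_ge_zero) auto
  have "y powr (4 * s) \<le> y powr (3 - 4 * d)" using y s by (intro powr_mono) auto
  also have "\<dots> \<le> \<tau> powr (3 - 4 * d) * ((y / \<tau>)^4 + 1)"
  proof (cases "y \<le> \<tau>")
    case True
    have "y powr (3 - 4 * d) \<le> \<tau> powr (3 - 4 * d) * 1" using True y d by (simp add: powr_mono2)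
    also have "\<dots> \<le> \<tau> powr (3 - 4 * d) * ((y / \<tau>)^4 + 1)" by (intro mult_left_mono) auto
    finally show ?thesis .
  next
    case False
    have "y powr (3 - 4 * d) = \<tau> powr (3 - 4 * d) * (y / \<tau>) powr (3 - 4 * d)"
      using y \<tau> by (simp add: powr_divide)
    also have "(y / \<tau>) powr (3 - 4 * d) \<le> (y / \<tau>) powr 4" using False \<tau> d by (intro powr_mono) auto
    also have "(y / \<tau>) powr 4 = (y / \<tau>)^4" using y \<tau> by simp
    also have "\<tau> powr (3 - 4 * d) * (y / \<tau>)^4 \<le> \<tau> powr (3 - 4 * d) * ((y / \<tau>)^4 + 1)" by (intro mult_left_mono) auto
    finally show ?thesis by (simp add: mult_left_mono)
  qed
  also have "\<dots> = \<tau> powr (- 4 * d) * (y^4 / \<tau> + \<tau>^3)"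
    unfolding t using \<tau> by (simp add: field_simps eval_nat_numeral)
  finally show "y powr (4 * s) \<le> \<tau> powr (- 4 * d) * (y^4 / \<tau> + \<tau>^3)" .
qed

text \<open>The hypothesis of the theorem on a fixed ball, with \<open>\<epsilon> = 1\<close> and for a Borel representative of \<open>V\<close>.\<close>

definition frac_bounded :: "(real^'n::finite \<Rightarrow> complex) \<Rightarrow> real \<Rightarrow> real \<Rightarrow> real \<Rightarrow> bool" where
  "frac_bounded V s R c \<longleftrightarrow> c \<ge> 0 \<and> V \<in> borel_measurable borel \<and>
    (\<forall>u w. H2 u \<longrightarrow> is_frac_laplacian s u w \<longrightarrow>
       (\<integral>\<^sup>+ x\<in>ball 0 R. ennreal ((cmod (V x))^2 * (cmod (u x))^2) \<partial>lborel)
         \<le> (\<integral>\<^sup>+ x. ennreal ((cmod (w x))^2) \<partial>lborel) + ennreal c * (\<integral>\<^sup>+ x. ennreal ((cmod (u x))^2) \<partial>lborel))"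

text \<open>By Plancherel both terms on the right of the hypothesis become integrals over
  frequencies, where they can be compared pointwise.\<close>

lemma frac_bounded_frequency:
  fixes V h :: "real^'n::finite \<Rightarrow> complex"
  assumes fb: "frac_bounded V s R c"
    and h: "sqint h" "\<forall>k. norm k > M \<longrightarrow> h k = 0" "\<forall>k. norm k < 1 \<longrightarrow> h k = 0" and M: "M \<ge> 1"
  defines "C \<equiv> (gc TYPE(real^'n))^2"
  shows "integrable lborel (\<lambda>k. norm k powr (4 * s) * (cmod (h k))^2)"
    "(\<integral>\<^sup>+ x\<in>ball 0 R. ennreal ((cmod (V x))^2 * (cmod (IF h x / C))^2) \<partial>lborel)
      \<le> ennreal (((LBINT k. norm k powr (4 * s) * (cmod (h k))^2) + c * L2sq h) / C)"
proof -
  have C: "C > 0" using gc_pos[where 'a="real^'n"] by (simp add: C_def)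
  have c: "c \<ge> 0" using fb by (simp add: frac_bounded_def)
  define w where "w k = complex_of_real (norm k powr (2 * s)) * h k" for k
  note h' = h(1) h(2)[rule_format] h(3)[rule_format]
  note F = IF_H2_frac(1)[OF h' M, folded C_def] IF_H2_frac(2,3)[OF h' M, where s=s, folded C_def w_def]
  have sw: "sqint w" by (rule F(2))
  have ih: "integrable lborel h" by (rule integrable_bounded_support[OF h(1), of M]) (rule h'(2))
  have iw: "integrable lborel w" by (rule integrable_bounded_support[OF sw, of M]) (simp add: w_def h(2))
  have n: "(\<integral>\<^sup>+ x. ennreal ((cmod (IF f x / C))^2) \<partial>lborel) = ennreal (L2sq f / C)"
    if f: "integrable lborel f" "sqint f" for f :: "real^'n \<Rightarrow> complex"
  proof -
    have "sqint (\<lambda>x. IF f x / C)" using sqint_scale[OF plancherel_IF(1)[OF f], of "1 / C"] by simp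
    then have "(\<integral>\<^sup>+ x. ennreal ((cmod (IF f x / C))^2) \<partial>lborel) = ennreal (L2sq (\<lambda>x. IF f x / C))" by (rule nn_sq)
    also have "L2sq (\<lambda>x. IF f x / C) = L2sq f / C"
      using plancherel_IF(2)[OF f] C by (simp add: norm_divide power_divide C_def[symmetric]) (simp add: power2_eq_square)
    finally show ?thesis .
  qed
  have ws: "(cmod (w k))^2 = norm k powr (4 * s) * (cmod (h k))^2" for k
    by (simp add: w_def norm_mult power_mult_distrib) (simp add: power2_eq_square powr_add[symmetric])
  show "integrable lborel (\<lambda>k. norm k powr (4 * s) * (cmod (h k))^2)"
    using sqint_int[OF sw] unfolding ws .
  have "(\<integral>\<^sup>+ x\<in>ball 0 R. ennreal ((cmod (V x))^2 * (cmod (IF h x / C))^2) \<partial>lborel)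
     \<le> ennreal (L2sq w / C) + ennreal c * ennreal (L2sq h / C)"
    using fb F(1,3) unfolding frac_bounded_def n[OF iw sw, symmetric] n[OF ih h(1), symmetric] by blast
  also have "\<dots> = ennreal (L2sq w / C + c * (L2sq h / C))"
    using c C by (subst ennreal_mult[symmetric], simp_all)
  also have "L2sq w / C + c * (L2sq h / C)
     = ((LBINT k. norm k powr (4 * s) * (cmod (h k))^2) + c * L2sq h) / C"
    by (simp add: ws add_divide_distrib)
  finally show "(\<integral>\<^sup>+ x\<in>ball 0 R. ennreal ((cmod (V x))^2 * (cmod (IF h x / C))^2) \<partial>lborel)
      \<le> ennreal (((LBINT k. norm k powr (4 * s) * (cmod (h k))^2) + c * L2sq h) / C)" .
qed

lemma fatou_bound:
  fixes u :: "nat \<Rightarrow> 'a \<Rightarrow> ennreal"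
  assumes [measurable]: "\<And>n. u n \<in> borel_measurable M" and l: "AE x in M. (\<lambda>n. u n x) \<longlonglongrightarrow> f x"
    and B: "\<And>n. (\<integral>\<^sup>+ x. u n x \<partial>M) \<le> B"
  shows "(\<integral>\<^sup>+ x. f x \<partial>M) \<le> B"
proof -
  have "(\<integral>\<^sup>+ x. f x \<partial>M) = (\<integral>\<^sup>+ x. liminf (\<lambda>n. u n x) \<partial>M)"
    by (rule nn_integral_cong_AE) (use l in eventually_elim, simp add: lim_imp_Liminf)
  also have "\<dots> \<le> liminf (\<lambda>n. \<integral>\<^sup>+ x. u n x \<partial>M)" by (rule nn_integral_liminf) simp
  also have "\<dots> \<le> liminf (\<lambda>n. B)" by (intro Liminf_mono always_eventually allI B)
  also have "\<dots> = B" by (simp add: Liminf_const)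
  finally show ?thesis .
qed

lemma L2_AE_subseq:
  fixes v :: "'a::euclidean_space \<Rightarrow> complex"
  assumes "\<And>n::nat. sqint (\<lambda>x. w n x - v x)" "(\<lambda>n. L2sq (\<lambda>x. w n x - v x)) \<longlonglongrightarrow> 0"
  obtains r where "strict_mono r" "AE x in lborel. (\<lambda>n. w (r n) x) \<longlonglongrightarrow> v x"
proof -
  have "\<exists>r. strict_mono r \<and> (AE x in lborel. (\<lambda>n. (cmod (w (r n) x - v x))^2) \<longlonglongrightarrow> 0)"
    by (rule tendsto_L1_AE_subseq) (use assms sqint_int in auto)
  then obtain r where r: "strict_mono r" "AE x in lborel. (\<lambda>n. (cmod (w (r n) x - v x))^2) \<longlonglongrightarrow> 0" by blast
  have "AE x in lborel. (\<lambda>n. w (r n) x) \<longlonglongrightarrow> v x"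
    using r(2)
  proof eventually_elim
    case (elim x)
    have "(\<lambda>n. sqrt ((cmod (w (r n) x - v x))^2)) \<longlonglongrightarrow> sqrt 0" by (rule tendsto_real_sqrt[OF elim])
    then show ?case by (simp add: tendsto_norm_zero_iff LIM_zero_iff)
  qed
  then show ?thesis using r(1) that by blast
qed

lemma IF_modulation:
  fixes h :: "'a::euclidean_space \<Rightarrow> complex"
  shows "IF (\<lambda>k. h (k - \<xi>)) x = cis (\<xi> \<bullet> x) * IF h x"
proof -
  have "IF (\<lambda>k. h (k - \<xi>)) x = (LBINT k. cis ((k + \<xi>) \<bullet> x) * h (k + \<xi> - \<xi>))"
    unfolding IF_def by (rule integral_translate(1)[symmetric])
  also have "\<dots> = (LBINT k. cis (\<xi> \<bullet> x) * (cis (k \<bullet> x) * h k))"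
    by (simp add: inner_add_left mult.assoc[symmetric] cis_mult add.commute)
  finally show ?thesis by (simp add: IF_def)
qed

lemma FT_C2_compact:
  fixes v :: "'a::euclidean_space \<Rightarrow> complex"
  assumes v: "C2_on UNIV v" and v0: "\<forall>x. x \<notin> ball 0 R \<longrightarrow> v x = 0"
  defines "C \<equiv> (gc TYPE('a))^2"
  shows "integrable lborel v" "sqint v" "sqint (lap v)" "sqint (FT v)"
    "L2sq (FT v) = C * L2sq v"
    "integrable lborel (\<lambda>k. (norm k)^4 * (cmod (FT v k))^2)"
    "(LBINT k. (norm k)^4 * (cmod (FT v k))^2) = C * L2sq (lap v)"
proof -
  have z0: "v x = 0" if "x \<notin> ball 0 R" for x using v0 that by blast
  have c: "continuous_on UNIV v" "continuous_on UNIV (lap v)"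
    by (rule C2_on_continuous[OF v], rule C2_on_continuous_lap[OF v])
  have z: "lap v x = 0" if "x \<notin> ball 0 (\<bar>R\<bar> + 1)" for x
    by (rule lap_zero_outside[of "cball 0 \<bar>R\<bar>"]) (use that z0 in \<open>auto simp: dist_norm\<close>)
  show v1: "integrable lborel v" by (rule integrable_compact_support[OF c(1) z0])
  show v2: "sqint v" by (rule sqint_cont[OF c(1) z0])
  have l1: "integrable lborel (lap v)" by (rule integrable_compact_support[OF c(2) z])
  show l2: "sqint (lap v)" by (rule sqint_cont[OF c(2) z])
  note p = plancherel[OF v1 v2] and q = plancherel[OF l1 l2]
  have e: "(cmod (FT (lap v) k))^2 = (norm k)^4 * (cmod (FT v k))^2" for k
  proof -
    have "cmod (FT (lap v) k) = (norm k)^2 * cmod (FT v k)"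
    proof -
      have "FT (lap v) k = - complex_of_real ((norm k)^2) * FT v k" by (rule FT_lap[OF v]) (rule z0)
      then show ?thesis by (simp only: norm_mult norm_minus_cancel norm_of_real) simp
    qed
    then show ?thesis by (simp add: power_mult_distrib flip: power_mult)
  qed
  show "sqint (FT v)" "L2sq (FT v) = C * L2sq v"
    using p by (simp_all add: C_def)
  show "integrable lborel (\<lambda>k. (norm k)^4 * (cmod (FT v k))^2)"
    "(LBINT k. (norm k)^4 * (cmod (FT v k))^2) = C * L2sq (lap v)"
    using sqint_int[OF q(1)] q(2) by (simp_all add: e C_def)
qed

lemma frequency_truncation:
  fixes v :: "'a::euclidean_space \<Rightarrow> complex"
  assumes v: "integrable lborel v" "sqint v"
  defines "C \<equiv> (gc TYPE('a))^2"
  defines "vm \<equiv> \<lambda>M x. IF (\<lambda>k. indicator (ball 0 M) k * FT v k) x / C"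
  shows "sqint (\<lambda>x. vm M x - v x)"
    "L2sq (\<lambda>x. vm M x - v x) = L2sq (\<lambda>k. indicator (ball 0 M) k * FT v k - FT v k) / C"
proof -
  note t = sqint_truncate[OF plancherel(1)[OF v], of M]
  have "sqint (vm M)" using sqint_scale[OF plancherel_IF(1)[OF t(2,1)], of "1 / C"] by (simp add: vm_def)
  then show "sqint (\<lambda>x. vm M x - v x)" by (rule sqint_diff[OF _ v(2)])
  show "L2sq (\<lambda>x. vm M x - v x) = L2sq (\<lambda>k. indicator (ball 0 M) k * FT v k - FT v k) / C"
    using FT_isometry[OF v t(2,1)] by (simp add: vm_def C_def norm_minus_commute)
qed

lemma ennreal_two: "0 \<le> y \<Longrightarrow> 0 \<le> z \<Longrightarrow> ennreal (2 * y + 2 * z) = 2 * ennreal y + 2 * ennreal z"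
  by (simp add: ennreal_mult)

text \<open>The exponent \<open>s\<close> may be negative, so that the multiplier is singular at \<open>0\<close>. The frequencies below \<open>1\<close> are therefore first moved
  by a vector of length \<open>2\<close>, which multiplies the function by a character and does not change its modulus.\<close>

lemma frac_bounded_C2:
  fixes V v :: "real^'n::finite \<Rightarrow> complex"
  assumes fb: "frac_bounded V s R c" and d: "0 < d" "d \<le> 3/4" "s \<le> 3/4 - d" and \<tau>: "\<tau> \<ge> 1"
    and v: "C2_on UNIV v" "\<And>x. x \<notin> ball 0 R \<Longrightarrow> v x = 0"
  defines "E \<equiv> \<tau> powr (- 4 * d) * (L2sq (lap v) / \<tau> + \<tau>^3 * L2sq v)"
  shows "integrable lborel (\<lambda>x. (cmod (V x))^2 * (cmod (v x))^2)"
    "(LBINT x. (cmod (V x))^2 * (cmod (v x))^2) \<le> (56 + 4 * c) * E"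
proof -
  define C where "C = (gc TYPE(real^'n))^2"
  have C: "C > 0" using gc_pos[where 'a="real^'n"] by (simp add: C_def)
  have c: "c \<ge> 0" and Vm [measurable]: "V \<in> borel_measurable borel" using fb by (auto simp: frac_bounded_def)
  have [measurable]: "ball (0::real^'n) M \<in> sets borel" for M by simp
  have v0: "\<forall>x. x \<notin> ball 0 R \<longrightarrow> v x = 0" using v(2) by blast
  note F = FT_C2_compact[OF v(1) v0, folded C_def]
  have [measurable]: "v \<in> borel_measurable borel" by (rule sqint_meas[OF F(2)])
  define g where "g = FT v"
  note [measurable] = sqint_meas[OF F(4), folded g_def]
  define N L where "N = L2sq v" and "L = L2sq (lap v)"
  have N0: "N \<ge> 0" "L \<ge> 0" unfolding N_def L_def by (auto intro!: integral_nonneg_AE)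
  have E: "E = \<tau> powr (- 4 * d) * (L / \<tau> + \<tau>^3 * N)" by (simp add: E_def N_def L_def)
  have NE: "N \<le> E"
  proof -
    have "1 * N \<le> (\<tau> powr (- 4 * d) * \<tau>^3) * N" by (rule mult_right_mono[OF power_interpolation(2)[OF \<tau> \<tau> d(2,1,3)] N0(1)])
    moreover have "0 \<le> \<tau> powr (- 4 * d) * (L / \<tau>)" using \<tau> N0 by simp
    ultimately show ?thesis unfolding E by (simp add: algebra_simps)
  qed
  have E0: "E \<ge> 0" using NE N0 by linarith
  \<comment> \<open>High and low frequencies are treated apart: \<open>power_interpolation\<close>
    needs modulus at least 1, and test functions need frequencies away from 0.\<close>
  define hi where "hi M k = (if 1 \<le> norm k \<and> norm k < M then g k else 0)" for M k
  define lo where "lo k = (if norm k < 1 then g k else 0)" for k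
  have shi: "sqint (hi M)" for M
    by (rule sqint_bound[OF F(4), where c=1]) (auto simp: hi_def[abs_def] g_def[symmetric])
  have slo: "sqint lo"
    by (rule sqint_bound[OF F(4), where c=1]) (auto simp: lo_def[abs_def] g_def[symmetric])
  have gi: "integrable lborel (\<lambda>k. (cmod (g k))^2)" unfolding g_def by (rule sqint_int[OF F(4)])
  have gN: "L2sq g = C * N" unfolding g_def N_def by (rule F(5))
  have le: "L2sq h \<le> C * N" if "sqint h" "\<And>k. cmod (h k) \<le> cmod (g k)" for h
    unfolding gN[symmetric] by (rule integral_mono[OF sqint_int[OF that(1)] gi]) (intro power_mono that(2) norm_ge_zero)
  have high: "(\<integral>\<^sup>+ x\<in>ball 0 R. ennreal ((cmod (V x))^2 * (cmod (IF (hi M) x / C))^2) \<partial>lborel) \<le> ennreal ((1 + c) * E)" if M: "M \<ge> 1" for M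
  proof -
    have z: "\<forall>k. norm k > M \<longrightarrow> hi M k = 0" by (simp add: hi_def)
    have z1: "\<forall>k. norm k < 1 \<longrightarrow> hi M k = 0" by (simp add: hi_def)
    note fbf = frac_bounded_frequency[OF fb shi z z1 M, folded C_def]
    have "(LBINT k. norm k powr (4 * s) * (cmod (hi M k))^2) \<le> (LBINT k. \<tau> powr (- 4 * d) * ((norm k)^4 * (cmod (g k))^2 / \<tau> + \<tau>^3 * (cmod (g k))^2))"
    proof (rule integral_mono[OF fbf(1)])
      show "integrable lborel (\<lambda>k. \<tau> powr (- 4 * d) * ((norm k)^4 * (cmod (g k))^2 / \<tau> + \<tau>^3 * (cmod (g k))^2))"
        using F(6) gi by (simp add: g_def)
      fix k
      show "norm k powr (4 * s) * (cmod (hi M k))^2 \<le> \<tau> powr (- 4 * d) * ((norm k)^4 * (cmod (g k))^2 / \<tau> + \<tau>^3 * (cmod (g k))^2)"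
      proof (cases "1 \<le> norm k \<and> norm k < M")
        case True
        from mult_right_mono[OF power_interpolation(1)[OF conjunct1[OF True] \<tau> d(2,1,3)], of "(cmod (g k))^2"]
        show ?thesis using True by (simp add: hi_def algebra_simps)
      next
        case False
        then have "hi M k = 0" by (auto simp: hi_def)
        then show ?thesis using \<tau> by simp
      qed
    qed
    also have "\<dots> = \<tau> powr (- 4 * d) * (C * L / \<tau> + \<tau>^3 * (C * N))"
      using F(6,7) gi gN by (simp add: g_def[symmetric] L_def[symmetric])
    also have "\<dots> = C * E" by (simp add: E algebra_simps)
    finally have a: "(LBINT k. norm k powr (4 * s) * (cmod (hi M k))^2) \<le> C * E" .
    have "c * L2sq (hi M) \<le> c * (C * N)"
      by (intro mult_left_mono c le shi) (simp add: hi_def)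
    also have "\<dots> \<le> c * (C * E)" using c C NE by (intro mult_left_mono) auto
    finally have "((LBINT k. norm k powr (4 * s) * (cmod (hi M k))^2) + c * L2sq (hi M)) / C \<le> (C * E + c * (C * E)) / C"
      using a C by (intro divide_right_mono add_mono) auto
    also have "\<dots> = (1 + c) * E" using C by (simp add: field_simps)
    finally show ?thesis by (intro order_trans[OF fbf(2)] ennreal_leI)
  qed
  have low: "(\<integral>\<^sup>+ x\<in>ball 0 R. ennreal ((cmod (V x))^2 * (cmod (IF lo x / C))^2) \<partial>lborel) \<le> ennreal ((27 + c) * E)"
  proof -
    \<comment> \<open>Length 2 moves the unit ball of frequencies into the annulus between 1 and 3.
      There the multiplier is at most 3^3 = 27, since 4 s <= 3.\<close>
    obtain \<xi> :: "real^'n" where \<xi>: "norm \<xi> = 2" using vector_choose_size[of 2] by auto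
    define H where "H k = lo (k - \<xi>)" for k
    have sH: "sqint H" unfolding H_def using sqint_translate[OF slo, of "- \<xi>"] by simp
    have z: "H k = 0" if "norm k > 3" for k
      using that norm_triangle_ineq2[of k \<xi>] \<xi> by (auto simp: H_def lo_def)
    have z1: "H k = 0" if "norm k < 1" for k
      using that norm_triangle_ineq2[of \<xi> k] \<xi> by (auto simp: H_def lo_def norm_minus_commute)
    have zz: "\<forall>k. norm k > 3 \<longrightarrow> H k = 0" and zz1: "\<forall>k. norm k < 1 \<longrightarrow> H k = 0" using z z1 by auto
    have three: "(1::real) \<le> 3" by simp
    note fbf = frac_bounded_frequency[OF fb sH zz zz1 three, folded C_def]
    have HN: "L2sq H \<le> C * N"
    proof -
      have "L2sq H = L2sq lo"
        using integral_translate(1)[of "\<lambda>k. (cmod (lo k))^2" "- \<xi>"] by (simp add: H_def)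
      also have "\<dots> \<le> C * N" by (rule le[OF slo]) (simp add: lo_def)
      finally show ?thesis .
    qed
    have "(LBINT k. norm k powr (4 * s) * (cmod (H k))^2) \<le> (LBINT k. 27 * (cmod (H k))^2)"
    proof (rule integral_mono[OF fbf(1)])
      show "integrable lborel (\<lambda>k. 27 * (cmod (H k))^2)" using sqint_int[OF sH] by simp
      fix k
      show "norm k powr (4 * s) * (cmod (H k))^2 \<le> 27 * (cmod (H k))^2"
      proof (cases "1 \<le> norm k \<and> norm k \<le> 3")
        case True
        have "norm k powr (4 * s) \<le> norm k powr 3" using True d by (intro powr_mono) auto
        also have "\<dots> \<le> 3 powr 3" using True by (intro powr_mono2) auto
        finally show ?thesis by (intro mult_right_mono) auto
      next
        case False
        then have "H k = 0" using z[of k] z1[of k] by linarith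
        then show ?thesis by simp
      qed
    qed
    also have "\<dots> = 27 * L2sq H" by simp
    also have "\<dots> \<le> 27 * (C * N)" using HN by simp
    also have "\<dots> \<le> 27 * (C * E)" using C NE by simp
    finally have a: "(LBINT k. norm k powr (4 * s) * (cmod (H k))^2) \<le> 27 * (C * E)" .
    have "c * L2sq H \<le> c * (C * N)" by (intro mult_left_mono c HN)
    also have "\<dots> \<le> c * (C * E)" using c C NE by (intro mult_left_mono) auto
    finally have "((LBINT k. norm k powr (4 * s) * (cmod (H k))^2) + c * L2sq H) / C \<le> (27 * (C * E) + c * (C * E)) / C"
      using a C by (intro divide_right_mono add_mono) auto
    also have "\<dots> = (27 + c) * E" using C by (simp add: field_simps)
    finally have b: "(\<integral>\<^sup>+ x\<in>ball 0 R. ennreal ((cmod (V x))^2 * (cmod (IF H x / C))^2) \<partial>lborel) \<le> ennreal ((27 + c) * E)"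
      by (intro order_trans[OF fbf(2)] ennreal_leI)
    have "cmod (IF H x / C) = cmod (IF lo x / C)" for x
      unfolding H_def IF_modulation norm_divide norm_mult by simp
    then show ?thesis using b by simp
  qed
  \<comment> \<open>Band-limited versions of \<open>v\<close>, to which the hypothesis applies.
    Convergence is known only in L^2, so V is carried to the limit by Fatou along an almost
    everywhere convergent subsequence.\<close>
  define w where "w m x = IF (\<lambda>k. indicator (ball 0 (real (Suc m))) k * g k) x / C" for m x
  have ilo: "integrable lborel lo" by (rule integrable_bounded_support[OF slo, of 1]) (simp add: lo_def)
  have ihi: "integrable lborel (hi M)" for M by (rule integrable_bounded_support[OF shi, of M M]) (simp add: hi_def)
  have w: "w m x = IF (hi (real (Suc m))) x / C + IF lo x / C" for m x
  proof -
    have "indicator (ball 0 (real (Suc m))) k * g k = hi (real (Suc m)) k + lo k" for k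
      by (auto simp: hi_def lo_def indicator_def)
    moreover have "IF (\<lambda>k. hi M k + lo k) x = IF (hi M) x + IF lo x" for M
    proof -
      have "integrable lborel (\<lambda>k. cis (k \<bullet> x) * hi M k)" "integrable lborel (\<lambda>k. cis (k \<bullet> x) * lo k)"
        by (intro integrable_cis ihi ilo, measurable)+
      then show ?thesis unfolding IF_def by (simp add: distrib_left)
    qed
    ultimately show ?thesis by (simp add: w_def add_divide_distrib)
  qed
  have wm [measurable]: "w m \<in> borel_measurable borel" for m
    using FT_borel(2)[OF ihi] FT_borel(2)[OF ilo] unfolding w[abs_def] by measurable
  have wb: "(\<integral>\<^sup>+ x. ennreal ((cmod (V x))^2 * (cmod (w m x))^2) * indicator (ball 0 R) x \<partial>lborel) \<le> ennreal ((56 + 4 * c) * E)" for m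
  proof -
    note [measurable] = FT_borel(2)[OF ihi] FT_borel(2)[OF ilo]
    let ?M = "real (Suc m)"
    have "(\<integral>\<^sup>+ x. ennreal ((cmod (V x))^2 * (cmod (w m x))^2) * indicator (ball 0 R) x \<partial>lborel)
      \<le> (\<integral>\<^sup>+ x. 2 * (ennreal ((cmod (V x))^2 * (cmod (IF (hi ?M) x / C))^2) * indicator (ball 0 R) x)
           + 2 * (ennreal ((cmod (V x))^2 * (cmod (IF lo x / C))^2) * indicator (ball 0 R) x) \<partial>lborel)"
    proof (rule nn_integral_mono)
      fix x
      have "(cmod (V x))^2 * (cmod (w m x))^2 \<le> (cmod (V x))^2 * (2 * (cmod (IF (hi ?M) x / C))^2 + 2 * (cmod (IF lo x / C))^2)"
        unfolding w by (intro mult_left_mono cmod_add_sq) simp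
      also have "\<dots> = 2 * ((cmod (V x))^2 * (cmod (IF (hi ?M) x / C))^2) + 2 * ((cmod (V x))^2 * (cmod (IF lo x / C))^2)"
        by (simp only: distrib_left mult.left_commute)
      finally have "ennreal ((cmod (V x))^2 * (cmod (w m x))^2) \<le> ennreal (2 * ((cmod (V x))^2 * (cmod (IF (hi ?M) x / C))^2) + 2 * ((cmod (V x))^2 * (cmod (IF lo x / C))^2))"
        by (rule ennreal_leI)
      also have "\<dots> = 2 * ennreal ((cmod (V x))^2 * (cmod (IF (hi ?M) x / C))^2) + 2 * ennreal ((cmod (V x))^2 * (cmod (IF lo x / C))^2)"
        by (rule ennreal_two) auto
      finally have "ennreal ((cmod (V x))^2 * (cmod (w m x))^2) \<le> 2 * ennreal ((cmod (V x))^2 * (cmod (IF (hi ?M) x / C))^2) + 2 * ennreal ((cmod (V x))^2 * (cmod (IF lo x / C))^2)" .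
      then show "ennreal ((cmod (V x))^2 * (cmod (w m x))^2) * indicator (ball 0 R) x \<le> 2 * (ennreal ((cmod (V x))^2 * (cmod (IF (hi ?M) x / C))^2) * indicator (ball 0 R) x)
           + 2 * (ennreal ((cmod (V x))^2 * (cmod (IF lo x / C))^2) * indicator (ball 0 R) x)"
        by (simp add: indicator_def)
    qed
    also have "\<dots> = 2 * (\<integral>\<^sup>+ x\<in>ball 0 R. ennreal ((cmod (V x))^2 * (cmod (IF (hi ?M) x / C))^2) \<partial>lborel)
        + 2 * (\<integral>\<^sup>+ x\<in>ball 0 R. ennreal ((cmod (V x))^2 * (cmod (IF lo x / C))^2) \<partial>lborel)"
      by (subst nn_integral_add, measurable) (subst (1 2) nn_integral_cmult, measurable)
    also have "\<dots> \<le> 2 * ennreal ((1 + c) * E) + 2 * ennreal ((27 + c) * E)"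
      by (intro add_mono mult_left_mono high low) auto
    also have "\<dots> = ennreal (2 * ((1 + c) * E) + 2 * ((27 + c) * E))"
      by (rule ennreal_two[symmetric]) (use c E0 in auto)
    \<comment> \<open>56 = 2 * (1 + 27): the high and the low part, doubled by the inequality for
      the square of a sum.\<close>
    also have "2 * ((1 + c) * E) + 2 * ((27 + c) * E) = (56 + 4 * c) * E" by (simp add: algebra_simps)
    finally show ?thesis .
  qed
  note ft = frequency_truncation[OF F(1,2), folded C_def]
  have conv: "(\<lambda>m. L2sq (\<lambda>x. w m x - v x)) \<longlonglongrightarrow> 0"
  proof -
    have "filterlim (\<lambda>m. real (Suc m)) at_top sequentially"
      using filterlim_compose[OF filterlim_real_sequentially filterlim_Suc] .
    from filterlim_compose[OF truncation_tendsto[OF F(4)] this]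
    have "(\<lambda>m. (L2sq (\<lambda>k. indicator (ball 0 (real (Suc m))) k * FT v k - FT v k)) / C) \<longlonglongrightarrow> 0 / C"
      by (intro tendsto_divide tendsto_const) (use C in auto)
    then show ?thesis unfolding w_def g_def ft(2) by simp
  qed
  obtain r where r: "strict_mono r" "AE x in lborel. (\<lambda>n. w (r n) x) \<longlonglongrightarrow> v x"
    using L2_AE_subseq[of w v, OF _ conv] ft(1) unfolding w_def g_def by blast
  have "(\<integral>\<^sup>+ x. ennreal ((cmod (V x))^2 * (cmod (v x))^2) * indicator (ball 0 R) x \<partial>lborel) \<le> ennreal ((56 + 4 * c) * E)"
  proof (rule fatou_bound[where u="\<lambda>n x. ennreal ((cmod (V x))^2 * (cmod (w (r n) x))^2) * indicator (ball 0 R) x"])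
    show "AE x in lborel. (\<lambda>n. ennreal ((cmod (V x))^2 * (cmod (w (r n) x))^2) * indicator (ball 0 R) x) \<longlonglongrightarrow> ennreal ((cmod (V x))^2 * (cmod (v x))^2) * indicator (ball 0 R) x"
      using r(2)
    proof eventually_elim
      case (elim x)
      have "(\<lambda>n. ennreal ((cmod (V x))^2 * (cmod (w (r n) x))^2)) \<longlonglongrightarrow> ennreal ((cmod (V x))^2 * (cmod (v x))^2)"
        by (intro tendsto_ennrealI tendsto_intros elim)
      then show ?case by (cases "x \<in> ball 0 R") (auto simp: indicator_def)
    qed
  qed (measurable, rule wb)
  also have "(\<integral>\<^sup>+ x. ennreal ((cmod (V x))^2 * (cmod (v x))^2) * indicator (ball 0 R) x \<partial>lborel) = (\<integral>\<^sup>+ x. ennreal ((cmod (V x))^2 * (cmod (v x))^2) \<partial>lborel)"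
    by (intro nn_integral_cong) (use v(2) in \<open>auto simp: indicator_def\<close>)
  finally have b: "(\<integral>\<^sup>+ x. ennreal ((cmod (V x))^2 * (cmod (v x))^2) \<partial>lborel) \<le> ennreal ((56 + 4 * c) * E)" .
  then show i: "integrable lborel (\<lambda>x. (cmod (V x))^2 * (cmod (v x))^2)"
    by (intro integrableI_nonneg) (auto simp: order.strict_trans1)
  show "(LBINT x. (cmod (V x))^2 * (cmod (v x))^2) \<le> (56 + 4 * c) * E"
    using b unfolding nn_integral_eq_integral[OF i AE_I2[OF mult_nonneg_nonneg[OF zero_le_power2 zero_le_power2]]]
    by (subst (asm) ennreal_le_iff) (use c E0 in auto)
qed

context potential_bound
begin

text \<open>The bound for V with \<tau> = 1, extended by a cut-off to functions without compact
  support. It makes V bounded from functions with square-integrable Laplacian to L^2 of the unit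
  ball.\<close>

lemma potential_local:
  obtains C where "C \<ge> 0" "\<And>w. C2_on UNIV w \<Longrightarrow> sqint w \<Longrightarrow> sqint (lap w) \<Longrightarrow>
    L2on (cball 0 1) (\<lambda>x. V x * w x) \<le> C * (L2sq (lap w) + L2sq w)"
proof -
  define L where "L = 1000 * (1 + real DIM('a))"
  have L: "L > 0" by (simp add: L_def)
  note bc = ball_cutoff[OF zero_less_one, where 'a='a, folded L_def, simplified, folded L_def]
  note b = bump[OF zero_less_one, where 'a='a]
  let ?m = "indicator (cball 0 (exp 1)) :: 'a \<Rightarrow> real"
  let ?\<beta> = "\<lambda>x::'a. bump 1 x * bump 1 x"
  define C where "C = K * (15 + 63 * L^4 + 1)"
  have C: "C \<ge> 0" using K L by (simp add: C_def)
  have "L2on (cball 0 1) (\<lambda>x. V x * w x) \<le> C * (L2sq (lap w) + L2sq w)"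
    if w: "C2_on UNIV w" and sw: "sqint w" and sl: "sqint (lap w)" for w
  proof -
    have s: "bump 1 x = 0" "?\<beta> x = 0" "?m x = 0" if "x \<notin> ball 0 4" for x :: 'a
      using b(5)[of x] that exp_le by (auto simp: indicator_def)
    have m: "?m \<in> borel_measurable borel" "\<And>x. 0 \<le> ?m x" "\<And>x. ?m x \<le> 1" by (intro borel_measurable_indicator) auto
    have bc': "gsq ?\<beta> x \<le> (L * bump 1 x)^2" "gsq (bump 1 :: 'a \<Rightarrow> real) x \<le> (L * ?m x)^2" "\<bar>lap ?\<beta> x\<bar> \<le> L^2 * ?m x" "(bump 1 x)^2 \<le> ?\<beta> x * ?m x" for x :: 'a
      using ball_cutoff(2-5)[OF zero_less_one, where 'a='a, of x] by (simp_all add: L_def)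
    have \<beta>2: "C2_on UNIV ?\<beta>" by (rule ball_cutoff(1)) simp
    note E = energy_complex[OF w \<beta>2 C2_C1[OF b(1)] s m L bc']
    have b1: "0 \<le> ?\<beta> x" "(?\<beta> x)^2 \<le> 1" for x
    proof -
      show "0 \<le> ?\<beta> x" by simp
      have "?\<beta> x \<le> 1" using mult_mono[OF b(3)[of x] b(3)[of x]] b(2)[of x] by simp
      then show "(?\<beta> x)^2 \<le> 1" using \<open>0 \<le> ?\<beta> x\<close> by (simp add: power_le_one)
    qed
    have c\<beta>: "C2_on UNIV (\<lambda>x. ?\<beta> x *\<^sub>R w x)" by (intro C2_on_scaleR \<beta>2 w open_UNIV)
    have z\<beta>: "?\<beta> x *\<^sub>R w x = 0" if "x \<notin> ball 0 3" for x using b(5)[of x] that exp_le by simp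
    define A where "A = L2sq (lap w)"
    define N where "N = L2sq w"
    have N0: "N \<ge> 0" "A \<ge> 0" unfolding N_def A_def by (auto intro!: integral_nonneg_AE)
    have EA: "(LBINT x. (?\<beta> x)^2 * (cmod (lap w x))^2) \<le> A" unfolding A_def
    proof (rule integral_mono[OF E(4) sqint_int[OF sl]])
      show "(?\<beta> x)^2 * (cmod (lap w x))^2 \<le> (cmod (lap w x))^2" for x
        using mult_right_mono[OF b1(2)[of x], of "(cmod (lap w x))^2"] by simp
    qed auto
    have EN: "(LBINT x. (?m x)^2 * (cmod (w x))^2) \<le> N" unfolding N_def
      by (rule integral_mono[OF E(3) sqint_int[OF sw]]) (auto simp: indicator_def)
    have i\<beta>: "integrable lborel (\<lambda>x. (cmod (?\<beta> x *\<^sub>R w x))^2)"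
      by (rule integrable_compact_support[of _ 3]) (use z\<beta> in \<open>auto intro!: continuous_intros C2_on_continuous[OF w] C2_on_continuous[OF b(1)]\<close>)
    have bN: "L2sq (\<lambda>x. ?\<beta> x *\<^sub>R w x) \<le> N" unfolding N_def
    proof (rule integral_mono[OF i\<beta> sqint_int[OF sw]])
      show "(cmod (?\<beta> x *\<^sub>R w x))^2 \<le> (cmod (w x))^2" for x
        using mult_right_mono[OF b1(2)[of x], of "(cmod (w x))^2"] by (simp add: norm_mult power_mult_distrib)
    qed
    have vb: "integrable lborel (\<lambda>x. (cmod (V x))^2 * (cmod (?\<beta> x *\<^sub>R w x))^2)"
      "(LBINT x. (cmod (V x))^2 * (cmod (?\<beta> x *\<^sub>R w x))^2) \<le> K * (L2sq (\<lambda>x. lap (\<lambda>x. ?\<beta> x *\<^sub>R w x) x) + L2sq (\<lambda>x. ?\<beta> x *\<^sub>R w x))"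
      using VB[of 1, OF _ c\<beta> z\<beta>] by simp_all
    have "L2on (cball 0 1) (\<lambda>x. V x * w x) \<le> (LBINT x. (cmod (V x))^2 * (cmod (?\<beta> x *\<^sub>R w x))^2)"
    proof (rule integral_mono[OF integrable_ball_V(1)[OF w order_refl] vb(1)])
      show "indicator (cball 0 1) x * (cmod (V x * w x))^2 \<le> (cmod (V x))^2 * (cmod (?\<beta> x *\<^sub>R w x))^2" for x
        using b(4)[of x] by (auto simp: indicator_def norm_mult power_mult_distrib)
    qed
    also note vb(2)
    also have "K * (L2sq (\<lambda>x. lap (\<lambda>x. ?\<beta> x *\<^sub>R w x) x) + L2sq (\<lambda>x. ?\<beta> x *\<^sub>R w x)) \<le> K * ((15 * A + 63 * L^4 * N) + N)"
    proof (intro mult_left_mono add_mono bN K)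
      have "63 * L^4 * (LBINT x. (?m x)^2 * (cmod (w x))^2) \<le> 63 * L^4 * N" using EN L by (intro mult_left_mono) auto
      then show "L2sq (\<lambda>x. lap (\<lambda>x. ?\<beta> x *\<^sub>R w x) x) \<le> 15 * A + 63 * L^4 * N"
        using E(2)[of 4] EA by simp
    qed
    also have "\<dots> \<le> C * (A + N)"
    proof -
      have "0 \<le> 63 * L^4 * A + A + 15 * N" using N0 L by simp
      then have "K * ((15 * A + 63 * L^4 * N) + N) \<le> K * ((15 + 63 * L^4 + 1) * (A + N))"
        by (intro mult_left_mono K) (simp add: algebra_simps)
      then show ?thesis by (simp add: C_def mult.assoc)
    qed
    finally show ?thesis by (simp add: A_def N_def)
  qed
  with C show thesis by (rule that)
qed

text \<open>On the unit ball the defect is (lap u_j - b) - V (u_j - a). The limit \<open>a\<close>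
  is not C2, so the bound for V cannot be applied to u_j - a; it is applied to u_j - u_n instead,
  and n tends to infinity by Fatou along an almost everywhere convergent subsequence.\<close>

lemma err_tendsto:
  assumes u: "\<And>j::nat. C2_on UNIV (u j)" "\<And>j. sqint (u j)" "\<And>j. sqint (lap (u j))" and ab: "sqint a" "sqint b"
    and e: "AE x in lborel. x \<in> cball 0 1 \<longrightarrow> b x = V x * a x"
    and c: "(\<lambda>j. L2sq (\<lambda>x. u j x - a x)) \<longlonglongrightarrow> 0" "(\<lambda>j. L2sq (\<lambda>x. lap (u j) x - b x)) \<longlonglongrightarrow> 0"
  shows "(\<lambda>j. L2on (cball 0 1) (err (u j))) \<longlonglongrightarrow> 0"
proof -
  obtain C where C: "C \<ge> 0" and pl: "\<And>w. C2_on UNIV w \<Longrightarrow> sqint w \<Longrightarrow> sqint (lap w) \<Longrightarrow>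
    L2on (cball 0 1) (\<lambda>x. V x * w x) \<le> C * (L2sq (lap w) + L2sq w)"
    by (rule potential_local) (rule that)
  note [measurable] = sqint_meas[OF ab(1)] sqint_meas[OF ab(2)] sqint_meas[OF u(2)] sqint_meas[OF u(3)]
  have [measurable]: "cball (0::'a) 1 \<in> sets borel" by simp
  define P Q where "P j = L2sq (\<lambda>x. u j x - a x)" and "Q j = L2sq (\<lambda>x. lap (u j) x - b x)" for j
  obtain r where r: "strict_mono r" "AE x in lborel. (\<lambda>n. u (r n) x) \<longlonglongrightarrow> a x"
    using L2_AE_subseq[OF sqint_diff[OF u(2) ab(1)] c(1)] .
  have pair: "L2on (cball 0 1) (\<lambda>x. V x * (u j x - u n x)) \<le> C * (2 * (Q j + Q n) + 2 * (P j + P n))"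
    and ip: "L2int (cball 0 1) (\<lambda>x. V x * (u j x - u n x))" for j n
  proof -
    have bl: "bounded_linear (uminus :: complex \<Rightarrow> complex)" by (intro bounded_linear_minus bounded_linear_ident)
    have n2: "C2_on UNIV (\<lambda>x. - u n x)" by (rule C2_on_linear(1)[OF open_UNIV u(1) bl])
    have d2: "C2_on UNIV (\<lambda>x. u j x - u n x)" using C2_on_add[OF open_UNIV u(1) n2, of j] by simp
    have dl: "lap (\<lambda>x. u j x - u n x) x = lap (u j) x - lap (u n) x" for x
      using lap_add[OF open_UNIV u(1) n2, of x j] C2_on_linear(3)[OF open_UNIV u(1) bl, of x n] by simp
    have "L2on (cball 0 1) (\<lambda>x. V x * (u j x - u n x))
      \<le> C * (L2sq (\<lambda>x. lap (u j) x - lap (u n) x) + L2sq (\<lambda>x. u j x - u n x))"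
      using pl[OF d2 sqint_diff[OF u(2) u(2)]] sqint_diff[OF u(3) u(3)] unfolding dl[abs_def] by blast
    also have "\<dots> \<le> C * ((2 * Q j + 2 * Q n) + (2 * P j + 2 * P n))"
    proof -
      have c: "L2sq (\<lambda>x. b x - lap (u n) x) = Q n" "L2sq (\<lambda>x. a x - u n x) = P n"
        by (simp_all only: P_def Q_def norm_minus_commute)
      show ?thesis using L2_triangle[OF u(3)[of j] ab(2) u(3)[of n]] L2_triangle[OF u(2)[of j] ab(1) u(2)[of n]]
        unfolding c P_def[symmetric] Q_def[symmetric] by (intro mult_left_mono add_mono C)
    qed
    finally show "L2on (cball 0 1) (\<lambda>x. V x * (u j x - u n x)) \<le> C * (2 * (Q j + Q n) + 2 * (P j + P n))"
      by (simp only: distrib_left)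
    show "L2int (cball 0 1) (\<lambda>x. V x * (u j x - u n x))"
      by (rule integrable_ball_V(1)[OF d2]) simp
  qed
  show ?thesis
  proof (rule LIMSEQ_I)
    fix \<epsilon>' :: real assume "\<epsilon>' > 0"
    define \<epsilon> where "\<epsilon> = \<epsilon>' / (2 * (2 + 16 * C))"
    have pos: "2 + 16 * C > 0" using C by simp
    have "(2 + 16 * C) * \<epsilon> = \<epsilon>' / 2" using pos unfolding \<epsilon>_def times_divide_eq_right by (subst mult.commute) (subst mult_divide_mult_cancel_right, auto)
    moreover have "\<epsilon> > 0" unfolding \<epsilon>_def using \<open>\<epsilon>' > 0\<close> pos by (intro divide_pos_pos) auto
    ultimately have \<epsilon>: "\<epsilon> > 0" "(2 + 16 * C) * \<epsilon> < \<epsilon>'" using \<open>\<epsilon>' > 0\<close> by auto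
    have "\<forall>\<^sub>F j in sequentially. P j < \<epsilon> \<and> Q j < \<epsilon>"
      using order_tendstoD(2)[OF c(1) \<epsilon>(1)] order_tendstoD(2)[OF c(2) \<epsilon>(1)] unfolding P_def Q_def by eventually_elim simp
    then obtain N where N: "\<And>j. j \<ge> N \<Longrightarrow> P j < \<epsilon> \<and> Q j < \<epsilon>" unfolding eventually_sequentially by blast
    have "norm (L2on (cball 0 1) (err (u j)) - 0) < \<epsilon>'" if j: "j \<ge> N" for j
    proof -
      have "(\<integral>\<^sup>+ x. ennreal (indicator (cball 0 1) x * (cmod (V x * (u j x - a x)))^2) \<partial>lborel) \<le> ennreal (8 * C * \<epsilon>)"
      proof (rule fatou_bound[where u="\<lambda>n x. ennreal (indicator (cball 0 1) x * (cmod (V x * (u j x - u (r (n + N)) x)))^2)"])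
        show "AE x in lborel. (\<lambda>n. ennreal (indicator (cball 0 1) x * (cmod (V x * (u j x - u (r (n + N)) x)))^2)) \<longlonglongrightarrow> ennreal (indicator (cball 0 1) x * (cmod (V x * (u j x - a x)))^2)"
          using r(2)
        proof eventually_elim
          case (elim x)
          have "(\<lambda>n. u (r (n + N)) x) \<longlonglongrightarrow> a x" using LIMSEQ_ignore_initial_segment[OF elim] .
          then show ?case by (intro tendsto_ennrealI tendsto_intros)
        qed
        fix n
        have rn: "r (n + N) \<ge> N" using seq_suble[OF r(1), of "n + N"] by simp
        have "(\<integral>\<^sup>+ x. ennreal (indicator (cball 0 1) x * (cmod (V x * (u j x - u (r (n + N)) x)))^2) \<partial>lborel)
          = ennreal (L2on (cball 0 1) (\<lambda>x. V x * (u j x - u (r (n + N)) x)))"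
          by (rule nn_integral_eq_integral[OF ip]) auto
        also have "\<dots> \<le> ennreal (C * (2 * (Q j + Q (r (n + N))) + 2 * (P j + P (r (n + N)))))"
          by (intro ennreal_leI pair)
        also have "\<dots> \<le> ennreal (C * (8 * \<epsilon>))"
          using N[OF j] N[OF rn] by (intro ennreal_leI mult_left_mono C) auto
        finally show "(\<integral>\<^sup>+ x. ennreal (indicator (cball 0 1) x * (cmod (V x * (u j x - u (r (n + N)) x)))^2) \<partial>lborel) \<le> ennreal (8 * C * \<epsilon>)"
          by (simp add: mult_ac)
      qed measurable
      then have va: "(\<integral>\<^sup>+ x. ennreal (indicator (cball 0 1) x * (cmod (V x * (u j x - a x)))^2) \<partial>lborel) \<le> ennreal (8 * C * \<epsilon>)" .
      have iv: "L2int (cball 0 1) (\<lambda>x. V x * (u j x - a x))"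
        using va by (intro integrableI_nonneg) (auto simp: order.strict_trans1)
      have va': "L2on (cball 0 1) (\<lambda>x. V x * (u j x - a x)) \<le> 8 * C * \<epsilon>"
        using va by (subst (asm) nn_integral_eq_integral[OF iv]) (use C \<epsilon> in auto)
      note iq = sqint_int[OF sqint_diff[OF u(3) ab(2)], of j]
      have "L2on (cball 0 1) (err (u j))
        \<le> (LBINT x. 2 * (cmod (lap (u j) x - b x))^2 + 2 * (indicator (cball 0 1) x * (cmod (V x * (u j x - a x)))^2))"
      proof (rule integral_mono_AE[OF integrable_ball_V(2)[OF u(1) order_refl]])
        show "AE x in lborel. indicator (cball 0 1) x * (cmod (err (u j) x))^2 \<le> 2 * (cmod (lap (u j) x - b x))^2 + 2 * (indicator (cball 0 1) x * (cmod (V x * (u j x - a x)))^2)"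
          using e
        proof eventually_elim
          case (elim x)
          show ?case
          proof (cases "x \<in> cball 0 1")
            case True
            with elim have "err (u j) x = (lap (u j) x - b x) - V x * (u j x - a x)" by (simp add: err_def right_diff_distrib)
            then show ?thesis using True cmod_diff_sq by simp
          qed simp
        qed
      qed (use iv iq in simp)
      also have "\<dots> = 2 * Q j + 2 * L2on (cball 0 1) (\<lambda>x. V x * (u j x - a x))"
        using iv iq by (simp add: Q_def)
      also have "\<dots> \<le> 2 * \<epsilon> + 2 * (8 * C * \<epsilon>)" using N[OF j] va' by linarith
      also have "\<dots> = (2 + 16 * C) * \<epsilon>" by (simp add: algebra_simps)
      finally have "L2on (cball 0 1) (err (u j)) < \<epsilon>'" using \<epsilon>(2) by linarith
      moreover have "0 \<le> L2on (cball 0 1) (err (u j))" by (auto intro!: integral_nonneg_AE)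
      ultimately show ?thesis by simp
    qed
    then show "\<exists>no. \<forall>n\<ge>no. norm (L2on (cball 0 1) (err (u n)) - 0) < \<epsilon>'" by blast
  qed
qed

end

section \<open>Moving a point of the space to the origin\<close>

lemma pd_translate:
  assumes "f differentiable (at (x + c))"
  shows "pd b (\<lambda>x. f (x + c)) x = pd b f (x + c)" "(\<lambda>x. f (x + c)) differentiable (at x)"
proof -
  have d: "(f has_derivative frechet_derivative f (at (x + c))) (at (x + c))" using assms frechet_derivative_works by blast
  have "((\<lambda>x. x + c) has_derivative (\<lambda>h. h)) (at x)" by (auto intro!: derivative_eq_intros)
  from has_derivative_compose[OF this d] have k: "((\<lambda>x. f (x + c)) has_derivative frechet_derivative f (at (x + c))) (at x)" .
  show "pd b (\<lambda>x. f (x + c)) x = pd b f (x + c)" using pd_eqI[OF k] by (simp add: pd_def)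
  show "(\<lambda>x. f (x + c)) differentiable (at x)" using k by (rule differentiableI)
qed

lemma C2_translate:
  assumes f: "C2_on UNIV f"
  shows "C2_on UNIV (\<lambda>x. f (x + c))" "lap (\<lambda>x. f (x + c)) = (\<lambda>x. lap f (x + c))"
proof -
  have t: "C1_on UNIV (\<lambda>x. g (x + c))" "pd b (\<lambda>x. g (x + c)) = (\<lambda>x. pd b g (x + c))" if "C1_on UNIV g" for g :: "'a \<Rightarrow> 'b" and b
  proof -
    have d: "g differentiable (at x)" for x using C1_onD[OF that] by simp
    show p: "pd b (\<lambda>x. g (x + c)) = (\<lambda>x. pd b g (x + c))" for b using pd_translate(1)[OF d] by (rule ext)
    show "C1_on UNIV (\<lambda>x. g (x + c))" unfolding C1_on_def p
    proof (intro conjI ballI)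
      show "(\<lambda>x. g (x + c)) differentiable (at x)" for x by (rule pd_translate(2)[OF d])
      show "continuous_on UNIV (\<lambda>x. pd b g (x + c))" if "b \<in> Basis" for b
        by (rule continuous_on_compose2[OF C1_on_continuous_pd[OF \<open>C1_on UNIV g\<close> that]]) (auto intro!: continuous_intros)
    qed
  qed
  note p1 = t(2)[OF C2_C1[OF f]]
  have p2: "pd e (pd b (\<lambda>x. f (x + c))) = (\<lambda>x. pd e (pd b f) (x + c))" if "b \<in> Basis" for b e
    unfolding p1 by (rule t(2)[OF C2_C1_pd[OF f that]])
  show "C2_on UNIV (\<lambda>x. f (x + c))" unfolding C2_on_def
  proof (intro conjI ballI)
    show "C1_on UNIV (\<lambda>x. f (x + c))" by (rule t(1)[OF C2_C1[OF f]])
    show "C1_on UNIV (pd b (\<lambda>x. f (x + c)))" if "b \<in> Basis" for b unfolding p1 by (rule t(1)[OF C2_C1_pd[OF f that]])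
    show "pd b (pd e (\<lambda>x. f (x + c))) x = pd e (pd b (\<lambda>x. f (x + c))) x" if "b \<in> Basis" "e \<in> Basis" for b e x
      by (simp only: p2 that C2_sym[OF f UNIV_I that])
  qed
  show "lap (\<lambda>x. f (x + c)) = (\<lambda>x. lap f (x + c))" unfolding lap_def by (simp add: p2 fun_eq_iff)
qed

lemma AE_translate:
  fixes c :: "'a::euclidean_space"
  assumes "AE x in lborel. P x" shows "AE x in lborel. P (x + c)"
proof (rule AE_distrD[of "\<lambda>x. x + c" lborel borel])
  have "distr lborel borel (\<lambda>x. x + c) = (lborel :: 'a measure)" using lborel_distr_plus[of c] by (simp add: add.commute[of _ c])
  then show "AE x in distr lborel borel (\<lambda>x. x + c). P x" using assms by (simp only:)
qed simp

text \<open>The hypothesis concerns balls around the origin; radius |x0| + 3 contains the ball of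
  radius 3 around x0 that \<open>potential_bound\<close> refers to after translation.\<close>

lemma frac_bounded_local:
  fixes V :: "real^'n::finite \<Rightarrow> complex"
  assumes fb: "frac_bounded V s (norm x0 + 3) c" and d: "0 < d" "d \<le> 3/4" "s \<le> 3/4 - d"
  shows "potential_bound (\<lambda>x. V (x + x0)) (56 + 4 * c) d"
proof
  have [measurable]: "V \<in> borel_measurable borel" and c: "c \<ge> 0" using fb by (auto simp: frac_bounded_def)
  show "(\<lambda>x. V (x + x0)) \<in> borel_measurable borel" by measurable
  show "0 \<le> 56 + 4 * c" using c by simp
  show "0 < d" by (rule d)
  fix \<tau> :: real and v :: "real^'n \<Rightarrow> complex" assume \<tau>: "1 \<le> \<tau>" and v: "C2_on UNIV v" "\<And>x. x \<notin> ball 0 3 \<Longrightarrow> v x = 0"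
  define w where "w x = v (x + - x0)" for x
  have w: "C2_on UNIV w" "lap w = (\<lambda>x. lap v (x + - x0))" unfolding w_def[abs_def] by (rule C2_translate[OF v(1)])+
  have z: "w x = 0" if "x \<notin> ball 0 (norm x0 + 3)" for x
    unfolding w_def by (rule v(2)) (use that norm_triangle_ineq2[of x x0] in auto)
  note F = frac_bounded_C2[OF fb d \<tau> w(1) z]
  have t: "(LBINT x. f (x + - x0)) = (LBINT x. f x)" for f :: "real^'n \<Rightarrow> real" by (rule integral_translate(1))
  have e: "(\<lambda>x. (cmod (V (x + x0)))^2 * (cmod (v x))^2) = (\<lambda>x. (cmod (V (x + x0)))^2 * (cmod (w (x + x0)))^2)" by (simp add: w_def)
  have i: "integrable lborel (\<lambda>x. (cmod (V (x + x0)))^2 * (cmod (v x))^2)"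
    unfolding e using integral_translate(2)[of "\<lambda>x. (cmod (V x))^2 * (cmod (w x))^2" x0] F(1) by simp
  have "(LBINT x. (cmod (V (x + x0)))^2 * (cmod (v x))^2) = (LBINT x. (cmod (V x))^2 * (cmod (w x))^2)"
    unfolding e by (rule integral_translate(1))
  moreover have "L2sq (lap w) = L2sq (lap v)"
    unfolding w(2) by (rule t[of "\<lambda>x. (cmod (lap v x))^2"])
  moreover have "L2sq w = L2sq v"
    unfolding w_def by (rule t[of "\<lambda>x. (cmod (v x))^2"])
  ultimately show "integrable lborel (\<lambda>x. (cmod (V (x + x0)))^2 * (cmod (v x))^2) \<and>
      (LBINT x. (cmod (V (x + x0)))^2 * (cmod (v x))^2) \<le>
        (56 + 4 * c) * \<tau> powr (- 4 * d) * (L2sq (lap v) / \<tau> + \<tau>^3 * L2sq v)"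
    using i F(2) by (simp only: mult.assoc simp_thms)
qed

lemma solution_local:
  fixes V \<Psi> :: "real^'n::finite \<Rightarrow> complex"
  assumes sol: "solves_schroedinger V0 \<Psi>0" and V: "AE x in lborel. V0 x = V x"
    and \<Psi>: "\<Psi> \<in> borel_measurable borel" "AE x in lborel. \<Psi>0 x = \<Psi> x" and pb: "potential_bound (\<lambda>x. V (x + x0)) K d"
  shows "\<exists>u. potential_bound.approximates (\<lambda>x. V (x + x0)) u (\<lambda>x. \<Psi> (x + x0))"
proof -
  obtain a b u where ab: "sqint a" "sqint b" "AE x in lborel. x \<in> ball 0 (norm x0 + 3) \<longrightarrow> a x = \<Psi>0 x"
    "AE x in lborel. x \<in> ball 0 (norm x0 + 3) \<longrightarrow> b x = V0 x * \<Psi>0 x"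
    and u: "\<And>j::nat. C2_on UNIV (u j)" "\<And>j. sqint (u j)" "\<And>j. sqint (lap (u j))"
    "(\<lambda>j. L2sq (\<lambda>x. u j x - a x)) \<longlonglongrightarrow> 0" "(\<lambda>j. L2sq (\<lambda>x. lap (u j) x - b x)) \<longlonglongrightarrow> 0"
    by (rule solution_approx[OF sol, of "norm x0 + 3"]) (simp add: add_nonneg_pos, rule that)
  note [measurable] = sqint_meas[OF ab(1)] sqint_meas[OF u(2)] \<Psi>(1)
  have [measurable]: "cball (0::real^'n) 1 \<in> sets borel" by simp
  have in_ball: "x + x0 \<in> ball 0 (norm x0 + 3)" if "x \<in> cball 0 1" for x
    using that norm_triangle_ineq[of x x0] by simp
  have A: "AE x in lborel. x \<in> cball 0 1 \<longrightarrow> \<Psi> (x + x0) = a (x + x0)"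
    using AE_translate[OF ab(3), of x0] AE_translate[OF \<Psi>(2), of x0] by eventually_elim (use in_ball in auto)
  have B: "AE x in lborel. x \<in> cball 0 1 \<longrightarrow> b (x + x0) = V (x + x0) * a (x + x0)"
    using AE_translate[OF ab(4), of x0] AE_translate[OF ab(3), of x0] AE_translate[OF V, of x0] by eventually_elim (use in_ball in auto)
  have \<Psi>i: "L2int (cball 0 1) (\<lambda>x. \<Psi> (x + x0))" by (rule L2on_le_L2sq(1)[OF _ _ sqint_translate[OF ab(1)] A]) measurable
  have t: "(LBINT x. f (x + x0)) = (LBINT x. f x)" for f :: "real^'n \<Rightarrow> real" by (rule integral_translate(1))
  define w where "w j x = u j (x + x0)" for j x
  have w: "C2_on UNIV (w j)" "lap (w j) = (\<lambda>x. lap (u j) (x + x0))" for j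
    unfolding w_def[abs_def] by (rule C2_translate[OF u(1)])+
  have sw: "sqint (w j)" "sqint (lap (w j))" for j
  proof -
    show "sqint (w j)" unfolding w_def[abs_def] by (rule sqint_translate[OF u(2)])
    show "sqint (lap (w j))" unfolding w(2) by (rule sqint_translate[OF u(3)])
  qed
  have c1: "(\<lambda>j. L2sq (\<lambda>x. w j x - a (x + x0))) \<longlonglongrightarrow> 0"
    unfolding w_def using u(4) by (subst t[where f="\<lambda>x. (cmod (u _ x - a x))^2"])
  have c2: "(\<lambda>j. L2sq (\<lambda>x. lap (w j) x - b (x + x0))) \<longlonglongrightarrow> 0"
    unfolding w(2) using u(5) by (subst t[where f="\<lambda>x. (cmod (lap (u _) x - b x))^2"])
  have "(\<lambda>j. L2on (cball 0 1) (\<lambda>x. w j x - \<Psi> (x + x0))) \<longlonglongrightarrow> 0"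
  proof (rule tendsto_sandwich[OF _ _ tendsto_const c1])
    note [measurable] = sqint_meas[OF sw(1)]
    have "L2on (cball 0 1) (\<lambda>x. w j x - \<Psi> (x + x0)) \<le> L2sq (\<lambda>x. w j x - a (x + x0))" for j
      by (rule L2on_le_L2sq(2)[OF _ _ sqint_diff[OF sw(1) sqint_translate[OF ab(1)]]]) (measurable, use A in auto)
    then show "\<forall>\<^sub>F j in sequentially. L2on (cball 0 1) (\<lambda>x. w j x - \<Psi> (x + x0)) \<le> L2sq (\<lambda>x. w j x - a (x + x0))" by simp
  qed (auto intro!: always_eventually integral_nonneg_AE)
  moreover have "(\<lambda>j. L2on (cball 0 1) (\<lambda>x. potential_bound.err (\<lambda>x. V (x + x0)) (w j) x)) \<longlonglongrightarrow> 0"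
    by (rule potential_bound.err_tendsto[OF pb w(1) sw sqint_translate[OF ab(1)] sqint_translate[OF ab(2)] B c1 c2])
  ultimately show ?thesis
    unfolding potential_bound.approximates_def[OF pb] using w(1) \<Psi>i by (intro exI[of _ w]) auto
qed

section \<open>Density points\<close>

text \<open>The set of bad points is covered, up to a null set, by disjoint small balls on each of
  which S misses a fixed proportion. Their total measure is controlled by the measure of U - S for
  an open U around S, which can be made arbitrarily small.\<close>

lemma density_point:
  fixes S :: "'a::euclidean_space set"
  assumes S: "S \<in> sets borel" "emeasure lborel S > 0"
  obtains x where "\<And>\<eta>. \<eta> > 0 \<Longrightarrow> \<exists>r0>0. \<forall>r. 0 < r \<and> r < r0 \<longrightarrow> measure lborel (ball x r - S) \<le> \<eta> * r ^ DIM('a)"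
proof -
  \<comment> \<open>Points of S around which, at arbitrarily small scales, the complement of S fills
    at least the fraction 1/m of the ball.\<close>
  define T where "T m = {x\<in>S. \<forall>d>0. \<exists>r. 0 < r \<and> r < d \<and> emeasure lborel (ball x r) \<le> of_nat m * emeasure lborel (ball x r - S)}" for m :: nat
  have neg: "negligible (T m)" for m
    unfolding negligible_outer_le
  proof (intro allI impI)
    fix e :: real assume e: "e > 0"
    have "S \<in> sets lebesgue" using S(1) by simp
    moreover have "e / (real m + 1) > 0" using e by simp
    ultimately obtain U where U: "open U" "S \<subseteq> U" "emeasure lebesgue (U - S) < ennreal (e / (real m + 1))"
      by (rule sets_lebesgue_outer_open) (rule that)
    \<comment> \<open>The balls must lie inside \<open>U\<close>, so that what they miss of S is
      part of U - S. The bad scales are arbitrarily small, which gives a Vitali covering.\<close>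
    define K where "K = {(x, r). x \<in> T m \<and> 0 < r \<and> ball x r \<subseteq> U \<and> emeasure lborel (ball x r) \<le> of_nat m * emeasure lborel (ball x r - S)}"
    have cov: "\<exists>i. i \<in> K \<and> x \<in> ball (fst i) (snd i) \<and> snd i < d" if x: "x \<in> T m" and d: "0 < d" for x d
    proof -
      have "x \<in> U" using x U(2) by (auto simp: T_def)
      then obtain k where k: "k > 0" "ball x k \<subseteq> U" using U(1) openE by blast
      have "min d k > 0" using d k by simp
      then obtain r where r: "0 < r" "r < min d k" "emeasure lborel (ball x r) \<le> of_nat m * emeasure lborel (ball x r - S)"
        using x unfolding T_def by blast
      have "ball x r \<subseteq> U" using r(2) k(2) subset_ball[of r k x] by auto
      then have "(x, r) \<in> K" using x r by (simp add: K_def)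
      then show ?thesis using r by (intro exI[of _ "(x, r)"]) auto
    qed
    obtain C where C: "countable C" "C \<subseteq> K" "pairwise (\<lambda>i j. disjnt (ball (fst i) (snd i)) (ball (fst j) (snd j))) C"
      "negligible (T m - (\<Union>i\<in>C. ball (fst i) (snd i)))"
      using Vitali_covering_theorem_balls[of "T m" K fst snd, OF cov] by blast
    define B where "B i = ball (fst i) (snd i)" for i :: "'a \<times> real"
    have Bm: "B i \<in> sets lborel" "B i - S \<in> sets lborel" for i using S(1) by (auto simp: B_def)
    have dis: "disjoint_family_on B C" "disjoint_family_on (\<lambda>i. B i - S) C"
      using C(3) unfolding disjoint_family_on_def pairwise_def disjnt_def B_def by blast+
    have BU: "B i \<subseteq> U" if "i \<in> C" for i using C(2) that unfolding B_def K_def by (cases i) auto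
    have US: "U - S \<in> sets lborel" using U(1) S(1) by simp
    have "emeasure lborel (\<Union>i\<in>C. B i) = (\<integral>\<^sup>+ i. emeasure lborel (B i) \<partial>count_space C)"
      by (rule emeasure_UN_countable[OF Bm(1) C(1) dis(1)])
    also have "\<dots> \<le> (\<integral>\<^sup>+ i. of_nat m * emeasure lborel (B i - S) \<partial>count_space C)"
      by (rule nn_integral_mono) (use C(2) in \<open>auto simp: B_def K_def\<close>)
    also have "\<dots> = of_nat m * (\<integral>\<^sup>+ i. emeasure lborel (B i - S) \<partial>count_space C)" by (rule nn_integral_cmult) simp
    also have "(\<integral>\<^sup>+ i. emeasure lborel (B i - S) \<partial>count_space C) = emeasure lborel (\<Union>i\<in>C. B i - S)"
      by (rule emeasure_UN_countable[OF Bm(2) C(1) dis(2), symmetric])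
    also have "\<dots> \<le> emeasure lborel (U - S)"
      by (rule emeasure_mono[OF _ US]) (use BU in auto)
    also have "\<dots> = emeasure lebesgue (U - S)" using US by simp
    also have "\<dots> \<le> ennreal (e / (real m + 1))" using U(3) by simp
    finally have le: "emeasure lborel (\<Union>i\<in>C. B i) \<le> of_nat m * ennreal (e / (real m + 1))" by (simp add: mult_left_mono)
    also have "\<dots> = ennreal (m * (e / (real m + 1)))" unfolding ennreal_of_nat_eq_real_of_nat by (rule ennreal_mult[symmetric]) (use e in auto)
    also have "\<dots> \<le> ennreal e" using e by (intro ennreal_leI) (simp add: field_simps)
    finally have le: "emeasure lborel (\<Union>i\<in>C. B i) \<le> ennreal e" .
    have Um: "(\<Union>i\<in>C. B i) \<in> sets lborel" unfolding B_def by (simp add: open_UN)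
    have Ul: "(\<Union>i\<in>C. B i) \<in> lmeasurable" "measure lebesgue (\<Union>i\<in>C. B i) \<le> e"
    proof -
      show "(\<Union>i\<in>C. B i) \<in> lmeasurable"
        by (rule fmeasurableI) (use Um le in \<open>auto simp: order.strict_trans1\<close>)
      have "measure lborel (\<Union>i\<in>C. B i) \<le> e"
        using le e by (simp add: measure_def enn2real_leI)
      then show "measure lebesgue (\<Union>i\<in>C. B i) \<le> e" using Um by simp
    qed
    let ?N = "T m - (\<Union>i\<in>C. B i)"
    have N: "negligible ?N" using C(4) by (simp add: B_def)
    show "\<exists>T'. T m \<subseteq> T' \<and> T' \<in> lmeasurable \<and> measure lebesgue T' \<le> e"
    proof (intro exI conjI)
      show "T m \<subseteq> ?N \<union> (\<Union>i\<in>C. B i)" by blast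
      show "?N \<union> (\<Union>i\<in>C. B i) \<in> lmeasurable" by (intro fmeasurable.Un negligible_imp_measurable N Ul)
      have "measure lebesgue (?N \<union> (\<Union>i\<in>C. B i)) \<le> measure lebesgue ?N + measure lebesgue (\<Union>i\<in>C. B i)"
        by (rule measure_Un_le) (use negligible_imp_measurable[OF N] Ul in \<open>auto simp: fmeasurable_def\<close>)
      then show "measure lebesgue (?N \<union> (\<Union>i\<in>C. B i)) \<le> e" using negligible_imp_measure0[OF N] Ul(2) by simp
    qed
  qed
  have "\<not> S \<subseteq> (\<Union>m. T m)"
  proof
    assume "S \<subseteq> (\<Union>m. T m)"
    then have "negligible S" by (rule negligible_subset[OF negligible_Union_nat[OF neg]])
    then show False using S by (simp add: negligible_iff_null_sets null_sets_def)
  qed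
  then obtain x where x: "x \<in> S" "\<And>m. x \<notin> T m" by blast
  show thesis
  proof (rule that[of x])
    fix \<eta> :: real assume \<eta>: "\<eta> > 0"
    define c where "c = measure lborel (ball (0::'a) 1)"
    have c: "c > 0" by (simp add: c_def)
    \<comment> \<open>A ball of radius r has measure c r^n; outside \<open>T m\<close> the missing
      part is at most c r^n / m, which is below \<eta> r^n.\<close>
    obtain m :: nat where m: "m > c / \<eta>" using reals_Archimedean2 by blast
    then have m0: "real m > 0" using divide_pos_pos[OF c \<eta>] by linarith
    obtain d where d: "d > 0" "\<And>r. 0 < r \<Longrightarrow> r < d \<Longrightarrow> \<not> emeasure lborel (ball x r) \<le> of_nat m * emeasure lborel (ball x r - S)"
      using x(2)[of m] x(1) unfolding T_def by blast
    have "measure lborel (ball x r - S) \<le> \<eta> * r ^ DIM('a)" if r: "0 < r" "r < d" for r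
    proof -
      have f: "emeasure lborel (ball x r - S) < \<infinity>" "emeasure lborel (ball x r) < \<infinity>"
        using emeasure_bounded_finite[of "ball x r - S"] emeasure_bounded_finite[OF bounded_ball] by auto
      have "of_nat m * emeasure lborel (ball x r - S) \<le> emeasure lborel (ball x r)" using d(2)[OF r] by auto
      then have "ennreal (m * measure lborel (ball x r - S)) \<le> ennreal (measure lborel (ball x r))"
        using f by (simp add: emeasure_eq_ennreal_measure ennreal_mult ennreal_of_nat_eq_real_of_nat less_top[symmetric])
      then have "m * measure lborel (ball x r - S) \<le> r ^ DIM('a) * c"
        using content_ball_conv_unit_ball[of r x] r by (simp add: c_def)
      then have "measure lborel (ball x r - S) \<le> r ^ DIM('a) * c / m" using m0 by (simp add: field_simps)
      also have "\<dots> = (c / m) * r ^ DIM('a)" by simp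
      also have "\<dots> \<le> \<eta> * r ^ DIM('a)" using m m0 \<eta> r by (intro mult_right_mono) (auto simp: field_simps)
      finally show ?thesis .
    qed
    then show "\<exists>r0>0. \<forall>r. 0 < r \<and> r < r0 \<longrightarrow> measure lborel (ball x r - S) \<le> \<eta> * r ^ DIM('a)" using d(1) by blast
  qed
qed

text \<open>Cauchy-Schwarz against the indicator, from the nonnegativity of the integral of (f -
  t)^2 over A for every t. For a null set A no minimising t exists, and that case is argued
  separately.\<close>

lemma square_integral_le:
  fixes f :: "'a \<Rightarrow> real"
  assumes A: "A \<in> sets M" "emeasure M A < \<infinity>" and f: "f \<in> borel_measurable M" "integrable M (\<lambda>x. (f x)^2)"
  shows "(\<integral>x. indicator A x * f x \<partial>M)^2 \<le> measure M A * (\<integral>x. (f x)^2 \<partial>M)"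
proof -
  note [measurable] = A(1) f(1)
  have iA: "integrable M (\<lambda>x. indicator A x :: real)" using A by simp
  have i2: "integrable M (\<lambda>x. indicator A x * (f x)^2)"
    by (rule integrable_bound[OF f(2)]) (auto simp: indicator_def)
  have i1: "integrable M (\<lambda>x. indicator A x * f x)"
  proof (rule integrable_bound)
    show "integrable M (\<lambda>x. indicator A x + indicator A x * (f x)^2)" using iA i2 by simp
    show "AE x in M. norm (indicator A x * f x) \<le> norm (indicator A x + indicator A x * (f x)^2)"
    proof (rule AE_I2)
      fix x
      have "\<bar>f x\<bar> \<le> 1 + (f x)^2" using sum_squares_bound[of 1 "\<bar>f x\<bar>"] by simp
      then show "norm (indicator A x * f x) \<le> norm (indicator A x + indicator A x * (f x)^2)" by (simp add: indicator_def)
    qed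
  qed measurable
  define W I J where "W = measure M A" and "I = (\<integral>x. indicator A x * f x \<partial>M)" and "J = (\<integral>x. indicator A x * (f x)^2 \<partial>M)"
  have W: "W \<ge> 0" by (simp add: W_def)
  have JJ: "J \<le> (\<integral>x. (f x)^2 \<partial>M)" unfolding J_def by (rule integral_mono[OF i2 f(2)]) (auto simp: indicator_def)
  have q: "0 \<le> J - 2 * t * I + t^2 * W" for t
  proof -
    have "0 \<le> (\<integral>x. indicator A x * (f x - t)^2 \<partial>M)" by (auto intro!: integral_nonneg_AE)
    also have "\<dots> = (\<integral>x. indicator A x * (f x)^2 - 2 * t * (indicator A x * f x) + t^2 * indicator A x \<partial>M)"
      by (intro integral_cong refl) (simp add: power2_eq_square algebra_simps)
    also have "\<dots> = J - 2 * t * I + t^2 * W" using i1 i2 iA A by (simp add: J_def I_def W_def)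
    finally show ?thesis .
  qed
  have "I^2 \<le> W * J"
  proof (cases "W = 0")
    case True
    have "I = 0"
    proof (rule ccontr)
      assume "I \<noteq> 0"
      then show False using q[of "(J + 1) / (2 * I)"] True by simp
    qed
    then show ?thesis using True by simp
  next
    case False
    have "0 \<le> W * (J - 2 * (I / W) * I + (I / W)^2 * W)" using W q[of "I / W"] by (rule mult_nonneg_nonneg)
    also have "\<dots> = W * J - I^2" using False by (simp add: field_simps power2_eq_square)
    finally show ?thesis by simp
  qed
  also have "\<dots> \<le> W * (\<integral>x. (f x)^2 \<partial>M)" by (intro mult_left_mono JJ W)
  finally show ?thesis by (simp add: I_def W_def)
qed

text \<open>The part of \<open>v\<close> with frequencies below \<open>\<mu>\<close> is bounded pointwise, the rest is small in the mean.\<close>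

lemma small_set_bound:
  fixes v :: "'a::euclidean_space \<Rightarrow> complex"
  assumes v: "C2_on UNIV v" "\<forall>x. x \<notin> ball 0 R \<longrightarrow> v x = 0" and A: "A \<in> sets borel" "emeasure lborel A < \<infinity>" and \<mu>: "\<mu> > 0"
  shows "L2on A v \<le> 2 / \<mu>^4 * L2sq (lap v)
     + 2 * measure lborel A * (measure lborel (ball (0::'a) 1) / (gc TYPE('a))^2) * \<mu> ^ DIM('a) * L2sq v"
proof -
  define C where "C = (gc TYPE('a))^2"
  have C: "C > 0" using gc_pos[where 'a='a] by (simp add: C_def)
  note F = FT_C2_compact[OF v, folded C_def]
  define g where "g = FT v"
  define N L where "N = L2sq v" and "L = L2sq (lap v)"
  define w where "w x = IF (\<lambda>k. indicator (ball 0 \<mu>) k * g k) x / C" for x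
  note t = sqint_truncate[OF F(4), of \<mu>, folded g_def]
  note [measurable] = sqint_meas[OF F(2)] sqint_meas[OF F(4), folded g_def] A(1)
  note ft = frequency_truncation[OF F(1,2), of \<mu>, folded C_def g_def, folded w_def]
  have wm [measurable]: "w \<in> borel_measurable borel" unfolding w_def[abs_def] using FT_borel(2)[OF t(2)] by measurable
  define c where "c = measure lborel (ball (0::'a) 1)"
  \<comment> \<open>A function is bounded by the L^1 norm of its transform, and Cauchy-Schwarz over
    the ball of frequencies brings in its volume c \<mu>^n. One of the two factors 1/C is used up by
    Plancherel.\<close>
  have wb: "(cmod (w x))^2 \<le> c / C * \<mu> ^ DIM('a) * N" for x
  proof -
    have "cmod (w x) \<le> (LBINT k. cmod (indicator (ball 0 \<mu>) k * g k)) / C"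
      unfolding w_def norm_divide norm_of_real using FT_borel(4)[OF t(2), of x] C by (simp add: divide_right_mono)
    also have "(LBINT k. cmod (indicator (ball 0 \<mu>) k * g k)) = (LBINT k. indicator (ball 0 \<mu>) k * cmod (g k))"
      by (intro integral_cong refl) (auto simp: indicator_def)
    finally have "(cmod (w x))^2 \<le> ((LBINT k. indicator (ball 0 \<mu>) k * cmod (g k)) / C)^2" by (intro power_mono) auto
    also have "\<dots> = (LBINT k. indicator (ball 0 \<mu>) k * cmod (g k))^2 / C^2" by (simp add: power_divide)
    also have "\<dots> \<le> (measure lborel (ball (0::'a) \<mu>) * L2sq g) / C^2"
      using emeasure_bounded_finite[OF bounded_ball, of "0::'a" \<mu>] sqint_int[OF F(4), folded g_def]
      by (intro divide_right_mono square_integral_le) auto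
    also have "measure lborel (ball (0::'a) \<mu>) = \<mu> ^ DIM('a) * c" unfolding c_def by (rule content_ball_conv_unit_ball) (use \<mu> in simp)
    also have "L2sq g = C * N" unfolding g_def N_def by (rule F(5))
    also have "\<mu> ^ DIM('a) * c * (C * N) / C^2 = c / C * \<mu> ^ DIM('a) * N" using C by (simp add: power2_eq_square)
    finally show ?thesis .
  qed
  \<comment> \<open>Beyond frequency \<mu> one has 1 <= |k|^4 / \<mu>^4, and |k|^4 stands for the
    square of the Laplacian.\<close>
  have d: "L2sq (\<lambda>x. w x - v x) \<le> L / \<mu>^4"
  proof -
    have "L2sq (\<lambda>x. w x - v x) = L2sq (\<lambda>k. indicator (ball 0 \<mu>) k * g k - g k) / C" by (rule ft(2))
    also have "\<dots> \<le> (LBINT k. (norm k)^4 * (cmod (g k))^2 / \<mu>^4) / C"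
    proof (intro divide_right_mono integral_mono)
      show "integrable lborel (\<lambda>k. (cmod (indicator (ball 0 \<mu>) k * g k - g k))^2)"
        by (rule sqint_int[OF sqint_diff[OF t(1) F(4)[folded g_def]]])
      show "integrable lborel (\<lambda>k. (norm k)^4 * (cmod (g k))^2 / \<mu>^4)" using F(6) by (simp add: g_def)
      show "(cmod (indicator (ball 0 \<mu>) k * g k - g k))^2 \<le> (norm k)^4 * (cmod (g k))^2 / \<mu>^4" for k
      proof (cases "norm k < \<mu>")
        case False
        then have "\<mu>^4 \<le> (norm k)^4" using \<mu> by (intro power_mono) auto
        then have "\<mu>^4 * (cmod (g k))^2 \<le> (norm k)^4 * (cmod (g k))^2" by (intro mult_right_mono) auto
        then show ?thesis using False \<mu> by (simp add: field_simps)
      qed simp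
    qed (use C in auto)
    also have "\<dots> = L / \<mu>^4" using F(7) C by (simp add: g_def[symmetric] L_def[symmetric])
    finally show ?thesis .
  qed
  have iv: "L2int A v"
    by (rule integrable_bound[OF sqint_int[OF F(2)]]) (auto simp: indicator_def)
  have iA: "integrable lborel (\<lambda>x. indicator A x :: real)" using A by simp
  have i3: "integrable lborel (\<lambda>x. 2 * (cmod (w x - v x))^2 + 2 * (c / C * \<mu> ^ DIM('a) * N) * indicator A x)"
    using sqint_int[OF ft(1)] iA by simp
  have "L2on A v \<le> (LBINT x. 2 * (cmod (w x - v x))^2 + 2 * (c / C * \<mu> ^ DIM('a) * N) * indicator A x)"
  proof (rule integral_mono[OF iv i3])
    fix x
    have "(cmod (v x))^2 \<le> 2 * (cmod (w x))^2 + 2 * (cmod (w x - v x))^2" using cmod_add_sq[of "w x" "- (w x - v x)"] by (simp add: norm_minus_commute)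
    then show "indicator A x * (cmod (v x))^2 \<le> 2 * (cmod (w x - v x))^2 + 2 * (c / C * \<mu> ^ DIM('a) * N) * indicator A x"
      using wb[of x] by (auto simp: indicator_def)
  qed
  also have "\<dots> = 2 * L2sq (\<lambda>x. w x - v x) + 2 * (c / C * \<mu> ^ DIM('a) * N) * measure lborel A"
    using sqint_int[OF ft(1)] iA A by simp
  also have "\<dots> \<le> 2 * (L / \<mu>^4) + 2 * (c / C * \<mu> ^ DIM('a) * N) * measure lborel A" using d by simp
  finally show ?thesis by (simp add: N_def L_def c_def C_def mult_ac)
qed

text \<open>The claimed bound scales by exactly e^k from e to exp 1 * e, so one use of the decay
  hypothesis carries it down one step. Induction is on the number of steps needed to climb above
  \<open>r0\<close>, where monotonicity suffices.\<close>

lemma geometric_decay: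
  fixes N :: "real \<Rightarrow> real"
  assumes mono: "\<And>r s. 0 < r \<Longrightarrow> r \<le> s \<Longrightarrow> s \<le> 1 \<Longrightarrow> N r \<le> N s" and N0: "N 1 \<ge> 0"
    and r0: "0 < r0" "exp 1 * r0 \<le> 1" and dec: "\<And>r. 0 < r \<Longrightarrow> r < r0 \<Longrightarrow> N r \<le> exp (- real k) * N (exp 1 * r)"
    and e: "0 < e" "e < 1"
  shows "N e \<le> N 1 / r0 ^ k * e ^ k"
proof -
  have ek: "(exp 1 :: real) ^ k = exp (real k)" by (simp add: exp_of_nat_mult[symmetric])
  have step: "\<forall>e. 0 < e \<and> e \<le> 1 \<and> r0 * exp (- real m) \<le> e \<longrightarrow> N e \<le> N 1 / r0 ^ k * e ^ k" for m :: nat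
  proof (induction m)
    case 0
    have "N e \<le> N 1 / r0 ^ k * e ^ k" if "0 < e" "e \<le> 1" "r0 \<le> e" for e
    proof -
      have "N e \<le> N 1 * 1" using mono[of e 1] that by simp
      also have "\<dots> \<le> N 1 * (e / r0) ^ k" using that r0 N0 by (intro mult_left_mono one_le_power) auto
      finally show ?thesis by (simp add: power_divide)
    qed
    then show ?case by simp
  next
    case (Suc m)
    show ?case
    proof (intro allI impI)
      fix e assume e: "0 < e \<and> e \<le> 1 \<and> r0 * exp (- real (Suc m)) \<le> e"
      show "N e \<le> N 1 / r0 ^ k * e ^ k"
      proof (cases "r0 \<le> e")
        case True
        have "r0 * exp (- real m) \<le> r0 * 1" using r0 by (intro mult_left_mono) auto
        then show ?thesis using Suc e True by auto
      next
        case False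
        have a: "exp 1 * e \<le> 1" using False r0(2) order_trans[OF mult_left_mono[of e r0 "exp 1"]] by auto
        have "exp 1 * (r0 * exp (- real (Suc m))) = r0 * (exp 1 * exp (- real (Suc m)))" by simp
        also have "exp 1 * exp (- real (Suc m)) = exp (- real m)" unfolding exp_add[symmetric] by simp
        finally have q: "exp 1 * (r0 * exp (- real (Suc m))) = r0 * exp (- real m)" .
        have "exp 1 * (r0 * exp (- real (Suc m))) \<le> exp 1 * e" using e by (intro mult_left_mono) auto
        then have b: "r0 * exp (- real m) \<le> exp 1 * e" unfolding q .
        have "N e \<le> exp (- real k) * N (exp 1 * e)" using dec e False by simp
        also have "\<dots> \<le> exp (- real k) * (N 1 / r0 ^ k * (exp 1 * e) ^ k)"
          using Suc a b e by (intro mult_left_mono) auto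
        also have "\<dots> = N 1 / r0 ^ k * e ^ k" unfolding power_mult_distrib ek by (simp add: exp_minus field_simps)
        finally show ?thesis .
      qed
    qed
  qed
  obtain m :: nat where "real m > - ln (e / r0)" using reals_Archimedean2 by blast
  then have "exp (- real m) \<le> exp (ln (e / r0))" by simp
  then have "r0 * exp (- real m) \<le> e" using e r0 by (simp add: field_simps)
  then show ?thesis using step[of m] e by auto
qed

context potential_bound
begin

lemma doubling:
  assumes ap: "approximates u \<Psi>"
    and S: "S \<in> sets borel" "AE x in lborel. x \<in> S \<longrightarrow> \<Psi> x = 0"
  obtains D where "D \<ge> 0" "\<And>M r. M > 0 \<Longrightarrow> r > 0 \<Longrightarrow> exp 1 * r \<le> 1 \<Longrightarrow>
    L2on (cball 0 r) \<Psi> \<le>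
      D * (1 / M^4 + M ^ DIM('a) * (measure lborel (cball 0 r - S) / r ^ DIM('a))) * L2on (cball 0 (exp 1 * r)) \<Psi>"
proof -
  have \<Psi>: "L2int (cball 0 1) \<Psi>" and \<Psi>m: "\<Psi> \<in> borel_measurable borel" and u: "C2_on UNIV (u j)"
    and conv: "(\<lambda>j. L2on (cball 0 1) (\<lambda>x. u j x - \<Psi> x)) \<longlonglongrightarrow> 0" "(\<lambda>j. L2on (cball 0 1) (err (u j))) \<longlonglongrightarrow> 0" for j
    using ap by (auto simp: approximates_def)
  obtain C where C: "C \<ge> 0" and cac: "\<And>u r. C2_on UNIV u \<Longrightarrow> 0 < r \<Longrightarrow> exp 1 * r \<le> 1 \<Longrightarrow>
      r^4 * L2sq (\<lambda>x. lap (\<lambda>x. (bump r x * bump r x) *\<^sub>R u x) x) \<le>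
        C * (L2on (cball 0 (exp 1 * r)) u + L2on (cball 0 (exp 1 * r)) (err u)) \<and>
      r^2 * (LBINT x. indicator (cball 0 r) x * gsqc u x) \<le>
        C * (L2on (cball 0 (exp 1 * r)) u + L2on (cball 0 (exp 1 * r)) (err u))"
    by (rule caccioppoli) (rule that)
  define c0 where "c0 = measure lborel (ball (0::'a) 1) / (gc TYPE('a))^2"
  have c0: "c0 \<ge> 0" by (simp add: c0_def)
  note [measurable] = C2_borel[OF u] \<Psi>m S(1)
  have [measurable]: "cball 0 s \<in> sets (borel :: 'a measure)" for s by simp
  define P where "P j = L2on (cball 0 1) (\<lambda>x. u j x - \<Psi> x)" for j
  define E where "E j = L2on (cball 0 1) (err (u j))" for j
  define N where "N s = L2on (cball 0 s) \<Psi>" for s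
  have iu: "L2int (cball 0 s) (u j)" for s j
    by (intro integrable_cball continuous_intros C2_on_continuous u)
  have i\<Psi>: "L2int (cball 0 s) \<Psi>" if "s \<le> 1" for s by (rule L2on_subset(1)[OF _ _ \<Psi>]) (use that in auto)
  note near = L2on_perturb[OF _ _ _ C2_borel(1)[OF u] \<Psi>m iu \<Psi>]
  have iP: "L2int (cball 0 1) (\<lambda>x. u j x - \<Psi> x)" for j by (rule near(1)[of "cball 0 1"]) auto
  have main: "N r \<le> (8 * C + 8 * c0) * (1 / M^4 + M ^ DIM('a) * (measure lborel (cball 0 r - S) / r ^ DIM('a))) * N (exp 1 * r)"
    if M: "M > 0" and r: "r > 0" and er: "exp 1 * r \<le> 1" for M r
  proof -
    have r1: "r \<le> 1" using r er order_trans[OF mult_right_mono[of 1 "exp 1" r] er] by auto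
    \<comment> \<open>Up to a null set, the mass of \<Psi> in the ball sits on this part, whose
      measure is small near a density point.\<close>
    define A where "A = cball 0 r - S"
    have A [measurable]: "A \<in> sets borel" using S(1) by (simp add: A_def)
    have Af: "emeasure lborel A < \<infinity>" unfolding A_def by (rule emeasure_bounded_finite) (auto intro: bounded_subset[OF bounded_cball])
    define X Y where "X = 1 / M^4" and "Y = M ^ DIM('a) * (measure lborel A / r ^ DIM('a))"
    have XY: "X \<ge> 0" "Y \<ge> 0" using M r by (simp_all add: X_def Y_def)
    note b = bump[OF r, where 'a='a]
    have jb: "N r \<le> 2 * P j + (4 * C * X + 4 * c0 * Y) * (2 * N (exp 1 * r) + 2 * P j) + 4 * C * X * E j" for j
    proof -
      define v where "v x = (bump r x * bump r x) *\<^sub>R u j x" for x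
      define L where "L = L2sq (lap v)"
      define Nj where "Nj = L2on (cball 0 (exp 1 * r)) (u j)"
      have v2: "C2_on UNIV v" unfolding v_def[abs_def] by (intro C2_on_scaleR C2_on_mult b u open_UNIV)
      have vz: "\<forall>x. x \<notin> ball 0 2 \<longrightarrow> v x = 0" using b(5) er by (auto simp: v_def)
      note F = FT_C2_compact[OF v2 vz]
      have vN: "L2sq v \<le> Nj" unfolding Nj_def
      proof (rule integral_mono[OF sqint_int[OF F(2)] iu])
        fix x
        show "(cmod (v x))^2 \<le> indicator (cball 0 (exp 1 * r)) x * (cmod (u j x))^2"
        proof (cases "norm x \<le> exp 1 * r")
          case True
          have "bump r x * bump r x \<le> 1" using mult_mono[OF b(3)[of x] b(3)[of x]] b(2)[of x] by simp
          then have "cmod (v x) \<le> 1 * cmod (u j x)" unfolding v_def norm_scaleR by (intro mult_right_mono) auto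
          then show ?thesis using True by (simp add: power_mono)
        next
          case False
          then show ?thesis using b(5)[of x] by (simp add: v_def)
        qed
      qed
      have Ej: "L2on (cball 0 (exp 1 * r)) (err (u j)) \<le> E j" unfolding E_def
        by (rule integral_mono[OF integrable_ball_V(2)[OF u er] integrable_ball_V(2)[OF u order_refl]])
          (use er in \<open>auto simp: indicator_def\<close>)
      have "r^4 * L \<le> C * (Nj + L2on (cball 0 (exp 1 * r)) (err (u j)))"
        using cac[OF u r er, of j] unfolding L_def Nj_def v_def by blast
      also have "\<dots> \<le> C * (Nj + E j)" using C Ej by (intro mult_left_mono) auto
      finally have rL: "r^4 * L \<le> C * (Nj + E j)" .
      \<comment> \<open>Frequency M/r is the scale-invariant choice: the first term becomes 2 M^(-4)
        times r^4 L, exactly what Caccioppoli bounds, and the second depends only on the measure of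
        A relative to r^n.\<close>
      have "L2on A v \<le> 2 / (M / r)^4 * L + 2 * measure lborel A * c0 * (M / r) ^ DIM('a) * L2sq v"
        unfolding L_def c0_def by (rule small_set_bound[OF v2 vz A Af]) (use M r in simp)
      also have "2 / (M / r)^4 * L = 2 * X * (r^4 * L)" using r M by (simp add: X_def power_divide field_simps)
      also have "2 * measure lborel A * c0 * (M / r) ^ DIM('a) * L2sq v = 2 * c0 * Y * L2sq v"
        by (simp add: Y_def power_divide)
      also have "2 * X * (r^4 * L) + 2 * c0 * Y * L2sq v \<le> 2 * X * (C * (Nj + E j)) + 2 * c0 * Y * Nj"
        using XY c0 by (intro add_mono mult_left_mono rL vN) auto
      finally have vA: "L2on A v \<le> 2 * X * (C * (Nj + E j)) + 2 * c0 * Y * Nj" .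
      have iA: "L2int A v"
        using sqint_meas[OF F(2)] by (intro integrable_bound[OF sqint_int[OF F(2)]]) (auto simp: indicator_def)
      have "N r \<le> (LBINT x. 2 * (indicator (cball 0 1) x * (cmod (u j x - \<Psi> x))^2) + 2 * (indicator A x * (cmod (v x))^2))"
        unfolding N_def
      proof (rule integral_mono_AE[OF i\<Psi>[OF r1]])
        show "integrable lborel (\<lambda>x. 2 * (indicator (cball 0 1) x * (cmod (u j x - \<Psi> x))^2) + 2 * (indicator A x * (cmod (v x))^2))"
          using iP iA by simp
        show "AE x in lborel. indicator (cball 0 r) x * (cmod (\<Psi> x))^2 \<le> 2 * (indicator (cball 0 1) x * (cmod (u j x - \<Psi> x))^2) + 2 * (indicator A x * (cmod (v x))^2)"
          using S(2)
        proof eventually_elim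
          case (elim x)
          show ?case
          proof (cases "x \<in> A")
            case True
            then have x: "norm x \<le> r" by (simp add: A_def)
            then have "v x = u j x" using b(4)[of x] by (simp add: v_def)
            moreover have "(cmod (\<Psi> x))^2 \<le> 2 * (cmod (u j x - \<Psi> x))^2 + 2 * (cmod (u j x))^2"
              using cmod_diff_sq[of "u j x" "u j x - \<Psi> x"] by simp
            ultimately show ?thesis using True x r1 by simp
          next
            case False
            then have "indicator (cball 0 r) x * (cmod (\<Psi> x))^2 = 0" using elim by (auto simp: A_def indicator_def)
            then show ?thesis by (simp only:) simp
          qed
        qed
      qed
      also have "\<dots> = 2 * P j + 2 * L2on A v" using iP iA by (simp add: P_def)
      also have "\<dots> \<le> 2 * P j + 2 * (2 * X * (C * (Nj + E j)) + 2 * c0 * Y * Nj)" using vA by simp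
      also have "\<dots> = 2 * P j + (4 * C * X + 4 * c0 * Y) * Nj + 4 * C * X * E j" by (simp add: algebra_simps)
      also have "\<dots> \<le> 2 * P j + (4 * C * X + 4 * c0 * Y) * (2 * N (exp 1 * r) + 2 * P j) + 4 * C * X * E j"
      proof -
        have le: "Nj \<le> 2 * N (exp 1 * r) + 2 * P j"
          unfolding Nj_def N_def P_def by (rule near(2)) (use er in auto)
        have "0 \<le> 4 * C * X + 4 * c0 * Y" using C c0 XY by simp
        from mult_left_mono[OF le this] show ?thesis by (intro add_right_mono add_left_mono)
      qed
      finally show ?thesis .
    qed
    have "(\<lambda>j. 2 * P j + (4 * C * X + 4 * c0 * Y) * (2 * N (exp 1 * r) + 2 * P j) + 4 * C * X * E j) \<longlonglongrightarrow>
      2 * 0 + (4 * C * X + 4 * c0 * Y) * (2 * N (exp 1 * r) + 2 * 0) + 4 * C * X * 0"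
      unfolding P_def E_def by (intro tendsto_intros conv)
    moreover have "2 * 0 + (4 * C * X + 4 * c0 * Y) * (2 * N (exp 1 * r) + 2 * 0) + 4 * C * X * 0 = (8 * C * X + 8 * c0 * Y) * N (exp 1 * r)"
      by (simp add: algebra_simps)
    ultimately have "(\<lambda>j. 2 * P j + (4 * C * X + 4 * c0 * Y) * (2 * N (exp 1 * r) + 2 * P j) + 4 * C * X * E j) \<longlonglongrightarrow> (8 * C * X + 8 * c0 * Y) * N (exp 1 * r)"
      by (simp only:)
    from tendsto_lowerbound[OF this always_eventually[OF allI[OF jb]]]
    have "N r \<le> (8 * C * X + 8 * c0 * Y) * N (exp 1 * r)" by simp
    also have "\<dots> \<le> ((8 * C + 8 * c0) * (X + Y)) * N (exp 1 * r)"
    proof (rule mult_right_mono)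
      have "0 \<le> C * Y" "0 \<le> c0 * X" using C c0 XY by auto
      then show "8 * C * X + 8 * c0 * Y \<le> (8 * C + 8 * c0) * (X + Y)" by (simp add: algebra_simps)
      show "0 \<le> N (exp 1 * r)" unfolding N_def by (auto intro!: integral_nonneg_AE)
    qed
    finally show ?thesis by (simp add: X_def Y_def A_def)
  qed
  show thesis
  proof (rule that[of "8 * C + 8 * c0"])
    show "8 * C + 8 * c0 \<ge> 0" using C c0 by simp
  qed (use main[unfolded N_def] in blast)
qed

lemma infinite_order_at_density_point:
  assumes ap: "approximates u \<Psi>"
    and S: "S \<in> sets borel" "AE x in lborel. x \<in> S \<longrightarrow> \<Psi> x = 0"
    and dens: "\<And>\<eta>. \<eta> > 0 \<Longrightarrow> \<exists>r0>0. \<forall>r. 0 < r \<and> r < r0 \<longrightarrow> measure lborel (ball 0 r - S) \<le> \<eta> * r ^ DIM('a)"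
  shows "\<exists>c. \<forall>e. 0 < e \<and> e < 1 \<longrightarrow> L2on (ball 0 e) \<Psi> \<le> c * e ^ k"
proof -
  have \<Psi>: "L2int (cball 0 1) \<Psi>" and \<Psi>m: "\<Psi> \<in> borel_measurable borel" and u: "C2_on UNIV (u j)"
    and conv: "(\<lambda>j. L2on (cball 0 1) (\<lambda>x. u j x - \<Psi> x)) \<longlonglongrightarrow> 0" "(\<lambda>j. L2on (cball 0 1) (err (u j))) \<longlonglongrightarrow> 0" for j
    using ap by (auto simp: approximates_def)
  obtain D where D: "D \<ge> 0" and dbl: "\<And>M r. M > 0 \<Longrightarrow> r > 0 \<Longrightarrow> exp 1 * r \<le> 1 \<Longrightarrow>
    L2on (cball 0 r) \<Psi> \<le>
      D * (1 / M^4 + M ^ DIM('a) * (measure lborel (cball 0 r - S) / r ^ DIM('a))) * L2on (cball 0 (exp 1 * r)) \<Psi>"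
    by (rule doubling[OF ap S]) (rule that)
  define N where "N s = L2on (cball 0 s) \<Psi>" for s
  note [measurable] = \<Psi>m
  have [measurable]: "cball 0 s \<in> sets (borel :: 'a measure)" "ball 0 s \<in> sets (borel :: 'a measure)" for s by auto
  have N0: "N s \<ge> 0" for s unfolding N_def by (auto intro!: integral_nonneg_AE)
  have mono: "N r \<le> N s" if "r \<le> s" "s \<le> 1" for r s
    unfolding N_def by (rule L2on_subset(2)[OF _ _ L2on_subset(1)[OF _ _ \<Psi>]]) (use that in auto)
  define \<kappa> where "\<kappa> = exp (- real k)"
  \<comment> \<open>The wanted decay factor \<kappa> is split in halves. \<open>M\<close> is chosen
    first, to put D / M^4 below one half; only then is \<eta> chosen, small enough to beat M^n as
    well, and the density of S fixes the radius.\<close>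
  define M where "M = 1 + 2 * D / \<kappa>"
  have \<kappa>: "\<kappa> > 0" by (simp add: \<kappa>_def)
  have M: "M \<ge> 1" using D \<kappa> by (simp add: M_def)
  have DM: "D / M^4 \<le> \<kappa> / 2"
  proof -
    have "2 * D / \<kappa> \<le> M" by (simp add: M_def)
    also have "M \<le> M^4" using M power_increasing[of 1 4 M] by simp
    finally have "2 * D \<le> \<kappa> * M^4" using \<kappa> by (simp add: field_simps)
    then show ?thesis using M by (simp add: field_simps)
  qed
  define D1 where "D1 = D + 1"
  have D1: "D1 > 0" "D \<le> D1" using D by (simp_all add: D1_def)
  \<comment> \<open>2^n pays for enclosing a closed ball in the open ball of twice its radius;
    \<open>D1\<close> replaces D so that the quotient makes sense even for D = 0.\<close>
  define \<eta> where "\<eta> = \<kappa> / (2 * D1 * M ^ DIM('a) * 2 ^ DIM('a))"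
  have \<eta>: "\<eta> > 0" unfolding \<eta>_def using \<kappa> D1 M by (intro divide_pos_pos mult_pos_pos) auto
  obtain r0 where r0: "r0 > 0" "\<And>r. 0 < r \<Longrightarrow> r < r0 \<Longrightarrow> measure lborel (ball 0 r - S) \<le> \<eta> * r ^ DIM('a)"
    using dens[OF \<eta>] by blast
  define r1 where "r1 = min (r0 / 2) (exp (-1))"
  have r1: "r1 > 0" "exp 1 * r1 \<le> 1"
  proof -
    show "r1 > 0" using r0 by (simp add: r1_def)
    have "exp 1 * r1 \<le> exp 1 * exp (-1)" by (intro mult_left_mono) (auto simp: r1_def)
    then show "exp 1 * r1 \<le> 1" by (simp flip: exp_add)
  qed
  have dec: "N r \<le> exp (- real k) * N (exp 1 * r)" if r: "0 < r" "r < r1" for r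
  proof -
    have er: "exp 1 * r \<le> 1" by (rule order_trans[OF mult_left_mono[of r r1 "exp 1"] r1(2)]) (use r in auto)
    have "measure lborel (cball 0 r - S) \<le> measure lborel (ball 0 (2 * r) - S)"
    proof (rule measure_mono_fmeasurable)
      show "cball 0 r - S \<subseteq> ball 0 (2 * r) - S" using r by auto
      show "cball 0 r - S \<in> sets lborel" using S(1) by simp
      show "ball 0 (2 * r) - S \<in> fmeasurable lborel"
        using S(1) emeasure_bounded_finite[of "ball 0 (2 * r) - S"] by (intro fmeasurableI) auto
    qed
    also have "\<dots> \<le> \<eta> * (2 * r) ^ DIM('a)" using r by (intro r0(2)) (auto simp: r1_def)
    also have "\<dots> = \<eta> * 2 ^ DIM('a) * r ^ DIM('a)" by (simp add: power_mult_distrib)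
    finally have "measure lborel (cball 0 r - S) / r ^ DIM('a) \<le> \<eta> * 2 ^ DIM('a)"
      using r by (simp add: pos_divide_le_eq)
    then have "D * (M ^ DIM('a) * (measure lborel (cball 0 r - S) / r ^ DIM('a))) \<le> D * (M ^ DIM('a) * (\<eta> * 2 ^ DIM('a)))"
      using D M by (intro mult_left_mono) auto
    also have "\<dots> \<le> D1 * (M ^ DIM('a) * (\<eta> * 2 ^ DIM('a)))"
      using M \<eta> D1 by (intro mult_right_mono) auto
    also have "\<dots> = \<kappa> / 2" using D1 M by (simp add: \<eta>_def)
    finally have "D * (1 / M^4 + M ^ DIM('a) * (measure lborel (cball 0 r - S) / r ^ DIM('a))) \<le> \<kappa> / 2 + \<kappa> / 2"
      using DM unfolding distrib_left by (intro add_mono) auto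
    then have "D * (1 / M^4 + M ^ DIM('a) * (measure lborel (cball 0 r - S) / r ^ DIM('a))) * N (exp 1 * r) \<le> \<kappa> * N (exp 1 * r)"
      by (intro mult_right_mono N0) simp
    then show ?thesis using dbl[of M r] M r er unfolding N_def \<kappa>_def by simp
  qed
  have "L2on (ball 0 e) \<Psi> \<le> N 1 / r1 ^ k * e ^ k" if e: "0 < e" "e < 1" for e
  proof -
    have "L2on (ball 0 e) \<Psi> \<le> N e"
      unfolding N_def by (rule L2on_subset(2)[OF _ _ L2on_subset(1)[OF _ _ \<Psi>]]) (use e in auto)
    also have "N e \<le> N 1 / r1 ^ k * e ^ k"
      by (rule geometric_decay[where N = N, OF _ N0 r1 dec e]) (rule mono)
    finally show ?thesis .
  qed
  then show ?thesis by blast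
qed

end

section \<open>Unique continuation\<close>

lemma vanishes_local:
  fixes V \<Psi> :: "real^'n::finite \<Rightarrow> complex"
  assumes sol: "solves_schroedinger V0 \<Psi>0" and V: "AE x in lborel. V0 x = V x"
    and \<Psi>: "\<Psi> \<in> borel_measurable borel" "AE x in lborel. \<Psi>0 x = \<Psi> x" and pb: "potential_bound (\<lambda>x. V (x + x0)) K d"
    and vanish: "\<And>k. \<exists>c. \<forall>e. 0 < e \<and> e < 1 \<longrightarrow> L2on (ball 0 e) (\<lambda>x. \<Psi> (x + x0)) \<le> c * e ^ k"
  shows "AE x in lborel. x \<in> ball x0 (1/8) \<longrightarrow> \<Psi> x = 0"
proof -
  obtain u where "potential_bound.approximates (\<lambda>x. V (x + x0)) u (\<lambda>x. \<Psi> (x + x0))"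
    using solution_local[OF sol V \<Psi> pb] by blast
  from potential_bound.vanish_near_zero[OF pb this vanish]
  have "AE x in lborel. x \<in> ball 0 (1/8) \<longrightarrow> \<Psi> (x + x0) = 0" .
  from AE_translate[OF this, of "- x0"] show ?thesis
    by eventually_elim (auto simp: dist_norm norm_minus_commute)
qed

text \<open>Around a point inside a zero ball the mass is zero on radii below the distance \<rho> to
  its boundary. For larger radii (e / \<rho>)^k is at least 1, so the total mass times this factor
  is a bound.\<close>

lemma vanishes_propagate:
  fixes \<Psi> :: "'a::euclidean_space \<Rightarrow> complex"
  assumes \<Psi>: "\<Psi> \<in> borel_measurable borel" and i: "L2int (cball 0 1) (\<lambda>x. \<Psi> (x + y))"
    and z: "AE x in lborel. x \<in> ball x0 \<rho>0 \<longrightarrow> \<Psi> x = 0" and y: "y \<in> ball x0 \<rho>0"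
  shows "\<exists>c. \<forall>e. 0 < e \<and> e < 1 \<longrightarrow> L2on (ball 0 e) (\<lambda>x. \<Psi> (x + y)) \<le> c * e ^ k"
proof -
  note [measurable] = \<Psi>
  have [measurable]: "ball 0 s \<in> sets (borel :: 'a measure)" for s by simp
  define \<rho> where "\<rho> = \<rho>0 - dist x0 y"
  have \<rho>: "\<rho> > 0" using y by (simp add: \<rho>_def)
  define N where "N = L2on (cball 0 1) (\<lambda>x. \<Psi> (x + y))"
  have N: "N \<ge> 0" unfolding N_def by (auto intro!: integral_nonneg_AE)
  have zy: "AE x in lborel. x \<in> ball 0 \<rho> \<longrightarrow> \<Psi> (x + y) = 0"
    using AE_translate[OF z, of y]
  proof eventually_elim
    case (elim x)
    have "x \<in> ball 0 \<rho> \<Longrightarrow> x + y \<in> ball x0 \<rho>0"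
      using dist_triangle[of x0 "x + y" y] by (simp add: \<rho>_def dist_norm)
    then show ?case using elim by blast
  qed
  have "L2on (ball 0 e) (\<lambda>x. \<Psi> (x + y)) \<le> N / \<rho> ^ k * e ^ k" if e: "0 < e" "e < 1" for e
  proof (cases "e \<le> \<rho>")
    case True
    have "L2on (ball 0 e) (\<lambda>x. \<Psi> (x + y)) = (\<integral>x. 0 \<partial>(lborel :: 'a measure))"
    proof (rule integral_cong_AE)
      show "AE x in lborel. indicator (ball 0 e) x * (cmod (\<Psi> (x + y)))^2 = 0"
        using zy by eventually_elim (use True in \<open>auto simp: indicator_def\<close>)
    qed measurable
    then show ?thesis using N \<rho> e by simp
  next
    case False
    have "L2on (ball 0 e) (\<lambda>x. \<Psi> (x + y)) \<le> N" unfolding N_def by (rule L2on_subset(2)[OF _ _ i]) (use e in auto)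
    also have "N * 1 \<le> N * (e / \<rho>) ^ k" using False \<rho> N by (intro mult_left_mono one_le_power) auto
    finally show ?thesis by (simp add: power_divide)
  qed
  then show ?thesis by blast
qed

text \<open>Because the radius is the same at every point, the set of centres of zero balls is open
  and closed. The balls are then reduced to countably many, so that the exceptional null sets can be
  united.\<close>

lemma vanishes_everywhere:
  fixes \<Psi> :: "'a::euclidean_space \<Rightarrow> complex"
  assumes "r > 0" and z: "AE x in lborel. x \<in> ball x0 r \<longrightarrow> \<Psi> x = 0"
    and step: "\<And>x y. (AE z in lborel. z \<in> ball x r \<longrightarrow> \<Psi> z = 0) \<Longrightarrow> y \<in> ball x r \<Longrightarrow> AE z in lborel. z \<in> ball y r \<longrightarrow> \<Psi> z = 0"
  shows "AE x in lborel. \<Psi> x = 0"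
proof -
  define Z where "Z = {x. AE z in lborel. z \<in> ball x r \<longrightarrow> \<Psi> z = 0}"
  have st: "y \<in> Z" if "x \<in> Z" "dist x y < r" for x y using step[of x y] that by (simp add: Z_def)
  have "open Z" unfolding open_dist
  proof
    fix x assume "x \<in> Z"
    then show "\<exists>e>0. \<forall>y. dist y x < e \<longrightarrow> y \<in> Z" using st[of x] \<open>r > 0\<close> by (auto simp: dist_commute)
  qed
  moreover have "closed Z" unfolding closed_def open_dist
  proof
    fix x assume "x \<in> - Z"
    then show "\<exists>e>0. \<forall>y. dist y x < e \<longrightarrow> y \<in> - Z" using st[of _ x] \<open>r > 0\<close> by auto
  qed
  moreover have "x0 \<in> Z" using z by (simp add: Z_def)
  ultimately have "Z = UNIV" using clopen[of Z] by blast
  then have az: "AE z in lborel. z \<in> ball x r \<longrightarrow> \<Psi> z = 0" for x unfolding Z_def by blast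
  have op: "open B" if "B \<in> range (\<lambda>x::'a. ball x r)" for B using that by auto
  obtain F where F: "F \<subseteq> range (\<lambda>x::'a. ball x r)" "countable F" "\<Union>F = \<Union>(range (\<lambda>x::'a. ball x r))"
    by (rule Lindelof[of "range (\<lambda>x::'a. ball x r)", OF op])
  have "AE z in lborel. \<forall>B\<in>F. z \<in> B \<longrightarrow> \<Psi> z = 0"
    unfolding AE_ball_countable[OF F(2)] using F(1) az by blast
  then show ?thesis
  proof eventually_elim
    case (elim z)
    have "z \<in> \<Union>F" unfolding F(3) using \<open>r > 0\<close> by (intro UN_I[of z]) auto
    then show ?case using elim by blast
  qed
qed

lemma translate_measure:
  fixes A :: "'a::euclidean_space set"
  shows "measure lborel {x. x + c \<in> A} = measure lborel A"
proof -
  have "measure lborel {x. x + c \<in> A} = (LBINT x. indicator {x. x + c \<in> A} x)" by simp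
  also have "\<dots> = (LBINT x. indicator A (x + c))" by (intro integral_cong) (auto simp: indicator_def)
  also have "\<dots> = (LBINT x. indicator A x)" by (rule integral_translate(1))
  finally show ?thesis by simp
qed

theorem theorem1p1:
  fixes \<delta> :: real
  assumes "\<delta> > 0"
  shows "\<exists>\<epsilon>::real. \<epsilon> > 0 \<and>
    (\<forall>(V :: real^'n::finite \<Rightarrow> complex) (\<Psi> :: real^'n \<Rightarrow> complex).
      L2loc V \<longrightarrow>
      (\<forall>R>0. \<exists>cR::real. cR \<ge> 0 \<and>
         (\<forall>u w. H2 u \<longrightarrow> is_frac_laplacian (3/4 - \<delta>) u w \<longrightarrow>
            (\<integral>\<^sup>+ x\<in>ball 0 R. ennreal ((cmod (V x))\<^sup>2 * (cmod (u x))\<^sup>2) \<partial>lebesgue)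
              \<le> ennreal \<epsilon> * (\<integral>\<^sup>+ x. ennreal ((cmod (w x))\<^sup>2) \<partial>lebesgue)
                + ennreal cR * (\<integral>\<^sup>+ x. ennreal ((cmod (u x))\<^sup>2) \<partial>lebesgue))) \<longrightarrow>
      solves_schroedinger V \<Psi> \<longrightarrow>
      ((\<exists>S \<in> sets lebesgue. emeasure lebesgue S > 0 \<and> (\<forall>x\<in>S. \<Psi> x = 0)) \<or>
       (\<exists>x0. vanishes_infinite_order \<Psi> x0)) \<longrightarrow>
      (AE x in lebesgue. \<Psi> x = 0))"
proof (intro exI[of _ 1] conjI allI impI)
  fix V0 \<Psi>0 :: "real^'n \<Rightarrow> complex"
  assume L: "L2loc V0" and sol: "solves_schroedinger V0 \<Psi>0"
  assume hyp: "\<forall>R>0. \<exists>cR::real. cR \<ge> 0 \<and>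
         (\<forall>u w. H2 u \<longrightarrow> is_frac_laplacian (3/4 - \<delta>) u w \<longrightarrow>
            (\<integral>\<^sup>+ x\<in>ball 0 R. ennreal ((cmod (V0 x))^2 * (cmod (u x))^2) \<partial>lebesgue)
              \<le> ennreal 1 * (\<integral>\<^sup>+ x. ennreal ((cmod (w x))^2) \<partial>lebesgue)
                + ennreal cR * (\<integral>\<^sup>+ x. ennreal ((cmod (u x))^2) \<partial>lebesgue))"
  assume van: "(\<exists>S \<in> sets lebesgue. emeasure lebesgue S > 0 \<and> (\<forall>x\<in>S. \<Psi>0 x = 0)) \<or> (\<exists>x0. vanishes_infinite_order \<Psi>0 x0)"
  \<comment> \<open>\<delta> may exceed 3/4, and then the exponent 3/4 - \<delta> is negative.
    Capping keeps 3 - 4 d nonnegative, as \<open>power_interpolation\<close> requires, and 3/4 -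
    \<delta> <= 3/4 - d still holds.\<close>
  define d where "d = min \<delta> (3/4)"
  have d: "0 < d" "d \<le> 3/4" "3/4 - \<delta> \<le> 3/4 - d" using assms by (auto simp: d_def)
  have "V0 \<in> borel_measurable lebesgue" using L by (simp add: L2loc_def)
  then obtain V where V: "V \<in> borel_measurable borel" "AE x in lborel. V0 x = V x" by (rule borel_version)
  have \<Psi>0m: "\<Psi>0 \<in> borel_measurable lebesgue" using sol by (simp add: solves_schroedinger_def H2loc_def)
  then obtain \<Psi> where \<Psi>: "\<Psi> \<in> borel_measurable borel" "AE x in lborel. \<Psi>0 x = \<Psi> x" by (rule borel_version)
  have "\<exists>c. frac_bounded V (3/4 - \<delta>) R c" if R: "R > 0" for R
  proof -
    obtain c where c: "c \<ge> 0" "\<And>u w. H2 u \<Longrightarrow> is_frac_laplacian (3/4 - \<delta>) u w \<Longrightarrow>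
            (\<integral>\<^sup>+ x\<in>ball 0 R. ennreal ((cmod (V0 x))^2 * (cmod (u x))^2) \<partial>lborel)
              \<le> (\<integral>\<^sup>+ x. ennreal ((cmod (w x))^2) \<partial>lborel) + ennreal c * (\<integral>\<^sup>+ x. ennreal ((cmod (u x))^2) \<partial>lborel)"
      using hyp R unfolding nn_integral_completion ennreal_1 mult_1 by blast
    have "(\<integral>\<^sup>+ x\<in>ball 0 R. ennreal ((cmod (V x))^2 * (cmod (u x))^2) \<partial>lborel) = (\<integral>\<^sup>+ x\<in>ball 0 R. ennreal ((cmod (V0 x))^2 * (cmod (u x))^2) \<partial>lborel)" for u
      by (rule nn_integral_cong_AE) (use V(2) in eventually_elim, simp)
    then have "frac_bounded V (3/4 - \<delta>) R c" using c V(1) unfolding frac_bounded_def by simp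
    then show ?thesis by blast
  qed
  then obtain c where fb: "\<And>R. R > 0 \<Longrightarrow> frac_bounded V (3/4 - \<delta>) R (c R)" by metis
  have pb: "potential_bound (\<lambda>x. V (x + x0)) (56 + 4 * c (norm x0 + 3)) d" for x0
    by (rule frac_bounded_local[OF fb d]) (simp add: add_nonneg_pos)
  note loc = vanishes_local[OF sol V(2) \<Psi> pb] and sl = solution_local[OF sol V(2) \<Psi> pb]
  have i\<Psi>: "L2int (cball 0 1) (\<lambda>x. \<Psi> (x + x0))" for x0
    using sl[of x0] by (auto simp: potential_bound.approximates_def[OF pb])
  have "\<exists>x0. \<forall>k. \<exists>c. \<forall>e. 0 < e \<and> e < 1 \<longrightarrow> L2on (ball 0 e) (\<lambda>x. \<Psi> (x + x0)) \<le> c * e ^ k"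
    using van
  proof (elim disjE)
    assume "\<exists>S \<in> sets lebesgue. emeasure lebesgue S > 0 \<and> (\<forall>x\<in>S. \<Psi>0 x = 0)"
    then obtain S where S: "S \<in> sets lebesgue" "emeasure lebesgue S > 0" "\<And>x. x \<in> S \<Longrightarrow> \<Psi>0 x = 0" by blast
    \<comment> \<open>A Lebesgue set differs from a Borel subset by a null set; the density argument
      runs on the Borel part, which keeps positive measure.\<close>
    obtain S' N N' where N: "S = S' \<union> N" "N \<subseteq> N'" "N' \<in> null_sets lborel" "S' \<in> sets lborel"
      using S(1) by (rule sets_completionE)
    have "emeasure lborel S' \<noteq> 0"
    proof
      assume "emeasure lborel S' = 0"
      then have "S' \<in> null_sets lborel" using N(4) by auto
      then have "S' \<union> N' \<in> null_sets (completion lborel)" using N(3) by (intro null_sets_completionI null_sets.Un)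
      then have "S \<in> null_sets lebesgue" by (rule null_sets_subset[OF _ S(1)]) (use N(1,2) in blast)
      then show False using S(2) by (simp add: null_sets_def)
    qed
    then have S': "S' \<in> sets borel" "emeasure lborel S' > 0" "S' \<subseteq> S"
      using N by (auto simp: zero_less_iff_neq_zero)
    obtain x0 where x0: "\<And>\<eta>. \<eta> > 0 \<Longrightarrow> \<exists>r0>0. \<forall>r. 0 < r \<and> r < r0 \<longrightarrow> measure lborel (ball x0 r - S') \<le> \<eta> * r ^ DIM(real^'n)"
      using density_point[OF S'(1,2)] by blast
    define S1 where "S1 = {x. x + x0 \<in> S'}"
    have S1: "S1 \<in> sets borel" unfolding S1_def using S'(1) by measurable
    have z: "AE x in lborel. x \<in> S1 \<longrightarrow> \<Psi> (x + x0) = 0"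
      using AE_translate[OF \<Psi>(2), of x0] by eventually_elim (use S(3) S'(3) in \<open>auto simp: S1_def\<close>)
    have "ball 0 r - S1 = {x. x + x0 \<in> ball x0 r - S'}" for r by (auto simp: S1_def dist_norm)
    then have dens: "\<exists>r0>0. \<forall>r. 0 < r \<and> r < r0 \<longrightarrow> measure lborel (ball 0 r - S1) \<le> \<eta> * r ^ DIM(real^'n)" if "\<eta> > 0" for \<eta>
      using x0[OF that] by (simp only: translate_measure)
    obtain u where u: "potential_bound.approximates (\<lambda>x. V (x + x0)) u (\<lambda>x. \<Psi> (x + x0))" using sl by blast
    have "\<exists>c. \<forall>e. 0 < e \<and> e < 1 \<longrightarrow> L2on (ball 0 e) (\<lambda>x. \<Psi> (x + x0)) \<le> c * e ^ k" for k
      by (rule potential_bound.infinite_order_at_density_point[OF pb u S1 z dens])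
    then show ?thesis by blast
  next
    assume "\<exists>x0. vanishes_infinite_order \<Psi>0 x0"
    then obtain x0 where x0: "vanishes_infinite_order \<Psi>0 x0" by blast
    have e: "(\<integral> x\<in>ball x0 e. (cmod (\<Psi>0 x))^2 \<partial>lebesgue) = L2on (ball 0 e) (\<lambda>x. \<Psi> (x + x0))" for e
    proof -
      have m: "(\<lambda>x. indicator (ball x0 e) x * (cmod (\<Psi> x))^2) \<in> borel_measurable borel"
        using \<Psi>(1) by (intro borel_measurable_times borel_measurable_power borel_measurable_norm borel_measurable_indicator) auto
      have m0: "(\<lambda>x. indicat_real (ball x0 e) x *\<^sub>R (cmod (\<Psi>0 x))^2) \<in> borel_measurable lebesgue"
        using \<Psi>0m by (intro borel_measurable_scaleR borel_measurable_power borel_measurable_norm borel_measurable_indicator) auto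
      have "(\<integral> x\<in>ball x0 e. (cmod (\<Psi>0 x))^2 \<partial>lebesgue) = (\<integral>x. indicator (ball x0 e) x * (cmod (\<Psi> x))^2 \<partial>lebesgue)"
        unfolding set_lebesgue_integral_def
      proof (rule integral_cong_AE[OF m0])
        show "(\<lambda>x. indicator (ball x0 e) x * (cmod (\<Psi> x))^2) \<in> borel_measurable lebesgue"
          by (rule measurable_completion) (use m in simp)
        show "AE x in lebesgue. indicat_real (ball x0 e) x *\<^sub>R (cmod (\<Psi>0 x))^2 = indicator (ball x0 e) x * (cmod (\<Psi> x))^2"
          using \<Psi>(2) unfolding AE_completion_iff by eventually_elim simp
      qed
      also have "\<dots> = L2on (ball x0 e) \<Psi>" by (rule integral_completion) (use m in simp)
      also have "\<dots> = (LBINT x. indicator (ball x0 e) (x + x0) * (cmod (\<Psi> (x + x0)))^2)" by (rule integral_translate(1)[symmetric])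
      also have "\<dots> = L2on (ball 0 e) (\<lambda>x. \<Psi> (x + x0))"
        by (intro integral_cong refl) (auto simp: indicator_def dist_norm)
      finally show ?thesis .
    qed
    have ge: "\<exists>c. \<forall>e. 0 < e \<and> e < 1 \<longrightarrow> L2on (ball 0 e) (\<lambda>x. \<Psi> (x + x0)) \<le> c * e ^ k" if "k \<ge> 1" for k
      using x0 that unfolding vanishes_infinite_order_def e by (meson less_imp_le)
    \<comment> \<open>The definition of infinite order speaks of exponents k >= 1; the exponent 0
      follows from k = 1 because e < 1.\<close>
    have "\<exists>c. \<forall>e. 0 < e \<and> e < 1 \<longrightarrow> L2on (ball 0 e) (\<lambda>x. \<Psi> (x + x0)) \<le> c * e ^ k" for k
    proof (cases "k \<ge> 1")
      case False
      obtain c where c: "\<And>e. 0 < e \<and> e < 1 \<Longrightarrow> L2on (ball 0 e) (\<lambda>x. \<Psi> (x + x0)) \<le> c * e ^ 1"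
        using ge[of 1] by auto
      have "c * e \<le> \<bar>c\<bar>" if "0 < e" "e < 1" for e
        using mult_mono[of c "\<bar>c\<bar>" e 1] that by auto
      then have "L2on (ball 0 e) (\<lambda>x. \<Psi> (x + x0)) \<le> \<bar>c\<bar>" if "0 < e" "e < 1" for e
        using order_trans[OF c[of e]] that by simp
      moreover have "k = 0" using False by simp
      ultimately show ?thesis by (intro exI[of _ "\<bar>c\<bar>"]) simp
    qed (rule ge)
    then show ?thesis by blast
  qed
  then obtain x0 where x0: "\<And>k. \<exists>c. \<forall>e. 0 < e \<and> e < 1 \<longrightarrow> L2on (ball 0 e) (\<lambda>x. \<Psi> (x + x0)) \<le> c * e ^ k"
    by blast
  have "AE x in lborel. \<Psi> x = 0"
  proof (rule vanishes_everywhere[of "1/8" x0])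
    show "AE x in lborel. x \<in> ball x0 (1/8) \<longrightarrow> \<Psi> x = 0" by (rule loc[OF x0])
    fix x y assume "AE z in lborel. z \<in> ball x (1/8) \<longrightarrow> \<Psi> z = 0" "y \<in> ball x (1/8)"
    from vanishes_propagate[OF \<Psi>(1) i\<Psi> this]
    show "AE z in lborel. z \<in> ball y (1/8) \<longrightarrow> \<Psi> z = 0" by (rule loc)
  qed simp
  then show "AE x in lebesgue. \<Psi>0 x = 0" unfolding AE_completion_iff using \<Psi>(2) by eventually_elim simp
qed simp

end
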